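(* (i) In LZFC: if a model $M$ is extendible, then $M$ is $\Pi_1^1$-indescribable. (ii) In ${\rm LZFC}+{\rm Found}_{On}$: the converse of (i) is false; i.e., if there is a $\Pi_1^1$-indescribable model, then there is a $\Pi_1^1$-indescribable model which is not extendible.
   Context: The formal language is ${\cal L}=\{\in\}$. BST is the theory with axioms: Empty set, Extensionality, Pair, Union, Cartesian Product, "$\omega$ exists", $\Delta_0$-Separation. $Loc({\rm ZFC})$ is the statement that every set belongs to a transitive model of ZFC; ${\rm LZFC}={\rm BST}+Loc({\rm ZFC})$. "Model" means a (set) transitive model of ZFC. ${\rm Found}_{On}$ is the scheme: for each formula $\phi$, $\exists \alpha\in On\ \phi(\alpha)\rightarrow \exists\alpha\in On[\phi(\alpha)\wedge \forall\beta<\alpha\,\neg\phi(\beta)]$. A model $M$ is (elementarily) extendible if there is a model $N$ such that $M\in N$ and $M\prec N$. For a model $M$, $Def(M)$ is the set of subsets of $M$ definable over $(M,\in)$ by formulas of ${\cal L}$ (with parameters from $M$). Let ${\cal L}_2$ be ${\cal L}$ augmented with second-order variables, and ${\cal L}_2({\bf S},{\bf c}_i)$ be ${\cal L}_2$ augmented with a unary predicate ${\bf S}(\cdot)$ and first-order constants ${\bf c}_i$ naming elements $c_i$ of $M$. In a structure $(M,\in,U,Def(M))$, ${\bf S}$ is interpreted as $U\subseteq M$ and second-order variables range over $Def(M)$. A $\Pi^1_1$ sentence is one consisting of universal second-order quantifiers followed by a formula with only first-order quantifiers. A model $M$ is $\Pi^1_1$-indescribable if for every $U\in Def(M)$ and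 every $\Pi^1_1$ sentence $\phi$ of ${\cal L}_2({\bf S},{\bf c}_i)$, if $(M,\in,U,Def(M))\models\phi$, then there is a model $N\in M$ such that $U\cap N\in Def(N)$ and $(N,\in,U\cap N,Def(N))\models\phi$ (where $N$ contains the elements named by the constants occurring in $\phi$). *)

theory Defs
  imports Main
begin

section \<open>The language of set theory and its structures\<close>

datatype fm = FMem nat nat | FEq nat nat | FNeg fm | FAnd fm fm | FAll nat fm

definition FOr :: "fm \<Rightarrow> fm \<Rightarrow> fm" where "FOr p q = FNeg (FAnd (FNeg p) (FNeg q))"
definition FImp :: "fm \<Rightarrow> fm \<Rightarrow> fm" where "FImp p q = FNeg (FAnd p (FNeg q))"
definition FIff :: "fm \<Rightarrow> fm \<Rightarrow> fm" where "FIff p q = FAnd (FImp p q) (FImp q p)"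
definition FEx :: "nat \<Rightarrow> fm \<Rightarrow> fm" where "FEx i p = FNeg (FAll i (FNeg p))"
definition FAllIn :: "nat \<Rightarrow> nat \<Rightarrow> fm \<Rightarrow> fm" where "FAllIn i j p = FAll i (FImp (FMem i j) p)"
definition FExIn :: "nat \<Rightarrow> nat \<Rightarrow> fm \<Rightarrow> fm" where "FExIn i j p = FEx i (FAnd (FMem i j) p)"

primrec fv :: "fm \<Rightarrow> nat set" where
  "fv (FMem i j) = {i, j}"
| "fv (FEq i j) = {i, j}"
| "fv (FNeg p) = fv p"
| "fv (FAnd p q) = fv p \<union> fv q"
| "fv (FAll i p) = fv p - {i}"

inductive delta0 :: "fm \<Rightarrow> bool" where
  "delta0 (FMem i j)"
| "delta0 (FEq i j)"
| "delta0 p \<Longrightarrow> delta0 (FNeg p)"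
| "delta0 p \<Longrightarrow> delta0 q \<Longrightarrow> delta0 (FAnd p q)"
| "delta0 p \<Longrightarrow> i \<noteq> j \<Longrightarrow> delta0 (FAllIn i j p)"

primrec holds :: "'a set \<Rightarrow> ('a \<Rightarrow> 'a \<Rightarrow> bool) \<Rightarrow> (nat \<Rightarrow> 'a) \<Rightarrow> fm \<Rightarrow> bool" where
  "holds V E e (FMem i j) \<longleftrightarrow> E (e i) (e j)"
| "holds V E e (FEq i j) \<longleftrightarrow> e i = e j"
| "holds V E e (FNeg p) \<longleftrightarrow> \<not> holds V E e p"
| "holds V E e (FAnd p q) \<longleftrightarrow> holds V E e p \<and> holds V E e q"
| "holds V E e (FAll i p) \<longleftrightarrow> (\<forall>x\<in>V. holds V E (e(i := x)) p)"

definition satisfies_theory :: "'a set \<Rightarrow> ('a \<Rightarrow> 'a \<Rightarrow> bool) \<Rightarrow> fm set \<Rightarrow> bool" where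
  "satisfies_theory V E T \<longleftrightarrow> (\<forall>p\<in>T. \<forall>e. range e \<subseteq> V \<longrightarrow> holds V E e p)"


section \<open>Axioms\<close>

definition Extensionality :: fm where
  "Extensionality = FAll 0 (FAll 1 (FImp (FAll 2 (FIff (FMem 2 0) (FMem 2 1))) (FEq 0 1)))"

definition Empty_set :: fm where
  "Empty_set = FEx 0 (FAll 1 (FNeg (FMem 1 0)))"

definition Pairing :: fm where
  "Pairing = FAll 0 (FAll 1 (FEx 2 (FAll 3 (FIff (FMem 3 2) (FOr (FEq 3 0) (FEq 3 1))))))"

definition Union_ax :: fm where
  "Union_ax = FAll 0 (FEx 1 (FAll 2 (FIff (FMem 2 1) (FExIn 3 0 (FMem 2 3)))))"

text \<open>The subformula starting with \<open>FAll 6\<close> says that variable 3 is the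
  Kuratowski pair of variables 4 and 5.\<close>

definition Cartesian_product :: fm where
  "Cartesian_product =
     FAll 0 (FAll 1 (FEx 2 (FAll 3 (FIff (FMem 3 2)
       (FExIn 4 0 (FExIn 5 1
         (FAll 6 (FIff (FMem 6 3)
           (FOr (FAll 7 (FIff (FMem 7 6) (FEq 7 4)))
                (FAll 7 (FIff (FMem 7 6) (FOr (FEq 7 4) (FEq 7 5)))))))))))))"

definition Powerset :: fm where
  "Powerset = FAll 0 (FEx 1 (FAll 2 (FIff (FMem 2 1) (FAllIn 3 2 (FMem 3 0)))))"

text \<open>In the following formulas with parameters, all variables above the parameters are
  used only as bound variables.\<close>

definition Is_empty :: "nat \<Rightarrow> fm" where
  "Is_empty x = FAll (x+1) (FNeg (FMem (x+1) x))"

definition Is_succ :: "nat \<Rightarrow> nat \<Rightarrow> fm" where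
  "Is_succ y x = (let z = max x y + 1 in
     FAll z (FIff (FMem z y) (FOr (FMem z x) (FEq z x))))"

text \<open>An ordinal is a transitive set that is well-ordered by membership. Well-foundedness is
  part of the definition because BST has no axiom of foundation.\<close>

definition Is_ordinal :: "nat \<Rightarrow> fm" where
  "Is_ordinal x =
     FAnd (FAllIn (x+1) x (FAllIn (x+2) (x+1) (FMem (x+2) x)))
    (FAnd (FAllIn (x+1) x (FAllIn (x+2) x
             (FOr (FMem (x+1) (x+2)) (FOr (FEq (x+1) (x+2)) (FMem (x+2) (x+1))))))
          (FAll (x+1) (FImp
             (FAnd (FAllIn (x+2) (x+1) (FMem (x+2) x)) (FEx (x+2) (FMem (x+2) (x+1))))
             (FExIn (x+2) (x+1) (FAllIn (x+3) (x+1) (FNeg (FMem (x+3) (x+2))))))))"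

definition Is_zero_or_succ :: "nat \<Rightarrow> fm" where
  "Is_zero_or_succ x = FOr (Is_empty x) (FEx (x+1) (Is_succ x (x+1)))"

definition Is_natural :: "nat \<Rightarrow> fm" where
  "Is_natural x =
     FAnd (Is_ordinal x) (FAnd (Is_zero_or_succ x) (FAllIn (x+1) x (Is_zero_or_succ (x+1))))"

definition Omega_exists :: fm where
  "Omega_exists = FEx 0 (FAll 1 (FIff (FMem 1 0) (Is_natural 1)))"

definition Infinity :: fm where
  "Infinity = FEx 0 (FAnd (FExIn 1 0 (Is_empty 1)) (FAllIn 1 0 (FExIn 2 0 (Is_succ 2 1))))"

definition Foundation :: fm where
  "Foundation = FAll 0 (FImp (FEx 1 (FMem 1 0)) (FExIn 1 0 (FAllIn 2 1 (FNeg (FMem 2 0)))))"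

text \<open>Choice: every set of nonempty, pairwise disjoint sets has a transversal.\<close>

definition Choice :: fm where
  "Choice = FAll 0 (FImp
     (FAnd (FAllIn 1 0 (FEx 2 (FMem 2 1)))
           (FAllIn 1 0 (FAllIn 2 0 (FImp (FEx 3 (FAnd (FMem 3 1) (FMem 3 2))) (FEq 1 2)))))
     (FEx 4 (FAllIn 1 0 (FEx 2 (FAll 3 (FIff (FAnd (FMem 3 1) (FMem 3 4)) (FEq 3 2)))))))"

definition Separation :: "fm \<Rightarrow> nat \<Rightarrow> nat \<Rightarrow> nat \<Rightarrow> fm" where
  "Separation p x y z =
     FAll x (FEx y (FAll z (FIff (FMem z y) (FAnd (FMem z x) p))))"

definition BST :: "fm set" where
  "BST = {Empty_set, Extensionality, Pairing, Union_ax, Cartesian_product, Omega_exists} \<union>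
     {Separation p x y z | p x y z. delta0 p \<and> distinct [x, y, z] \<and> y \<notin> fv p}"

definition ZFC_single_axioms :: "fm set" where
  "ZFC_single_axioms = {Extensionality, Empty_set, Pairing, Union_ax, Powerset, Infinity,
     Foundation, Choice}"


section \<open>Syntax and semantics inside a structure\<close>

text \<open>We work inside an arbitrary structure \<open>(V, \<epsilon>)\<close>, thought of as a universe of sets, whose
  set of natural numbers may be nonstandard. Every definition in this locale spells out a
  formula of set theory interpreted in \<open>(V, \<epsilon>)\<close>: all quantifiers over individuals range over
  elements of \<open>V\<close>, and HOL sets of individuals only serve as notation for definable classes.\<close>

locale universe =
  fixes V :: "'a set" and E :: "'a \<Rightarrow> 'a \<Rightarrow> bool" (infix "\<epsilon>" 50)
begin

definition ext :: "'a \<Rightarrow> 'a set" where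
  "ext x = {y \<in> V. y \<epsilon> x}"

text \<open>\<open>mk X\<close> is the element of \<open>V\<close> with extension \<open>X\<close>. It is only used where BST guarantees
  that there is one.\<close>

definition mk :: "'a set \<Rightarrow> 'a" where
  "mk X = (THE x. x \<in> V \<and> ext x = X)"

definition opair :: "'a \<Rightarrow> 'a \<Rightarrow> 'a" where
  "opair x y = mk {mk {x}, mk {x, y}}"

definition triple :: "'a \<Rightarrow> 'a \<Rightarrow> 'a \<Rightarrow> 'a" where
  "triple x y z = opair x (opair y z)"

definition is_fun :: "'a \<Rightarrow> 'a set \<Rightarrow> 'a set \<Rightarrow> bool" where
  "is_fun f A B \<longleftrightarrow> f \<in> V \<and> (\<forall>p\<in>ext f. \<exists>x\<in>A. \<exists>y\<in>B. p = opair x y) \<and>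
     (\<forall>x\<in>A. \<exists>!y. y \<in> B \<and> opair x y \<epsilon> f)"

definition On :: "'a set" where
  "On = {a \<in> V. holds V E (\<lambda>_. a) (Is_ordinal 0)}"

definition Omega :: "'a set" where
  "Omega = {n \<in> V. holds V E (\<lambda>_. n) (Is_natural 0)}"

primrec num :: "nat \<Rightarrow> 'a" where
  "num 0 = mk {}"
| "num (Suc n) = mk (insert (num n) (ext (num n)))"


subsection \<open>Codes of formulas of \<open>\<L>\<^sub>2(S, c\<^sub>i)\<close>\<close>

text \<open>First-order and second-order variables are indexed by the elements of \<open>Omega\<close>; the
  constant naming the set \<open>c\<close> is coded by \<open>con c\<close>.\<close>

definition var :: "'a \<Rightarrow> 'a" where "var i = opair (num 0) i"
definition con :: "'a \<Rightarrow> 'a" where "con c = opair (num 1) c"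

definition cMem :: "'a \<Rightarrow> 'a \<Rightarrow> 'a" where "cMem s t = triple (num 0) s t"
definition cEq :: "'a \<Rightarrow> 'a \<Rightarrow> 'a" where "cEq s t = triple (num 1) s t"
definition cS :: "'a \<Rightarrow> 'a" where "cS t = opair (num 2) t"
definition cApp2 :: "'a \<Rightarrow> 'a \<Rightarrow> 'a" where "cApp2 j t = triple (num 3) j t"
definition cNeg :: "'a \<Rightarrow> 'a" where "cNeg p = opair (num 4) p"
definition cAnd :: "'a \<Rightarrow> 'a \<Rightarrow> 'a" where "cAnd p q = triple (num 5) p q"
definition cAll :: "'a \<Rightarrow> 'a \<Rightarrow> 'a" where "cAll i p = triple (num 6) i p"
definition cAll2 :: "'a \<Rightarrow> 'a \<Rightarrow> 'a" where "cAll2 j p = triple (num 7) j p"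

definition cImp :: "'a \<Rightarrow> 'a \<Rightarrow> 'a" where "cImp p q = cNeg (cAnd p (cNeg q))"
definition cIff :: "'a \<Rightarrow> 'a \<Rightarrow> 'a" where "cIff p q = cAnd (cImp p q) (cImp q p)"
definition cEx :: "'a \<Rightarrow> 'a \<Rightarrow> 'a" where "cEx i p = cNeg (cAll i (cNeg p))"

primrec quote :: "fm \<Rightarrow> 'a" where
  "quote (FMem i j) = cMem (var (num i)) (var (num j))"
| "quote (FEq i j) = cEq (var (num i)) (var (num j))"
| "quote (FNeg p) = cNeg (quote p)"
| "quote (FAnd p q) = cAnd (quote p) (quote q)"
| "quote (FAll i p) = cAll (num i) (quote p)"

definition terms :: "'a set \<Rightarrow> 'a set" where
  "terms C = var ` Omega \<union> con ` C"

definition term_vars :: "'a \<Rightarrow> 'a set" where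
  "term_vars t = {i \<in> Omega. t = var i}"

text \<open>\<open>generated step x\<close>: inside the universe there is a finite sequence ending with \<open>x\<close> each of
  whose entries is obtained by \<open>step\<close> from earlier entries.\<close>

definition generated :: "(('a \<Rightarrow> bool) \<Rightarrow> 'a \<Rightarrow> bool) \<Rightarrow> 'a \<Rightarrow> bool" where
  "generated step x \<longleftrightarrow> x \<in> V \<and>
     (\<exists>n\<in>Omega. \<exists>f\<in>V. is_fun f (insert n (ext n)) V \<and> opair n x \<epsilon> f \<and>
        (\<forall>k\<in>insert n (ext n). \<forall>y\<in>V. opair k y \<epsilon> f \<longrightarrow>
           step (\<lambda>z. \<exists>j\<in>ext k. opair j z \<epsilon> f) y))"

text \<open>The formation rules generate triples \<open>(\<phi>, v, r)\<close> in which \<open>v\<close> and \<open>r\<close> are the sets of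
  (indices of) free first-order and second-order variables of \<open>\<phi>\<close>.\<close>

definition formed_by ::
  "(('a \<Rightarrow> 'a \<Rightarrow> 'a \<Rightarrow> bool) \<Rightarrow> 'a \<Rightarrow> 'a \<Rightarrow> 'a \<Rightarrow> bool) \<Rightarrow> 'a \<Rightarrow> 'a \<Rightarrow> 'a \<Rightarrow> bool" where
  "formed_by step \<phi> v r \<longleftrightarrow> \<phi> \<in> V \<and> v \<in> V \<and> r \<in> V \<and>
     generated (\<lambda>P x. \<exists>\<psi>\<in>V. \<exists>w\<in>V. \<exists>s\<in>V. x = triple \<psi> w s \<and>
                  step (\<lambda>\<psi> w s. P (triple \<psi> w s)) \<psi> w s)
               (triple \<phi> v r)"

definition set_atom :: "'a set \<Rightarrow> 'a \<Rightarrow> 'a \<Rightarrow> 'a \<Rightarrow> bool" where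
  "set_atom C \<phi> v r \<longleftrightarrow> (\<exists>s\<in>terms C. \<exists>t\<in>terms C. (\<phi> = cMem s t \<or> \<phi> = cEq s t) \<and>
     ext v = term_vars s \<union> term_vars t \<and> ext r = {})"

definition predicate_atom :: "'a set \<Rightarrow> 'a \<Rightarrow> 'a \<Rightarrow> 'a \<Rightarrow> bool" where
  "predicate_atom C \<phi> v r \<longleftrightarrow>
     (\<exists>t\<in>terms C. \<phi> = cS t \<and> ext v = term_vars t \<and> ext r = {}) \<or>
     (\<exists>j\<in>Omega. \<exists>t\<in>terms C. \<phi> = cApp2 j t \<and> ext v = term_vars t \<and> ext r = {j})"

definition first_order_step ::
  "('a \<Rightarrow> 'a \<Rightarrow> 'a \<Rightarrow> bool) \<Rightarrow> 'a \<Rightarrow> 'a \<Rightarrow> 'a \<Rightarrow> bool" where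
  "first_order_step P \<phi> v r \<longleftrightarrow>
     (\<exists>p\<in>V. \<phi> = cNeg p \<and> P p v r) \<or>
     (\<exists>p\<in>V. \<exists>q\<in>V. \<exists>v1\<in>V. \<exists>v2\<in>V. \<exists>r1\<in>V. \<exists>r2\<in>V. \<phi> = cAnd p q \<and> P p v1 r1 \<and> P q v2 r2 \<and>
        ext v = ext v1 \<union> ext v2 \<and> ext r = ext r1 \<union> ext r2) \<or>
     (\<exists>i\<in>Omega. \<exists>p\<in>V. \<exists>w\<in>V. \<phi> = cAll i p \<and> P p w r \<and> ext v = ext w - {i})"

definition second_order_step ::
  "('a \<Rightarrow> 'a \<Rightarrow> 'a \<Rightarrow> bool) \<Rightarrow> 'a \<Rightarrow> 'a \<Rightarrow> 'a \<Rightarrow> bool" where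
  "second_order_step P \<phi> v r \<longleftrightarrow>
     (\<exists>j\<in>Omega. \<exists>p\<in>V. \<exists>s\<in>V. \<phi> = cAll2 j p \<and> P p v s \<and> ext r = ext s - {j})"

text \<open>\<open>\<phi>\<close> is an \<open>\<L>\<close>-formula with set \<open>v\<close> of free variables.\<close>

definition L_formula :: "'a \<Rightarrow> 'a \<Rightarrow> bool" where
  "L_formula \<phi> v \<longleftrightarrow>
     formed_by (\<lambda>P \<phi> v r. set_atom {} \<phi> v r \<or> first_order_step P \<phi> v r) \<phi> v (num 0)"

text \<open>Formulas of \<open>\<L>\<^sub>2(S, c\<^sub>i)\<close> with constants for elements of \<open>C\<close>.\<close>

definition L2_formula :: "'a set \<Rightarrow> 'a \<Rightarrow> 'a \<Rightarrow> 'a \<Rightarrow> bool" where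
  "L2_formula C = formed_by (\<lambda>P \<phi> v r. set_atom C \<phi> v r \<or> predicate_atom C \<phi> v r \<or>
     first_order_step P \<phi> v r \<or> second_order_step P \<phi> v r)"

definition no_second_order_quantifiers :: "'a set \<Rightarrow> 'a \<Rightarrow> 'a \<Rightarrow> 'a \<Rightarrow> bool" where
  "no_second_order_quantifiers C = formed_by (\<lambda>P \<phi> v r. set_atom C \<phi> v r \<or>
     predicate_atom C \<phi> v r \<or> first_order_step P \<phi> v r)"

definition Pi11_formula :: "'a set \<Rightarrow> 'a \<Rightarrow> 'a \<Rightarrow> 'a \<Rightarrow> bool" where
  "Pi11_formula C = formed_by (\<lambda>P \<phi> v r. no_second_order_quantifiers C \<phi> v r \<or>
     second_order_step P \<phi> v r)"

definition Pi11_sentence :: "'a set \<Rightarrow> 'a \<Rightarrow> bool" where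
  "Pi11_sentence C \<phi> \<longleftrightarrow> Pi11_formula C \<phi> (num 0) (num 0)"


subsection \<open>Satisfaction in \<open>(M, \<in>, U, D)\<close>\<close>

text \<open>An assignment for \<open>\<phi>\<close> is a pair of functions, from the free first-order variables to \<open>M\<close>
  and from the free second-order variables to \<open>D\<close>; \<open>T\<close> is the set of the satisfying ones.\<close>

definition denotes :: "'a \<Rightarrow> 'a \<Rightarrow> 'a \<Rightarrow> bool" where
  "denotes a t x \<longleftrightarrow> (\<exists>i\<in>Omega. t = var i \<and> opair i x \<epsilon> a) \<or> t = con x"

definition truth_set ::
  "'a set \<Rightarrow> 'a set \<Rightarrow> 'a \<Rightarrow> 'a \<Rightarrow> ('a \<Rightarrow> 'a \<Rightarrow> bool) \<Rightarrow> bool" where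
  "truth_set M D \<phi> T Q \<longleftrightarrow> (\<exists>v\<in>V. \<exists>r\<in>V. L2_formula M \<phi> v r \<and>
     ext T = {opair a A | a A. is_fun a (ext v) M \<and> is_fun A (ext r) D \<and> Q a A})"

text \<open>Since every element of a truth set has exactly the free variables of the formula as
  domain, the subsets \<open>b\<close>, \<open>B\<close> below are the restrictions to the free variables of the
  respective subformula.\<close>

definition sat_step ::
  "'a set \<Rightarrow> 'a set \<Rightarrow> 'a set \<Rightarrow> ('a \<Rightarrow> 'a \<Rightarrow> bool) \<Rightarrow> 'a \<Rightarrow> 'a \<Rightarrow> bool" where
  "sat_step M U D P \<phi> T \<longleftrightarrow>
     (\<exists>s\<in>terms M. \<exists>t\<in>terms M. \<phi> = cMem s t \<and>
        truth_set M D \<phi> T (\<lambda>a A. \<exists>x\<in>M. \<exists>y\<in>M. denotes a s x \<and> denotes a t y \<and> x \<epsilon> y)) \<or>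
     (\<exists>s\<in>terms M. \<exists>t\<in>terms M. \<phi> = cEq s t \<and>
        truth_set M D \<phi> T (\<lambda>a A. \<exists>x\<in>M. denotes a s x \<and> denotes a t x)) \<or>
     (\<exists>t\<in>terms M. \<phi> = cS t \<and>
        truth_set M D \<phi> T (\<lambda>a A. \<exists>x\<in>U. denotes a t x)) \<or>
     (\<exists>j\<in>Omega. \<exists>t\<in>terms M. \<phi> = cApp2 j t \<and>
        truth_set M D \<phi> T (\<lambda>a A. \<exists>x\<in>M. \<exists>X\<in>D. denotes a t x \<and> opair j X \<epsilon> A \<and> x \<epsilon> X)) \<or>
     (\<exists>p\<in>V. \<exists>T1\<in>V. \<phi> = cNeg p \<and> P p T1 \<and>
        truth_set M D \<phi> T (\<lambda>a A. \<not> opair a A \<epsilon> T1)) \<or>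
     (\<exists>p\<in>V. \<exists>q\<in>V. \<exists>T1\<in>V. \<exists>T2\<in>V. \<phi> = cAnd p q \<and> P p T1 \<and> P q T2 \<and>
        truth_set M D \<phi> T (\<lambda>a A.
          (\<exists>b\<in>V. \<exists>B\<in>V. ext b \<subseteq> ext a \<and> ext B \<subseteq> ext A \<and> opair b B \<epsilon> T1) \<and>
          (\<exists>b\<in>V. \<exists>B\<in>V. ext b \<subseteq> ext a \<and> ext B \<subseteq> ext A \<and> opair b B \<epsilon> T2))) \<or>
     (\<exists>i\<in>Omega. \<exists>p\<in>V. \<exists>T1\<in>V. \<phi> = cAll i p \<and> P p T1 \<and>
        truth_set M D \<phi> T (\<lambda>a A.
          \<forall>x\<in>M. \<exists>b\<in>V. ext b \<subseteq> insert (opair i x) (ext a) \<and> opair b A \<epsilon> T1)) \<or>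
     (\<exists>j\<in>Omega. \<exists>p\<in>V. \<exists>T1\<in>V. \<phi> = cAll2 j p \<and> P p T1 \<and>
        truth_set M D \<phi> T (\<lambda>a A.
          \<forall>X\<in>D. \<exists>B\<in>V. ext B \<subseteq> insert (opair j X) (ext A) \<and> opair a B \<epsilon> T1))"

definition sat :: "'a set \<Rightarrow> 'a set \<Rightarrow> 'a set \<Rightarrow> 'a \<Rightarrow> 'a \<Rightarrow> 'a \<Rightarrow> bool" where
  "sat M U D \<phi> a A \<longleftrightarrow> (\<exists>T\<in>V. opair a A \<epsilon> T \<and>
     generated (\<lambda>P x. \<exists>\<psi>\<in>V. \<exists>S\<in>V. x = opair \<psi> S \<and>
                  sat_step M U D (\<lambda>\<psi> S. P (opair \<psi> S)) \<psi> S)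
               (opair \<phi> T))"

text \<open>\<open>(M, \<in>) \<Turnstile> \<phi>[a]\<close> for an \<open>\<L>\<close>-formula \<open>\<phi>\<close>; \<open>num 0\<close> is the empty second-order assignment.\<close>

definition sat1 :: "'a \<Rightarrow> 'a \<Rightarrow> 'a \<Rightarrow> bool" where
  "sat1 M \<phi> a \<longleftrightarrow> sat (ext M) {} {} \<phi> a (num 0)"

text \<open>\<open>(M, \<in>, U, D) \<Turnstile> \<phi>\<close> for a sentence \<open>\<phi>\<close> of \<open>\<L>\<^sub>2(S, c\<^sub>i)\<close>.\<close>

definition sat2 :: "'a \<Rightarrow> 'a \<Rightarrow> 'a set \<Rightarrow> 'a \<Rightarrow> bool" where
  "sat2 M U D \<phi> \<longleftrightarrow> sat (ext M) (ext U) D \<phi> (num 0) (num 0)"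


subsection \<open>Transitive models of ZFC\<close>

definition c_separation :: "'a \<Rightarrow> 'a \<Rightarrow> 'a \<Rightarrow> 'a \<Rightarrow> 'a" where
  "c_separation p x y z = cAll x (cEx y (cAll z
     (cIff (cMem (var z) (var y)) (cAnd (cMem (var z) (var x)) p))))"

text \<open>If for every \<open>x \<in> A\<close> there is a unique \<open>y\<close> with \<open>p(x, y)\<close>, then the image of \<open>A\<close> exists.\<close>

definition c_replacement :: "'a \<Rightarrow> 'a \<Rightarrow> 'a \<Rightarrow> 'a \<Rightarrow> 'a \<Rightarrow> 'a \<Rightarrow> 'a" where
  "c_replacement p A B x y z = cAll A (cImp
     (cAll x (cImp (cMem (var x) (var A)) (cEx z (cAll y (cIff p (cEq (var y) (var z)))))))
     (cEx B (cAll y (cIff (cMem (var y) (var B))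
                          (cEx x (cAnd (cMem (var x) (var A)) p))))))"

definition ZFC_axiom :: "'a \<Rightarrow> bool" where
  "ZFC_axiom \<phi> \<longleftrightarrow>
     \<phi> \<in> quote ` ZFC_single_axioms \<or>
     (\<exists>p\<in>V. \<exists>v\<in>V. \<exists>x\<in>Omega. \<exists>y\<in>Omega. \<exists>z\<in>Omega. L_formula p v \<and> distinct [x, y, z] \<and>
        y \<notin> ext v \<and> \<phi> = c_separation p x y z) \<or>
     (\<exists>p\<in>V. \<exists>v\<in>V. \<exists>A\<in>Omega. \<exists>B\<in>Omega. \<exists>x\<in>Omega. \<exists>y\<in>Omega. \<exists>z\<in>Omega.
        L_formula p v \<and> distinct [A, B, x, y, z] \<and> B \<notin> ext v \<and> z \<notin> ext v \<and>
        \<phi> = c_replacement p A B x y z)"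

text \<open>Truth of a formula with free variables is truth of its universal closure.\<close>

definition true_in :: "'a \<Rightarrow> 'a \<Rightarrow> bool" where
  "true_in M \<phi> \<longleftrightarrow> (\<exists>v\<in>V. L_formula \<phi> v \<and> (\<forall>a\<in>V. is_fun a (ext v) (ext M) \<longrightarrow> sat1 M \<phi> a))"

definition model :: "'a \<Rightarrow> bool" where
  "model M \<longleftrightarrow> M \<in> V \<and> (\<forall>x\<in>ext M. ext x \<subseteq> ext M) \<and> (\<forall>\<phi>\<in>V. ZFC_axiom \<phi> \<longrightarrow> true_in M \<phi>)"

definition Loc_ZFC :: bool where
  "Loc_ZFC \<longleftrightarrow> (\<forall>x\<in>V. \<exists>M\<in>V. model M \<and> x \<epsilon> M)"

definition LZFC :: bool where
  "LZFC \<longleftrightarrow> satisfies_theory V E BST \<and> Loc_ZFC"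

text \<open>The scheme holds in the universe for all formulas with arbitrary parameters.\<close>

definition Found_On :: bool where
  "Found_On \<longleftrightarrow> (\<forall>p e i. range e \<subseteq> V \<longrightarrow>
     (\<exists>\<alpha>\<in>On. holds V E (e(i := \<alpha>)) p) \<longrightarrow>
     (\<exists>\<alpha>\<in>On. holds V E (e(i := \<alpha>)) p \<and> (\<forall>\<beta>\<in>On. \<beta> \<epsilon> \<alpha> \<longrightarrow> \<not> holds V E (e(i := \<beta>)) p)))"


subsection \<open>Extendible and indescribable models\<close>

definition elementary_submodel :: "'a \<Rightarrow> 'a \<Rightarrow> bool" where
  "elementary_submodel M N \<longleftrightarrow> ext M \<subseteq> ext N \<and>
     (\<forall>\<phi>\<in>V. \<forall>v\<in>V. \<forall>a\<in>V. L_formula \<phi> v \<longrightarrow> is_fun a (ext v) (ext M) \<longrightarrow>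
        (sat1 M \<phi> a \<longleftrightarrow> sat1 N \<phi> a))"

definition extendible :: "'a \<Rightarrow> bool" where
  "extendible M \<longleftrightarrow> (\<exists>N\<in>V. model N \<and> M \<epsilon> N \<and> elementary_submodel M N)"

text \<open>The variable \<open>i\<close> of \<open>\<phi>\<close> runs through \<open>M\<close>, the assignment \<open>a\<close> supplies the parameters, and
  \<open>b\<close> is \<open>a\<close> extended by the value \<open>x\<close> for \<open>i\<close>.\<close>

definition Def :: "'a \<Rightarrow> 'a set" where
  "Def M = {X \<in> V. \<exists>\<phi>\<in>V. \<exists>v\<in>V. \<exists>i\<in>ext v. \<exists>a\<in>V.
     L_formula \<phi> v \<and> is_fun a (ext v - {i}) (ext M) \<and>
     ext X = {x \<in> ext M. \<exists>b\<in>V. ext b = insert (opair i x) (ext a) \<and> sat1 M \<phi> b}}"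

definition Pi11_indescribable :: "'a \<Rightarrow> bool" where
  "Pi11_indescribable M \<longleftrightarrow> (\<forall>U\<in>Def M. \<forall>\<phi>\<in>V.
     Pi11_sentence (ext M) \<phi> \<and> sat2 M U (Def M) \<phi> \<longrightarrow>
     (\<exists>N\<in>V. model N \<and> N \<epsilon> M \<and> Pi11_sentence (ext N) \<phi> \<and>
        (\<exists>W\<in>Def N. ext W = ext U \<inter> ext N \<and> sat2 N W (Def N) \<phi>)))"

end

end

theory Submission
  imports Defs
begin

text \<open>If \<open>M \<prec> N\<close> and \<open>M \<in> N\<close>, then \<open>N\<close> sees that \<open>M\<close> itself is a model in which the given
  \<open>\<Pi>\<^sup>1\<^sub>1\<close> sentence holds of the class defined by the given formula, and elementarity produces such
  a model inside \<open>M\<close>. For the second part, a membership-minimal \<open>\<Pi>\<^sup>1\<^sub>1\<close>-indescribable model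
  among the members of \<open>{M} \<union> M\<close> cannot be extendible, since otherwise its indescribability would
  be reflected to one of its elements; Foundation for sets holds because every set lies in a model
  of ZFC.

  What makes this work over the weak theory LZFC, in a universe whose natural numbers may be
  nonstandard, is that satisfaction is absolute: the stages of a formation or truth sequence lie in
  any model that contains its parameters, by induction along the sequence, so quantifiers over such
  sequences may be restricted to models. Induction is available because every set lies in a transitive
  set, so that instances of separation can be bounded by it. Truth sets for a
  model exist for all formulas, even nonstandard ones, since the instances of Separation true in
  the model contain them as subformulas.\<close>


text \<open>The obstacle is that BST separates only by Delta_0 formulas, whereas formation, truth
  and indescribability quantify over all of \<open>V\<close>. The notion \<open>adef\<close> removes
  it and serves twice. A predicate that one standard formula defines in every model becomes Delta_0
  once the formula is relativized to a model, so it may be used in Separation; and since the very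
  same formula works in \<open>M\<close> and in \<open>N\<close>, its truth can be carried over by
  elementarity. The labour lies in confining witnesses: for each definition that says
  \<open>\<exists>x\<in>V\<close>, every such \<open>x\<close> is shown to belong to all models that
  contain the parameters.

  Two languages have to be kept apart. Formulas of type \<open>fm\<close> are standard and admit HOL
  induction; they are the means of definability arguments. Codes in \<open>V\<close> admit only
  induction along generating sequences, and only for definable predicates. The function
  \<open>quote_with\<close> leads from the first language to the second; there is no way
  back.\<close>

lemma holds_FOr [simp]: "holds V E e (FOr p q) \<longleftrightarrow> holds V E e p \<or> holds V E e q"
  by (simp add: FOr_def)

lemma holds_FImp [simp]: "holds V E e (FImp p q) \<longleftrightarrow> (holds V E e p \<longrightarrow> holds V E e q)"
  by (simp add: FImp_def)

lemma holds_FIff [simp]: "holds V E e (FIff p q) \<longleftrightarrow> (holds V E e p \<longleftrightarrow> holds V E e q)"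
  by (auto simp add: FIff_def)

lemma holds_FEx [simp]: "holds V E e (FEx i p) \<longleftrightarrow> (\<exists>x\<in>V. holds V E (e(i := x)) p)"
  by (simp add: FEx_def)

lemma holds_FAllIn [simp]:
  "holds V E e (FAllIn i j p) \<longleftrightarrow>
     (\<forall>x\<in>V. E x ((e(i := x)) j) \<longrightarrow> holds V E (e(i := x)) p)"
  by (simp add: FAllIn_def)

lemma holds_FExIn [simp]:
  "holds V E e (FExIn i j p) \<longleftrightarrow>
     (\<exists>x\<in>V. E x ((e(i := x)) j) \<and> holds V E (e(i := x)) p)"
  by (simp add: FExIn_def)

section \<open>Free variables and renaming of formulas\<close>

lemma finite_fv [simp]: "finite (fv p)"
  by (induction p) auto

lemma holds_cong: "(\<And>n. n \<in> fv p \<Longrightarrow> e n = e' n) \<Longrightarrow> holds V E e p = holds V E e' p"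
proof (induction p arbitrary: e e')
  case (FAll i p)
  have "holds V E (e(i := x)) p = holds V E (e'(i := x)) p" for x
    by (rule FAll.IH) (use FAll.prems in auto)
  then show ?case by simp
next
  case (FNeg p)
  then show ?case by (metis fv.simps(3) holds.simps(3))
next
  case (FAnd p q)
  then show ?case by (metis UnCI fv.simps(4) holds.simps(4))
qed auto

text \<open>No injectivity of \<open>f\<close> is assumed: each bound variable is moved to an index
  outside the image of the free variables, so nothing is captured. The same \<open>q\<close> serves
  all domains and assignments, as a formula for all models at once must.\<close>

lemma holds_rename: "\<exists>q. \<forall>W e. holds W E e q \<longleftrightarrow> holds W E (\<lambda>n. e (f n)) p"
proof (induction p arbitrary: f)
  case (FMem i j)
  show ?case by (rule exI[of _ "FMem (f i) (f j)"]) simp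
next
  case (FEq i j)
  show ?case by (rule exI[of _ "FEq (f i) (f j)"]) simp
next
  case (FNeg p)
  then obtain q where "\<forall>W e. holds W E e q \<longleftrightarrow> holds W E (\<lambda>n. e (f n)) p" by blast
  then show ?case by (intro exI[of _ "FNeg q"]) simp
next
  case (FAnd p1 p2)
  obtain q1 where "\<forall>W e. holds W E e q1 \<longleftrightarrow> holds W E (\<lambda>n. e (f n)) p1"
    using FAnd.IH(1) by blast
  moreover obtain q2 where "\<forall>W e. holds W E e q2 \<longleftrightarrow> holds W E (\<lambda>n. e (f n)) p2"
    using FAnd.IH(2) by blast
  ultimately show ?case by (intro exI[of _ "FAnd q1 q2"]) simp
next
  case (FAll i p)
  obtain k where k: "k \<notin> f ` fv p"
    using ex_new_if_finite[OF infinite_UNIV_nat, of "f ` fv p"] by auto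
  obtain q where q: "\<forall>W e. holds W E e q \<longleftrightarrow> holds W E (\<lambda>n. e ((f(i := k)) n)) p"
    using FAll.IH by blast
  have "holds W E (\<lambda>n. (e(k := x)) ((f(i := k)) n)) p = holds W E ((\<lambda>n. e (f n))(i := x)) p"
    for W e x
    by (rule holds_cong) (use k in auto)
  with q show ?case by (intro exI[of _ "FAll k q"]) simp
qed

section \<open>Relativization to a set\<close>

primrec relativize :: "nat \<Rightarrow> fm \<Rightarrow> fm" where
  "relativize k (FMem i j) = FMem i j"
| "relativize k (FEq i j) = FEq i j"
| "relativize k (FNeg p) = FNeg (relativize k p)"
| "relativize k (FAnd p q) = FAnd (relativize k p) (relativize k q)"
| "relativize k (FAll i p) = FAllIn i k (relativize k p)"

primrec vars :: "fm \<Rightarrow> nat set" where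
  "vars (FMem i j) = {i, j}"
| "vars (FEq i j) = {i, j}"
| "vars (FNeg p) = vars p"
| "vars (FAnd p q) = vars p \<union> vars q"
| "vars (FAll i p) = insert i (vars p)"

lemma finite_vars [simp]: "finite (vars p)"
  by (induction p) auto

lemma fv_relativize: "fv (relativize k p) \<subseteq> insert k (vars p)"
  by (induction p) (auto simp: FAllIn_def FImp_def)

text \<open>The gate through which arbitrary formulas enter Delta_0-Separation: all quantifiers
  become bounded by the parameter \<open>k\<close>, whose value will be a model. The set
  \<open>vars\<close> counts bound variables too, so that no quantifier captures
  \<open>k\<close>.\<close>

lemma delta0_relativize: "k \<notin> vars p \<Longrightarrow> delta0 (relativize k p)"
  by (induction p) (auto intro: delta0.intros)

lemma holds_relativize:
  "k \<notin> vars p \<Longrightarrow> holds V E e (relativize k p) \<longleftrightarrow> holds {x \<in> V. E x (e k)} E e p"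
  by (induction p arbitrary: e) (auto simp: fun_upd_twist)

section \<open>Elementary set theory in the universe\<close>

locale lzfc = universe +
  assumes BST: "satisfies_theory V E BST" and Loc: Loc_ZFC and nonempty: "V \<noteq> {}"
begin

lemma holds_BST: "p \<in> BST \<Longrightarrow> range e \<subseteq> V \<Longrightarrow> holds V E e p"
  using BST by (auto simp: satisfies_theory_def)

lemma ext_subset: "ext x \<subseteq> V" by (auto simp: ext_def)

lemma extD: "y \<in> ext x \<Longrightarrow> y \<in> V \<and> y \<epsilon> x" by (auto simp: ext_def)

lemma ext_in_V: "y \<in> ext x \<Longrightarrow> y \<in> V" by (auto simp: ext_def)

lemma mem_ext: "y \<in> V \<Longrightarrow> y \<in> ext x \<longleftrightarrow> y \<epsilon> x" by (auto simp: ext_def)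

lemma ext_eqI: "x \<in> V \<Longrightarrow> y \<in> V \<Longrightarrow> ext x = ext y \<Longrightarrow> x = y"
proof -
  assume a: "x \<in> V" "y \<in> V" "ext x = ext y"
  have "holds V E (\<lambda>_. x) Extensionality"
    by (rule holds_BST) (use a in \<open>auto simp: BST_def\<close>)
  then have "\<forall>x\<in>V. \<forall>y\<in>V. (\<forall>z\<in>V. z \<epsilon> x \<longleftrightarrow> z \<epsilon> y) \<longrightarrow> x = y"
    by (simp add: Extensionality_def)
  with a show ?thesis by (auto simp: ext_def set_eq_iff)
qed

text \<open>Marks the HOL sets on which \<open>mk\<close> is specified; for any other argument
  \<open>mk\<close> denotes nothing useful.\<close>

definition isset :: "'a set \<Rightarrow> bool" where
  "isset X \<longleftrightarrow> (\<exists>x\<in>V. ext x = X)"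

lemma isset_ext [simp]: "x \<in> V \<Longrightarrow> isset (ext x)" by (auto simp: isset_def)

lemma issetE: assumes "isset X" obtains x where "x \<in> V" "ext x = X"
  using assms by (auto simp: isset_def)

lemma mk_ext [simp]: "x \<in> V \<Longrightarrow> mk (ext x) = x"
  unfolding mk_def by (rule the_equality) (auto intro: ext_eqI)

lemma mk_in_V [simp]: "isset X \<Longrightarrow> mk X \<in> V" by (auto elim!: issetE)

lemma ext_mk [simp]: "isset X \<Longrightarrow> ext (mk X) = X" by (auto elim!: issetE)

lemma mk_eq_iff: "isset X \<Longrightarrow> x \<in> V \<Longrightarrow> x = mk X \<longleftrightarrow> ext x = X"
  by (auto elim!: issetE intro: ext_eqI)

lemma isset_empty [simp]: "isset {}"
proof -
  obtain x where "x \<in> V" using nonempty by blast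
  then have "holds V E (\<lambda>_. x) Empty_set" by (intro holds_BST) (auto simp: BST_def)
  then show ?thesis by (auto simp: Empty_set_def isset_def ext_def)
qed

lemma isset_pair [simp]: "x \<in> V \<Longrightarrow> y \<in> V \<Longrightarrow> isset {x, y}"
proof -
  assume a: "x \<in> V" "y \<in> V"
  have "holds V E (\<lambda>_. x) Pairing" by (rule holds_BST) (use a in \<open>auto simp: BST_def\<close>)
  then have "\<forall>x\<in>V. \<forall>y\<in>V. \<exists>z\<in>V. \<forall>w\<in>V. w \<epsilon> z \<longleftrightarrow> w = x \<or> w = y"
    by (simp add: Pairing_def)
  then obtain z where "z \<in> V" "\<forall>w\<in>V. w \<epsilon> z \<longleftrightarrow> w = x \<or> w = y" using a by blast
  with a show ?thesis unfolding isset_def by (intro bexI[of _ z]) (auto simp: ext_def)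
qed

lemma isset_single [simp]: "x \<in> V \<Longrightarrow> isset {x}"
  using isset_pair[of x x] by simp

lemma isset_Union: "x \<in> V \<Longrightarrow> isset (\<Union>y\<in>ext x. ext y)"
proof -
  assume a: "x \<in> V"
  have "holds V E (\<lambda>_. x) Union_ax" by (rule holds_BST) (use a in \<open>auto simp: BST_def\<close>)
  then have "\<forall>x\<in>V. \<exists>z\<in>V. \<forall>w\<in>V. w \<epsilon> z \<longleftrightarrow> (\<exists>y\<in>V. y \<epsilon> x \<and> w \<epsilon> y)"
    by (simp add: Union_ax_def)
  then obtain z where "z \<in> V" "\<forall>w\<in>V. w \<epsilon> z \<longleftrightarrow> (\<exists>y\<in>V. y \<epsilon> x \<and> w \<epsilon> y)" using a by blast
  with a show ?thesis unfolding isset_def by (intro bexI[of _ z]) (auto simp: ext_def)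
qed

lemma isset_Un [simp]: assumes "isset X" "isset Y" shows "isset (X \<union> Y)"
proof -
  obtain x y where xy: "x \<in> V" "y \<in> V" "ext x = X" "ext y = Y" using assms by (meson issetE)
  then have "isset (\<Union>z\<in>ext (mk {x, y}). ext z)" by (intro isset_Union mk_in_V) auto
  with xy show ?thesis by simp
qed

lemma isset_insert [simp]: "x \<in> V \<Longrightarrow> isset X \<Longrightarrow> isset (insert x X)"
  using isset_Un[of "{x}" X] by simp

lemma opair_in_V [simp]: "x \<in> V \<Longrightarrow> y \<in> V \<Longrightarrow> opair x y \<in> V"
  by (auto simp: opair_def intro!: mk_in_V)

lemma mk_eq_mk: "isset X \<Longrightarrow> isset Y \<Longrightarrow> mk X = mk Y \<longleftrightarrow> X = Y"
  by (metis ext_mk)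

lemma opair_inject [simp]:
  "x \<in> V \<Longrightarrow> y \<in> V \<Longrightarrow> x' \<in> V \<Longrightarrow> y' \<in> V \<Longrightarrow> opair x y = opair x' y' \<longleftrightarrow> x = x' \<and> y = y'"
  by (auto simp: opair_def mk_eq_mk mk_in_V doubleton_eq_iff)

lemma triple_in_V [simp]: "x \<in> V \<Longrightarrow> y \<in> V \<Longrightarrow> z \<in> V \<Longrightarrow> triple x y z \<in> V"
  by (simp add: triple_def)

lemma triple_inject [simp]:
  "x \<in> V \<Longrightarrow> y \<in> V \<Longrightarrow> z \<in> V \<Longrightarrow> x' \<in> V \<Longrightarrow> y' \<in> V \<Longrightarrow> z' \<in> V \<Longrightarrow>
   triple x y z = triple x' y' z' \<longleftrightarrow> x = x' \<and> y = y' \<and> z = z'"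
  by (simp add: triple_def)

text \<open>On the right everything is read off from members of \<open>t\<close> and their members,
  so the condition means the same in every transitive set containing \<open>t\<close>; the
  definition through \<open>mk\<close> does not show this.\<close>

lemma opair_eq_iff:
  "t \<in> V \<Longrightarrow> x \<in> V \<Longrightarrow> y \<in> V \<Longrightarrow> t = opair x y \<longleftrightarrow>
     (\<exists>s\<in>ext t. \<exists>u\<in>ext t. ext s = {x} \<and> ext u = {x, y} \<and> ext t = {s, u})"
proof -
  assume a: "t \<in> V" "x \<in> V" "y \<in> V"
  have "t = opair x y \<longleftrightarrow> ext t = {mk {x}, mk {x, y}}"
    using a unfolding opair_def by (intro mk_eq_iff) (auto intro: mk_in_V)
  also have "\<dots> \<longleftrightarrow> (\<exists>s\<in>ext t. \<exists>u\<in>ext t. s = mk {x} \<and> u = mk {x, y} \<and> ext t = {s, u})"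
    by auto
  also have "\<dots> \<longleftrightarrow> (\<exists>s\<in>ext t. \<exists>u\<in>ext t. ext s = {x} \<and> ext u = {x, y} \<and> ext t = {s, u})"
    using a by (intro bex_cong refl) (metis ext_in_V isset_pair isset_single mk_eq_iff)
  finally show ?thesis .
qed

lemma isset_times: "a \<in> V \<Longrightarrow> b \<in> V \<Longrightarrow> isset {opair x y | x y. x \<in> ext a \<and> y \<in> ext b}"
proof -
  assume a: "a \<in> V" "b \<in> V"
  have "holds V E (\<lambda>_. a) Cartesian_product"
    by (rule holds_BST) (use a in \<open>auto simp: BST_def\<close>)
  then have "\<forall>a\<in>V. \<forall>b\<in>V. \<exists>c\<in>V. \<forall>t\<in>V. t \<epsilon> c \<longleftrightarrow> (\<exists>x\<in>V. x \<epsilon> a \<and> (\<exists>y\<in>V. y \<epsilon> b \<and>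
     (\<forall>s\<in>V. s \<epsilon> t \<longleftrightarrow> (\<forall>w\<in>V. w \<epsilon> s \<longleftrightarrow> w = x) \<or> (\<forall>w\<in>V. w \<epsilon> s \<longleftrightarrow> w = x \<or> w = y))))"
    by (simp add: Cartesian_product_def)
  from bspec[OF bspec[OF this a(1)] a(2)]
  obtain c where c: "c \<in> V" "\<forall>t\<in>V. t \<epsilon> c \<longleftrightarrow> (\<exists>x\<in>V. x \<epsilon> a \<and> (\<exists>y\<in>V. y \<epsilon> b \<and>
     (\<forall>s\<in>V. s \<epsilon> t \<longleftrightarrow> (\<forall>w\<in>V. w \<epsilon> s \<longleftrightarrow> w = x) \<or> (\<forall>w\<in>V. w \<epsilon> s \<longleftrightarrow> w = x \<or> w = y))))"
    by (elim bexE)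
  have *: "(\<forall>s\<in>V. s \<epsilon> t \<longleftrightarrow> (\<forall>w\<in>V. w \<epsilon> s \<longleftrightarrow> w = x) \<or> (\<forall>w\<in>V. w \<epsilon> s \<longleftrightarrow> w = x \<or> w = y))
      \<longleftrightarrow> t = opair x y" if "t \<in> V" "x \<in> V" "y \<in> V" for t x y
  proof -
    have 1: "(\<forall>w\<in>V. w \<epsilon> s \<longleftrightarrow> w = x) \<longleftrightarrow> s = mk {x}" if "s \<in> V" for s
      using that \<open>x \<in> V\<close> by (subst mk_eq_iff) (auto simp: ext_def)
    have 2: "(\<forall>w\<in>V. w \<epsilon> s \<longleftrightarrow> w = x \<or> w = y) \<longleftrightarrow> s = mk {x, y}" if "s \<in> V" for s
      using that \<open>x \<in> V\<close> \<open>y \<in> V\<close> by (subst mk_eq_iff) (auto simp: ext_def)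
    have "t = opair x y \<longleftrightarrow> ext t = {mk {x}, mk {x, y}}"
      using that unfolding opair_def by (intro mk_eq_iff) (auto intro: mk_in_V)
    also have "\<dots> \<longleftrightarrow> (\<forall>s\<in>V. s \<epsilon> t \<longleftrightarrow> s = mk {x} \<or> s = mk {x, y})"
      using that by (auto simp: ext_def mk_in_V set_eq_iff)
    finally show ?thesis using 1 2 by simp
  qed
  have "t \<epsilon> c \<longleftrightarrow> (\<exists>x\<in>V. x \<epsilon> a \<and> (\<exists>y\<in>V. y \<epsilon> b \<and> t = opair x y))" if t: "t \<in> V" for t
    unfolding c(2)[rule_format, OF t] by (intro bex_cong conj_cong refl * t)
  then have "ext c = {opair x y | x y. x \<in> ext a \<and> y \<in> ext b}"
    by (fastforce simp: ext_def)
  with c show ?thesis unfolding isset_def by blast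
qed

text \<open>Satisfaction of a standard formula in a set \<open>K\<close> is Delta_0 in the parameter
  \<open>K\<close>, so one instance of the scheme suffices. Variable \<open>0\<close> is the tested
  element, \<open>a\<close> the given set, \<open>b\<close> the subset and \<open>k\<close> the
  bound \<open>K\<close>.\<close>

lemma rel_separation:
  assumes K: "K \<in> V" and x: "x \<in> V" and e: "range e \<subseteq> ext K"
  shows "isset {z \<in> ext x. z \<in> ext K \<and> holds (ext K) E (e(0 := z)) p}"
proof -
  define B where "B = insert 0 (vars p)"
  have fB: "finite B" by (simp add: B_def)
  obtain k where k: "k \<notin> B" using ex_new_if_finite[OF infinite_UNIV_nat fB] by blast
  obtain a where a: "a \<notin> insert k B"
    using ex_new_if_finite[OF infinite_UNIV_nat, of "insert k B"] fB by blast
  obtain b where b: "b \<notin> insert a (insert k B)"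
    using ex_new_if_finite[OF infinite_UNIV_nat, of "insert a (insert k B)"] fB by blast
  define q where "q = FAnd (FMem 0 k) (relativize k p)"
  have "delta0 q" using k by (auto simp: q_def B_def intro: delta0_relativize delta0.intros)
  moreover have "b \<notin> fv q"
    using b fv_relativize[of k p] by (auto simp: q_def B_def)
  moreover have "distinct [a, b, 0]" using a b by (auto simp: B_def)
  ultimately have "Separation q a b 0 \<in> BST" unfolding BST_def by blast
  then have "holds V E (e(k := K)) (Separation q a b 0)"
    by (rule holds_BST) (use e K ext_in_V in \<open>auto simp: image_subset_iff\<close>)
  with x a b have "\<exists>y\<in>V. \<forall>z\<in>V. z \<epsilon> y \<longleftrightarrow> z \<epsilon> x \<and>
      holds V E (e(k := K, a := x, b := y, 0 := z)) q"
    by (auto simp: Separation_def B_def)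
  then obtain y where y: "y \<in> V" "\<And>z. z \<in> V \<Longrightarrow> z \<epsilon> y \<longleftrightarrow> z \<epsilon> x \<and>
      holds V E (e(k := K, a := x, b := y, 0 := z)) q" by blast
  have "holds V E (e(k := K, a := x, b := y, 0 := z)) q \<longleftrightarrow>
        z \<in> ext K \<and> holds (ext K) E (e(0 := z)) p" if "z \<in> V" for z
  proof -
    have "holds V E (e(k := K, a := x, b := y, 0 := z)) (relativize k p) \<longleftrightarrow>
      holds {w \<in> V. E w ((e(k := K, a := x, b := y, 0 := z)) k)} E (e(k := K, a := x, b := y, 0 := z)) p"
      using k by (intro holds_relativize) (simp add: B_def)
    also have "\<dots> \<longleftrightarrow> holds (ext K) E (e(k := K, a := x, b := y, 0 := z)) p"
      using k a b by (simp add: ext_def B_def)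
    also have "\<dots> \<longleftrightarrow> holds (ext K) E (e(0 := z)) p"
    proof (rule holds_cong)
      have "fv p \<subseteq> vars p" by (induction p) auto
      then show "n \<in> fv p \<Longrightarrow> (e(k := K, a := x, b := y, 0 := z)) n = (e(0 := z)) n" for n
        using k a b by (auto simp: B_def)
    qed
    finally show ?thesis using that k a b by (auto simp: q_def ext_def B_def)
  qed
  with y have "ext y = {z \<in> ext x. z \<in> ext K \<and> holds (ext K) E (e(0 := z)) p}"
    by (auto simp: ext_def)
  with y show ?thesis unfolding isset_def by blast
qed

lemma model_in_V: "model K \<Longrightarrow> K \<in> V" by (simp add: model_def)

lemma model_trans: "model K \<Longrightarrow> x \<in> ext K \<Longrightarrow> y \<in> ext x \<Longrightarrow> y \<in> ext K"
  by (auto simp: model_def)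

lemma model_opairD:
  assumes K: "model K" and t: "opair x y \<in> ext K" and xy: "x \<in> V" "y \<in> V"
  shows "x \<in> ext K \<and> y \<in> ext K"
proof -
  have "mk {x, y} \<in> ext (opair x y)" using xy by (simp add: opair_def mk_in_V)
  then have "mk {x, y} \<in> ext K" using model_trans K t by blast
  moreover have "x \<in> ext (mk {x, y})" "y \<in> ext (mk {x, y})" using xy by auto
  ultimately show ?thesis using model_trans K by blast
qed

lemma model_tripleD:
  "model K \<Longrightarrow> triple x y z \<in> ext K \<Longrightarrow> x \<in> V \<Longrightarrow> y \<in> V \<Longrightarrow> z \<in> V \<Longrightarrow>
   x \<in> ext K \<and> y \<in> ext K \<and> z \<in> ext K"
  unfolding triple_def by (meson model_opairD opair_in_V)

text \<open>\<open>Loc_ZFC\<close> provides a model around a single set. The list is packed into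
  nested pairs, which transitivity of the model unpacks again.\<close>

lemma model_containing:
  assumes "set ps \<subseteq> V" shows "\<exists>K. model K \<and> set ps \<subseteq> ext K"
proof -
  have "\<exists>t\<in>V. \<forall>K. model K \<longrightarrow> t \<in> ext K \<longrightarrow> set ps \<subseteq> ext K" using assms
  proof (induction ps)
    case Nil
    then show ?case using nonempty by auto
  next
    case (Cons a ps)
    then obtain t where t: "t \<in> V" "\<forall>K. model K \<longrightarrow> t \<in> ext K \<longrightarrow> set ps \<subseteq> ext K" by auto
    with Cons.prems show ?case by (intro bexI[of _ "opair a t"]) (auto dest: model_opairD)
  qed
  then show ?thesis using Loc unfolding Loc_ZFC_def by (meson mem_ext)
qed

section \<open>Predicates defined by one formula in all models\<close>

text \<open>A predicate is \<open>adef\<close> if one formula defines it in all models at once. The predicate itself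
  is evaluated in the universe, so this is definability and absoluteness in one notion; \<open>aterm\<close>
  and \<open>acls\<close> are its analogues for functions and for classes.\<close>

definition adef :: "((nat \<Rightarrow> 'a) \<Rightarrow> bool) \<Rightarrow> bool" where
  "adef P \<longleftrightarrow> (\<exists>p. \<forall>K e. model K \<longrightarrow> range e \<subseteq> ext K \<longrightarrow> (holds (ext K) E e p \<longleftrightarrow> P e))"

definition aterm :: "((nat \<Rightarrow> 'a) \<Rightarrow> 'a) \<Rightarrow> bool" where
  "aterm F \<longleftrightarrow> (\<forall>K e. model K \<longrightarrow> range e \<subseteq> ext K \<longrightarrow> F e \<in> ext K) \<and>
     adef (\<lambda>e. e 0 = F (\<lambda>n. e (Suc n)))"

definition acls :: "((nat \<Rightarrow> 'a) \<Rightarrow> 'a set) \<Rightarrow> bool" where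
  "acls A \<longleftrightarrow> (\<forall>K e. model K \<longrightarrow> range e \<subseteq> ext K \<longrightarrow> A e \<subseteq> ext K) \<and>
     adef (\<lambda>e. e 0 \<in> A (\<lambda>n. e (Suc n)))"

text \<open>A parameter list read as a total assignment. Taking the head as the default keeps the
  range inside every model that contains the listed sets.\<close>

definition env :: "'a list \<Rightarrow> nat \<Rightarrow> 'a" where
  "env xs n = (if n < length xs then xs ! n else hd xs)"

lemma env_simps [simp]:
  "env (x # xs) 0 = x" "n < length xs \<Longrightarrow> env (x # xs) (Suc n) = xs ! n"
  by (auto simp: env_def)

lemma range_env: "xs \<noteq> [] \<Longrightarrow> range (env xs) \<subseteq> set xs"
  by (auto simp: env_def)

lemma adefI: "(\<And>K e. model K \<Longrightarrow> range e \<subseteq> ext K \<Longrightarrow> holds (ext K) E e p \<longleftrightarrow> P e) \<Longrightarrow> adef P"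
  unfolding adef_def by blast

lemma adefE:
  assumes "adef P"
  obtains p where "\<And>K e. model K \<Longrightarrow> range e \<subseteq> ext K \<Longrightarrow> holds (ext K) E e p \<longleftrightarrow> P e"
  using assms unfolding adef_def by blast

lemma adef_cong:
  assumes "adef P" "\<And>K e. model K \<Longrightarrow> range e \<subseteq> ext K \<Longrightarrow> Q e \<longleftrightarrow> P e"
  shows "adef Q"
  using assms(1) by (elim adefE, intro adefI) (simp add: assms(2))

lemma adef_rename: "adef P \<Longrightarrow> adef (\<lambda>e. P (\<lambda>n. e (f n)))"
proof -
  assume "adef P"
  then obtain p where p: "\<And>K e. model K \<Longrightarrow> range e \<subseteq> ext K \<Longrightarrow> holds (ext K) E e p \<longleftrightarrow> P e"
    by (rule adefE) blast
  obtain q where q: "\<forall>W (e :: nat \<Rightarrow> 'a). holds W E e q \<longleftrightarrow> holds W E (\<lambda>n. e (f n)) p"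
    using holds_rename[where E = E] by blast
  show ?thesis
  proof (rule adefI)
    fix K and e :: "nat \<Rightarrow> 'a" assume K: "model K" "range e \<subseteq> ext K"
    then have "range (\<lambda>n. e (f n)) \<subseteq> ext K" by auto
    with K(1) q p show "holds (ext K) E e q \<longleftrightarrow> P (\<lambda>n. e (f n))" by blast
  qed
qed

section \<open>Closure of definability under logical operations and substitution\<close>

lemma adef_not: "adef P \<Longrightarrow> adef (\<lambda>e. \<not> P e)"
  by (elim adefE, rule_tac p = "FNeg p" in adefI) simp

lemma adef_and: "adef P \<Longrightarrow> adef Q \<Longrightarrow> adef (\<lambda>e. P e \<and> Q e)"
  by (elim adefE, rule_tac p = "FAnd p pa" in adefI) simp

lemma adef_or: "adef P \<Longrightarrow> adef Q \<Longrightarrow> adef (\<lambda>e. P e \<or> Q e)"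
  by (elim adefE, rule_tac p = "FOr p pa" in adefI) simp

lemma adef_imp: "adef P \<Longrightarrow> adef Q \<Longrightarrow> adef (\<lambda>e. P e \<longrightarrow> Q e)"
  by (elim adefE, rule_tac p = "FImp p pa" in adefI) simp

lemma adef_iff: "adef P \<Longrightarrow> adef Q \<Longrightarrow> adef (\<lambda>e. P e \<longleftrightarrow> Q e)"
  by (elim adefE, rule_tac p = "FIff p pa" in adefI) simp

lemma adef_const: "adef (\<lambda>e. b)"
  by (rule adefI[of "if b then FEq 0 0 else FNeg (FEq 0 0)"]) simp

text \<open>Predicates follow a de Bruijn convention: the bound element is \<open>e 0\<close> and
  the old assignment is shifted by one. Formulas have named variables, hence the fresh index
  \<open>k\<close> and the renaming along \<open>case_nat k id\<close>. The second premise carries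
  the absoluteness: having a witness in \<open>K\<close> must be the same statement for every model
  \<open>K\<close>.\<close>

lemma adef_ex_K:
  assumes P: "adef (\<lambda>e. P (e 0) (\<lambda>n. e (Suc n)))"
    and Q: "\<And>K e. model K \<Longrightarrow> range e \<subseteq> ext K \<Longrightarrow> Q e \<longleftrightarrow> (\<exists>x\<in>ext K. P x e)"
  shows "adef Q"
proof -
  from P obtain p where p: "\<And>K e. model K \<Longrightarrow> range e \<subseteq> ext K \<Longrightarrow>
    holds (ext K) E e p \<longleftrightarrow> P (e 0) (\<lambda>n. e (Suc n))" by (rule adefE) blast
  obtain k where k: "k \<notin> (\<lambda>n. n - 1) ` fv p"
    using ex_new_if_finite[OF infinite_UNIV_nat, of "(\<lambda>n. n - 1) ` fv p"] by auto
  obtain q where q: "\<forall>W (e :: nat \<Rightarrow> 'a). holds W E e q \<longleftrightarrow> holds W E (\<lambda>n. e (case_nat k id n)) p"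
    using holds_rename[where E = E] by blast
  show ?thesis
  proof (rule adefI)
    fix K and e :: "nat \<Rightarrow> 'a" assume K: "model K" "range e \<subseteq> ext K"
    have "holds (ext K) E (e(k := x)) q \<longleftrightarrow> P x e" if x: "x \<in> ext K" for x
    proof -
      have "holds (ext K) E (e(k := x)) q \<longleftrightarrow> holds (ext K) E (\<lambda>n. (e(k := x)) (case_nat k id n)) p"
        using q by blast
      also have "\<dots> \<longleftrightarrow> holds (ext K) E (case_nat x e) p"
        by (rule holds_cong) (use k in \<open>force split: nat.splits\<close>)
      also have "\<dots> \<longleftrightarrow> P x e"
        by (subst p[OF K(1)]) (use K x in \<open>auto simp: image_subset_iff split: nat.splits\<close>)
      finally show ?thesis .
    qed
    then show "holds (ext K) E e (FEx k q) \<longleftrightarrow> Q e" using Q[OF K] by simp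
  qed
qed

text \<open>An unbounded quantifier is harmless if all its witnesses lie in each model that contains
  the parameters. Most absoluteness proofs below reduce to the second premise of this rule.\<close>

lemma adef_exV:
  assumes "adef (\<lambda>e. P (e 0) (\<lambda>n. e (Suc n)))"
    and "\<And>K e x. model K \<Longrightarrow> range e \<subseteq> ext K \<Longrightarrow> x \<in> V \<Longrightarrow> P x e \<Longrightarrow> x \<in> ext K"
  shows "adef (\<lambda>e. \<exists>x\<in>V. P x e)"
  by (rule adef_ex_K[OF assms(1)]) (use assms(2) ext_in_V in blast)

lemma aterm_var: "aterm (\<lambda>e. e i)"
  unfolding aterm_def by (auto intro: adefI[of "FEq 0 (Suc i)"])

lemma aterm_in: "aterm F \<Longrightarrow> model K \<Longrightarrow> range e \<subseteq> ext K \<Longrightarrow> F e \<in> ext K"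
  by (auto simp: aterm_def)

lemma aterm_graph: "aterm F \<Longrightarrow> adef (\<lambda>e. e 0 = F (\<lambda>n. e (Suc n)))"
  by (auto simp: aterm_def)

lemma acls_sub: "acls A \<Longrightarrow> model K \<Longrightarrow> range e \<subseteq> ext K \<Longrightarrow> A e \<subseteq> ext K"
  by (auto simp: acls_def)

lemma acls_graph: "acls A \<Longrightarrow> adef (\<lambda>e. e 0 \<in> A (\<lambda>n. e (Suc n)))"
  by (auto simp: acls_def)

lemma range_Suc: "range e \<subseteq> A \<Longrightarrow> range (\<lambda>n. e (Suc n)) \<subseteq> A" by auto

lemma aterm_lift: "aterm F \<Longrightarrow> aterm (\<lambda>e. F (\<lambda>n. e (Suc n)))"
  unfolding aterm_def using adef_rename[of "\<lambda>e. e 0 = F (\<lambda>n. e (Suc n))" "case_nat 0 (\<lambda>n. Suc (Suc n))"]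
  by (auto simp: range_Suc image_subset_iff)

lemma acls_lift: "acls F \<Longrightarrow> acls (\<lambda>e. F (\<lambda>n. e (Suc n)))"
  unfolding acls_def using adef_rename[of "\<lambda>e. e 0 \<in> F (\<lambda>n. e (Suc n))" "case_nat 0 (\<lambda>n. Suc (Suc n))"]
  by (simp add: range_Suc)

text \<open>Substitution is expressed as \<open>\<exists>x. x = F e \<and> R x e\<close>: the graph
  of \<open>F\<close> is definable and its value lies in the model, so formulas need no function
  symbols.\<close>

lemma adef_sub:
  assumes "adef (\<lambda>e. R (e 0) (\<lambda>n. e (Suc n)))" "aterm F"
  shows "adef (\<lambda>e. R (F e) e)"
  by (rule adef_ex_K[OF adef_and[OF aterm_graph[OF assms(2)] assms(1)]])
    (use aterm_in[OF assms(2)] in auto)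

lemma adef_comp2:
  assumes "\<And>i j. adef (\<lambda>e. R (e i) (e j))" "aterm F" "aterm G"
  shows "adef (\<lambda>e. R (F e) (G e))"
  by (rule adef_sub[of "\<lambda>x e. R x (G e)", OF _ assms(2)],
      rule adef_sub[of "\<lambda>x e. R (e 0) x", OF _ aterm_lift[OF assms(3)]]) (rule assms(1))

lemma adef_comp3:
  assumes "\<And>i j k. adef (\<lambda>e. R (e i) (e j) (e k))" "aterm F" "aterm G" "aterm H"
  shows "adef (\<lambda>e. R (F e) (G e) (H e))"
  by (rule adef_sub[of "\<lambda>x e. R x (G e) (H e)", OF _ assms(2)],
      rule adef_sub[of "\<lambda>x e. R (e 0) x (H (\<lambda>n. e (Suc n)))", OF _ aterm_lift[OF assms(3)]],
      rule adef_sub[of "\<lambda>x e. R (e (Suc 0)) (e 0) x", OF _ aterm_lift[OF aterm_lift[OF assms(4)]]])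
    (rule assms(1))

lemma adef_comp4:
  assumes "\<And>i j k l. adef (\<lambda>e. R (e i) (e j) (e k) (e l))" "aterm F" "aterm G" "aterm H" "aterm I"
  shows "adef (\<lambda>e. R (F e) (G e) (H e) (I e))"
  by (rule adef_sub[of "\<lambda>x e. R x (G e) (H e) (I e)", OF _ assms(2)],
      rule adef_sub[of "\<lambda>x e. R (e 0) x (H (\<lambda>n. e (Suc n))) (I (\<lambda>n. e (Suc n)))", OF _ aterm_lift[OF assms(3)]],
      rule adef_sub[of "\<lambda>x e. R (e (Suc 0)) (e 0) x (I (\<lambda>n. e (Suc (Suc n))))", OF _ aterm_lift[OF aterm_lift[OF assms(4)]]],
      rule adef_sub[of "\<lambda>x e. R (e (Suc (Suc 0))) (e (Suc 0)) (e 0) x",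
        OF _ aterm_lift[OF aterm_lift[OF aterm_lift[OF assms(5)]]]])
    (rule assms(1))

lemma adef_eq: "aterm F \<Longrightarrow> aterm G \<Longrightarrow> adef (\<lambda>e. F e = G e)"
  by (rule adef_comp2[of "(=)"]) (rule_tac p = "FEq i j" in adefI, simp)

lemma adef_mem: "aterm F \<Longrightarrow> aterm G \<Longrightarrow> adef (\<lambda>e. F e \<epsilon> G e)"
  by (rule adef_comp2[of "(\<epsilon>)"]) (rule_tac p = "FMem i j" in adefI, simp)

lemma adef_in: "aterm F \<Longrightarrow> acls A \<Longrightarrow> adef (\<lambda>e. F e \<in> A e)"
  by (rule adef_sub[of "\<lambda>x e. x \<in> A e"]) (rule acls_graph)

lemma adef_bex [intro]:
  "acls A \<Longrightarrow> adef (\<lambda>e. P (e 0) (\<lambda>n. e (Suc n))) \<Longrightarrow> adef (\<lambda>e. \<exists>x\<in>A e. P x e)"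
  by (rule adef_ex_K[OF adef_and[OF acls_graph]]) (auto dest: acls_sub)

lemma adef_ball [intro]:
  "acls A \<Longrightarrow> adef (\<lambda>e. P (e 0) (\<lambda>n. e (Suc n))) \<Longrightarrow> adef (\<lambda>e. \<forall>x\<in>A e. P x e)"
  using adef_not[OF adef_bex[of A "\<lambda>x e. \<not> P x e"]] adef_not by simp

lemma adef_subset: "acls A \<Longrightarrow> acls B \<Longrightarrow> adef (\<lambda>e. A e \<subseteq> B e)"
  unfolding subset_iff Ball_def[symmetric] by (intro adef_ball acls_graph acls_lift)

lemma adef_set_eq: "acls A \<Longrightarrow> acls B \<Longrightarrow> adef (\<lambda>e. A e = B e)"
  unfolding set_eq_subset by (intro adef_and adef_subset)

lemma adef_Bex_finite:
  assumes "finite T" "\<And>p. adef (R p)" shows "adef (\<lambda>e. \<exists>p\<in>T. R p e)"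
  using assms by (induction T rule: finite_induct) (simp_all add: adef_const adef_or)

lemma aclsI:
  assumes "\<And>K e. model K \<Longrightarrow> range e \<subseteq> ext K \<Longrightarrow> A e \<subseteq> ext K"
    and "adef (\<lambda>e. e 0 \<in> A (\<lambda>n. e (Suc n)))"
  shows "acls A"
  using assms by (auto simp: acls_def)

lemma acls_ext: "aterm F \<Longrightarrow> acls (\<lambda>e. ext (F e))"
proof (rule aclsI)
  assume F: "aterm F"
  show "ext (F e) \<subseteq> ext K" if "model K" "range e \<subseteq> ext K" for K e
    using model_trans[OF that(1)] aterm_in[OF F that] by blast
  show "adef (\<lambda>e. e 0 \<in> ext (F (\<lambda>n. e (Suc n))))"
    by (rule adef_cong[OF adef_mem[OF aterm_var aterm_lift[OF F]]])
      (auto simp: ext_def)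
qed

lemma acls_empty: "acls (\<lambda>e. {})"
  by (rule aclsI) (simp_all add: adef_const)

lemma acls_insert: "aterm F \<Longrightarrow> acls A \<Longrightarrow> acls (\<lambda>e. insert (F e) (A e))"
  by (rule aclsI) (auto simp: insert_iff intro!: adef_or adef_in adef_eq aterm_var aterm_lift acls_lift dest: aterm_in acls_sub)

lemma acls_Un: "acls A \<Longrightarrow> acls B \<Longrightarrow> acls (\<lambda>e. A e \<union> B e)"
  by (rule aclsI) (auto intro!: adef_or adef_and adef_not adef_in aterm_var acls_lift dest: acls_sub)

lemma acls_Int: "acls A \<Longrightarrow> acls B \<Longrightarrow> acls (\<lambda>e. A e \<inter> B e)"
  by (rule aclsI) (auto intro!: adef_or adef_and adef_not adef_in aterm_var acls_lift dest: acls_sub)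

lemma acls_Diff: "acls A \<Longrightarrow> acls B \<Longrightarrow> acls (\<lambda>e. A e - B e)"
  by (rule aclsI) (auto intro!: adef_or adef_and adef_not adef_in aterm_var acls_lift dest: acls_sub)

lemma acls_Collect [intro]:
  "acls A \<Longrightarrow> adef (\<lambda>e. P (e 0) (\<lambda>n. e (Suc n))) \<Longrightarrow> acls (\<lambda>e. {x \<in> A e. P x e})"
  by (rule aclsI) (auto intro!: adef_and adef_in aterm_var acls_lift dest: acls_sub)

lemma acls_comp1:
  assumes "\<And>i. acls (\<lambda>e. A (e i))" "aterm F" shows "acls (\<lambda>e. A (F e))"
proof (rule aclsI)
  show "A (F e) \<subseteq> ext K" if "model K" "range e \<subseteq> ext K" for K e
    using acls_sub[OF assms(1) that(1), of "\<lambda>_. F e"] aterm_in[OF assms(2) that] by auto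
  show "adef (\<lambda>e. e 0 \<in> A (F (\<lambda>n. e (Suc n))))"
    by (rule adef_comp2[of "\<lambda>x y. x \<in> A y", OF _ aterm_var aterm_lift[OF assms(2)]])
      (intro adef_in aterm_var assms)
qed

text \<open>The predicate is evaluated in a model around \<open>x\<close> and the parameters; there
  it is a formula over a set, to which \<open>rel_separation\<close> applies.\<close>

lemma separation:
  assumes P: "adef P" and ps: "set ps \<subseteq> V" and x: "x \<in> V"
  shows "isset {z \<in> ext x. P (env (z # ps))}"
proof -
  obtain K where K: "model K" "set (x # ps) \<subseteq> ext K"
    using model_containing[of "x # ps"] ps x by auto
  obtain p where p: "\<And>K e. model K \<Longrightarrow> range e \<subseteq> ext K \<Longrightarrow> holds (ext K) E e p \<longleftrightarrow> P e"
    using adefE[OF P] by blast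
  \<comment> \<open>Beyond the list the assignment \<open>?e\<close> has the default
    \<open>x\<close>, but \<open>env (z # ps)\<close> has the default \<open>z\<close>. Redirecting
    these positions to \<open>0\<close> makes the two agree.\<close>
  obtain q where q: "\<forall>W (e :: nat \<Rightarrow> 'a). holds W E e q \<longleftrightarrow>
      holds W E (\<lambda>n. e (if n \<le> length ps then n else 0)) p"
    using holds_rename[where E = E and f = "\<lambda>n. if n \<le> length ps then n else 0"] by blast
  let ?e = "env (x # ps)"
  have re: "range ?e \<subseteq> ext K" using range_env[of "x # ps"] K(2) by blast
  have 1: "isset {z \<in> ext x. z \<in> ext K \<and> holds (ext K) E (?e(0 := z)) q}"
    by (rule rel_separation) (use model_in_V K x re in auto)
  have "holds (ext K) E (?e(0 := z)) q \<longleftrightarrow> P (env (z # ps))" if z: "z \<in> ext K" for z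
  proof -
    have "(\<lambda>n. (?e(0 := z)) (if n \<le> length ps then n else 0)) = env (z # ps)"
      by (rule ext) (auto simp: env_def nth_Cons')
    moreover have "range (env (z # ps)) \<subseteq> ext K"
      using range_env[of "z # ps"] z K(2) by auto
    ultimately show ?thesis using q p[OF K(1)] by simp
  qed
  moreover have "ext x \<subseteq> ext K" using K model_trans by auto
  ultimately have "{z \<in> ext x. z \<in> ext K \<and> holds (ext K) E (?e(0 := z)) q} = {z \<in> ext x. P (env (z # ps))}"
    by blast
  with 1 show ?thesis by simp
qed

section \<open>Pairs, triples and function values in all models\<close>

lemma adef_is_opair: "adef (\<lambda>e. e i = opair (e j) (e k))"
proof (rule adef_cong)
  show "adef (\<lambda>e. \<exists>s\<in>ext (e i). \<exists>u\<in>ext (e i). ext s = {e j} \<and> ext u = {e j, e k} \<and> ext (e i) = {s, u})"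
    by (intro adef_bex adef_and adef_set_eq acls_ext acls_insert acls_empty aterm_var)
  show "e i = opair (e j) (e k) \<longleftrightarrow>
      (\<exists>s\<in>ext (e i). \<exists>u\<in>ext (e i). ext s = {e j} \<and> ext u = {e j, e k} \<and> ext (e i) = {s, u})"
    if "model K" "range e \<subseteq> ext K" for K e
    by (rule opair_eq_iff) (use that ext_in_V in auto)
qed

lemma adef_opair_eq [intro]:
  "aterm F \<Longrightarrow> aterm G \<Longrightarrow> aterm H \<Longrightarrow> adef (\<lambda>e. F e = opair (G e) (H e))"
  by (rule adef_comp3[of "\<lambda>x y z. x = opair y z"]) (rule adef_is_opair)

lemma adef_opair_mem [intro]:
  assumes "aterm F" "aterm G" "aterm H" shows "adef (\<lambda>e. opair (F e) (G e) \<epsilon> H e)"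
proof -
  have "adef (\<lambda>e. \<exists>t\<in>ext (H e). t = opair (F e) (G e))"
    by (intro adef_bex acls_ext adef_opair_eq aterm_var aterm_lift assms)
  then show ?thesis
    by (rule adef_cong) (metis aterm_in assms(1,2) ext_in_V extD mem_ext opair_in_V)
qed

lemma adef_triple_eq [intro]:
  assumes "aterm F" "aterm G" "aterm H" "aterm I"
  shows "adef (\<lambda>e. F e = triple (G e) (H e) (I e))"
proof -
  have "adef (\<lambda>e. \<exists>t\<in>V. F e = opair (G e) t \<and> t = opair (H e) (I e))"
  proof (rule adef_exV)
    show "adef (\<lambda>e. F (\<lambda>n. e (Suc n)) = opair (G (\<lambda>n. e (Suc n))) (e 0) \<and>
       e 0 = opair (H (\<lambda>n. e (Suc n))) (I (\<lambda>n. e (Suc n))))"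
      by (intro adef_and adef_opair_eq aterm_var aterm_lift assms)
    show "x \<in> ext K" if "model K" "range e \<subseteq> ext K" "x \<in> V"
      "F e = opair (G e) x \<and> x = opair (H e) (I e)" for K e x
      using aterm_in[OF assms(1) that(1,2)] aterm_in[OF assms(2) that(1,2)] that
      by (metis ext_in_V model_opairD)
  qed
  then show ?thesis
  proof (rule adef_cong)
    show "F e = triple (G e) (H e) (I e) \<longleftrightarrow> (\<exists>t\<in>V. F e = opair (G e) t \<and> t = opair (H e) (I e))"
      if "model K" "range e \<subseteq> ext K" for K e
      using aterm_in[OF assms(3) that] aterm_in[OF assms(4) that]
      by (auto simp: triple_def dest!: ext_in_V)
  qed
qed

text \<open>In this rule and its variants for triples and function values the witness is a component
  of a pair that belongs to the model, hence belongs to it by transitivity.\<close>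

lemma adef_ex_snd:
  assumes F: "aterm F" and G: "aterm G" and R: "adef (\<lambda>e. R (e 0) (\<lambda>n. e (Suc n)))"
  shows "adef (\<lambda>e. \<exists>y\<in>V. F e = opair (G e) y \<and> R y e)"
proof (rule adef_exV)
  show "adef (\<lambda>e. F (\<lambda>n. e (Suc n)) = opair (G (\<lambda>n. e (Suc n))) (e 0) \<and> R (e 0) (\<lambda>n. e (Suc n)))"
    by (rule adef_and[OF adef_opair_eq[OF aterm_lift[OF F] aterm_lift[OF G] aterm_var] R])
  show "y \<in> ext K" if a: "model K" "range e \<subseteq> ext K" "y \<in> V" "F e = opair (G e) y \<and> R y e" for K e y
  proof -
    have "opair (G e) y \<in> ext K" using aterm_in[OF F a(1,2)] a(4) by simp
    then show ?thesis using model_opairD[OF a(1)] ext_in_V[OF aterm_in[OF G a(1,2)]] a(3) by blast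
  qed
qed

lemma adef_ex_fst_snd:
  assumes F: "aterm F" and R: "adef (\<lambda>e. R (e (Suc 0)) (e 0) (\<lambda>n. e (Suc (Suc n))))"
  shows "adef (\<lambda>e. \<exists>x\<in>V. \<exists>y\<in>V. F e = opair x y \<and> R x y e)"
proof (rule adef_exV)
  show "adef (\<lambda>e. \<exists>y\<in>V. F (\<lambda>n. e (Suc n)) = opair (e 0) y \<and> R (e 0) y (\<lambda>n. e (Suc n)))"
    by (rule adef_ex_snd[where R = "\<lambda>y e. R (e 0) y (\<lambda>n. e (Suc n))", OF aterm_lift[OF F] aterm_var R])
  show "x \<in> ext K" if a: "model K" "range e \<subseteq> ext K" "x \<in> V" "\<exists>y\<in>V. F e = opair x y \<and> R x y e" for K e x
  proof -
    obtain y where y: "y \<in> V" "F e = opair x y" using a(4) by blast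
    then have "opair x y \<in> ext K" using aterm_in[OF F a(1,2)] by simp
    then show ?thesis using model_opairD[OF a(1)] a(3) y by blast
  qed
qed

lemma adef_ex_triple:
  assumes F: "aterm F" and R: "adef (\<lambda>e. R (e (Suc (Suc 0))) (e (Suc 0)) (e 0) (\<lambda>n. e (Suc (Suc (Suc n)))))"
  shows "adef (\<lambda>e. \<exists>x\<in>V. \<exists>y\<in>V. \<exists>z\<in>V. F e = triple x y z \<and> R x y z e)"
proof (rule adef_exV)
  show "adef (\<lambda>e. \<exists>y\<in>V. \<exists>z\<in>V. F (\<lambda>n. e (Suc n)) = triple (e 0) y z \<and> R (e 0) y z (\<lambda>n. e (Suc n)))"
  proof (rule adef_exV)
    show "adef (\<lambda>e. \<exists>z\<in>V. F (\<lambda>n. e (Suc (Suc n))) = triple (e (Suc 0)) (e 0) z \<and>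
        R (e (Suc 0)) (e 0) z (\<lambda>n. e (Suc (Suc n))))"
    proof (rule adef_exV)
      show "adef (\<lambda>e. F (\<lambda>n. e (Suc (Suc (Suc n)))) = triple (e (Suc (Suc 0))) (e (Suc 0)) (e 0) \<and>
        R (e (Suc (Suc 0))) (e (Suc 0)) (e 0) (\<lambda>n. e (Suc (Suc (Suc n)))))"
        by (rule adef_and[OF adef_triple_eq[OF aterm_lift[OF aterm_lift[OF aterm_lift[OF F]]] aterm_var aterm_var aterm_var] R])
      show "x \<in> ext K" if a: "model K" "range e \<subseteq> ext K" "x \<in> V"
        "F (\<lambda>n. e (Suc (Suc n))) = triple (e (Suc 0)) (e 0) x \<and> R (e (Suc 0)) (e 0) x (\<lambda>n. e (Suc (Suc n)))" for K e x
      proof -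
        have "triple (e (Suc 0)) (e 0) x \<in> ext K"
          using aterm_in[OF aterm_lift[OF aterm_lift[OF F]] a(1,2)] a(4) by simp
        moreover have "e (Suc 0) \<in> V" "e 0 \<in> V" using a(2) ext_in_V by auto
        ultimately show ?thesis using model_tripleD[OF a(1)] a(3) by blast
      qed
    qed
    show "x \<in> ext K" if a: "model K" "range e \<subseteq> ext K" "x \<in> V"
      "\<exists>z\<in>V. F (\<lambda>n. e (Suc n)) = triple (e 0) x z \<and> R (e 0) x z (\<lambda>n. e (Suc n))" for K e x
    proof -
      obtain z where z: "z \<in> V" "F (\<lambda>n. e (Suc n)) = triple (e 0) x z" using a(4) by blast
      then have "triple (e 0) x z \<in> ext K"
        using aterm_in[OF aterm_lift[OF F] a(1,2)] by simp
      moreover have "e 0 \<in> V" using a(2) ext_in_V by auto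
      ultimately show ?thesis using model_tripleD[OF a(1)] a(3) z by blast
    qed
  qed
  show "x \<in> ext K" if a: "model K" "range e \<subseteq> ext K" "x \<in> V" "\<exists>y\<in>V. \<exists>z\<in>V. F e = triple x y z \<and> R x y z e" for K e x
  proof -
    obtain y z where z: "y \<in> V" "z \<in> V" "F e = triple x y z" using a(4) by blast
    then have "triple x y z \<in> ext K" using aterm_in[OF F a(1,2)] by simp
    then show ?thesis using model_tripleD[OF a(1)] a(3) z by blast
  qed
qed

lemma opair_mem_iff: "x \<in> V \<Longrightarrow> y \<in> V \<Longrightarrow> opair x y \<epsilon> f \<longleftrightarrow> opair x y \<in> ext f"
  by (simp add: ext_def)

lemma adef_ex_value:
  assumes F: "aterm F" and G: "aterm G" and R: "adef (\<lambda>e. R (e 0) (\<lambda>n. e (Suc n)))"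
  shows "adef (\<lambda>e. \<exists>y\<in>V. opair (G e) y \<epsilon> F e \<and> R y e)"
proof (rule adef_exV)
  show "adef (\<lambda>e. opair (G (\<lambda>n. e (Suc n))) (e 0) \<epsilon> F (\<lambda>n. e (Suc n)) \<and> R (e 0) (\<lambda>n. e (Suc n)))"
    by (rule adef_and[OF adef_opair_mem[OF aterm_lift[OF G] aterm_var aterm_lift[OF F]] R])
  show "y \<in> ext K" if a: "model K" "range e \<subseteq> ext K" "y \<in> V" "opair (G e) y \<epsilon> F e \<and> R y e" for K e y
  proof -
    have G': "G e \<in> V" using ext_in_V[OF aterm_in[OF G a(1,2)]] .
    then have "opair (G e) y \<in> ext K"
      using aterm_in[OF F a(1,2)] model_trans[OF a(1)] opair_mem_iff a(3,4) by blast
    then show ?thesis using model_opairD[OF a(1)] a(3) G' by blast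
  qed
qed

lemma adef_ex_pair_mem:
  assumes F: "aterm F" and R: "adef (\<lambda>e. R (e (Suc 0)) (e 0) (\<lambda>n. e (Suc (Suc n))))"
  shows "adef (\<lambda>e. \<exists>x\<in>V. \<exists>y\<in>V. opair x y \<epsilon> F e \<and> R x y e)"
proof (rule adef_exV)
  show "adef (\<lambda>e. \<exists>y\<in>V. opair (e 0) y \<epsilon> F (\<lambda>n. e (Suc n)) \<and> R (e 0) y (\<lambda>n. e (Suc n)))"
    by (rule adef_ex_value[where R = "\<lambda>y e. R (e 0) y (\<lambda>n. e (Suc n))", OF aterm_lift[OF F] aterm_var R])
  show "x \<in> ext K" if a: "model K" "range e \<subseteq> ext K" "x \<in> V" "\<exists>y\<in>V. opair x y \<epsilon> F e \<and> R x y e" for K e x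
  proof -
    obtain y where y: "y \<in> V" "opair x y \<epsilon> F e" using a(4) by blast
    then have "opair x y \<in> ext K"
      using aterm_in[OF F a(1,2)] model_trans[OF a(1)] opair_mem_iff a(3) by blast
    then show ?thesis using model_opairD[OF a(1)] a(3) y by blast
  qed
qed

lemmas adef_rules = aterm_var adef_opair_mem adef_opair_eq adef_triple_eq adef_not adef_and adef_or
  adef_imp adef_iff adef_eq adef_mem adef_in adef_set_eq adef_subset adef_bex adef_ball
  acls_ext acls_empty acls_insert acls_Un acls_Int acls_Diff acls_Collect

section \<open>Natural numbers and generating sequences\<close>

definition zero_or_suc :: "'a \<Rightarrow> bool" where
  "zero_or_suc n \<longleftrightarrow> ext n = {} \<or> (\<exists>m\<in>V. ext n = insert m (ext m))"

definition suc :: "'a \<Rightarrow> 'a" where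
  "suc n = mk (insert n (ext n))"

lemma suc_in_V [simp]: "n \<in> V \<Longrightarrow> suc n \<in> V"
  by (simp add: suc_def)

lemma ext_suc [simp]: "n \<in> V \<Longrightarrow> ext (suc n) = insert n (ext n)"
  by (simp add: suc_def)

lemma holds_Is_zero_or_succ:
  "e i \<in> V \<Longrightarrow> holds V E e (Is_zero_or_succ i) \<longleftrightarrow> zero_or_suc (e i)"
  unfolding zero_or_suc_def Is_zero_or_succ_def Is_empty_def Is_succ_def Let_def
  by (auto simp: ext_def)

lemma holds_Is_ordinal:
  "e i \<in> V \<Longrightarrow> holds V E e (Is_ordinal i) \<longleftrightarrow>
     (\<forall>x\<in>ext (e i). ext x \<subseteq> ext (e i)) \<and>
     (\<forall>x\<in>ext (e i). \<forall>y\<in>ext (e i). x \<epsilon> y \<or> x = y \<or> y \<epsilon> x) \<and>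
     (\<forall>y\<in>V. ext y \<subseteq> ext (e i) \<and> ext y \<noteq> {} \<longrightarrow> (\<exists>z\<in>ext y. ext z \<inter> ext y = {}))"
proof -
  assume i: "e i \<in> V"
  have 1: "holds V E e (FAllIn (i+1) i (FAllIn (i+2) (i+1) (FMem (i+2) i))) \<longleftrightarrow>
      (\<forall>x\<in>ext (e i). ext x \<subseteq> ext (e i))"
    by (auto simp: ext_def)
  have 2: "holds V E e (FAllIn (i+1) i (FAllIn (i+2) i
       (FOr (FMem (i+1) (i+2)) (FOr (FEq (i+1) (i+2)) (FMem (i+2) (i+1)))))) \<longleftrightarrow>
      (\<forall>x\<in>ext (e i). \<forall>y\<in>ext (e i). x \<epsilon> y \<or> x = y \<or> y \<epsilon> x)"
    by (auto simp: ext_def)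
  have 3: "holds V E e (FAll (i+1) (FImp
       (FAnd (FAllIn (i+2) (i+1) (FMem (i+2) i)) (FEx (i+2) (FMem (i+2) (i+1))))
       (FExIn (i+2) (i+1) (FAllIn (i+3) (i+1) (FNeg (FMem (i+3) (i+2))))))) \<longleftrightarrow>
     (\<forall>y\<in>V. (\<forall>x\<in>V. x \<epsilon> y \<longrightarrow> x \<epsilon> e i) \<and> (\<exists>x\<in>V. x \<epsilon> y) \<longrightarrow>
       (\<exists>z\<in>V. z \<epsilon> y \<and> (\<forall>w\<in>V. w \<epsilon> y \<longrightarrow> \<not> w \<epsilon> z)))"
    by simp
  have 4: "(\<forall>x\<in>V. x \<epsilon> y \<longrightarrow> x \<epsilon> e i) \<longleftrightarrow> ext y \<subseteq> ext (e i)"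
    "(\<exists>x\<in>V. x \<epsilon> y) \<longleftrightarrow> ext y \<noteq> {}"
    "(\<exists>z\<in>V. z \<epsilon> y \<and> (\<forall>w\<in>V. w \<epsilon> y \<longrightarrow> \<not> w \<epsilon> z)) \<longleftrightarrow> (\<exists>z\<in>ext y. ext z \<inter> ext y = {})" for y
    by (auto simp: ext_def)
  show ?thesis
    unfolding Is_ordinal_def holds.simps(4)[of _ _ _ "FAllIn _ _ _"] 1 2 3 4 by (rule refl)
qed

lemma Omega_iff:
  "n \<in> Omega \<longleftrightarrow> n \<in> V \<and>
     (\<forall>x\<in>ext n. ext x \<subseteq> ext n) \<and>
     (\<forall>x\<in>ext n. \<forall>y\<in>ext n. x \<epsilon> y \<or> x = y \<or> y \<epsilon> x) \<and>
     (\<forall>y\<in>V. ext y \<subseteq> ext n \<and> ext y \<noteq> {} \<longrightarrow> (\<exists>z\<in>ext y. ext z \<inter> ext y = {})) \<and>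
     zero_or_suc n \<and> (\<forall>m\<in>ext n. zero_or_suc m)"
proof (cases "n \<in> V")
  case True
  have "(\<forall>m\<in>V. m \<epsilon> n \<longrightarrow> holds V E ((\<lambda>_. n)(1 := m)) (Is_zero_or_succ 1)) \<longleftrightarrow>
      (\<forall>m\<in>ext n. zero_or_suc m)"
    by (auto simp: holds_Is_zero_or_succ ext_def)
  then show ?thesis using True
    by (simp add: Omega_def Is_natural_def holds_Is_ordinal holds_Is_zero_or_succ)
qed (simp add: Omega_def)

lemma Omega_in_V [simp]: "n \<in> Omega \<Longrightarrow> n \<in> V" by (simp add: Omega_def)

lemma Omega_trans: "n \<in> Omega \<Longrightarrow> m \<in> ext n \<Longrightarrow> k \<in> ext m \<Longrightarrow> k \<in> ext n"
  unfolding Omega_iff by blast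

lemma Omega_linear: "n \<in> Omega \<Longrightarrow> x \<in> ext n \<Longrightarrow> y \<in> ext n \<Longrightarrow> x \<in> ext y \<or> x = y \<or> y \<in> ext x"
  unfolding Omega_iff by (meson mem_ext ext_in_V)

lemma Omega_zs: "n \<in> Omega \<Longrightarrow> m \<in> insert n (ext n) \<Longrightarrow> zero_or_suc m"
  unfolding Omega_iff by blast

lemma Omega_wf:
  assumes "n \<in> Omega" "y \<in> V" "ext y \<subseteq> ext n" "ext y \<noteq> {}"
  shows "\<exists>z\<in>ext y. ext z \<inter> ext y = {}"
proof -
  have "\<forall>y\<in>V. ext y \<subseteq> ext n \<and> ext y \<noteq> {} \<longrightarrow> (\<exists>z\<in>ext y. ext z \<inter> ext y = {})"
    using assms(1) unfolding Omega_iff by (elim conjE)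
  from bspec[OF this assms(2)] show ?thesis using assms by blast
qed

text \<open>The one induction principle on numbers that may be nonstandard. Well-foundedness is
  asserted only for subsets that are elements of \<open>V\<close>, so each use has to establish
  \<open>isset B\<close> beforehand.\<close>

lemma Omega_min:
  "n \<in> Omega \<Longrightarrow> isset B \<Longrightarrow> B \<subseteq> ext n \<Longrightarrow> B \<noteq> {} \<Longrightarrow> \<exists>k\<in>B. \<forall>j\<in>ext k. j \<notin> B"
proof -
  assume a: "n \<in> Omega" "isset B" "B \<subseteq> ext n" "B \<noteq> {}"
  obtain b where b: "b \<in> V" "ext b = B" using a(2) by (rule issetE)
  show ?thesis using Omega_wf[OF a(1) b(1)] a b(2) by blast
qed

lemma Omega_irrefl: assumes "n \<in> Omega" shows "n \<notin> ext n"
proof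
  assume "n \<in> ext n"
  then show False using Omega_min[of n "{n}"] assms by auto
qed

lemma Omega_asym: "n \<in> Omega \<Longrightarrow> m \<in> ext n \<Longrightarrow> n \<notin> ext m"
  using Omega_irrefl Omega_trans by blast

lemma Omega_elem: assumes n: "n \<in> Omega" and m: "m \<in> ext n" shows "m \<in> Omega"
  unfolding Omega_iff
proof (intro conjI ballI impI)
  have mV: "m \<in> V" using m ext_in_V by blast
  then show "m \<in> V" .
  have sub: "ext m \<subseteq> ext n" using n m Omega_trans by blast
  show "ext x \<subseteq> ext m" if x: "x \<in> ext m" for x
  proof
    fix y assume y: "y \<in> ext x"
    have xn: "x \<in> ext n" using sub x by blast
    then have yn: "y \<in> ext n" using y n Omega_trans by blast
    have V: "x \<in> V" "y \<in> V" using x y ext_in_V by auto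
    \<comment> \<open>The two unwanted cases produce the membership cycles \<open>{x, m}\<close> and
      \<open>{x, y, m}\<close>, which are sets without a minimal element.\<close>
    consider "y \<in> ext m" | "y = m" | "m \<in> ext y" using Omega_linear[OF n yn m] by blast
    then show "y \<in> ext m"
    proof cases
      case 2
      then show ?thesis
        using Omega_min[OF n, of "{x, m}"] x y xn m V mV by auto
    next
      case 3
      then show ?thesis
        using Omega_min[OF n, of "{x, y, m}"] x y xn yn m V mV by auto
    qed
  qed
  show "x \<epsilon> y \<or> x = y \<or> y \<epsilon> x" if "x \<in> ext m" "y \<in> ext m" for x y
    using Omega_linear[OF n, of x y] sub that by (auto dest: extD)
  show "\<exists>z\<in>ext y. ext z \<inter> ext y = {}" if "y \<in> V" "ext y \<subseteq> ext m \<and> ext y \<noteq> {}" for y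
    using Omega_wf[OF n, of y] sub that by blast
  show "zero_or_suc x" if "x \<in> ext m" for x
    using Omega_zs[OF n] sub that by blast
  show "zero_or_suc m"
    using Omega_zs[OF n] m by blast
qed

lemma Omega_zero: "x \<in> V \<Longrightarrow> ext x = {} \<Longrightarrow> x \<in> Omega"
  unfolding Omega_iff zero_or_suc_def by simp

lemma num_0 [simp]: "num 0 \<in> Omega" "ext (num 0) = {}"
  by (auto intro: Omega_zero)

declare num.simps(1) [simp del]

lemma Omega_suc [simp]: assumes n: "n \<in> Omega" shows "suc n \<in> Omega"
  unfolding Omega_iff
proof (intro conjI ballI impI)
  have nV [simp]: "n \<in> V" using n by simp
  show "suc n \<in> V" by simp
  show "ext x \<subseteq> ext (suc n)" if "x \<in> ext (suc n)" for x
    using n that Omega_trans by auto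
  show "x \<epsilon> y \<or> x = y \<or> y \<epsilon> x" if "x \<in> ext (suc n)" "y \<in> ext (suc n)" for x y
    using that Omega_linear[OF n, of x y] nV by (simp only: ext_suc) (auto dest: extD)
  show "\<exists>z\<in>ext y. ext z \<inter> ext y = {}" if y: "y \<in> V" "ext y \<subseteq> ext (suc n) \<and> ext y \<noteq> {}" for y
  proof (cases "ext y \<inter> ext n = {}")
    case True
    then have "ext y = {n}" using y by auto
    then show ?thesis using Omega_irrefl[OF n] by auto
  next
    case False
    \<comment> \<open>An element minimal in the part of \<open>y\<close> below \<open>n\<close> is
      minimal in all of \<open>y\<close>, because its members are below \<open>n\<close> as
      well.\<close>
    have "isset {z \<in> ext y. z \<epsilon> n}"
      using separation[OF adef_mem[OF aterm_var aterm_var], of "[n]" y 0 1] y by simp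
    moreover have "{z \<in> ext y. z \<epsilon> n} = ext y \<inter> ext n" by (auto simp: ext_def)
    ultimately obtain k where k: "k \<in> ext y \<inter> ext n" "\<forall>j\<in>ext k. j \<notin> ext y \<inter> ext n"
      using Omega_min[OF n, of "ext y \<inter> ext n"] False by auto
    then have "ext k \<inter> ext y = {}" using Omega_trans[OF n] by blast
    then show ?thesis using k by blast
  qed
  show "zero_or_suc (suc n)" unfolding zero_or_suc_def by (auto intro: nV)
  show "zero_or_suc x" if "x \<in> ext (suc n)" for x
    using that Omega_zs[OF n] by simp
qed

lemma num_Suc: "num (Suc k) = suc (num k)" by (simp add: suc_def)

declare num.simps(2) [simp del]

lemma num_in_Omega [simp]: "num k \<in> Omega"
  by (induction k) (auto simp: num_Suc)

lemma num_in_V [simp]: "num k \<in> V" by simp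

lemma suc_inject: assumes "m \<in> Omega" "n \<in> Omega" "suc m = suc n" shows "m = n"
proof -
  have "insert m (ext m) = insert n (ext n)" using assms ext_suc by (metis Omega_in_V)
  then show ?thesis using assms Omega_asym by (metis insertE insertI1)
qed

lemma num_inject [simp]: "num j = num k \<longleftrightarrow> j = k"
proof (induction j arbitrary: k)
  case 0
  then show ?case
  proof (cases k)
    case (Suc k')
    have "ext (num 0) \<noteq> ext (suc (num k'))" by simp
    then show ?thesis using Suc by (metis num_Suc nat.distinct(1))
  qed simp
next
  case (Suc j)
  show ?case
  proof (cases k)
    case 0
    have "ext (num 0) \<noteq> ext (suc (num j))" by simp
    then show ?thesis using 0 by (metis num_Suc nat.distinct(1))
  next
    case (Suc k')
    then show ?thesis using Suc.IH[of k'] suc_inject by (metis num_Suc num_in_Omega)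
  qed
qed

lemma isset_Omega: "isset Omega"
proof -
  obtain x where "x \<in> V" using nonempty by blast
  then have "holds V E (\<lambda>_. x) Omega_exists" by (intro holds_BST) (auto simp: BST_def)
  then obtain w where w: "w \<in> V" "\<forall>n\<in>V. n \<epsilon> w \<longleftrightarrow> holds V E ((\<lambda>_. x)(0 := w, 1 := n)) (Is_natural 1)"
    by (auto simp: Omega_exists_def)
  have "holds V E ((\<lambda>_. x)(0 := w, 1 := n)) (Is_natural 1) \<longleftrightarrow> n \<in> Omega" if n: "n \<in> V" for n
  proof -
    have "(\<forall>m\<in>V. m \<epsilon> n \<longrightarrow> holds V E ((\<lambda>_. x)(0 := w, 1 := n, 2 := m)) (Is_zero_or_succ 2)) \<longleftrightarrow>
      (\<forall>m\<in>ext n. zero_or_suc m)"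
      by (auto simp: holds_Is_zero_or_succ ext_def)
    then show ?thesis using n unfolding Omega_iff
      by (simp add: Is_natural_def holds_Is_ordinal holds_Is_zero_or_succ numeral_2_eq_2)
  qed
  with w have "ext w = Omega" by (auto simp: ext_def)
  with w show ?thesis by (auto simp: isset_def)
qed

definition omega :: 'a where "omega = mk Omega"

lemma omega [simp]: "omega \<in> V" "ext omega = Omega"
  by (auto simp: omega_def isset_Omega)

lemma isset_Int: "x \<in> V \<Longrightarrow> y \<in> V \<Longrightarrow> isset (ext x \<inter> ext y)"
proof -
  assume "x \<in> V" "y \<in> V"
  then have "isset {z \<in> ext x. z \<epsilon> y}"
    using separation[OF adef_mem[OF aterm_var aterm_var], of "[y]" x 0 1] by simp
  moreover have "{z \<in> ext x. z \<epsilon> y} = ext x \<inter> ext y" by (auto simp: ext_def)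
  ultimately show ?thesis by simp
qed

lemma isset_Diff: "x \<in> V \<Longrightarrow> y \<in> V \<Longrightarrow> isset (ext x - ext y)"
proof -
  assume "x \<in> V" "y \<in> V"
  then have "isset {z \<in> ext x. \<not> z \<epsilon> y}"
    using separation[OF adef_not[OF adef_mem[OF aterm_var aterm_var]], of "[y]" x 0 1] by simp
  moreover have "{z \<in> ext x. \<not> z \<epsilon> y} = ext x - ext y" by (auto simp: ext_def)
  ultimately show ?thesis by simp
qed

text \<open>The least element \<open>k\<close> of \<open>n\<close> outside \<open>c\<close> has
  exactly the members of \<open>c\<close>: what is below \<open>k\<close> lies in \<open>c\<close>
  by minimality, and what lies in \<open>c\<close> is below \<open>k\<close> by linearity and
  transitivity.\<close>

lemma Omega_initial:
  assumes n: "n \<in> Omega" and c: "c \<in> V" "ext c \<subseteq> ext n" "\<And>x y. x \<in> ext c \<Longrightarrow> y \<in> ext x \<Longrightarrow> y \<in> ext c"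
  shows "c = n \<or> c \<in> ext n"
proof (cases "ext n - ext c = {}")
  case True
  then show ?thesis using c n ext_eqI by (metis Diff_eq_empty_iff Omega_in_V subset_antisym)
next
  case False
  obtain k where k: "k \<in> ext n - ext c" "\<forall>j\<in>ext k. j \<notin> ext n - ext c"
    using Omega_min[OF n isset_Diff] n c False by (metis Diff_subset Omega_in_V)
  have "ext k = ext c"
  proof (intro set_eqI iffI)
    fix j assume "j \<in> ext k"
    then show "j \<in> ext c" using k Omega_trans[OF n] by blast
  next
    fix j assume j: "j \<in> ext c"
    then show "j \<in> ext k" using Omega_linear[OF n, of j k] k c by blast
  qed
  then have "k = c" using k c ext_eqI ext_in_V by (metis DiffD1)
  then show ?thesis using k by blast
qed

text \<open>The intersection of the two numbers is an initial segment of each; if it were a proper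
  one in both, it would be a member of itself.\<close>

lemma Omega_trichotomy:
  assumes m: "m \<in> Omega" and n: "n \<in> Omega"
  shows "m \<in> ext n \<or> m = n \<or> n \<in> ext m"
proof -
  obtain c where c: "c \<in> V" "ext c = ext m \<inter> ext n"
    using isset_Int m n by (meson Omega_in_V issetE)
  have "c = n \<or> c \<in> ext n"
    by (rule Omega_initial) (use c n m Omega_trans in auto)
  moreover have "c = m \<or> c \<in> ext m"
    by (rule Omega_initial) (use c n m Omega_trans in auto)
  moreover have "\<not> (c \<in> ext m \<and> c \<in> ext n)"
    using Omega_irrefl[of c] Omega_elem[OF m, of c] c by auto
  ultimately show ?thesis by blast
qed

section \<open>Generating sequences: truncation, extension, induction\<close>

definition genseq :: "(('a \<Rightarrow> bool) \<Rightarrow> 'a \<Rightarrow> bool) \<Rightarrow> 'a \<Rightarrow> 'a \<Rightarrow> bool" where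
  "genseq step n f \<longleftrightarrow> n \<in> Omega \<and> f \<in> V \<and> is_fun f (insert n (ext n)) V \<and>
     (\<forall>k\<in>insert n (ext n). \<forall>y\<in>V. opair k y \<epsilon> f \<longrightarrow>
        step (\<lambda>z. \<exists>j\<in>ext k. opair j z \<epsilon> f) y)"

text \<open>The range of the sequence. Forgetting the stage gives a notion that is preserved when
  the sequence is lengthened.\<close>

definition occ :: "'a \<Rightarrow> 'a \<Rightarrow> bool" where
  "occ f y \<longleftrightarrow> y \<in> V \<and> (\<exists>k\<in>V. opair k y \<epsilon> f)"

lemma generated_iff: "generated step x \<longleftrightarrow> x \<in> V \<and> (\<exists>n f. genseq step n f \<and> opair n x \<epsilon> f)"
  unfolding generated_def genseq_def by blast

lemma is_fun_mem: "is_fun f A B \<Longrightarrow> opair x y \<epsilon> f \<Longrightarrow> x \<in> V \<Longrightarrow> y \<in> V \<Longrightarrow> A \<subseteq> V \<Longrightarrow> B \<subseteq> V \<Longrightarrow>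
  x \<in> A \<and> y \<in> B"
proof -
  assume a: "is_fun f A B" "opair x y \<epsilon> f" "x \<in> V" "y \<in> V" "A \<subseteq> V" "B \<subseteq> V"
  then have "opair x y \<in> ext f" by (simp add: ext_def)
  then obtain x' y' where *: "x' \<in> A" "y' \<in> B" "opair x y = opair x' y'"
    using a(1) unfolding is_fun_def by blast
  moreover from * a have "x' \<in> V" "y' \<in> V" by auto
  ultimately show ?thesis using a(3,4) by simp
qed

lemma is_fun_elem: "is_fun f A B \<Longrightarrow> p \<in> ext f \<Longrightarrow> \<exists>x\<in>A. \<exists>y\<in>B. p = opair x y"
  unfolding is_fun_def by blast

lemma is_fun_unique: "is_fun f A B \<Longrightarrow> opair x y \<epsilon> f \<Longrightarrow> opair x z \<epsilon> f \<Longrightarrow> x \<in> A \<Longrightarrow> y \<in> B \<Longrightarrow> z \<in> B \<Longrightarrow> y = z"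
  unfolding is_fun_def by blast

lemma is_fun_ex: "is_fun f A B \<Longrightarrow> x \<in> A \<Longrightarrow> \<exists>y\<in>B. opair x y \<epsilon> f"
  unfolding is_fun_def by blast

lemma is_fun_in_V: "is_fun f A B \<Longrightarrow> f \<in> V"
  unfolding is_fun_def by blast

lemma genseq_index:
  "genseq step n f \<Longrightarrow> opair k y \<epsilon> f \<Longrightarrow> k \<in> V \<Longrightarrow> y \<in> V \<Longrightarrow> k \<in> insert n (ext n) \<and> k \<in> Omega"
  unfolding genseq_def using is_fun_mem[of f "insert n (ext n)" V k y] ext_subset Omega_elem
  by (metis Omega_in_V insert_iff insert_subset order_refl)

lemma genseq_unique:
  "genseq step n f \<Longrightarrow> opair k y \<epsilon> f \<Longrightarrow> opair k z \<epsilon> f \<Longrightarrow> k \<in> V \<Longrightarrow> y \<in> V \<Longrightarrow> z \<in> V \<Longrightarrow> y = z"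
  using genseq_index[of step n f k y] is_fun_unique[of f "insert n (ext n)" V k y z]
  unfolding genseq_def by blast

lemma genseq_step:
  "genseq step n f \<Longrightarrow> opair k y \<epsilon> f \<Longrightarrow> k \<in> V \<Longrightarrow> y \<in> V \<Longrightarrow> step (\<lambda>z. \<exists>j\<in>ext k. opair j z \<epsilon> f) y"
  using genseq_index[of step n f k y] unfolding genseq_def by blast

lemma genseq_elem: "genseq step n f \<Longrightarrow> p \<in> ext f \<Longrightarrow> \<exists>k\<in>insert n (ext n). \<exists>y\<in>V. p = opair k y"
  unfolding genseq_def using is_fun_elem[of f "insert n (ext n)" V p] by blast

lemma genseq_in_V: "genseq step n f \<Longrightarrow> n \<in> V \<and> f \<in> V \<and> n \<in> Omega"
  unfolding genseq_def by simp

lemma genseqI: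
  assumes "n \<in> Omega" "f \<in> V" "\<And>p. p \<in> ext f \<Longrightarrow> \<exists>k\<in>insert n (ext n). \<exists>y\<in>V. p = opair k y"
    "\<And>k. k \<in> insert n (ext n) \<Longrightarrow> \<exists>y\<in>V. opair k y \<epsilon> f"
    "\<And>k y z. k \<in> insert n (ext n) \<Longrightarrow> y \<in> V \<Longrightarrow> z \<in> V \<Longrightarrow> opair k y \<epsilon> f \<Longrightarrow> opair k z \<epsilon> f \<Longrightarrow> y = z"
    "\<And>k y. k \<in> insert n (ext n) \<Longrightarrow> y \<in> V \<Longrightarrow> opair k y \<epsilon> f \<Longrightarrow> step (\<lambda>z. \<exists>j\<in>ext k. opair j z \<epsilon> f) y"
  shows "genseq step n f"
  unfolding genseq_def is_fun_def
proof (intro conjI ballI impI)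
  show "\<exists>!y. y \<in> V \<and> opair k y \<epsilon> f" if k: "k \<in> insert n (ext n)" for k
    using assms(4)[OF k] assms(5)[OF k] by (elim bexE) (rule ex1I, blast, blast)
qed (use assms(1-3,6) in \<open>blast+\<close>)

text \<open>Pairs with a component outside the universe are junk, hence the restriction to \<open>V\<close>.\<close>

definition mono_step :: "(('a \<Rightarrow> bool) \<Rightarrow> 'a \<Rightarrow> bool) \<Rightarrow> bool" where
  "mono_step step \<longleftrightarrow> (\<forall>P P' y. (\<forall>z\<in>V. P z \<longrightarrow> P' z) \<longrightarrow> step P y \<longrightarrow> step P' y)"

lemma mono_stepD: "mono_step step \<Longrightarrow> step P y \<Longrightarrow> (\<And>z. z \<in> V \<Longrightarrow> P z \<Longrightarrow> P' z) \<Longrightarrow> step P' y"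
  unfolding mono_step_def by blast

lemma initial_segment:
  assumes f: "f \<in> V" "k \<in> V"
  obtains g where "g \<in> V" "ext g = {p \<in> ext f. \<exists>j\<in>insert k (ext k). \<exists>z\<in>V. p = opair j z}"
    "\<And>j z. j \<in> V \<Longrightarrow> z \<in> V \<Longrightarrow> opair j z \<epsilon> g \<longleftrightarrow> opair j z \<epsilon> f \<and> j \<in> insert k (ext k)"
proof -
  \<comment> \<open>The conjunct \<open>True\<close> gives the formula the shape that
    \<open>adef_ex_snd\<close> expects; the device recurs below.\<close>
  have "adef (\<lambda>e. \<exists>j\<in>insert (e 1) (ext (e 1)). \<exists>z\<in>V. e 0 = opair j z \<and> True)"
    by (intro adef_ex_snd adef_const adef_rules)
  from separation[OF this, of "[k]" f] f
  have "isset {p \<in> ext f. \<exists>j\<in>insert k (ext k). \<exists>z\<in>V. p = opair j z}" by simp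
  then obtain g where g: "g \<in> V" "ext g = {p \<in> ext f. \<exists>j\<in>insert k (ext k). \<exists>z\<in>V. p = opair j z}"
    by (rule issetE)
  have sub: "j \<in> insert k (ext k) \<Longrightarrow> j \<in> V" for j using f ext_in_V by auto
  have "opair j z \<epsilon> g \<longleftrightarrow> opair j z \<epsilon> f \<and> j \<in> insert k (ext k)" if "j \<in> V" "z \<in> V" for j z
  proof -
    have "opair j z \<epsilon> g \<longleftrightarrow> opair j z \<in> ext g" using that by (simp add: mem_ext)
    also have "\<dots> \<longleftrightarrow> opair j z \<in> ext f \<and> j \<in> insert k (ext k)"
      unfolding g using that sub by auto
    finally show ?thesis using that by (simp add: mem_ext)
  qed
  with g that show ?thesis by blast
qed

text \<open>A step refers to earlier entries only, and these survive the restriction of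
  \<open>f\<close> to indices up to \<open>k\<close>; so the restriction is a sequence ending with
  \<open>y\<close>. Monotonicity transfers the step from \<open>f\<close> to its
  restriction.\<close>

lemma gen_truncate:
  assumes g: "genseq step n f" and m: "mono_step step" and k: "opair k y \<epsilon> f" "k \<in> V" "y \<in> V"
  shows "generated step y"
proof -
  have kn: "k \<in> insert n (ext n)" "k \<in> Omega" using genseq_index[OF g k] by auto
  have n: "n \<in> Omega" "f \<in> V" using genseq_in_V[OF g] by auto
  have sub: "insert k (ext k) \<subseteq> insert n (ext n)" "insert k (ext k) \<subseteq> V"
    using kn n Omega_trans k ext_subset by blast+
  obtain h where h: "h \<in> V" "ext h = {p \<in> ext f. \<exists>j\<in>insert k (ext k). \<exists>z\<in>V. p = opair j z}"
    "\<And>j z. j \<in> V \<Longrightarrow> z \<in> V \<Longrightarrow> opair j z \<epsilon> h \<longleftrightarrow> opair j z \<epsilon> f \<and> j \<in> insert k (ext k)"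
    using initial_segment[OF n(2) k(2)] by blast
  have "genseq step k h"
  proof (rule genseqI)
    show "k \<in> Omega" "h \<in> V" using kn h by auto
    show "\<exists>j\<in>insert k (ext k). \<exists>z\<in>V. p = opair j z" if "p \<in> ext h" for p
      using that h by blast
  next
    fix i assume i: "i \<in> insert k (ext k)"
    have iV: "i \<in> V" using i sub by auto
    show "\<exists>y\<in>V. opair i y \<epsilon> h"
      using is_fun_ex[of f "insert n (ext n)" V i] g sub i iV h(3) unfolding genseq_def by blast
    fix z assume z: "z \<in> V" "opair i z \<epsilon> h"
    show "z = z'" if "z' \<in> V" "opair i z' \<epsilon> h" for z'
      using genseq_unique[OF g] h(3) that z iV by blast
    have "step (\<lambda>z. \<exists>j\<in>ext i. opair j z \<epsilon> f) z"
      using genseq_step[OF g, of i z] h(3) z iV by blast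
    then show "step (\<lambda>z. \<exists>j\<in>ext i. opair j z \<epsilon> h) z"
    proof (rule mono_stepD[OF m], elim bexE)
      fix w j assume "w \<in> V" "j \<in> ext i" "opair j w \<epsilon> f"
      moreover have "j \<in> insert k (ext k)" using \<open>j \<in> ext i\<close> i Omega_trans[OF kn(2)] by blast
      ultimately show "\<exists>j\<in>ext i. opair j w \<epsilon> h" using h(3) ext_in_V by blast
    qed
  qed
  then show ?thesis unfolding generated_iff using k h(3) by blast
qed

text \<open>The inversion principle for generated sets: the earlier entries on which the last step
  relies are themselves generated, by truncation.\<close>

lemma generated_step:
  assumes m: "mono_step step" and g: "generated step x" shows "step (generated step) x"
proof -
  obtain n f where f: "x \<in> V" "genseq step n f" "opair n x \<epsilon> f"
    using g by (auto simp: generated_iff)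
  have n: "n \<in> V" using genseq_in_V[OF f(2)] by simp
  show ?thesis
    by (rule mono_stepD[OF m genseq_step[OF f(2,3) n f(1)]])
      (use gen_truncate[OF f(2) m] ext_in_V in blast)
qed

lemma gen_occ_step:
  assumes m: "mono_step step" and g: "genseq step n f" and x: "occ f x" shows "step (occ f) x"
proof -
  obtain k where k: "k \<in> V" "opair k x \<epsilon> f" "x \<in> V" using x by (auto simp: occ_def)
  show ?thesis
    by (rule mono_stepD[OF m genseq_step[OF g k(2,1,3)]]) (use ext_in_V in \<open>auto simp: occ_def\<close>)
qed

lemma gen_occ: "genseq step n f \<Longrightarrow> mono_step step \<Longrightarrow> occ f x \<Longrightarrow> generated step x"
  unfolding occ_def using gen_truncate by blast

lemma generated_occ: "generated step x \<Longrightarrow> \<exists>n f. genseq step n f \<and> occ f x"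
  unfolding generated_iff occ_def by (metis genseq_in_V)

lemma gen_single:
  assumes "y \<in> V" "step (\<lambda>z. False) y" "mono_step step"
  shows "\<exists>n f. genseq step n f \<and> occ f y"
proof -
  define f where "f = mk {opair (num 0) y}"
  have f: "f \<in> V" "ext f = {opair (num 0) y}" using assms(1) by (auto simp: f_def)
  have mem: "opair j z \<epsilon> f \<longleftrightarrow> j = num 0 \<and> z = y" if "j \<in> V" "z \<in> V" for j z
  proof -
    have "opair j z \<epsilon> f \<longleftrightarrow> opair j z \<in> ext f" using that by (simp add: mem_ext)
    also have "\<dots> \<longleftrightarrow> j = num 0 \<and> z = y" unfolding f using that assms(1) by auto
    finally show ?thesis .
  qed
  have "genseq step (num 0) f"
    by (rule genseqI) (use assms f mem in \<open>auto intro: mono_stepD\<close>)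
  then show ?thesis using mem assms(1) unfolding occ_def by (metis num_in_V)
qed

text \<open>Sequences are lengthened one entry at a time, at index \<open>suc n\<close>. Joining two
  sequences would call for arithmetic on \<open>Omega\<close>, which is thereby avoided.\<close>

lemma gen_extend:
  assumes g: "genseq step n f" and m: "mono_step step" and y: "y \<in> V" "step (occ f) y"
  shows "\<exists>n' f'. genseq step n' f' \<and> occ f' y \<and> (\<forall>z. occ f z \<longrightarrow> occ f' z)"
proof -
  have n: "n \<in> Omega" "n \<in> V" "f \<in> V" using genseq_in_V[OF g] by auto
  define f' where "f' = mk (insert (opair (suc n) y) (ext f))"
  have f': "f' \<in> V" "ext f' = insert (opair (suc n) y) (ext f)" using y n by (auto simp: f'_def)
  have mem: "opair j z \<epsilon> f' \<longleftrightarrow> (j = suc n \<and> z = y) \<or> opair j z \<epsilon> f" if "j \<in> V" "z \<in> V" for j z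
  proof -
    have "opair j z \<epsilon> f' \<longleftrightarrow> opair j z \<in> ext f'" using that by (simp add: mem_ext)
    also have "\<dots> \<longleftrightarrow> (j = suc n \<and> z = y) \<or> opair j z \<epsilon> f" unfolding f' using that y n by (auto simp: mem_ext)
    finally show ?thesis .
  qed
  have sn: "suc n \<notin> insert n (ext n)"
    using Omega_irrefl[OF Omega_suc[OF n(1)]] n by auto
  have new: "\<not> opair (suc n) z \<epsilon> f" if "z \<in> V" for z
    using genseq_index[OF g, of "suc n" z] that n sn by auto
  have "genseq step (suc n) f'"
  proof (rule genseqI)
    show "suc n \<in> Omega" "f' \<in> V" using n f' by auto
    show "\<exists>j\<in>insert (suc n) (ext (suc n)). \<exists>z\<in>V. p = opair j z" if "p \<in> ext f'" for p
      using that f' genseq_elem[OF g] n y by auto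
  next
    fix i assume i: "i \<in> insert (suc n) (ext (suc n))"
    have iV: "i \<in> V" using i n ext_in_V by auto
    show "\<exists>y\<in>V. opair i y \<epsilon> f'"
      using is_fun_ex[of f "insert n (ext n)" V i] g i iV mem y n unfolding genseq_def by auto
    fix z assume z: "z \<in> V" "opair i z \<epsilon> f'"
    show "z = z'" if "z' \<in> V" "opair i z' \<epsilon> f'" for z'
    proof -
      have "(i = suc n \<and> z = y) \<or> opair i z \<epsilon> f" "(i = suc n \<and> z' = y) \<or> opair i z' \<epsilon> f"
        using mem[OF iV] that z by blast+
      then show ?thesis
        using new[OF z(1)] new[OF that(1)] genseq_unique[OF g _ _ iV z(1) that(1)] by blast
    qed
    show "step (\<lambda>z. \<exists>j\<in>ext i. opair j z \<epsilon> f') z"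
    proof (cases "i = suc n")
      case True
      then have "z = y" using z mem iV new by blast
      show ?thesis unfolding \<open>z = y\<close>
      proof (rule mono_stepD[OF m y(2)])
        fix w assume w: "w \<in> V" "occ f w"
        then obtain k where k: "k \<in> V" "opair k w \<epsilon> f" by (auto simp: occ_def)
        then have "k \<in> insert n (ext n)" using genseq_index[OF g] w by blast
        then show "\<exists>j\<in>ext i. opair j w \<epsilon> f'" using True mem k w n by auto
      qed
    next
      case False
      then have "opair i z \<epsilon> f" using mem z iV by blast
      then have "step (\<lambda>z. \<exists>j\<in>ext i. opair j z \<epsilon> f) z"
        using genseq_step[OF g] z iV by blast
      then show ?thesis by (rule mono_stepD[OF m]) (use mem ext_in_V in blast)
    qed
  qed
  moreover have "occ f' y" using mem y n unfolding occ_def by (metis suc_in_V)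
  moreover have "occ f z \<Longrightarrow> occ f' z" for z using mem unfolding occ_def by blast
  ultimately show ?thesis by blast
qed

text \<open>The argument is by a least bad stage; the bad stages form a set because \<open>Q\<close>
  is definable. In the induction step \<open>P\<close> stands for being an earlier entry, and all
  that is known about it is that such entries occur in \<open>f\<close> and satisfy
  \<open>Q\<close>.\<close>

lemma gen_induct:
  assumes g: "genseq step n f" and m: "mono_step step"
    and Q: "adef Q" "set ps \<subseteq> V"
    and st: "\<And>P y. y \<in> V \<Longrightarrow> (\<And>z. z \<in> V \<Longrightarrow> P z \<Longrightarrow> occ f z \<and> Q (env (z # ps))) \<Longrightarrow> step P y \<Longrightarrow> occ f y \<Longrightarrow>
      Q (env (y # ps))"
    and x: "occ f x"
  shows "Q (env (x # ps))"
proof (rule ccontr)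
  assume nx: "\<not> Q (env (x # ps))"
  have n: "n \<in> Omega" "n \<in> V" "f \<in> V" using genseq_in_V[OF g] by auto
  define B where "B = {k \<in> ext (suc n). \<exists>y\<in>V. opair k y \<epsilon> f \<and> \<not> Q (env (y # ps))}"
  \<comment> \<open>The assignment holds the stage at \<open>0\<close>, the sequence at
    \<open>1\<close> and \<open>ps\<close> from \<open>2\<close> on, whereas \<open>Q\<close> reads
    its argument at \<open>0\<close> and \<open>ps\<close> from \<open>1\<close> on.\<close>
  have Q': "adef (\<lambda>e. \<exists>y\<in>V. opair (e 0) y \<epsilon> e 1 \<and>
      \<not> Q (\<lambda>i. if i = 0 then y else if i \<le> length ps then e (Suc i) else y))"
  proof (rule adef_ex_value[OF aterm_var aterm_var], rule adef_not)
    show "adef (\<lambda>e. Q (\<lambda>i. if i = 0 then e 0 else if i \<le> length ps then e (Suc (Suc i)) else e 0))"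
    proof -
      let ?g = "\<lambda>i. if i = 0 then 0 else if i \<le> length ps then Suc (Suc i) else 0"
      have "(\<lambda>i. if i = 0 then e 0 else if i \<le> length ps then e (Suc (Suc i)) else e 0) = (\<lambda>i. e (?g i))"
        for e :: "nat \<Rightarrow> 'a"
        by (rule HOL.ext) auto
      then show ?thesis using adef_rename[OF Q(1), of ?g] by simp
    qed
  qed
  have env': "(\<lambda>i. if i = 0 then y else if i \<le> length ps then env (k # f # ps) (Suc i) else y) = env (y # ps)" for y k
    by (rule HOL.ext) (auto simp: env_def nth_Cons')
  have "isset {k \<in> ext (suc n). \<exists>y\<in>V. opair (env (k # f # ps) 0) y \<epsilon> env (k # f # ps) 1 \<and>
      \<not> Q (\<lambda>i. if i = 0 then y else if i \<le> length ps then env (k # f # ps) (Suc i) else y)}"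
    using separation[OF Q', of "f # ps" "suc n"] Q(2) n by simp
  then have "isset B" unfolding B_def env' by simp
  moreover have "B \<subseteq> ext (suc n)" by (auto simp: B_def)
  moreover have "B \<noteq> {}"
  proof -
    obtain k where "k \<in> V" "opair k x \<epsilon> f" "x \<in> V" using x by (auto simp: occ_def)
    then have "k \<in> B" using genseq_index[OF g, of k x] nx n by (auto simp: B_def)
    then show ?thesis by blast
  qed
  ultimately obtain k where k: "k \<in> B" "\<forall>j\<in>ext k. j \<notin> B"
    using Omega_min[OF Omega_suc[OF n(1)]] by blast
  then obtain y where y: "y \<in> V" "opair k y \<epsilon> f" "\<not> Q (env (y # ps))" "k \<in> ext (suc n)"
    by (auto simp: B_def)
  have kV: "k \<in> V" using y ext_in_V by blast
  have "Q (env (y # ps))"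
  proof (rule st[OF y(1) _ genseq_step[OF g y(2) kV y(1)]])
    fix z assume z: "z \<in> V" "\<exists>j\<in>ext k. opair j z \<epsilon> f"
    then obtain j where j: "j \<in> ext k" "opair j z \<epsilon> f" by blast
    then have "j \<in> ext (suc n)" using Omega_trans[OF Omega_suc[OF n(1)] y(4)] by blast
    then show "occ f z \<and> Q (env (z # ps))"
      using k(2) j z ext_in_V unfolding B_def occ_def by blast
  qed (use y kV in \<open>auto simp: occ_def\<close>)
  with y show False by blast
qed

section \<open>Formation of formulas\<close>

lemmas codes = cMem_def cEq_def cS_def cApp2_def cNeg_def cAnd_def cAll_def cAll2_def triple_def

lemma var_in_V [simp]: "i \<in> V \<Longrightarrow> var i \<in> V" by (simp add: var_def)
lemma con_in_V [simp]: "i \<in> V \<Longrightarrow> con i \<in> V" by (simp add: con_def)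
lemma var_inject [simp]: "i \<in> V \<Longrightarrow> j \<in> V \<Longrightarrow> var i = var j \<longleftrightarrow> i = j" by (simp add: var_def)
lemma var_con [simp]: "i \<in> V \<Longrightarrow> j \<in> V \<Longrightarrow> var i \<noteq> con j" by (simp add: con_def var_def)

lemma terms_in_V: "C \<subseteq> V \<Longrightarrow> t \<in> terms C \<Longrightarrow> t \<in> V"
  by (auto simp: terms_def)

lemma code_in_V [simp]:
  "s \<in> V \<Longrightarrow> t \<in> V \<Longrightarrow> cMem s t \<in> V" "s \<in> V \<Longrightarrow> t \<in> V \<Longrightarrow> cEq s t \<in> V" "t \<in> V \<Longrightarrow> cS t \<in> V"
  "s \<in> V \<Longrightarrow> t \<in> V \<Longrightarrow> cApp2 s t \<in> V" "t \<in> V \<Longrightarrow> cNeg t \<in> V" "s \<in> V \<Longrightarrow> t \<in> V \<Longrightarrow> cAnd s t \<in> V"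
  "s \<in> V \<Longrightarrow> t \<in> V \<Longrightarrow> cAll s t \<in> V" "s \<in> V \<Longrightarrow> t \<in> V \<Longrightarrow> cAll2 s t \<in> V"
  by (simp_all add: codes)

definition lift3 :: "(('a \<Rightarrow> 'a \<Rightarrow> 'a \<Rightarrow> bool) \<Rightarrow> 'a \<Rightarrow> 'a \<Rightarrow> 'a \<Rightarrow> bool) \<Rightarrow> ('a \<Rightarrow> bool) \<Rightarrow> 'a \<Rightarrow> bool" where
  "lift3 step P x \<longleftrightarrow> (\<exists>\<psi>\<in>V. \<exists>w\<in>V. \<exists>s\<in>V. x = triple \<psi> w s \<and> step (\<lambda>\<psi> w s. P (triple \<psi> w s)) \<psi> w s)"

definition mono3 :: "(('a \<Rightarrow> 'a \<Rightarrow> 'a \<Rightarrow> bool) \<Rightarrow> 'a \<Rightarrow> 'a \<Rightarrow> 'a \<Rightarrow> bool) \<Rightarrow> bool" where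
  "mono3 step \<longleftrightarrow> (\<forall>P P'. (\<forall>\<psi>\<in>V. \<forall>w\<in>V. \<forall>s\<in>V. P \<psi> w s \<longrightarrow> P' \<psi> w s) \<longrightarrow>
     (\<forall>\<psi>\<in>V. \<forall>w\<in>V. \<forall>s\<in>V. step P \<psi> w s \<longrightarrow> step P' \<psi> w s))"

lemma mono3D: "mono3 step \<Longrightarrow> step P \<phi> v r \<Longrightarrow> \<phi> \<in> V \<Longrightarrow> v \<in> V \<Longrightarrow> r \<in> V \<Longrightarrow>
  (\<And>\<psi> w s. \<psi> \<in> V \<Longrightarrow> w \<in> V \<Longrightarrow> s \<in> V \<Longrightarrow> P \<psi> w s \<Longrightarrow> P' \<psi> w s) \<Longrightarrow> step P' \<phi> v r"
  unfolding mono3_def by blast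

lemma lift3_triple [simp]:
  "\<phi> \<in> V \<Longrightarrow> v \<in> V \<Longrightarrow> r \<in> V \<Longrightarrow> lift3 step P (triple \<phi> v r) \<longleftrightarrow> step (\<lambda>\<psi> w s. P (triple \<psi> w s)) \<phi> v r"
  unfolding lift3_def by auto

lemma formed_by_iff: "formed_by step \<phi> v r \<longleftrightarrow> \<phi> \<in> V \<and> v \<in> V \<and> r \<in> V \<and> generated (lift3 step) (triple \<phi> v r)"
  by (simp add: formed_by_def lift3_def[abs_def])

lemma mono_lift3: assumes "mono3 step" shows "mono_step (lift3 step)"
  unfolding mono_step_def
proof (intro allI impI)
  fix P P' y assume P: "\<forall>z\<in>V. P z \<longrightarrow> P' z" and y: "lift3 step P y"
  obtain \<phi> v r where *: "\<phi> \<in> V" "v \<in> V" "r \<in> V" "y = triple \<phi> v r" "step (\<lambda>\<psi> w s. P (triple \<psi> w s)) \<phi> v r"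
    using y by (auto simp: lift3_def)
  have "step (\<lambda>\<psi> w s. P' (triple \<psi> w s)) \<phi> v r"
    by (rule mono3D[OF assms *(5)]) (use * P in auto)
  with * show "lift3 step P' y" by simp
qed

lemma formed_inv:
  assumes m: "mono3 step" and f: "formed_by step \<phi> v r" shows "step (formed_by step) \<phi> v r"
proof -
  have *: "\<phi> \<in> V" "v \<in> V" "r \<in> V" "generated (lift3 step) (triple \<phi> v r)"
    using f by (auto simp: formed_by_iff)
  have "step (\<lambda>\<psi> w s. generated (lift3 step) (triple \<psi> w s)) \<phi> v r"
    using generated_step[OF mono_lift3[OF m] *(4)] * by simp
  then show ?thesis by (rule mono3D[OF m]) (auto simp: * formed_by_iff)
qed

text \<open>Since the induction runs along a sequence in \<open>V\<close>, the predicate must be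
  definable; the sets it refers to enter through the two parameters \<open>p\<close> and
  \<open>q\<close>.\<close>

lemma formed_induct:
  assumes f: "formed_by step \<phi> v r" and m: "mono3 step"
    and R: "adef (\<lambda>e. R (e 0) (e (Suc 0)) (e (Suc (Suc 0))) (e (Suc (Suc (Suc 0)))) (e (Suc (Suc (Suc (Suc 0))))))"
    and pq: "p \<in> V" "q \<in> V"
    and st: "\<And>\<phi> v r. \<phi> \<in> V \<Longrightarrow> v \<in> V \<Longrightarrow> r \<in> V \<Longrightarrow>
      step (\<lambda>\<phi> v r. formed_by step \<phi> v r \<and> R \<phi> v r p q) \<phi> v r \<Longrightarrow> R \<phi> v r p q"
  shows "R \<phi> v r p q"
proof -
  have *: "\<phi> \<in> V" "v \<in> V" "r \<in> V" "generated (lift3 step) (triple \<phi> v r)"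
    using f by (auto simp: formed_by_iff)
  have ml: "mono_step (lift3 step)" by (rule mono_lift3[OF m])
  obtain n g where g: "genseq (lift3 step) n g" "occ g (triple \<phi> v r)"
    using generated_occ[OF *(4)] by blast
  \<comment> \<open>Stated as the absence of a counterexample, which is the form covered by
    \<open>adef_ex_triple\<close>.\<close>
  define Q where "Q = (\<lambda>e. \<not> (\<exists>\<phi>\<in>V. \<exists>v\<in>V. \<exists>r\<in>V. e 0 = triple \<phi> v r \<and> \<not> R \<phi> v r (e (Suc 0)) (e (Suc (Suc 0)))))"
  \<comment> \<open>Under the three quantifiers the components are numbered backwards, index
    \<open>3\<close> is the triple being decomposed, and the parameters have moved to
    \<open>4\<close> and \<open>5\<close>.\<close>
  have "adef (\<lambda>e. \<not> R (e (Suc (Suc 0))) (e (Suc 0)) (e 0) (e (Suc (Suc (Suc (Suc 0))))) (e (Suc (Suc (Suc (Suc (Suc 0)))))))"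
    using adef_not[OF adef_rename[OF R, of "\<lambda>n. if n = 0 then 2 else if n = 1 then 1 else if n = 2 then 0 else Suc n"]]
    by (simp add: numeral_2_eq_2)
  then have Q: "adef Q"
    unfolding Q_def
    using adef_not[OF adef_ex_triple[OF aterm_var[of 0], where R = "\<lambda>\<phi> v r e. \<not> R \<phi> v r (e (Suc 0)) (e (Suc (Suc 0)))"]]
    by simp
  have "Q (env (triple \<phi> v r # [p, q]))"
  proof (rule gen_induct[OF g(1) ml Q _ _ g(2)])
    show "set [p, q] \<subseteq> V" using pq by simp
    fix P y assume y: "y \<in> V" and P: "\<And>z. z \<in> V \<Longrightarrow> P z \<Longrightarrow> occ g z \<and> Q (env (z # [p, q]))"
      and s: "lift3 step P y"
    show "Q (env (y # [p, q]))"
      unfolding Q_def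
    proof (intro notI, elim bexE conjE)
      fix \<psi> w s assume V: "\<psi> \<in> V" "w \<in> V" "s \<in> V" and y': "env (y # [p, q]) 0 = triple \<psi> w s"
        and nR: "\<not> R \<psi> w s (env (y # [p, q]) (Suc 0)) (env (y # [p, q]) (Suc (Suc 0)))"
      have "step (\<lambda>\<psi> w s. P (triple \<psi> w s)) \<psi> w s" using s V y' by simp
      then have "step (\<lambda>\<phi> v r. formed_by step \<phi> v r \<and> R \<phi> v r p q) \<psi> w s"
      proof (rule mono3D[OF m])
        fix \<chi> x t assume V': "\<chi> \<in> V" "x \<in> V" "t \<in> V" and "P (triple \<chi> x t)"
        then have *: "occ g (triple \<chi> x t)" "Q (env (triple \<chi> x t # [p, q]))" using P by auto
        then have "formed_by step \<chi> x t"
          unfolding formed_by_iff using gen_occ[OF g(1) ml] V' by blast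
        moreover have "R \<chi> x t p q" using *(2) V' unfolding Q_def by simp
        ultimately show "formed_by step \<chi> x t \<and> R \<chi> x t p q" ..
      qed (use V in auto)
      with st[OF V] nR show False by simp
    qed
  qed
  then show ?thesis using * unfolding Q_def by simp
qed

lemma formed_mono:
  assumes "\<And>P \<phi> v r. \<phi> \<in> V \<Longrightarrow> v \<in> V \<Longrightarrow> r \<in> V \<Longrightarrow> step P \<phi> v r \<Longrightarrow> step' P \<phi> v r" "formed_by step \<phi> v r"
  shows "formed_by step' \<phi> v r"
proof -
  have "genseq (lift3 step) n f \<Longrightarrow> genseq (lift3 step') n f" for n f
    unfolding genseq_def lift3_def using assms(1) by meson
  then show ?thesis using assms(2) unfolding formed_by_iff generated_iff by blast
qed

section \<open>Formation steps of the four classes of formulas, and unique readability\<close>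

definition L_step where "L_step P \<phi> v r \<longleftrightarrow> set_atom {} \<phi> v r \<or> first_order_step P \<phi> v r"

definition L2_step where "L2_step C P \<phi> v r \<longleftrightarrow> set_atom C \<phi> v r \<or> predicate_atom C \<phi> v r \<or>
     first_order_step P \<phi> v r \<or> second_order_step P \<phi> v r"

definition NS_step where "NS_step C P \<phi> v r \<longleftrightarrow> set_atom C \<phi> v r \<or> predicate_atom C \<phi> v r \<or>
     first_order_step P \<phi> v r"

definition Pi_step where "Pi_step C P \<phi> v r \<longleftrightarrow> no_second_order_quantifiers C \<phi> v r \<or> second_order_step P \<phi> v r"

lemma formula_iffs:
  "L_formula \<phi> v \<longleftrightarrow> formed_by L_step \<phi> v (num 0)"
  "L2_formula C = formed_by (L2_step C)"
  "no_second_order_quantifiers C = formed_by (NS_step C)"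
  "Pi11_formula C = formed_by (Pi_step C)"
  by (simp_all add: L_formula_def L2_formula_def no_second_order_quantifiers_def Pi11_formula_def
      L_step_def[abs_def] L2_step_def[abs_def] NS_step_def[abs_def] Pi_step_def[abs_def])

lemma mono3_first_order_step: "mono3 first_order_step"
  unfolding mono3_def first_order_step_def
proof (intro allI impI ballI)
  fix P P' :: "'a \<Rightarrow> 'a \<Rightarrow> 'a \<Rightarrow> bool" and \<phi> v r
  assume P: "\<forall>\<psi>\<in>V. \<forall>w\<in>V. \<forall>s\<in>V. P \<psi> w s \<longrightarrow> P' \<psi> w s" and V: "\<phi> \<in> V" "v \<in> V" "r \<in> V"
    and s: "(\<exists>p\<in>V. \<phi> = cNeg p \<and> P p v r) \<or>
     (\<exists>p\<in>V. \<exists>q\<in>V. \<exists>v1\<in>V. \<exists>v2\<in>V. \<exists>r1\<in>V. \<exists>r2\<in>V. \<phi> = cAnd p q \<and> P p v1 r1 \<and> P q v2 r2 \<and>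
        ext v = ext v1 \<union> ext v2 \<and> ext r = ext r1 \<union> ext r2) \<or>
     (\<exists>i\<in>Omega. \<exists>p\<in>V. \<exists>w\<in>V. \<phi> = cAll i p \<and> P p w r \<and> ext v = ext w - {i})"
  then show "(\<exists>p\<in>V. \<phi> = cNeg p \<and> P' p v r) \<or>
     (\<exists>p\<in>V. \<exists>q\<in>V. \<exists>v1\<in>V. \<exists>v2\<in>V. \<exists>r1\<in>V. \<exists>r2\<in>V. \<phi> = cAnd p q \<and> P' p v1 r1 \<and> P' q v2 r2 \<and>
        ext v = ext v1 \<union> ext v2 \<and> ext r = ext r1 \<union> ext r2) \<or>
     (\<exists>i\<in>Omega. \<exists>p\<in>V. \<exists>w\<in>V. \<phi> = cAll i p \<and> P' p w r \<and> ext v = ext w - {i})"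
    by (elim disjE) (meson V P)+
qed

lemma mono3_second_order_step: "mono3 second_order_step"
  unfolding mono3_def second_order_step_def by meson

lemma mono3_or: "mono3 A \<Longrightarrow> mono3 B \<Longrightarrow> mono3 (\<lambda>P \<phi> v r. A P \<phi> v r \<or> B P \<phi> v r)"
  unfolding mono3_def by blast

lemma mono3_const: "mono3 (\<lambda>P. A)"
  unfolding mono3_def by blast

lemma mono3_steps [simp]: "mono3 L_step" "mono3 (L2_step C)" "mono3 (NS_step C)" "mono3 (Pi_step C)"
  unfolding L_step_def[abs_def] L2_step_def[abs_def] NS_step_def[abs_def] Pi_step_def[abs_def]
  by (intro mono3_or mono3_const mono3_first_order_step mono3_second_order_step)+

lemma set_atom_mono: "C \<subseteq> C' \<Longrightarrow> set_atom C \<phi> v r \<Longrightarrow> set_atom C' \<phi> v r"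
  unfolding set_atom_def terms_def by blast

lemma L_imp_L2: "L_formula \<phi> v \<Longrightarrow> L2_formula C \<phi> v (num 0)"
  unfolding formula_iffs
  by (rule formed_mono) (auto simp: L_step_def L2_step_def intro: set_atom_mono)

lemma L2_in_V: "L2_formula C \<phi> v r \<Longrightarrow> \<phi> \<in> V \<and> v \<in> V \<and> r \<in> V"
  by (simp add: formula_iffs formed_by_iff)

lemma L_in_V: "L_formula \<phi> v \<Longrightarrow> \<phi> \<in> V \<and> v \<in> V"
  by (simp add: formula_iffs formed_by_iff)

lemma L2_step_codes:
  assumes C: "C \<subseteq> V" and V: "s \<in> V" "t \<in> V"
  shows "L2_step C P (cMem s t) v r \<longleftrightarrow> s \<in> terms C \<and> t \<in> terms C \<and> ext v = term_vars s \<union> term_vars t \<and> ext r = {}" (is ?Mem)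
    and "L2_step C P (cEq s t) v r \<longleftrightarrow> s \<in> terms C \<and> t \<in> terms C \<and> ext v = term_vars s \<union> term_vars t \<and> ext r = {}" (is ?Eq)
    and "L2_step C P (cS t) v r \<longleftrightarrow> t \<in> terms C \<and> ext v = term_vars t \<and> ext r = {}" (is ?S)
    and "L2_step C P (cApp2 s t) v r \<longleftrightarrow> s \<in> Omega \<and> t \<in> terms C \<and> ext v = term_vars t \<and> ext r = {s}" (is ?App)
    and "L2_step C P (cNeg t) v r \<longleftrightarrow> P t v r" (is ?Neg)
    and "L2_step C P (cAnd s t) v r \<longleftrightarrow> (\<exists>v1\<in>V. \<exists>v2\<in>V. \<exists>r1\<in>V. \<exists>r2\<in>V. P s v1 r1 \<and> P t v2 r2 \<and>
        ext v = ext v1 \<union> ext v2 \<and> ext r = ext r1 \<union> ext r2)" (is ?And)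
    and "L2_step C P (cAll s t) v r \<longleftrightarrow> s \<in> Omega \<and> (\<exists>w\<in>V. P t w r \<and> ext v = ext w - {s})" (is ?All)
    and "L2_step C P (cAll2 s t) v r \<longleftrightarrow> s \<in> Omega \<and> (\<exists>w\<in>V. P t v w \<and> ext r = ext w - {s})" (is ?All2)
proof -
  note T = terms_in_V[OF C]
  note defs = L2_step_def set_atom_def predicate_atom_def first_order_step_def second_order_step_def
  show ?Mem unfolding defs using V by (auto simp: T codes)
  show ?Eq unfolding defs using V by (auto simp: T codes)
  show ?S unfolding defs using V by (auto simp: T codes)
  show ?App unfolding defs using V by (auto simp: T codes)
  show ?Neg unfolding defs using V by (auto simp: T codes)
  show ?And unfolding defs using V by (auto simp: T codes)
  show ?All unfolding defs using V by (auto simp: T codes)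
  show ?All2 unfolding defs using V by (auto simp: T codes)
qed

lemma code_cases:
  assumes "L2_step C P \<phi> v r" "C \<subseteq> V"
  obtains (Mem) s t where "s \<in> V" "t \<in> V" "\<phi> = cMem s t"
  | (Eq) s t where "s \<in> V" "t \<in> V" "\<phi> = cEq s t"
  | (S) t where "t \<in> V" "\<phi> = cS t"
  | (App2) s t where "s \<in> V" "t \<in> V" "\<phi> = cApp2 s t"
  | (Neg) t where "t \<in> V" "\<phi> = cNeg t"
  | (And) s t where "s \<in> V" "t \<in> V" "\<phi> = cAnd s t"
  | (All) s t where "s \<in> V" "t \<in> V" "\<phi> = cAll s t"
  | (All2) s t where "s \<in> V" "t \<in> V" "\<phi> = cAll2 s t"
  using assms(1) terms_in_V[OF assms(2)] Omega_in_V
  unfolding L2_step_def set_atom_def predicate_atom_def first_order_step_def second_order_step_def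
  by (elim disjE bexE conjE) metis+

lemma L2_step_unique:
  assumes C: "C \<subseteq> V" and s: "L2_step C P \<phi> v r" "L2_step C P' \<phi> v' r'"
    and V: "v \<in> V" "r \<in> V" "v' \<in> V" "r' \<in> V"
    and P: "\<And>\<psi> w s w' s'. \<psi> \<in> V \<Longrightarrow> w \<in> V \<Longrightarrow> s \<in> V \<Longrightarrow> w' \<in> V \<Longrightarrow> s' \<in> V \<Longrightarrow>
      P \<psi> w s \<Longrightarrow> P' \<psi> w' s' \<Longrightarrow> w = w' \<and> s = s'"
  shows "v = v' \<and> r = r'"
proof -
  have "ext v = ext v' \<and> ext r = ext r'"
    using s(1) C
  proof (cases rule: code_cases)
    case (And s t)
    then show ?thesis using s C P by (simp add: L2_step_codes) metis
  next
    case (All s t)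
    then show ?thesis using s C P V by (simp add: L2_step_codes) metis
  next
    case (All2 s t)
    then show ?thesis using s C P V by (simp add: L2_step_codes) metis
  next
    case (Neg t)
    then show ?thesis using s C P V by (simp add: L2_step_codes) metis
  qed (use s C in \<open>simp_all add: L2_step_codes\<close>)
  then show ?thesis using V ext_eqI by blast
qed

text \<open>The induction compares a formula with the entries of one fixed sequence
  \<open>g\<close>, not with all derivations: quantification over the entries of a given set keeps
  the induction predicate definable.\<close>

lemma L2_unique:
  assumes C: "C \<subseteq> V" and f: "L2_formula C \<phi> v r" and f': "L2_formula C \<phi> v' r'"
  shows "v = v' \<and> r = r'"
proof -
  have V: "\<phi> \<in> V" "v \<in> V" "r \<in> V" "v' \<in> V" "r' \<in> V" using L2_in_V f f' by blast+
  have m: "mono_step (lift3 (L2_step C))" by (rule mono_lift3) simp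
  obtain n g where g: "genseq (lift3 (L2_step C)) n g" "occ g (triple \<phi> v' r')"
    using f' generated_occ unfolding formula_iffs formed_by_iff by blast
  define R where "R \<phi> v r g q \<longleftrightarrow> \<not> (\<exists>k\<in>V. \<exists>y\<in>V. opair k y \<epsilon> g \<and>
     (\<exists>\<phi>'\<in>V. \<exists>v'\<in>V. \<exists>r'\<in>V. y = triple \<phi>' v' r' \<and> \<phi>' = \<phi> \<and> \<not> (v = v' \<and> r = r')))" for \<phi> v r g q :: 'a
  have "R \<phi> v r g g"
  proof (rule formed_induct[where R = R, OF f[unfolded formula_iffs]])
    show "adef (\<lambda>e. R (e 0) (e (Suc 0)) (e (Suc (Suc 0))) (e (Suc (Suc (Suc 0)))) (e (Suc (Suc (Suc (Suc 0))))))"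
      unfolding R_def
      by (intro adef_not adef_ex_pair_mem adef_ex_triple adef_and adef_eq aterm_var)
    fix \<phi> v r assume V: "\<phi> \<in> V" "v \<in> V" "r \<in> V"
      and s: "L2_step C (\<lambda>\<phi> v r. formed_by (L2_step C) \<phi> v r \<and> R \<phi> v r g g) \<phi> v r"
    show "R \<phi> v r g g" unfolding R_def
    proof (intro notI, elim bexE conjE)
      fix k y \<phi>' v' r' assume V': "k \<in> V" "y \<in> V" "\<phi>' \<in> V" "v' \<in> V" "r' \<in> V"
        and y: "opair k y \<epsilon> g" "y = triple \<phi>' v' r'" "\<phi>' = \<phi>" "\<not> (v = v' \<and> r = r')"
      then have "occ g (triple \<phi> v' r')" by (auto simp: occ_def)
      then have "L2_step C (\<lambda>\<psi> w s. occ g (triple \<psi> w s)) \<phi> v' r'"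
        using gen_occ_step[OF m g(1), of "triple \<phi> v' r'"] V V' by simp
      from L2_step_unique[OF C s this V(2,3) V'(4,5)] have "v = v' \<and> r = r'"
        unfolding R_def occ_def by blast
      with y(4) show False by blast
    qed
  qed (use genseq_in_V[OF g(1)] in \<open>simp_all\<close>)
  then show ?thesis using g(2) V unfolding R_def occ_def by blast
qed

lemma bex_forward: "\<exists>x\<in>A. P x \<Longrightarrow> (\<And>x. x \<in> A \<Longrightarrow> P x \<Longrightarrow> Q x) \<Longrightarrow> \<exists>x\<in>A. Q x"
  by blast

section \<open>Truth sets as entries of generating sequences\<close>

definition sat_gen where
  "sat_gen M U D P x \<longleftrightarrow> (\<exists>\<psi>\<in>V. \<exists>S\<in>V. x = opair \<psi> S \<and> sat_step M U D (\<lambda>\<psi> S. P (opair \<psi> S)) \<psi> S)"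

text \<open>Separates the truth set of a formula from the individual assignment: satisfaction is
  then membership in this set.\<close>

definition tset :: "'a set \<Rightarrow> 'a set \<Rightarrow> 'a set \<Rightarrow> 'a \<Rightarrow> 'a \<Rightarrow> bool" where
  "tset M U D \<phi> T \<longleftrightarrow> \<phi> \<in> V \<and> T \<in> V \<and> generated (sat_gen M U D) (opair \<phi> T)"

lemma sat_gen_opair [simp]:
  "\<phi> \<in> V \<Longrightarrow> T \<in> V \<Longrightarrow> sat_gen M U D P (opair \<phi> T) \<longleftrightarrow> sat_step M U D (\<lambda>\<psi> S. P (opair \<psi> S)) \<phi> T"
  unfolding sat_gen_def by auto

lemma sat_iff: "\<phi> \<in> V \<Longrightarrow> sat M U D \<phi> a A \<longleftrightarrow> (\<exists>T\<in>V. opair a A \<epsilon> T \<and> tset M U D \<phi> T)"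
  by (simp add: sat_def tset_def sat_gen_def[abs_def] cong: bex_cong_simp)

lemma sat_step_mono:
  assumes "sat_step M U D P \<phi> T" "\<And>\<psi> S. \<psi> \<in> V \<Longrightarrow> S \<in> V \<Longrightarrow> P \<psi> S \<Longrightarrow> P' \<psi> S"
  shows "sat_step M U D P' \<phi> T"
  using assms(1) unfolding sat_step_def
  apply (elim disj_forward bex_forward conj_forward)
  apply (assumption | (rule assms(2), assumption+))+
  done

lemma mono_sat_gen: "mono_step (sat_gen M U D)"
  unfolding mono_step_def
proof (intro allI impI)
  fix P P' y assume P: "\<forall>z\<in>V. P z \<longrightarrow> P' z" and y: "sat_gen M U D P y"
  obtain \<phi> S where *: "\<phi> \<in> V" "S \<in> V" "y = opair \<phi> S" "sat_step M U D (\<lambda>\<psi> S. P (opair \<psi> S)) \<phi> S"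
    using y by (auto simp: sat_gen_def)
  have "sat_step M U D (\<lambda>\<psi> S. P' (opair \<psi> S)) \<phi> S"
    by (rule sat_step_mono[OF *(4)]) (use P in auto)
  with * show "sat_gen M U D P' y" by simp
qed

lemma tset_inv: assumes "tset M U D \<phi> T" shows "sat_step M U D (tset M U D) \<phi> T"
proof -
  have *: "\<phi> \<in> V" "T \<in> V" "generated (sat_gen M U D) (opair \<phi> T)"
    using assms by (auto simp: tset_def)
  have "sat_step M U D (\<lambda>\<psi> S. generated (sat_gen M U D) (opair \<psi> S)) \<phi> T"
    using generated_step[OF mono_sat_gen *(3)] * by simp
  then show ?thesis by (rule sat_step_mono) (auto simp: tset_def)
qed

lemma sat_step_codes:
  assumes M: "M \<subseteq> V" and V: "s \<in> V" "t \<in> V"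
  shows "sat_step M U D P (cMem s t) T \<longleftrightarrow> s \<in> terms M \<and> t \<in> terms M \<and>
        truth_set M D (cMem s t) T (\<lambda>a A. \<exists>x\<in>M. \<exists>y\<in>M. denotes a s x \<and> denotes a t y \<and> x \<epsilon> y)" (is ?Mem)
    and "sat_step M U D P (cEq s t) T \<longleftrightarrow> s \<in> terms M \<and> t \<in> terms M \<and>
        truth_set M D (cEq s t) T (\<lambda>a A. \<exists>x\<in>M. denotes a s x \<and> denotes a t x)" (is ?Eq)
    and "sat_step M U D P (cS t) T \<longleftrightarrow> t \<in> terms M \<and>
        truth_set M D (cS t) T (\<lambda>a A. \<exists>x\<in>U. denotes a t x)" (is ?S)
    and "sat_step M U D P (cApp2 s t) T \<longleftrightarrow> s \<in> Omega \<and> t \<in> terms M \<and>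
        truth_set M D (cApp2 s t) T (\<lambda>a A. \<exists>x\<in>M. \<exists>X\<in>D. denotes a t x \<and> opair s X \<epsilon> A \<and> x \<epsilon> X)" (is ?App)
    and "sat_step M U D P (cNeg t) T \<longleftrightarrow> (\<exists>T1\<in>V. P t T1 \<and>
        truth_set M D (cNeg t) T (\<lambda>a A. \<not> opair a A \<epsilon> T1))" (is ?Neg)
    and "sat_step M U D P (cAnd s t) T \<longleftrightarrow> (\<exists>T1\<in>V. \<exists>T2\<in>V. P s T1 \<and> P t T2 \<and>
        truth_set M D (cAnd s t) T (\<lambda>a A.
          (\<exists>b\<in>V. \<exists>B\<in>V. ext b \<subseteq> ext a \<and> ext B \<subseteq> ext A \<and> opair b B \<epsilon> T1) \<and>
          (\<exists>b\<in>V. \<exists>B\<in>V. ext b \<subseteq> ext a \<and> ext B \<subseteq> ext A \<and> opair b B \<epsilon> T2)))" (is ?And)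
    and "sat_step M U D P (cAll s t) T \<longleftrightarrow> s \<in> Omega \<and> (\<exists>T1\<in>V. P t T1 \<and>
        truth_set M D (cAll s t) T (\<lambda>a A.
          \<forall>x\<in>M. \<exists>b\<in>V. ext b \<subseteq> insert (opair s x) (ext a) \<and> opair b A \<epsilon> T1))" (is ?All)
    and "sat_step M U D P (cAll2 s t) T \<longleftrightarrow> s \<in> Omega \<and> (\<exists>T1\<in>V. P t T1 \<and>
        truth_set M D (cAll2 s t) T (\<lambda>a A.
          \<forall>X\<in>D. \<exists>B\<in>V. ext B \<subseteq> insert (opair s X) (ext A) \<and> opair a B \<epsilon> T1))" (is ?All2)
proof -
  note T = terms_in_V[OF M]
  note [simp del] = Bex_def bex_simps ball_simps
  show ?Mem unfolding sat_step_def using V by (auto simp: T codes)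
  show ?Eq unfolding sat_step_def using V by (auto simp: T codes)
  show ?S unfolding sat_step_def using V by (auto simp: T codes)
  show ?App unfolding sat_step_def using V by (auto simp: T codes)
  show ?Neg unfolding sat_step_def using V by (auto simp: T codes)
  show ?And unfolding sat_step_def using V by (auto simp: T codes)
  show ?All unfolding sat_step_def using V by (auto simp: T codes)
  show ?All2 unfolding sat_step_def using V by (auto simp: T codes)
qed

section \<open>Uniqueness of truth sets, fresh variables\<close>

lemma truth_setE:
  assumes "truth_set M D \<phi> T Q"
  obtains v r where "v \<in> V" "r \<in> V" "L2_formula M \<phi> v r"
    "ext T = {opair a A | a A. is_fun a (ext v) M \<and> is_fun A (ext r) D \<and> Q a A}"
  using assms unfolding truth_set_def by (elim bexE conjE) blast

lemma truth_set_formula: "truth_set M D \<phi> T Q \<Longrightarrow> \<exists>v r. L2_formula M \<phi> v r"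
  unfolding truth_set_def by blast

lemma truth_set_unique:
  assumes M: "M \<subseteq> V" and T: "T \<in> V" "T' \<in> V" "truth_set M D \<phi> T Q" "truth_set M D \<phi> T' Q'"
    and Q: "\<And>a A. a \<in> V \<Longrightarrow> A \<in> V \<Longrightarrow> Q a A \<longleftrightarrow> Q' a A"
  shows "T = T'"
proof -
  obtain v r where 1: "L2_formula M \<phi> v r"
    "ext T = {opair a A | a A. is_fun a (ext v) M \<and> is_fun A (ext r) D \<and> Q a A}"
    using T(3) by (rule truth_setE)
  obtain v' r' where 2: "L2_formula M \<phi> v' r'"
    "ext T' = {opair a A | a A. is_fun a (ext v') M \<and> is_fun A (ext r') D \<and> Q' a A}"
    using T(4) by (rule truth_setE)
  have "v = v' \<and> r = r'" using L2_unique[OF M 1(1) 2(1)] .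
  then have "ext T = ext T'" unfolding 1(2) 2(2) using Q is_fun_in_V by metis
  with T show ?thesis using ext_eqI by blast
qed

lemma sat_step_formula: "sat_step M U D P \<phi> T \<Longrightarrow> \<exists>v r. L2_formula M \<phi> v r"
  unfolding sat_step_def by (elim disjE bexE conjE; erule truth_set_formula)

lemma sat_step_unique:
  assumes M: "M \<subseteq> V" and s: "sat_step M U D P \<phi> T" "sat_step M U D P' \<phi> T'"
    and V: "T \<in> V" "T' \<in> V"
    and P: "\<And>\<psi> S S'. \<psi> \<in> V \<Longrightarrow> S \<in> V \<Longrightarrow> S' \<in> V \<Longrightarrow> P \<psi> S \<Longrightarrow> P' \<psi> S' \<Longrightarrow> S = S'"
  shows "T = T'"
proof -
  note U = truth_set_unique[OF M V]
  obtain v r where "L2_formula M \<phi> v r" using sat_step_formula[OF s(1)] by blast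
  then have "L2_step M (L2_formula M) \<phi> v r" unfolding formula_iffs by (rule formed_inv[rotated]) simp
  then show ?thesis using M
  proof (cases rule: code_cases)
    case (Mem s t)
    note s = s[unfolded \<open>\<phi> = _\<close> sat_step_codes[OF M Mem(1,2)]]
    show ?thesis using s by (elim conjE) (rule U, assumption+, rule refl)
  next
    case (Eq s t)
    note s = s[unfolded \<open>\<phi> = _\<close> sat_step_codes[OF M Eq(1,2)]]
    show ?thesis using s by (elim conjE) (rule U, assumption+, rule refl)
  next
    case (S t)
    note s = s[unfolded \<open>\<phi> = _\<close> sat_step_codes[OF M S(1,1)]]
    show ?thesis using s by (elim conjE) (rule U, assumption+, rule refl)
  next
    case (App2 s t)
    note s = s[unfolded \<open>\<phi> = _\<close> sat_step_codes[OF M App2(1,2)]]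
    show ?thesis using s by (elim conjE) (rule U, assumption+, rule refl)
  next
    case (Neg t)
    note s = s[unfolded \<open>\<phi> = _\<close> sat_step_codes[OF M Neg(1,1)]]
    obtain T1 T1' where *: "T1 \<in> V" "T1' \<in> V" "P t T1" "P' t T1'"
      and t: "truth_set M D (cNeg t) T (\<lambda>a A. \<not> opair a A \<epsilon> T1)"
        "truth_set M D (cNeg t) T' (\<lambda>a A. \<not> opair a A \<epsilon> T1')"
      using s by (elim bexE conjE)
    have "T1 = T1'" using P[OF Neg(1) *] .
    show ?thesis by (rule U[OF t]) (simp add: \<open>T1 = T1'\<close>)
  next
    case (And p q)
    note s = s[unfolded \<open>\<phi> = _\<close> sat_step_codes[OF M And(1,2)]]
    obtain T1 T2 T1' T2' where *: "T1 \<in> V" "T1' \<in> V" "P p T1" "P' p T1'"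
        "T2 \<in> V" "T2' \<in> V" "P q T2" "P' q T2'"
      and t: "truth_set M D (cAnd p q) T (\<lambda>a A.
          (\<exists>b\<in>V. \<exists>B\<in>V. ext b \<subseteq> ext a \<and> ext B \<subseteq> ext A \<and> opair b B \<epsilon> T1) \<and>
          (\<exists>b\<in>V. \<exists>B\<in>V. ext b \<subseteq> ext a \<and> ext B \<subseteq> ext A \<and> opair b B \<epsilon> T2))"
        "truth_set M D (cAnd p q) T' (\<lambda>a A.
          (\<exists>b\<in>V. \<exists>B\<in>V. ext b \<subseteq> ext a \<and> ext B \<subseteq> ext A \<and> opair b B \<epsilon> T1') \<and>
          (\<exists>b\<in>V. \<exists>B\<in>V. ext b \<subseteq> ext a \<and> ext B \<subseteq> ext A \<and> opair b B \<epsilon> T2'))"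
      using s by (elim bexE conjE)
    have "T1 = T1'" "T2 = T2'" using P[OF And(1) *(1-4)] P[OF And(2) *(5-8)] .
    show ?thesis by (rule U[OF t]) (simp add: \<open>T1 = T1'\<close> \<open>T2 = T2'\<close>)
  next
    case (All i t)
    note s = s[unfolded \<open>\<phi> = _\<close> sat_step_codes[OF M All(1,2)]]
    obtain T1 T1' where *: "T1 \<in> V" "T1' \<in> V" "P t T1" "P' t T1'"
      and t: "truth_set M D (cAll i t) T (\<lambda>a A.
          \<forall>x\<in>M. \<exists>b\<in>V. ext b \<subseteq> insert (opair i x) (ext a) \<and> opair b A \<epsilon> T1)"
        "truth_set M D (cAll i t) T' (\<lambda>a A.
          \<forall>x\<in>M. \<exists>b\<in>V. ext b \<subseteq> insert (opair i x) (ext a) \<and> opair b A \<epsilon> T1')"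
      using s by (elim bexE conjE)
    have "T1 = T1'" using P[OF All(2) *] .
    show ?thesis by (rule U[OF t]) (simp add: \<open>T1 = T1'\<close>)
  next
    case (All2 i t)
    note s = s[unfolded \<open>\<phi> = _\<close> sat_step_codes[OF M All2(1,2)]]
    obtain T1 T1' where *: "T1 \<in> V" "T1' \<in> V" "P t T1" "P' t T1'"
      and t: "truth_set M D (cAll2 i t) T (\<lambda>a A.
          \<forall>X\<in>D. \<exists>B\<in>V. ext B \<subseteq> insert (opair i X) (ext A) \<and> opair a B \<epsilon> T1)"
        "truth_set M D (cAll2 i t) T' (\<lambda>a A.
          \<forall>X\<in>D. \<exists>B\<in>V. ext B \<subseteq> insert (opair i X) (ext A) \<and> opair a B \<epsilon> T1')"
      using s by (elim bexE conjE)
    have "T1 = T1'" using P[OF All2(2) *] .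
    show ?thesis by (rule U[OF t]) (simp add: \<open>T1 = T1'\<close>)
  qed
qed

text \<open>The pattern of \<open>L2_unique\<close>: along one sequence every entry is compared with
  the entries for the same formula in a second sequence, which is kept as a parameter.\<close>

lemma tset_unique:
  assumes M: "M \<subseteq> V" and t: "tset M U D \<phi> T" and t': "tset M U D \<phi> T'"
  shows "T = T'"
proof -
  have V: "\<phi> \<in> V" "T \<in> V" "T' \<in> V" using t t' by (auto simp: tset_def)
  let ?st = "sat_gen M U D"
  obtain n g where g: "genseq ?st n g" "occ g (opair \<phi> T)"
    using t generated_occ unfolding tset_def by blast
  obtain n' h where h: "genseq ?st n' h" "occ h (opair \<phi> T')"
    using t' generated_occ unfolding tset_def by blast
  define Q where "Q = (\<lambda>e. \<not> (\<exists>\<phi>\<in>V. \<exists>T\<in>V. e 0 = opair \<phi> T \<and> (\<exists>k\<in>V. \<exists>y\<in>V. opair k y \<epsilon> e (Suc 0) \<and>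
     (\<exists>\<phi>'\<in>V. \<exists>T'\<in>V. y = opair \<phi>' T' \<and> \<phi>' = \<phi> \<and> \<not> T = T'))))"
  have Q_iff: "Q (env (opair \<phi> T # [h])) \<longleftrightarrow> (\<forall>T'\<in>V. occ h (opair \<phi> T') \<longrightarrow> T = T')"
    if "\<phi> \<in> V" "T \<in> V" for \<phi> T
  proof -
    define bad where "bad \<phi> T \<longleftrightarrow> (\<exists>k\<in>V. \<exists>y\<in>V. opair k y \<epsilon> h \<and>
     (\<exists>\<phi>'\<in>V. \<exists>T'\<in>V. y = opair \<phi>' T' \<and> \<phi>' = \<phi> \<and> \<not> T = T'))" for \<phi> T
    have "Q (env (opair \<phi> T # [h])) \<longleftrightarrow> \<not> (\<exists>\<phi>'\<in>V. \<exists>T'\<in>V. opair \<phi> T = opair \<phi>' T' \<and> bad \<phi>' T')"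
      by (simp add: Q_def bad_def)
    also have "\<dots> \<longleftrightarrow> \<not> bad \<phi> T"
      using that opair_inject[OF that] by metis
    also have "\<dots> \<longleftrightarrow> (\<forall>T'\<in>V. occ h (opair \<phi> T') \<longrightarrow> T = T')"
      unfolding bad_def occ_def using that opair_in_V by metis
    finally show ?thesis .
  qed
  have "Q (env (opair \<phi> T # [h]))"
  proof (rule gen_induct[OF g(1) mono_sat_gen _ _ _ g(2)])
    show "adef Q" unfolding Q_def
      by (intro adef_not adef_ex_pair_mem adef_ex_fst_snd adef_and adef_eq aterm_var)
    show "set [h] \<subseteq> V" using genseq_in_V[OF h(1)] by simp
    fix P y assume y: "y \<in> V" and P: "\<And>z. z \<in> V \<Longrightarrow> P z \<Longrightarrow> occ g z \<and> Q (env (z # [h]))"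
      and s: "?st P y"
    obtain \<psi> S where \<psi>: "\<psi> \<in> V" "S \<in> V" "y = opair \<psi> S" "sat_step M U D (\<lambda>\<psi> S. P (opair \<psi> S)) \<psi> S"
      using s by (auto simp: sat_gen_def)
    show "Q (env (y # [h]))" unfolding \<psi>(3) Q_iff[OF \<psi>(1,2)]
    proof (intro ballI impI)
      fix S' assume S': "S' \<in> V" "occ h (opair \<psi> S')"
      have "sat_step M U D (\<lambda>\<psi> S. occ h (opair \<psi> S)) \<psi> S'"
        using gen_occ_step[OF mono_sat_gen h(1) S'(2)] \<psi> S' by simp
      from sat_step_unique[OF M \<psi>(4) this \<psi>(2) S'(1)] show "S = S'"
        using P Q_iff by (meson opair_in_V)
    qed
  qed
  then show ?thesis using h V Q_iff by blast
qed

text \<open>The set of free variables may have a nonstandard number of elements, so its bound is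
  found by induction along the formation; two bounds have a maximum by trichotomy. The parameter
  \<open>omega\<close> bounds the quantifier over \<open>m\<close>.\<close>

lemma fresh:
  assumes "L_formula \<phi> v" shows "\<exists>m\<in>Omega. ext v \<subseteq> ext m"
proof -
  define R where "R \<phi> v r w q \<longleftrightarrow> (\<exists>m\<in>ext w. ext v \<subseteq> ext m)" for \<phi> v r w q :: 'a
  have "R \<phi> v (num 0) omega omega"
  proof (rule formed_induct[where R = R, OF assms[unfolded formula_iffs]])
    show "adef (\<lambda>e. R (e 0) (e (Suc 0)) (e (Suc (Suc 0))) (e (Suc (Suc (Suc 0)))) (e (Suc (Suc (Suc (Suc 0))))))"
      unfolding R_def by (intro adef_rules)
    fix \<phi> v r assume V: "\<phi> \<in> V" "v \<in> V" "r \<in> V"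
      and s: "L_step (\<lambda>\<phi> v r. formed_by L_step \<phi> v r \<and> R \<phi> v r omega omega) \<phi> v r"
    have two: "\<exists>m\<in>Omega. A \<union> B \<subseteq> ext m" if AB: "\<exists>m\<in>Omega. A \<subseteq> ext m" "\<exists>m\<in>Omega. B \<subseteq> ext m" for A B
    proof -
      obtain m n where "m \<in> Omega" "A \<subseteq> ext m" "n \<in> Omega" "B \<subseteq> ext n" using AB by blast
      moreover from this have "ext m \<subseteq> ext n \<or> ext n \<subseteq> ext m"
        using Omega_trichotomy[of m n] Omega_trans[of n m] Omega_trans[of m n] by blast
      ultimately show ?thesis by blast
    qed
    have tv: "\<exists>m\<in>Omega. term_vars t \<subseteq> ext m" if "t \<in> V" for t
    proof (cases "\<exists>i\<in>Omega. t = var i")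
      case True
      then obtain i where i: "i \<in> Omega" "t = var i" by blast
      then have "term_vars t \<subseteq> ext (suc i)" by (auto simp: term_vars_def)
      then show ?thesis using Omega_suc[OF i(1)] by blast
    next
      case False
      then have "term_vars t \<subseteq> ext (num 0)" by (auto simp: term_vars_def)
      then show ?thesis using num_in_Omega by blast
    qed
    have atom: "\<exists>m\<in>Omega. ext v \<subseteq> ext m"
      if "s \<in> terms {}" "t \<in> terms {}" "ext v = term_vars s \<union> term_vars t" for s t
      using two[OF tv tv, of s t] terms_in_V[of "{}"] that by simp
    have "\<exists>m\<in>Omega. ext v \<subseteq> ext m"
      using s unfolding L_step_def first_order_step_def set_atom_def R_def omega
    proof (elim disjE bexE conjE)
      fix v1 v2 m1 m2 assume "m1 \<in> Omega" "ext v1 \<subseteq> ext m1" "m2 \<in> Omega" "ext v2 \<subseteq> ext m2" "ext v = ext v1 \<union> ext v2"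
      then show ?thesis using two[of "ext v1" "ext v2"] by blast
    next
      fix m assume "m \<in> Omega" "ext v \<subseteq> ext m"
      then show ?thesis by blast
    next
      fix i w m assume "m \<in> Omega" "ext w \<subseteq> ext m" "ext v = ext w - {i}"
      then show ?thesis by blast
    qed (rule atom, assumption+)+
    then show "R \<phi> v r omega omega" by (simp add: R_def)
  qed simp_all
  then show ?thesis by (simp add: R_def)
qed

section \<open>Building formulas and assignments\<close>

lemma L_step_imp: "L_step P \<phi> v r \<Longrightarrow> L2_step {} P \<phi> v r"
  by (auto simp: L_step_def L2_step_def)

lemma L_formula_inv: "L_formula \<phi> v \<Longrightarrow> L2_step {} (formed_by L_step) \<phi> v (num 0)"
  unfolding formula_iffs by (rule L_step_imp[OF formed_inv]) simp

lemma L_unique: "L_formula \<phi> v \<Longrightarrow> L_formula \<phi> v' \<Longrightarrow> v = v'"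
  using L2_unique[of "{}"] L_imp_L2 by blast

lemma num_0_unique: "r \<in> V \<Longrightarrow> ext r = {} \<Longrightarrow> r = num 0"
  using ext_eqI[of r "num 0"] by simp

lemma L_cNeg_inv: "p \<in> V \<Longrightarrow> L_formula (cNeg p) v \<Longrightarrow> L_formula p v"
  by (drule L_formula_inv) (simp add: L2_step_codes formula_iffs)

lemma L_cAnd_inv:
  assumes "p \<in> V" "q \<in> V" "L_formula (cAnd p q) v"
  obtains v1 v2 where "L_formula p v1" "L_formula q v2" "ext v = ext v1 \<union> ext v2"
proof -
  obtain v1 v2 r1 r2 where *: "r1 \<in> V" "r2 \<in> V" "formed_by L_step p v1 r1" "formed_by L_step q v2 r2"
    "ext v = ext v1 \<union> ext v2" "ext (num 0) = ext r1 \<union> ext r2"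
    using L_formula_inv[OF assms(3)] assms(1,2) by (auto simp: L2_step_codes)
  then have "r1 = num 0" "r2 = num 0" using num_0_unique[of r1] num_0_unique[of r2] by auto
  with * that show ?thesis by (simp add: formula_iffs)
qed

lemma L_cAll_inv:
  assumes "p \<in> V" "i \<in> V" "L_formula (cAll i p) v"
  obtains w where "L_formula p w" "ext v = ext w - {i}" "i \<in> Omega"
  using L_formula_inv[OF assms(3)] assms(1,2) by (auto simp: L2_step_codes formula_iffs)

lemma term_vars_var: "i \<in> Omega \<Longrightarrow> term_vars (var i) = {i}"
  by (auto simp: term_vars_def)

lemma var_in_terms: "i \<in> Omega \<Longrightarrow> var i \<in> terms C"
  by (auto simp: terms_def)

lemma L_atom_inv:
  assumes "i \<in> Omega" "j \<in> Omega"
  shows "L_formula (cMem (var i) (var j)) v \<Longrightarrow> ext v = {i, j}"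
    and "L_formula (cEq (var i) (var j)) v \<Longrightarrow> ext v = {i, j}"
  using assms by (auto dest!: L_formula_inv simp: L2_step_codes term_vars_var)

lemma L_vars: "L_formula \<phi> v \<Longrightarrow> ext v \<subseteq> Omega"
  using fresh Omega_elem by blast

section \<open>Construction of codes inside the universe\<close>

definition Lco :: "'a list \<Rightarrow> bool" where
  "Lco \<Phi> \<longleftrightarrow> (\<exists>n f. genseq (lift3 L_step) n f \<and> (\<forall>\<phi>\<in>set \<Phi>. \<phi> \<in> V \<and> (\<exists>v\<in>V. occ f (triple \<phi> v (num 0)))))"

lemma mono_L [simp]: "mono_step (lift3 L_step)"
  by (rule mono_lift3) simp

lemma Lco_formula: "Lco \<Phi> \<Longrightarrow> \<phi> \<in> set \<Phi> \<Longrightarrow> \<exists>v. L_formula \<phi> v"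
  unfolding Lco_def formula_iffs formed_by_iff using gen_occ mono_L num_in_V by metis

lemma L_formula_Lco: "L_formula \<phi> v \<Longrightarrow> Lco [\<phi>]"
  unfolding Lco_def formula_iffs formed_by_iff using generated_occ by fastforce

text \<open>A compound formula needs its parts as entries of the same sequence. Hence
  \<open>Lco\<close> collects all formulas under construction in one sequence, and each construction
  rule appends one entry to it.\<close>

lemma Lco_step:
  assumes "Lco \<Phi>" "\<phi> \<in> V"
    and st: "\<And>f. (\<And>\<phi>. \<phi> \<in> set \<Phi> \<Longrightarrow> \<phi> \<in> V \<and> (\<exists>v\<in>V. occ f (triple \<phi> v (num 0)))) \<Longrightarrow>
      \<exists>v\<in>V. L_step (\<lambda>\<psi> w s. occ f (triple \<psi> w s)) \<phi> v (num 0)"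
  shows "Lco (\<phi> # \<Phi>)"
proof -
  obtain n f where f: "genseq (lift3 L_step) n f"
    "\<And>\<phi>. \<phi> \<in> set \<Phi> \<Longrightarrow> \<phi> \<in> V \<and> (\<exists>v\<in>V. occ f (triple \<phi> v (num 0)))"
    using assms(1) unfolding Lco_def by blast
  obtain v where v: "v \<in> V" "L_step (\<lambda>\<psi> w s. occ f (triple \<psi> w s)) \<phi> v (num 0)"
    using st[OF f(2)] by blast
  then have "lift3 L_step (occ f) (triple \<phi> v (num 0))" using assms(2) by simp
  then obtain n' f' where f': "genseq (lift3 L_step) n' f'" "occ f' (triple \<phi> v (num 0))"
    "\<forall>z. occ f z \<longrightarrow> occ f' z"
    using gen_extend[OF f(1) mono_L, of "triple \<phi> v (num 0)"] v assms(2) by auto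
  moreover have "\<forall>\<psi>\<in>set \<Phi>. \<psi> \<in> V \<and> (\<exists>v\<in>V. occ f' (triple \<psi> v (num 0)))"
    using f(2) f'(3) by blast
  ultimately have "\<forall>\<psi>\<in>set (\<phi> # \<Phi>). \<psi> \<in> V \<and> (\<exists>v\<in>V. occ f' (triple \<psi> v (num 0)))"
    using v(1) assms(2) by auto
  with f'(1) show ?thesis unfolding Lco_def by blast
qed

lemma L_step_atom:
  assumes "i \<in> Omega" "j \<in> Omega" "\<phi> = cMem (var i) (var j) \<or> \<phi> = cEq (var i) (var j)"
  shows "\<exists>v\<in>V. L_step P \<phi> v (num 0)"
proof
  show "mk {i, j} \<in> V" using assms by simp
  show "L_step P \<phi> (mk {i, j}) (num 0)"
    unfolding L_step_def set_atom_def
    by (rule disjI1, rule bexI[of _ "var i"], rule bexI[of _ "var j"])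
      (use assms var_in_terms in \<open>auto simp: term_vars_var\<close>)
qed

lemma Lco_Nil: "Lco []"
proof -
  \<comment> \<open>A generating sequence has at least the entry with index zero, so some atom must
    be present even for the empty list.\<close>
  let ?\<phi> = "cMem (var (num 0)) (var (num 0))"
  obtain v where v: "v \<in> V" "L_step (\<lambda>_ _ _. False) ?\<phi> v (num 0)"
    using L_step_atom[of "num 0" "num 0" ?\<phi> "\<lambda>_ _ _. False"] by auto
  then have "\<exists>n f. genseq (lift3 L_step) n f \<and> occ f (triple ?\<phi> v (num 0))"
    by (intro gen_single) auto
  then show ?thesis unfolding Lco_def by auto
qed

lemma Lco_Mem: "Lco \<Phi> \<Longrightarrow> i \<in> Omega \<Longrightarrow> j \<in> Omega \<Longrightarrow> Lco (cMem (var i) (var j) # \<Phi>)"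
  by (rule Lco_step) (auto intro: L_step_atom)

lemma Lco_Eq: "Lco \<Phi> \<Longrightarrow> i \<in> Omega \<Longrightarrow> j \<in> Omega \<Longrightarrow> Lco (cEq (var i) (var j) # \<Phi>)"
  by (rule Lco_step) (auto intro: L_step_atom)

lemma Lco_in_V: "Lco \<Phi> \<Longrightarrow> p \<in> set \<Phi> \<Longrightarrow> p \<in> V"
  unfolding Lco_def by blast

lemma Lco_Neg: assumes "Lco \<Phi>" "p \<in> set \<Phi>" shows "Lco (cNeg p # \<Phi>)"
proof (rule Lco_step[OF assms(1)])
  show "cNeg p \<in> V" using Lco_in_V[OF assms] by simp
  show "\<exists>v\<in>V. L_step (\<lambda>\<psi> w s. occ f (triple \<psi> w s)) (cNeg p) v (num 0)"
    if "\<And>\<phi>. \<phi> \<in> set \<Phi> \<Longrightarrow> \<phi> \<in> V \<and> (\<exists>v\<in>V. occ f (triple \<phi> v (num 0)))" for f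
    using that[OF assms(2)] unfolding L_step_def first_order_step_def by blast
qed

lemma Lco_And: assumes "Lco \<Phi>" "p \<in> set \<Phi>" "q \<in> set \<Phi>" shows "Lco (cAnd p q # \<Phi>)"
proof (rule Lco_step[OF assms(1)])
  show "cAnd p q \<in> V" using Lco_in_V[OF assms(1)] assms by simp
  show "\<exists>v\<in>V. L_step (\<lambda>\<psi> w s. occ f (triple \<psi> w s)) (cAnd p q) v (num 0)"
    if f: "\<And>\<phi>. \<phi> \<in> set \<Phi> \<Longrightarrow> \<phi> \<in> V \<and> (\<exists>v\<in>V. occ f (triple \<phi> v (num 0)))" for f
  proof -
    obtain v1 v2 where v: "p \<in> V" "q \<in> V" "v1 \<in> V" "v2 \<in> V" "occ f (triple p v1 (num 0))" "occ f (triple q v2 (num 0))"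
      using f[OF assms(2)] f[OF assms(3)] by blast
    then have "ext (mk (ext v1 \<union> ext v2)) = ext v1 \<union> ext v2" "mk (ext v1 \<union> ext v2) \<in> V" by simp_all
    moreover have "ext (num 0) = ext (num 0) \<union> ext (num 0)" by simp
    ultimately show ?thesis using v num_in_V unfolding L_step_def first_order_step_def by blast
  qed
qed

lemma Lco_All: assumes "Lco \<Phi>" "p \<in> set \<Phi>" "i \<in> Omega" shows "Lco (cAll i p # \<Phi>)"
proof (rule Lco_step[OF assms(1)])
  show "cAll i p \<in> V" using Lco_in_V[OF assms(1)] assms by simp
  show "\<exists>v\<in>V. L_step (\<lambda>\<psi> w s. occ f (triple \<psi> w s)) (cAll i p) v (num 0)"
    if f: "\<And>\<phi>. \<phi> \<in> set \<Phi> \<Longrightarrow> \<phi> \<in> V \<and> (\<exists>v\<in>V. occ f (triple \<phi> v (num 0)))" for f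
  proof -
    obtain w where v: "p \<in> V" "w \<in> V" "occ f (triple p w (num 0))"
      using f[OF assms(2)] by blast
    have "isset (ext w - ext (mk {i}))" using isset_Diff[of w "mk {i}"] v assms(3) by simp
    then have "isset (ext w - {i})" using assms(3) by simp
    then have "ext (mk (ext w - {i})) = ext w - {i}" "mk (ext w - {i}) \<in> V" by simp_all
    then show ?thesis using v assms(3) unfolding L_step_def first_order_step_def by blast
  qed
qed

lemma Lco_mono: "Lco \<Phi> \<Longrightarrow> set \<Psi> \<subseteq> set \<Phi> \<Longrightarrow> Lco \<Psi>"
  unfolding Lco_def by blast

text \<open>Like \<open>quote\<close>, but with the variables placed at prescribed numbers, so that
  a standard formula can be combined with a given code without a clash.\<close>

primrec quote_with :: "(nat \<Rightarrow> 'a) \<Rightarrow> fm \<Rightarrow> 'a" where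
  "quote_with f (FMem i j) = cMem (var (f i)) (var (f j))"
| "quote_with f (FEq i j) = cEq (var (f i)) (var (f j))"
| "quote_with f (FNeg p) = cNeg (quote_with f p)"
| "quote_with f (FAnd p q) = cAnd (quote_with f p) (quote_with f q)"
| "quote_with f (FAll i p) = cAll (f i) (quote_with f p)"

lemma quote_eq: "quote p = quote_with num p"
  by (induction p) simp_all

lemma Lco_quote:
  assumes "range f \<subseteq> Omega" shows "Lco \<Phi> \<Longrightarrow> Lco (quote_with f p # \<Phi>)"
proof (induction p arbitrary: \<Phi>)
  case (FMem i j)
  then show ?case using assms by (auto intro: Lco_Mem)
next
  case (FEq i j)
  then show ?case using assms by (auto intro: Lco_Eq)
next
  case (FNeg p)
  have "Lco (cNeg (quote_with f p) # quote_with f p # \<Phi>)"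
    by (rule Lco_Neg[OF FNeg.IH[OF FNeg.prems]]) simp
  then show ?case by (rule Lco_mono) auto
next
  case (FAnd p q)
  have "Lco (quote_with f q # quote_with f p # \<Phi>)"
    by (rule FAnd.IH(2)[OF FAnd.IH(1)[OF FAnd.prems]])
  then have "Lco (cAnd (quote_with f p) (quote_with f q) # quote_with f q # quote_with f p # \<Phi>)"
    by (rule Lco_And) simp_all
  then show ?case by (rule Lco_mono) auto
next
  case (FAll i p)
  have "Lco (cAll (f i) (quote_with f p) # quote_with f p # \<Phi>)"
    by (rule Lco_All[OF FAll.IH[OF FAll.prems]]) (use assms in auto)
  then show ?case by (rule Lco_mono) auto
qed

lemma quote_with_in_V: "range f \<subseteq> Omega \<Longrightarrow> quote_with f p \<in> V"
  using Lco_in_V[OF Lco_quote[OF _ Lco_Nil]] by simp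

lemma quote_in_V [simp]: "quote p \<in> V"
  unfolding quote_eq by (rule quote_with_in_V) auto

text \<open>The satisfaction relation of the universe uses assignments whose domain is exactly the set of
  free variables. Assignments defined on all of \<open>Omega\<close>, which are easier to update, are restricted
  to the free variables when needed.\<close>

definition asg :: "'a \<Rightarrow> 'a \<Rightarrow> bool" where "asg N g \<longleftrightarrow> is_fun g Omega (ext N)"

definition ap :: "'a \<Rightarrow> 'a \<Rightarrow> 'a" where "ap g i = (THE x. x \<in> V \<and> opair i x \<epsilon> g)"

definition upd :: "'a \<Rightarrow> 'a \<Rightarrow> 'a \<Rightarrow> 'a" where
  "upd g i x = mk (insert (opair i x) {p \<in> ext g. \<not> (\<exists>y\<in>V. p = opair i y)})"

definition restr :: "'a \<Rightarrow> 'a \<Rightarrow> 'a" where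
  "restr g v = mk {p \<in> ext g. \<exists>i\<in>ext v. \<exists>y\<in>V. p = opair i y}"

lemma is_funI:
  assumes "f \<in> V" "A \<subseteq> V" "B \<subseteq> V" "\<And>p. p \<in> ext f \<Longrightarrow> \<exists>x\<in>A. \<exists>y\<in>B. p = opair x y"
    "\<And>x. x \<in> A \<Longrightarrow> h x \<in> B" "\<And>x y. x \<in> A \<Longrightarrow> y \<in> B \<Longrightarrow> opair x y \<epsilon> f \<longleftrightarrow> y = h x"
  shows "is_fun f A B"
  unfolding is_fun_def
proof (intro conjI ballI)
  show "\<exists>!y. y \<in> B \<and> opair x y \<epsilon> f" if "x \<in> A" for x
    by (rule ex1I[of _ "h x"]) (use assms(5)[OF that] assms(6)[OF that] in auto)
qed (use assms(1,4) in auto)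

lemma ap_iff:
  assumes "is_fun g A B" "A \<subseteq> V" "B \<subseteq> V" "i \<in> A"
  shows "ap g i \<in> B \<and> (\<forall>x\<in>V. opair i x \<epsilon> g \<longleftrightarrow> x = ap g i)"
proof -
  obtain y where y: "y \<in> B" "opair i y \<epsilon> g" using is_fun_ex[OF assms(1,4)] by blast
  have un: "x = y" if "x \<in> V" "opair i x \<epsilon> g" for x
    using is_fun_unique[OF assms(1)] is_fun_mem[OF assms(1)] that y assms by blast
  have "ap g i = y" unfolding ap_def by (rule the_equality) (use y assms un in auto)
  with y un assms show ?thesis by blast
qed

lemma Omega_V: "Omega \<subseteq> V" by auto

lemma asg_ap: "asg N g \<Longrightarrow> i \<in> Omega \<Longrightarrow> ap g i \<in> ext N"
  unfolding asg_def using ap_iff[OF _ Omega_V ext_subset] by blast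

lemma asg_mem: "asg N g \<Longrightarrow> i \<in> Omega \<Longrightarrow> x \<in> V \<Longrightarrow> opair i x \<epsilon> g \<longleftrightarrow> x = ap g i"
  unfolding asg_def using ap_iff[OF _ Omega_V ext_subset] by blast

lemma asg_in_V: "asg N g \<Longrightarrow> g \<in> V"
  unfolding asg_def by (rule is_fun_in_V)

lemma asg_elem: "asg N g \<Longrightarrow> p \<in> ext g \<longleftrightarrow> (\<exists>i\<in>Omega. p = opair i (ap g i))"
proof
  assume g: "asg N g"
  show "\<exists>i\<in>Omega. p = opair i (ap g i)" if p: "p \<in> ext g"
  proof -
    obtain i y where *: "i \<in> Omega" "y \<in> ext N" "p = opair i y"
      using is_fun_elem[of g Omega "ext N" p] g p unfolding asg_def by blast
    then have "opair i y \<epsilon> g" using p extD by blast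
    then show ?thesis using asg_mem[OF g *(1), of y] * ext_in_V by blast
  qed
  show "p \<in> ext g" if "\<exists>i\<in>Omega. p = opair i (ap g i)"
  proof -
    obtain i where i: "i \<in> Omega" "p = opair i (ap g i)" using \<open>\<exists>i\<in>Omega. _ i\<close> by blast
    have "ap g i \<in> V" using asg_ap[OF g i(1)] ext_in_V by blast
    then show ?thesis using asg_mem[OF g i(1), of "ap g i"] i by (simp add: mem_ext)
  qed
qed

lemma restr:
  assumes g: "asg N g" and v: "v \<in> V" "ext v \<subseteq> Omega"
  shows "restr g v \<in> V" "ext (restr g v) = {opair i (ap g i) | i. i \<in> ext v}"
    "is_fun (restr g v) (ext v) (ext N)"
proof -
  have "adef (\<lambda>e. \<exists>i\<in>ext (e 1). \<exists>z\<in>V. e 0 = opair i z \<and> True)"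
    by (intro adef_ex_snd adef_const adef_rules)
  from separation[OF this, of "[v]" g] asg_in_V[OF g] v
  have "isset {p \<in> ext g. \<exists>i\<in>ext v. \<exists>y\<in>V. p = opair i y}" by simp
  moreover have "{p \<in> ext g. \<exists>i\<in>ext v. \<exists>y\<in>V. p = opair i y} = {opair i (ap g i) | i. i \<in> ext v}"
    unfolding asg_elem[OF g] using v asg_ap[OF g] ext_in_V by fastforce
  ultimately show r: "restr g v \<in> V" "ext (restr g v) = {opair i (ap g i) | i. i \<in> ext v}"
    unfolding restr_def by auto
  show "is_fun (restr g v) (ext v) (ext N)"
  proof (rule is_funI[where h = "ap g"])
    show "opair x y \<epsilon> restr g v \<longleftrightarrow> y = ap g x" if "x \<in> ext v" "y \<in> ext N" for x y
    proof -
      have "x \<in> V" "y \<in> V" using that ext_in_V by auto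
      then have "opair x y \<epsilon> restr g v \<longleftrightarrow> (\<exists>i\<in>ext v. opair x y = opair i (ap g i))"
        using r by (auto simp: opair_mem_iff)
      also have "\<dots> \<longleftrightarrow> y = ap g x"
        using that \<open>x \<in> V\<close> \<open>y \<in> V\<close> v asg_ap[OF g] ext_in_V opair_inject by (metis subsetD)
      finally show ?thesis .
    qed
  qed (use r v ext_subset asg_ap[OF g] in blast)+
qed

lemma restr_mem:
  assumes g: "asg N g" and v: "v \<in> V" "ext v \<subseteq> Omega" and i: "i \<in> ext v" "x \<in> V"
  shows "opair i x \<epsilon> restr g v \<longleftrightarrow> x = ap g i"
proof -
  have iV: "i \<in> V" "ap g i \<in> ext N" using i v ext_in_V asg_ap[OF g] by auto
  have f: "is_fun (restr g v) (ext v) (ext N)" by (rule restr[OF g v])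
  have "opair i (ap g i) \<in> ext (restr g v)" using restr(2)[OF g v] i by auto
  then have 1: "opair i (ap g i) \<epsilon> restr g v" using extD by blast
  have "x \<in> ext N" if "opair i x \<epsilon> restr g v"
    using is_fun_mem[OF f that iV(1) i(2) ext_subset ext_subset] by blast
  then show ?thesis using is_fun_unique[OF f 1 _ i(1) iV(2)] 1 by metis
qed

lemma restr_subset: "asg N g \<Longrightarrow> v \<in> V \<Longrightarrow> ext v \<subseteq> Omega \<Longrightarrow> ext (restr g v) \<subseteq> ext g"
  unfolding restr(2) using asg_elem by blast

text \<open>The clauses of \<open>sat_step\<close> speak of subsets of an assignment that lie in a
  truth set; this identifies such a subset with a restriction.\<close>

lemma fun_subset:
  assumes b: "is_fun b (ext v) (ext N)" and g: "asg N g" and v: "v \<in> V" "ext v \<subseteq> Omega"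
    and sub: "ext b \<subseteq> ext g"
  shows "b = restr g v"
proof (rule ext_eqI)
  show "b \<in> V" "restr g v \<in> V" using is_fun_in_V[OF b] restr[OF g v] by auto
  have *: "y = ap g i" if "i \<in> ext v" "y \<in> V" "opair i y \<in> ext b" for i y
    using asg_mem[OF g, of i y] that v sub extD by blast
  show "ext b = ext (restr g v)"
    unfolding restr(2)[OF g v]
  proof (intro set_eqI iffI)
    fix p assume p: "p \<in> ext b"
    then obtain i y where "i \<in> ext v" "y \<in> ext N" "p = opair i y" using is_fun_elem[OF b] by blast
    then show "p \<in> {opair i (ap g i) | i. i \<in> ext v}" using * p ext_in_V by blast
  next
    fix p assume "p \<in> {opair i (ap g i) | i. i \<in> ext v}"
    then obtain i where i: "i \<in> ext v" "p = opair i (ap g i)" by blast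
    obtain y where y: "y \<in> ext N" "opair i y \<epsilon> b" using is_fun_ex[OF b i(1)] by blast
    then have "opair i y \<in> ext b" using i ext_in_V by (simp add: opair_mem_iff[symmetric])
    then show "p \<in> ext b" using * i y ext_in_V by metis
  qed
qed

lemma upd:
  assumes g: "asg N g" and i: "i \<in> Omega" and x: "x \<in> ext N"
  shows "asg N (upd g i x)" "j \<in> Omega \<Longrightarrow> ap (upd g i x) j = (if j = i then x else ap g j)"
    "ext (upd g i x) = {opair j (if j = i then x else ap g j) | j. j \<in> Omega}"
proof -
  have V: "i \<in> V" "x \<in> V" "g \<in> V" using i x ext_in_V asg_in_V[OF g] by auto
  have "adef (\<lambda>e. \<not> (\<exists>z\<in>V. e 0 = opair (e 1) z \<and> True))"
    by (intro adef_not adef_ex_snd adef_const adef_rules)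
  from separation[OF this, of "[i]" g] V
  have s: "isset {p \<in> ext g. \<not> (\<exists>y\<in>V. p = opair i y)}" by simp
  have "{p \<in> ext g. \<not> (\<exists>y\<in>V. p = opair i y)} = {opair j (ap g j) | j. j \<in> Omega \<and> j \<noteq> i}"
  proof -
    have key: "j = i" if "j \<in> Omega" "y \<in> V" "opair j (ap g j) = opair i y" for j y
      using that V ext_in_V[OF asg_ap[OF g that(1)]] by simp
    have ai: "ap g i \<in> V" using ext_in_V[OF asg_ap[OF g i]] .
    show ?thesis
    proof (intro set_eqI iffI)
      fix p assume "p \<in> {p \<in> ext g. \<not> (\<exists>y\<in>V. p = opair i y)}"
      then obtain j where j: "j \<in> Omega" "p = opair j (ap g j)" "\<not> (\<exists>y\<in>V. p = opair i y)"
        using asg_elem[OF g] by auto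
      then have "j \<noteq> i" using ai by auto
      with j show "p \<in> {opair j (ap g j) | j. j \<in> Omega \<and> j \<noteq> i}" by blast
    next
      fix p assume "p \<in> {opair j (ap g j) | j. j \<in> Omega \<and> j \<noteq> i}"
      then obtain j where j: "p = opair j (ap g j)" "j \<in> Omega" "j \<noteq> i" by blast
      then have "p \<in> ext g" using asg_elem[OF g] by blast
      moreover have "\<not> (\<exists>y\<in>V. p = opair i y)" using j key by metis
      ultimately show "p \<in> {p \<in> ext g. \<not> (\<exists>y\<in>V. p = opair i y)}" by simp
    qed
  qed
  then have u: "upd g i x \<in> V" "ext (upd g i x) = insert (opair i x) {opair j (ap g j) | j. j \<in> Omega \<and> j \<noteq> i}"
    using s V unfolding upd_def by auto
  then show u': "ext (upd g i x) = {opair j (if j = i then x else ap g j) | j. j \<in> Omega}"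
    using i by auto
  have mem: "opair j y \<epsilon> upd g i x \<longleftrightarrow> y = (if j = i then x else ap g j)" if j: "j \<in> Omega" "y \<in> V" for j y
  proof -
    have "opair j y \<epsilon> upd g i x \<longleftrightarrow> (\<exists>k\<in>Omega. opair j y = opair k (if k = i then x else ap g k))"
      using u' j by (auto simp: opair_mem_iff)
    also have "\<dots> \<longleftrightarrow> (\<exists>k\<in>Omega. j = k \<and> y = (if k = i then x else ap g k))"
      using j V asg_ap[OF g] ext_in_V by (intro bex_cong refl opair_inject) auto
    finally show ?thesis using j by auto
  qed
  show a: "asg N (upd g i x)" unfolding asg_def
  proof (rule is_funI[where h = "\<lambda>j. if j = i then x else ap g j"])
    show "\<exists>xa\<in>Omega. \<exists>y\<in>ext N. p = opair xa y" if "p \<in> ext (upd g i x)" for p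
      using that u' x asg_ap[OF g] by (auto split: if_splits)
  qed (use u x asg_ap[OF g] ext_subset mem ext_in_V in auto)
  show "ap (upd g i x) j = (if j = i then x else ap g j)" if "j \<in> Omega"
    using asg_mem[OF a that, of "ap (upd g i x) j"] mem[OF that, of "ap (upd g i x) j"]
      asg_ap[OF a that] ext_in_V by blast
qed

text \<open>The product with a singleton yields an assignment for any set of variables, without
  recursion on its size.\<close>

lemma const_fun:
  assumes "v \<in> V" "c \<in> ext N" shows "\<exists>a. is_fun a (ext v) (ext N)"
proof -
  have c: "c \<in> V" using assms ext_in_V by blast
  have "isset {opair x y | x y. x \<in> ext v \<and> y \<in> ext (mk {c})}"
    by (rule isset_times) (use assms c in auto)
  then obtain a where a: "a \<in> V" "ext a = {opair x c | x. x \<in> ext v}"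
    using c by (auto elim!: issetE)
  have "is_fun a (ext v) (ext N)"
  proof (rule is_funI[where h = "\<lambda>_. c"])
    show "opair x y \<epsilon> a \<longleftrightarrow> y = c" if "x \<in> ext v" "y \<in> ext N" for x y
      using that c ext_in_V a by (auto simp: opair_mem_iff)
  qed (use a assms ext_subset in auto)
  then show ?thesis by blast
qed

lemma extend_fun:
  assumes a: "is_fun a (ext v) (ext N)" and v: "v \<in> V" "ext v \<subseteq> Omega" and c: "c \<in> ext N"
  shows "\<exists>g. asg N g \<and> restr g v = a"
proof -
  obtain w where w: "w \<in> V" "ext w = Omega - ext v"
    using isset_Diff[of omega v] v by (auto elim!: issetE)
  obtain b where b: "is_fun b (ext w) (ext N)" using const_fun[OF w(1) c] by blast
  define g where "g = mk (ext a \<union> ext b)"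
  have g: "g \<in> V" "ext g = ext a \<union> ext b"
    using is_fun_in_V[OF a] is_fun_in_V[OF b] by (auto simp: g_def)
  have "asg N g" unfolding asg_def is_fun_def
  proof (intro conjI ballI g(1))
    show "\<exists>x\<in>Omega. \<exists>y\<in>ext N. p = opair x y" if "p \<in> ext g" for p
      using that is_fun_elem[OF a] is_fun_elem[OF b] v w unfolding g by blast
    fix i assume i: "i \<in> Omega"
    have iV: "i \<in> V" using i by simp
    have ga: "opair i y \<epsilon> g \<longleftrightarrow> opair i y \<epsilon> a \<or> opair i y \<epsilon> b" if "y \<in> V" for y
      using that iV g by (simp add: opair_mem_iff)
    have na: "\<not> opair i y \<epsilon> a" if "y \<in> V" "i \<notin> ext v" for y
      using is_fun_mem[OF a _ iV that(1) ext_subset ext_subset] that by blast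
    have nb: "\<not> opair i y \<epsilon> b" if "y \<in> V" "i \<in> ext v" for y
      using is_fun_mem[OF b _ iV that(1) ext_subset ext_subset] that w by blast
    show "\<exists>!y. y \<in> ext N \<and> opair i y \<epsilon> g"
    proof (cases "i \<in> ext v")
      case True
      then have "\<exists>!y. y \<in> ext N \<and> opair i y \<epsilon> a" using a unfolding is_fun_def by blast
      then show ?thesis using ga nb True ext_in_V by metis
    next
      case False
      then have "i \<in> ext w" using w i by blast
      then have "\<exists>!y. y \<in> ext N \<and> opair i y \<epsilon> b" using b unfolding is_fun_def by blast
      then show ?thesis using ga na False ext_in_V by metis
    qed
  qed
  moreover have "a = restr g v"
    by (rule fun_subset[OF a calculation v]) (simp add: g)
  ultimately show ?thesis by blast
qed

section \<open>First-order satisfaction in a model\<close>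

abbreviation tset1 :: "'a \<Rightarrow> 'a \<Rightarrow> 'a \<Rightarrow> bool" where "tset1 N \<equiv> tset (ext N) {} {}"

lemma sat1_iff: "\<phi> \<in> V \<Longrightarrow> sat1 N \<phi> a \<longleftrightarrow> (\<exists>T\<in>V. opair a (num 0) \<epsilon> T \<and> tset1 N \<phi> T)"
  unfolding sat1_def by (rule sat_iff)

lemma is_fun_empty: "is_fun A {} B \<longleftrightarrow> A = num 0"
proof
  assume "is_fun A {} B"
  then have "A \<in> V" "ext A = {}" unfolding is_fun_def by auto
  then show "A = num 0" by (rule num_0_unique)
qed (auto simp: is_fun_def)

lemma tset1_sat1: "tset1 N \<phi> T \<Longrightarrow> sat1 N \<phi> a \<longleftrightarrow> opair a (num 0) \<epsilon> T"
  using tset_unique[OF ext_subset] sat1_iff unfolding tset_def by blast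

lemma truth_set_mem:
  assumes f: "L_formula \<phi> v" and t: "truth_set (ext N) {} \<phi> T Q" and a: "is_fun a (ext v) (ext N)"
  shows "opair a (num 0) \<epsilon> T \<longleftrightarrow> Q a (num 0)"
proof -
  obtain v' r where 1: "L2_formula (ext N) \<phi> v' r"
    "ext T = {opair a A | a A. is_fun a (ext v') (ext N) \<and> is_fun A (ext r) {} \<and> Q a A}"
    using t by (rule truth_setE)
  have "v' = v" "r = num 0" using L2_unique[OF ext_subset 1(1) L_imp_L2[OF f]] by auto
  then have T: "ext T = {opair a (num 0) | a. is_fun a (ext v) (ext N) \<and> Q a (num 0)}"
    using 1(2) by (auto simp: is_fun_empty)
  have aV: "a \<in> V" using is_fun_in_V[OF a] .
  then have "opair a (num 0) \<epsilon> T \<longleftrightarrow> opair a (num 0) \<in> ext T" by (simp add: ext_def)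
  also have "\<dots> \<longleftrightarrow> (\<exists>a'. opair a (num 0) = opair a' (num 0) \<and> is_fun a' (ext v) (ext N) \<and> Q a' (num 0))"
    unfolding T by simp
  also have "\<dots> \<longleftrightarrow> Q a (num 0)"
    using aV a is_fun_in_V opair_inject num_in_V by metis
  finally show ?thesis .
qed

lemma true_inD: "true_in N \<phi> \<Longrightarrow> L_formula \<phi> v \<Longrightarrow> is_fun a (ext v) (ext N) \<Longrightarrow> sat1 N \<phi> a"
  unfolding true_in_def using L_unique is_fun_in_V by metis

lemma model_true: "model N \<Longrightarrow> ZFC_axiom \<phi> \<Longrightarrow> \<phi> \<in> V \<Longrightarrow> true_in N \<phi>"
  unfolding model_def by blast

text \<open>A truth sequence for a compound formula passes through truth sets of its immediate
  parts. Read downwards, this is how \<open>total\<close> descends from an axiom to a formula inside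
  it.\<close>

lemma tset_sub:
  assumes M: "M \<subseteq> V"
  shows "p \<in> V \<Longrightarrow> tset M U D (cNeg p) T \<Longrightarrow> \<exists>T1. tset M U D p T1"
    "p \<in> V \<Longrightarrow> q \<in> V \<Longrightarrow> tset M U D (cAnd p q) T \<Longrightarrow> (\<exists>T1. tset M U D p T1) \<and> (\<exists>T2. tset M U D q T2)"
    "p \<in> V \<Longrightarrow> i \<in> V \<Longrightarrow> tset M U D (cAll i p) T \<Longrightarrow> \<exists>T1. tset M U D p T1"
proof -
  show "\<exists>T1. tset M U D p T1" if p: "p \<in> V" and t: "tset M U D (cNeg p) T"
    using tset_inv[OF t] unfolding sat_step_codes(5)[OF M p p] by blast
  show "(\<exists>T1. tset M U D p T1) \<and> (\<exists>T2. tset M U D q T2)" if p: "p \<in> V" "q \<in> V" and t: "tset M U D (cAnd p q) T"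
    using tset_inv[OF t] unfolding sat_step_codes(6)[OF M p] by blast
  show "\<exists>T1. tset M U D p T1" if p: "p \<in> V" "i \<in> V" and t: "tset M U D (cAll i p) T"
    using tset_inv[OF t] unfolding sat_step_codes(7)[OF M p(2,1)] by blast
qed

text \<open>The satisfaction clauses rest on \<open>total\<close>, which itself needs an element of
  the model; therefore the truth of \<open>Empty_set\<close> is unwound by hand. Over an empty
  domain the universal formula \<open>?\<psi>\<close> would hold vacuously, against the truth of its
  negation.\<close>

lemma model_nonempty: assumes N: "model N" shows "ext N \<noteq> {}"
proof
  assume e: "ext N = {}"
  let ?\<psi> = "cAll (num 0) (cNeg (cAll (num 1) (cNeg (cMem (var (num 1)) (var (num 0))))))"
  have q: "quote Empty_set = cNeg ?\<psi>" by (simp add: Empty_set_def FEx_def)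
  have "ZFC_axiom (quote Empty_set)"
    unfolding ZFC_axiom_def ZFC_single_axioms_def by blast
  then have t: "true_in N (cNeg ?\<psi>)" using model_true[OF N] q quote_in_V by metis
  have V: "?\<psi> \<in> V" by simp
  obtain v where v: "L_formula (cNeg ?\<psi>) v" using t unfolding true_in_def by blast
  then have v': "L_formula ?\<psi> v" by (rule L_cNeg_inv[rotated]) simp
  then obtain w where w: "L_formula (cNeg (cAll (num 1) (cNeg (cMem (var (num 1)) (var (num 0)))))) w"
    "ext v = ext w - {num 0}" by (rule L_cAll_inv[rotated 2]) simp_all
  from w(1) have "L_formula (cAll (num 1) (cNeg (cMem (var (num 1)) (var (num 0))))) w"
    by (rule L_cNeg_inv[rotated]) simp
  then obtain u where u: "L_formula (cNeg (cMem (var (num 1)) (var (num 0)))) u"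
    "ext w = ext u - {num 1}" by (rule L_cAll_inv[rotated 2]) simp_all
  from u(1) have "L_formula (cMem (var (num 1)) (var (num 0))) u"
    by (rule L_cNeg_inv[rotated]) simp
  then have "ext u = {num 1, num 0}" by (rule L_atom_inv(1)[rotated 2]) simp_all
  then have ve: "ext v = {}" using u w by auto
  then have a: "is_fun (num 0) (ext v) (ext N)" by (simp add: is_fun_empty)
  have "sat1 N (cNeg ?\<psi>) (num 0)" by (rule true_inD[OF t v a])
  then obtain T where T: "opair (num 0) (num 0) \<epsilon> T" "tset1 N (cNeg ?\<psi>) T"
    using sat1_iff[of "cNeg ?\<psi>"] by auto
  obtain T1 where T1: "tset1 N ?\<psi> T1" "truth_set (ext N) {} (cNeg ?\<psi>) T (\<lambda>a A. \<not> opair a A \<epsilon> T1)"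
    using tset_inv[OF T(2)] unfolding sat_step_codes(5)[OF ext_subset V V] by blast
  have 1: "\<not> opair (num 0) (num 0) \<epsilon> T1" using truth_set_mem[OF v T1(2) a] T(1) by simp
  obtain T2 where "truth_set (ext N) {} ?\<psi> T1 (\<lambda>a A.
          \<forall>x\<in>ext N. \<exists>b\<in>V. ext b \<subseteq> insert (opair (num 0) x) (ext a) \<and> opair b A \<epsilon> T2)"
    using tset_inv[OF T1(1)] by (subst (asm) sat_step_codes(7)[OF ext_subset]) auto
  from truth_set_mem[OF v' this a] 1 e show False by simp
qed

lemma c_separation_in_V: "p \<in> V \<Longrightarrow> x \<in> V \<Longrightarrow> y \<in> V \<Longrightarrow> z \<in> V \<Longrightarrow> c_separation p x y z \<in> V"
  by (simp add: c_separation_def cEx_def cIff_def cImp_def)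

text \<open>The truth set of an arbitrary formula is a by-product of the truth of its instance of
  Separation.\<close>

lemma total: assumes N: "model N" and p: "L_formula p v" shows "\<exists>T. tset1 N p T"
proof -
  obtain m where m: "m \<in> Omega" "ext v \<subseteq> ext m" using fresh[OF p] by blast
  \<comment> \<open>The separated set is named by \<open>m\<close>, which bounds the free variables
    of \<open>p\<close> and so is not one of them; its successors supply two further distinct
    variables.\<close>
  let ?x = "suc m" and ?z = "suc (suc m)"
  have V: "p \<in> V" "v \<in> V" "m \<in> V" using L_in_V[OF p] m by auto
  have i: "m \<notin> ext m" "suc m \<notin> ext (suc m)" "suc (suc m) \<notin> ext (suc (suc m))"
    using Omega_irrefl m Omega_suc by blast+
  then have d: "distinct [?x, m, ?z]" using V by auto
  have mv: "m \<notin> ext v" using i m by blast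
  have ax: "ZFC_axiom (c_separation p ?x m ?z)"
    unfolding ZFC_axiom_def
    by (rule disjI2, rule disjI1, rule bexI[of _ p], rule bexI[of _ v], rule bexI[of _ ?x], rule bexI[of _ m],
        rule bexI[of _ ?z]) (use p V m Omega_suc d mv in auto)
  have sV: "c_separation p ?x m ?z \<in> V" using V by (simp add: c_separation_in_V)
  have t: "true_in N (c_separation p ?x m ?z)" by (rule model_true[OF N ax sV])
  obtain w where w: "L_formula (c_separation p ?x m ?z) w" using t unfolding true_in_def by blast
  obtain c where c: "c \<in> ext N" using model_nonempty[OF N] by blast
  obtain a where a: "is_fun a (ext w) (ext N)" using const_fun[OF _ c] L_in_V[OF w] by blast
  obtain T where T: "tset1 N (c_separation p ?x m ?z) T"
    using true_inD[OF t w a] sat1_iff[OF sV] by blast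
  note sub = tset_sub[OF ext_subset]
  let ?A = "cMem (var ?z) (var m)" and ?B = "cMem (var ?z) (var ?x)"
  \<comment> \<open>The descent goes through the quantifiers to the biconditional, into its second
    implication, to the premise \<open>cAnd ?B p\<close> of that, and to its right conjunct.\<close>
  note T
  then have "\<exists>T. tset1 N (cEx m (cAll ?z (cIff ?A (cAnd ?B p)))) T"
    unfolding c_separation_def by (rule sub(3)[rotated 2]) (use V in \<open>simp_all add: cEx_def cIff_def cImp_def\<close>)
  then have "\<exists>T. tset1 N (cAll m (cNeg (cAll ?z (cIff ?A (cAnd ?B p))))) T"
    unfolding cEx_def by (elim exE) (rule sub(1)[rotated], assumption, use V in \<open>simp add: cIff_def cImp_def\<close>)
  then have "\<exists>T. tset1 N (cNeg (cAll ?z (cIff ?A (cAnd ?B p)))) T"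
    by (elim exE) (rule sub(3)[rotated 2], assumption, use V in \<open>simp_all add: cIff_def cImp_def\<close>)
  then have "\<exists>T. tset1 N (cAll ?z (cIff ?A (cAnd ?B p))) T"
    by (elim exE) (rule sub(1)[rotated], assumption, use V in \<open>simp_all add: cIff_def cImp_def\<close>)
  then have "\<exists>T. tset1 N (cIff ?A (cAnd ?B p)) T"
    by (elim exE) (rule sub(3)[rotated 2], assumption, use V in \<open>simp_all add: cIff_def cImp_def\<close>)
  then have "\<exists>T. tset1 N (cImp (cAnd ?B p) ?A) T"
    unfolding cIff_def by (elim exE) (rule sub(2)[THEN conjunct2, rotated 2], assumption, use V in \<open>simp_all add: cImp_def\<close>)
  then have "\<exists>T. tset1 N (cAnd (cAnd ?B p) (cNeg ?A)) T"
    unfolding cImp_def by (elim exE) (rule sub(1)[rotated], assumption, use V in \<open>simp_all\<close>)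
  then have "\<exists>T. tset1 N (cAnd ?B p) T"
    by (elim exE) (rule sub(2)[THEN conjunct1, rotated 2], assumption, use V in \<open>simp_all\<close>)
  then show ?thesis
    by (elim exE) (rule sub(2)[THEN conjunct2, rotated 2], assumption, use V in \<open>simp_all\<close>)
qed

section \<open>Satisfaction clauses for total assignments\<close>

definition Sat :: "'a \<Rightarrow> 'a \<Rightarrow> 'a \<Rightarrow> bool" where
  "Sat N \<phi> g \<longleftrightarrow> (\<exists>v. L_formula \<phi> v \<and> sat1 N \<phi> (restr g v))"

lemma Sat_iff: "L_formula \<phi> v \<Longrightarrow> Sat N \<phi> g \<longleftrightarrow> sat1 N \<phi> (restr g v)"
  unfolding Sat_def using L_unique by blast

lemma restr_fun: "asg N g \<Longrightarrow> L_formula \<phi> v \<Longrightarrow> is_fun (restr g v) (ext v) (ext N)"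
  by (rule restr(3)[OF _ conjunct2[OF L_in_V] L_vars])

lemma truth_set_Sat:
  assumes g: "asg N g" and f: "L_formula \<phi> v" and T: "tset1 N \<phi> T"
    and t: "truth_set (ext N) {} \<phi> T Q"
  shows "Sat N \<phi> g \<longleftrightarrow> Q (restr g v) (num 0)"
  unfolding Sat_iff[OF f] tset1_sat1[OF T] by (rule truth_set_mem[OF f t restr_fun[OF g f]])

lemma Sat_cNeg:
  assumes N: "model N" and g: "asg N g" and f: "L_formula (cNeg p) v" and p: "p \<in> V"
  shows "Sat N (cNeg p) g \<longleftrightarrow> \<not> Sat N p g"
proof -
  obtain T where T: "tset1 N (cNeg p) T" using total[OF N f] by blast
  obtain T1 where T1: "tset1 N p T1" "truth_set (ext N) {} (cNeg p) T (\<lambda>a A. \<not> opair a A \<epsilon> T1)"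
    using tset_inv[OF T] unfolding sat_step_codes(5)[OF ext_subset p p] by blast
  show ?thesis
    unfolding truth_set_Sat[OF g f T T1(2)] Sat_iff[OF L_cNeg_inv[OF p f]] tset1_sat1[OF T1(1)] by (rule refl)
qed

lemma tset_mem:
  assumes T: "tset1 N \<phi> T" and f: "L_formula \<phi> v" and b: "b \<in> V" "opair b (num 0) \<epsilon> T"
  shows "is_fun b (ext v) (ext N)"
proof -
  have TV: "T \<in> V" "\<phi> \<in> V" using T by (auto simp: tset_def)
  obtain Q where "truth_set (ext N) {} \<phi> T Q"
    using tset_inv[OF T] unfolding sat_step_def by blast
  then obtain v' r where 1: "L2_formula (ext N) \<phi> v' r"
    "ext T = {opair a A | a A. is_fun a (ext v') (ext N) \<and> is_fun A (ext r) {} \<and> Q a A}"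
    by (rule truth_setE)
  have v: "v' = v" using L2_unique[OF ext_subset 1(1) L_imp_L2[OF f]] by auto
  have "opair b (num 0) \<in> ext T" using b by (simp add: ext_def)
  then obtain a A where "opair b (num 0) = opair a A" "is_fun a (ext v') (ext N)" "is_fun A (ext r) {}"
    using 1(2) by auto
  then show ?thesis using v b is_fun_in_V opair_inject num_in_V by metis
qed

text \<open>Between the restriction and the whole of \<open>g\<close> there is room for only one
  function on the free variables. The existential clauses of \<open>sat_step\<close> thus amount to
  evaluation under \<open>g\<close>.\<close>

lemma sub_truth:
  assumes g: "asg N g" and f: "L_formula \<phi> v" and T: "tset1 N \<phi> T" and sub: "ext (restr g v) \<subseteq> X" "X \<subseteq> ext g"
  shows "(\<exists>b\<in>V. ext b \<subseteq> X \<and> opair b (num 0) \<epsilon> T) \<longleftrightarrow> Sat N \<phi> g"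
proof -
  have v: "v \<in> V" "ext v \<subseteq> Omega" using L_in_V[OF f] L_vars[OF f] by auto
  have "(\<exists>b\<in>V. ext b \<subseteq> X \<and> opair b (num 0) \<epsilon> T) \<longleftrightarrow> opair (restr g v) (num 0) \<epsilon> T"
  proof
    assume "\<exists>b\<in>V. ext b \<subseteq> X \<and> opair b (num 0) \<epsilon> T"
    then obtain b where b: "b \<in> V" "ext b \<subseteq> X" "opair b (num 0) \<epsilon> T" by blast
    have "b = restr g v"
      by (rule fun_subset[OF tset_mem[OF T f b(1,3)] g v]) (use b sub in blast)
    then show "opair (restr g v) (num 0) \<epsilon> T" using b by simp
  next
    assume "opair (restr g v) (num 0) \<epsilon> T"
    then show "\<exists>b\<in>V. ext b \<subseteq> X \<and> opair b (num 0) \<epsilon> T" using restr(1)[OF g v] sub by blast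
  qed
  then show ?thesis unfolding Sat_iff[OF f] tset1_sat1[OF T] .
qed

lemma Sat_cAnd:
  assumes N: "model N" and g: "asg N g" and f: "L_formula (cAnd p q) v" and p: "p \<in> V" "q \<in> V"
  shows "Sat N (cAnd p q) g \<longleftrightarrow> Sat N p g \<and> Sat N q g"
proof -
  obtain T where T: "tset1 N (cAnd p q) T" using total[OF N f] by blast
  obtain T1 T2 where T1: "tset1 N p T1" "tset1 N q T2" "truth_set (ext N) {} (cAnd p q) T (\<lambda>a A.
          (\<exists>b\<in>V. \<exists>B\<in>V. ext b \<subseteq> ext a \<and> ext B \<subseteq> ext A \<and> opair b B \<epsilon> T1) \<and>
          (\<exists>b\<in>V. \<exists>B\<in>V. ext b \<subseteq> ext a \<and> ext B \<subseteq> ext A \<and> opair b B \<epsilon> T2))"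
    using tset_inv[OF T] unfolding sat_step_codes(6)[OF ext_subset p] by blast
  obtain v1 v2 where v: "L_formula p v1" "L_formula q v2" "ext v = ext v1 \<union> ext v2"
    using L_cAnd_inv[OF p f] .
  have V: "v \<in> V" "ext v \<subseteq> Omega" "v1 \<in> V" "v2 \<in> V" "ext v1 \<subseteq> Omega" "ext v2 \<subseteq> Omega"
    using L_in_V L_vars f v by blast+
  have s: "ext (restr g v1) \<subseteq> ext (restr g v)" "ext (restr g v2) \<subseteq> ext (restr g v)" "ext (restr g v) \<subseteq> ext g"
    using restr_subset[OF g] V v restr(2)[OF g] by auto
  \<comment> \<open>The second-order assignment is empty here, and so is every subset of it.\<close>
  have z: "(\<exists>B\<in>V. ext b \<subseteq> X \<and> ext B \<subseteq> ext (num 0) \<and> opair b B \<epsilon> T) \<longleftrightarrow> ext b \<subseteq> X \<and> opair b (num 0) \<epsilon> T" for b X T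
    by (auto intro!: bexI[of _ "num 0"] dest: num_0_unique)
  show ?thesis
    unfolding truth_set_Sat[OF g f T T1(3)] z sub_truth[OF g v(1) T1(1) s(1,3)] sub_truth[OF g v(2) T1(2) s(2,3)]
    by (rule refl)
qed

lemma Sat_cAll:
  assumes N: "model N" and g: "asg N g" and f: "L_formula (cAll i p) v" and p: "p \<in> V" "i \<in> Omega"
  shows "Sat N (cAll i p) g \<longleftrightarrow> (\<forall>x\<in>ext N. Sat N p (upd g i x))"
proof -
  obtain T where T: "tset1 N (cAll i p) T" using total[OF N f] by blast
  obtain T1 where T1: "tset1 N p T1" "truth_set (ext N) {} (cAll i p) T (\<lambda>a A.
          \<forall>x\<in>ext N. \<exists>b\<in>V. ext b \<subseteq> insert (opair i x) (ext a) \<and> opair b A \<epsilon> T1)"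
    using tset_inv[OF T] unfolding sat_step_codes(7)[OF ext_subset Omega_in_V[OF p(2)] p(1)] by blast
  obtain w where w: "L_formula p w" "ext v = ext w - {i}"
    using L_cAll_inv[OF p(1) Omega_in_V[OF p(2)] f] .
  have V: "v \<in> V" "ext v \<subseteq> Omega" "w \<in> V" "ext w \<subseteq> Omega"
    using L_in_V L_vars f w by blast+
  have "(\<exists>b\<in>V. ext b \<subseteq> insert (opair i x) (ext (restr g v)) \<and> opair b (num 0) \<epsilon> T1) \<longleftrightarrow> Sat N p (upd g i x)"
    if x: "x \<in> ext N" for x
  proof (rule sub_truth[OF _ w(1) T1(1)])
    show u: "asg N (upd g i x)" by (rule upd(1)[OF g p(2) x])
    have ap: "ap (upd g i x) j = (if j = i then x else ap g j)" if "j \<in> Omega" for j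
      by (rule upd(2)[OF g p(2) x that])
    show "ext (restr (upd g i x) w) \<subseteq> insert (opair i x) (ext (restr g v))"
      unfolding restr(2)[OF u V(3,4)] restr(2)[OF g V(1,2)]
    proof
      fix q assume "q \<in> {opair k (ap (upd g i x) k) | k. k \<in> ext w}"
      then obtain k where k: "k \<in> ext w" "q = opair k (ap (upd g i x) k)" by blast
      then have "q = opair k (if k = i then x else ap g k)" using ap V(4) by auto
      then show "q \<in> insert (opair i x) {opair k (ap g k) | k. k \<in> ext v}"
        using k w(2) by (cases "k = i") auto
    qed
    show "insert (opair i x) (ext (restr g v)) \<subseteq> ext (upd g i x)"
      unfolding upd(3)[OF g p(2) x] restr(2)[OF g V(1,2)] using V w p by auto
  qed
  then show ?thesis
    unfolding truth_set_Sat[OF g f T T1(2)] by simp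
qed

lemma Sat_atom:
  assumes N: "model N" and g: "asg N g" and i: "i \<in> Omega" "j \<in> Omega"
  shows "Sat N (cMem (var i) (var j)) g \<longleftrightarrow> ap g i \<epsilon> ap g j"
    and "Sat N (cEq (var i) (var j)) g \<longleftrightarrow> ap g i = ap g j"
proof -
  have V: "var i \<in> V" "var j \<in> V" using i by auto
  have d: "denotes (restr g v) (var k) x \<longleftrightarrow> x = ap g k"
    if "L_formula \<phi> v" "k \<in> ext v" "k \<in> Omega" "x \<in> ext N" for v k x \<phi>
  proof -
    have xV: "x \<in> V" using that ext_in_V by blast
    have "denotes (restr g v) (var k) x \<longleftrightarrow> opair k x \<epsilon> restr g v"
      unfolding denotes_def using that xV var_con by auto
    then show ?thesis using restr_mem[OF g _ _ that(2) xV] L_in_V[OF that(1)] L_vars[OF that(1)] by blast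
  qed
  have gi: "ap g i \<in> ext N" "ap g j \<in> ext N" using asg_ap[OF g] i by auto
  obtain v where f: "L_formula (cMem (var i) (var j)) v"
    using Lco_formula[OF Lco_Mem[OF Lco_Nil i]] by auto
  have v: "ext v = {i, j}" by (rule L_atom_inv(1)[OF i f])
  obtain T where T: "tset1 N (cMem (var i) (var j)) T" using total[OF N f] by blast
  have "truth_set (ext N) {} (cMem (var i) (var j)) T
     (\<lambda>a A. \<exists>x\<in>ext N. \<exists>y\<in>ext N. denotes a (var i) x \<and> denotes a (var j) y \<and> x \<epsilon> y)"
    using tset_inv[OF T] unfolding sat_step_codes(1)[OF ext_subset V] by blast
  from truth_set_Sat[OF g f T this] show "Sat N (cMem (var i) (var j)) g \<longleftrightarrow> ap g i \<epsilon> ap g j"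
    using d[OF f] v i gi by auto
  obtain v where f: "L_formula (cEq (var i) (var j)) v"
    using Lco_formula[OF Lco_Eq[OF Lco_Nil i]] by auto
  have v: "ext v = {i, j}" by (rule L_atom_inv(2)[OF i f])
  obtain T where T: "tset1 N (cEq (var i) (var j)) T" using total[OF N f] by blast
  have "truth_set (ext N) {} (cEq (var i) (var j)) T
     (\<lambda>a A. \<exists>x\<in>ext N. denotes a (var i) x \<and> denotes a (var j) x)"
    using tset_inv[OF T] unfolding sat_step_codes(2)[OF ext_subset V] by blast
  from truth_set_Sat[OF g f T this] show "Sat N (cEq (var i) (var j)) g \<longleftrightarrow> ap g i = ap g j"
    using d[OF f] v i gi by auto
qed

text \<open>The bridge between coded and actual satisfaction, by HOL induction on the standard
  formula. Injectivity of \<open>f\<close> prevents the update at \<open>f i\<close> from changing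
  the values of other variables.\<close>

lemma Sat_quote:
  assumes N: "model N" and f: "range f \<subseteq> Omega" "inj f"
  shows "asg N g \<Longrightarrow> Sat N (quote_with f p) g \<longleftrightarrow> holds (ext N) E (\<lambda>n. ap g (f n)) p"
proof (induction p arbitrary: g)
  case (FMem i j)
  then show ?case using Sat_atom[OF N] f by (auto simp: image_subset_iff)
next
  case (FEq i j)
  then show ?case using Sat_atom[OF N] f by (auto simp: image_subset_iff)
next
  case (FNeg p)
  have V: "quote_with f p \<in> V" by (rule quote_with_in_V[OF f(1)])
  obtain v where "L_formula (cNeg (quote_with f p)) v"
    using Lco_formula[OF Lco_quote[OF f(1) Lco_Nil, of "FNeg p"]] by auto
  from Sat_cNeg[OF N FNeg.prems this V] FNeg.IH[OF FNeg.prems] show ?case by simp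
next
  case (FAnd p q)
  have V: "quote_with f p \<in> V" "quote_with f q \<in> V" by (rule quote_with_in_V[OF f(1)])+
  obtain v where "L_formula (cAnd (quote_with f p) (quote_with f q)) v"
    using Lco_formula[OF Lco_quote[OF f(1) Lco_Nil, of "FAnd p q"]] by auto
  from Sat_cAnd[OF N FAnd.prems this V] FAnd.IH[OF FAnd.prems] show ?case by simp
next
  case (FAll i p)
  have V: "quote_with f p \<in> V" by (rule quote_with_in_V[OF f(1)])
  obtain v where v: "L_formula (cAll (f i) (quote_with f p)) v"
    using Lco_formula[OF Lco_quote[OF f(1) Lco_Nil, of "FAll i p"]] by auto
  have fi: "f i \<in> Omega" using f by auto
  have "Sat N (quote_with f p) (upd g (f i) x) \<longleftrightarrow> holds (ext N) E ((\<lambda>n. ap g (f n))(i := x)) p"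
    if x: "x \<in> ext N" for x
  proof -
    have "(\<lambda>n. ap (upd g (f i) x) (f n)) = (\<lambda>n. ap g (f n))(i := x)"
      using upd(2)[OF FAll.prems fi x] f by (auto simp: inj_eq image_subset_iff fun_eq_iff)
    then show ?thesis using FAll.IH[OF upd(1)[OF FAll.prems fi x]] by simp
  qed
  then show ?case using Sat_cAll[OF N FAll.prems v V fi] by simp
qed

text \<open>Only finitely many values are prescribed, since an arbitrary HOL sequence of elements of
  \<open>N\<close> need not be represented by a set of the universe.\<close>

lemma asg_exists:
  assumes N: "model N" and f: "range f \<subseteq> Omega" "inj f" and e: "range e \<subseteq> ext N" and F: "finite F"
  shows "\<exists>g. asg N g \<and> (\<forall>n\<in>F. ap g (f n) = e n)"
  using F
proof (induction F rule: finite_induct)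
  case empty
  obtain c where c: "c \<in> ext N" using model_nonempty[OF N] by blast
  obtain g where "is_fun g (ext omega) (ext N)" using const_fun[OF _ c, of omega] by auto
  then show ?case by (auto simp: asg_def)
next
  case (insert k F)
  then obtain g where g: "asg N g" "\<forall>n\<in>F. ap g (f n) = e n" by blast
  have "f k \<in> Omega" "e k \<in> ext N" using f e by auto
  note u = upd[OF g(1) this]
  have "ap (upd g (f k) (e k)) (f n) = e n" if "n \<in> insert k F" for n
    using u(2)[of "f n"] f g that insert.hyps by (auto simp: inj_eq image_subset_iff)
  with u(1) show ?case by blast
qed

lemma inj_num: "inj num" by (rule injI) simp

lemma range_num: "range num \<subseteq> Omega" by auto

lemma model_holds:
  assumes N: "model N" and ax: "ZFC_axiom (quote p)" and e: "range e \<subseteq> ext N"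
  shows "holds (ext N) E e p"
proof -
  obtain g where g: "asg N g" "\<forall>n\<in>fv p. ap g (num n) = e n"
    using asg_exists[OF N range_num inj_num e finite_fv] by blast
  have t: "true_in N (quote p)" by (rule model_true[OF N ax quote_in_V])
  then obtain v where v: "L_formula (quote p) v" unfolding true_in_def by blast
  have "Sat N (quote p) g"
    unfolding Sat_iff[OF v] by (rule true_inD[OF t v restr_fun[OF g(1) v]])
  then have "holds (ext N) E (\<lambda>n. ap g (num n)) p"
    using Sat_quote[OF N range_num inj_num g(1)] by (simp add: quote_eq)
  then show ?thesis using holds_cong[of p e "\<lambda>n. ap g (num n)"] g(2) by auto
qed

lemma model_single: "model N \<Longrightarrow> p \<in> ZFC_single_axioms \<Longrightarrow> range e \<subseteq> ext N \<Longrightarrow> holds (ext N) E e p"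
  by (rule model_holds) (auto simp: ZFC_axiom_def)

lemma model_holds_separation:
  assumes N: "model N" and d: "distinct [x, y, z]" "y \<notin> fv p" and e: "range e \<subseteq> ext N"
  shows "holds (ext N) E e (Separation p x y z)"
proof (rule model_holds[OF N _ e])
  have q: "quote (Separation p x y z) = c_separation (quote p) (num x) (num y) (num z)"
    by (simp add: Separation_def FEx_def FIff_def FImp_def c_separation_def cEx_def cIff_def cImp_def)
  \<comment> \<open>The side condition of the coded axiom concerns the free variables as computed in
    the universe; they are matched with \<open>fv p\<close>.\<close>
  have fvq: "\<And>v. L_formula (quote p) v \<Longrightarrow> ext v = num ` fv p"
  proof (induction p)
    case (FMem i j)
    then show ?case using L_atom_inv(1)[of "num i" "num j" v] by simp
  next
    case (FEq i j)
    then show ?case using L_atom_inv(2)[of "num i" "num j" v] by simp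
  next
    case (FNeg p)
    then show ?case using L_cNeg_inv[of "quote p"] by simp
  next
    case (FAnd p q)
    from FAnd.prems have "L_formula (cAnd (quote p) (quote q)) v" by simp
    then obtain v1 v2 where "L_formula (quote p) v1" "L_formula (quote q) v2" "ext v = ext v1 \<union> ext v2"
      by (rule L_cAnd_inv[OF quote_in_V quote_in_V])
    then show ?case using FAnd.IH by auto
  next
    case (FAll i p)
    from FAll.prems have "L_formula (cAll (num i) (quote p)) v" by simp
    then obtain w where "L_formula (quote p) w" "ext v = ext w - {num i}"
      by (rule L_cAll_inv[OF quote_in_V num_in_V])
    then show ?case using FAll.IH by auto
  qed
  obtain v where v: "L_formula (quote p) v"
    using Lco_formula[OF Lco_quote[OF range_num Lco_Nil]] unfolding quote_eq by auto
  show "ZFC_axiom (quote (Separation p x y z))"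
    unfolding ZFC_axiom_def q
    by (rule disjI2, rule disjI1, rule bexI[of _ "quote p"], rule bexI[of _ v], rule bexI[of _ "num x"],
        rule bexI[of _ "num y"], rule bexI[of _ "num z"])
      (use v d fvq[OF v] L_in_V[OF v] in auto)
qed

section \<open>Closure properties of models\<close>

text \<open>The sharper companion of \<open>separation\<close>: the subset is an element of
  \<open>N\<close>, by the instance of Separation true in \<open>N\<close> for the formula that
  defines \<open>P\<close> there.\<close>

lemma model_sep:
  assumes N: "model N" and P: "adef P" and e: "range e \<subseteq> ext N" and x: "x \<in> ext N"
  shows "\<exists>y\<in>ext N. ext y = {z \<in> ext x. P (case_nat z e)}"
proof -
  obtain p where p: "\<And>K e. model K \<Longrightarrow> range e \<subseteq> ext K \<Longrightarrow> holds (ext K) E e p \<longleftrightarrow> P e"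
    using adefE[OF P] by blast
  obtain a where a: "a \<notin> insert 0 (fv p)"
    using ex_new_if_finite[OF infinite_UNIV_nat, of "insert 0 (fv p)"] by auto
  obtain b where b: "b \<notin> insert a (insert 0 (fv p))"
    using ex_new_if_finite[OF infinite_UNIV_nat, of "insert a (insert 0 (fv p))"] by auto
  have "\<exists>y\<in>ext N. \<forall>z\<in>ext N. z \<epsilon> y \<longleftrightarrow> z \<epsilon> x \<and> holds (ext N) E (e(a := x, b := y, 0 := z)) p"
    if "range e \<subseteq> ext N" for e
    using model_holds_separation[OF N _ _ that, of a b 0 p] a b x by (auto simp: Separation_def)
  \<comment> \<open>\<open>P\<close> reads the tested element at index \<open>0\<close>, so
    \<open>e\<close> is shifted by one; the \<open>x\<close> at index \<open>0\<close> only holds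
    the place until the update with \<open>z\<close>.\<close>
  from this[of "case_nat x e"] e x
  have "\<exists>y\<in>ext N. \<forall>z\<in>ext N. z \<epsilon> y \<longleftrightarrow> z \<epsilon> x \<and> holds (ext N) E ((case_nat x e)(a := x, b := y, 0 := z)) p"
    by (auto simp: image_subset_iff split: nat.splits)
  then obtain y where y: "y \<in> ext N" "\<And>z. z \<in> ext N \<Longrightarrow> z \<epsilon> y \<longleftrightarrow> z \<epsilon> x \<and>
      holds (ext N) E ((case_nat x e)(a := x, b := y, 0 := z)) p" by blast
  have "holds (ext N) E ((case_nat x e)(a := x, b := y, 0 := z)) p \<longleftrightarrow> P (case_nat z e)" if z: "z \<in> ext N" for z
  proof -
    have "holds (ext N) E ((case_nat x e)(a := x, b := y, 0 := z)) p \<longleftrightarrow> holds (ext N) E (case_nat z e) p"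
      by (rule holds_cong) (use a b in \<open>auto split: nat.splits\<close>)
    also have "\<dots> \<longleftrightarrow> P (case_nat z e)"
      by (rule p[OF N]) (use e z in \<open>auto simp: image_subset_iff split: nat.splits\<close>)
    finally show ?thesis .
  qed
  with y have *: "\<And>z. z \<in> ext N \<Longrightarrow> z \<epsilon> y \<longleftrightarrow> z \<epsilon> x \<and> P (case_nat z e)" by blast
  have "ext y = {z \<in> ext x. P (case_nat z e)}"
    using * model_trans[OF N y(1)] model_trans[OF N x] ext_in_V[of _ N] mem_ext by blast
  with y(1) show ?thesis by blast
qed

lemma foundation: assumes "x \<in> V" "ext x \<noteq> {}" shows "\<exists>y\<in>ext x. ext y \<inter> ext x = {}"
proof -
  obtain K where K: "model K" "x \<in> ext K" using model_containing[of "[x]"] assms by auto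
  have "holds (ext K) E (\<lambda>_. x) Foundation"
    by (rule model_single[OF K(1)]) (use K in \<open>auto simp: ZFC_single_axioms_def\<close>)
  then have "\<forall>x\<in>ext K. (\<exists>y\<in>ext K. y \<epsilon> x) \<longrightarrow> (\<exists>y\<in>ext K. y \<epsilon> x \<and> (\<forall>z\<in>ext K. z \<epsilon> y \<longrightarrow> \<not> z \<epsilon> x))"
    by (simp add: Foundation_def)
  then have "(\<exists>y\<in>ext K. y \<epsilon> x) \<longrightarrow> (\<exists>y\<in>ext K. y \<epsilon> x \<and> (\<forall>z\<in>ext K. z \<epsilon> y \<longrightarrow> \<not> z \<epsilon> x))"
    using K(2) by blast
  moreover have "\<exists>y\<in>ext K. y \<epsilon> x" using assms(2) model_trans[OF K] extD by blast
  ultimately obtain y where y: "y \<in> ext K" "y \<epsilon> x" "\<forall>z\<in>ext K. z \<epsilon> y \<longrightarrow> \<not> z \<epsilon> x" by blast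
  have "ext y \<inter> ext x = {}" using y(3) model_trans[OF K(1) y(1)] extD by blast
  moreover have "y \<in> ext x" using y ext_in_V by (simp add: mem_ext)
  ultimately show ?thesis by blast
qed

lemma model_empty: assumes N: "model N" shows "num 0 \<in> ext N"
proof -
  obtain c where c: "c \<in> ext N" using model_nonempty[OF N] by blast
  have "holds (ext N) E (\<lambda>_. c) Empty_set"
    by (rule model_single[OF N]) (use c in \<open>auto simp: ZFC_single_axioms_def\<close>)
  then obtain z where z: "z \<in> ext N" "\<forall>y\<in>ext N. \<not> y \<epsilon> z" by (auto simp: Empty_set_def)
  then have "ext z = {}" using model_trans[OF N z(1)] extD by blast
  then show ?thesis using z(1) num_0_unique ext_in_V by metis
qed

lemma model_pair: assumes N: "model N" and xy: "x \<in> ext N" "y \<in> ext N" shows "mk {x, y} \<in> ext N"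
proof -
  have V: "x \<in> V" "y \<in> V" using xy ext_in_V by auto
  have "holds (ext N) E (\<lambda>_. x) Pairing"
    by (rule model_single[OF N]) (use xy in \<open>auto simp: ZFC_single_axioms_def\<close>)
  then have "\<forall>x\<in>ext N. \<forall>y\<in>ext N. \<exists>z\<in>ext N. \<forall>w\<in>ext N. w \<epsilon> z \<longleftrightarrow> w = x \<or> w = y"
    by (simp add: Pairing_def)
  then obtain z where z: "z \<in> ext N" "\<forall>w\<in>ext N. w \<epsilon> z \<longleftrightarrow> w = x \<or> w = y" using xy by blast
  have "ext z = {x, y}"
    using z(2) model_trans[OF N z(1)] xy V mem_ext extD by blast
  then have "mk {x, y} = z" using mk_ext[of z] ext_in_V[OF z(1)] by simp
  then show ?thesis using z by simp
qed

lemma model_Union: assumes N: "model N" and x: "x \<in> ext N" shows "mk (\<Union>y\<in>ext x. ext y) \<in> ext N"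
proof -
  have "holds (ext N) E (\<lambda>_. x) Union_ax"
    by (rule model_single[OF N]) (use x in \<open>auto simp: ZFC_single_axioms_def\<close>)
  then have "\<forall>x\<in>ext N. \<exists>z\<in>ext N. \<forall>w\<in>ext N. w \<epsilon> z \<longleftrightarrow> (\<exists>y\<in>ext N. y \<epsilon> x \<and> w \<epsilon> y)"
    by (simp add: Union_ax_def)
  then obtain z where z: "z \<in> ext N" "\<forall>w\<in>ext N. w \<epsilon> z \<longleftrightarrow> (\<exists>y\<in>ext N. y \<epsilon> x \<and> w \<epsilon> y)" using x by blast
  have "ext z = (\<Union>y\<in>ext x. ext y)"
  proof (intro set_eqI iffI)
    fix w assume "w \<in> ext z"
    then have w: "w \<in> ext N" "w \<epsilon> z" using model_trans[OF N z(1)] extD by blast+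
    then obtain y where "y \<in> ext N" "y \<epsilon> x" "w \<epsilon> y" using z(2) by blast
    then show "w \<in> (\<Union>y\<in>ext x. ext y)" using w ext_in_V by (auto simp: mem_ext)
  next
    fix w assume "w \<in> (\<Union>y\<in>ext x. ext y)"
    then obtain y where y: "y \<in> ext x" "w \<in> ext y" by blast
    then have "y \<in> ext N" "w \<in> ext N" using model_trans[OF N] x by blast+
    then have "w \<epsilon> z" using z(2) y extD by blast
    then show "w \<in> ext z" using y ext_in_V by (simp add: mem_ext)
  qed
  then have "mk (\<Union>y\<in>ext x. ext y) = z" using mk_ext[of z] ext_in_V[OF z(1)] by simp
  then show ?thesis using z by simp
qed

lemma model_Pow: assumes N: "model N" and x: "x \<in> ext N"
  shows "\<exists>z\<in>ext N. ext z = {y \<in> ext N. ext y \<subseteq> ext x}"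
proof -
  have "holds (ext N) E (\<lambda>_. x) Powerset"
    by (rule model_single[OF N]) (use x in \<open>auto simp: ZFC_single_axioms_def\<close>)
  then have "\<forall>x\<in>ext N. \<exists>z\<in>ext N. \<forall>w\<in>ext N. w \<epsilon> z \<longleftrightarrow> (\<forall>y\<in>ext N. y \<epsilon> w \<longrightarrow> y \<epsilon> x)"
    by (simp add: Powerset_def)
  then obtain z where z: "z \<in> ext N" "\<forall>w\<in>ext N. w \<epsilon> z \<longleftrightarrow> (\<forall>y\<in>ext N. y \<epsilon> w \<longrightarrow> y \<epsilon> x)" using x by blast
  have *: "(\<forall>y\<in>ext N. y \<epsilon> w \<longrightarrow> y \<epsilon> x) \<longleftrightarrow> ext w \<subseteq> ext x" if "w \<in> ext N" for w
    using model_trans[OF N that] extD ext_in_V[of _ N] mem_ext by blast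
  have "ext z = {y \<in> ext N. ext y \<subseteq> ext x}"
  proof (intro set_eqI)
    fix w
    show "w \<in> ext z \<longleftrightarrow> w \<in> {y \<in> ext N. ext y \<subseteq> ext x}"
    proof (cases "w \<in> ext N")
      case True
      then show ?thesis using z(2) * mem_ext[OF ext_in_V[OF True], of z] by simp
    next
      case False
      then show ?thesis using model_trans[OF N z(1), of w] by blast
    qed
  qed
  with z(1) show ?thesis by blast
qed

lemma model_Un: assumes N: "model N" and xy: "x \<in> ext N" "y \<in> ext N" shows "mk (ext x \<union> ext y) \<in> ext N"
proof -
  have "mk (\<Union>z\<in>ext (mk {x, y}). ext z) \<in> ext N"
    by (rule model_Union[OF N model_pair[OF N xy]])
  moreover have "x \<in> V" "y \<in> V" using xy ext_in_V by auto
  ultimately show ?thesis by simp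
qed

lemma model_insert: assumes N: "model N" and xy: "x \<in> ext N" "y \<in> ext N" shows "mk (insert x (ext y)) \<in> ext N"
proof -
  have "mk (ext (mk {x, x}) \<union> ext y) \<in> ext N"
    by (rule model_Un[OF N model_pair[OF N xy(1) xy(1)] xy(2)])
  moreover have "x \<in> V" "y \<in> V" using xy ext_in_V by auto
  ultimately show ?thesis by simp
qed

lemma model_opair: "model N \<Longrightarrow> x \<in> ext N \<Longrightarrow> y \<in> ext N \<Longrightarrow> opair x y \<in> ext N"
  unfolding opair_def using model_pair[of N x x] by (intro model_pair) simp_all

lemma model_suc: "model N \<Longrightarrow> x \<in> ext N \<Longrightarrow> suc x \<in> ext N"
  unfolding suc_def by (rule model_insert)

section \<open>Definable functions, numerals and \<open>Omega\<close> in all models\<close>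

lemma aterm_opair: "aterm F \<Longrightarrow> aterm G \<Longrightarrow> aterm (\<lambda>e. opair (F e) (G e))"
proof -
  assume a: "aterm F" "aterm G"
  have "adef (\<lambda>e. e 0 = opair (F (\<lambda>n. e (Suc n))) (G (\<lambda>n. e (Suc n))))"
    by (rule adef_opair_eq[OF aterm_var aterm_lift[OF a(1)] aterm_lift[OF a(2)]])
  then show ?thesis unfolding aterm_def[of "\<lambda>e. opair (F e) (G e)"]
    using model_opair aterm_in a by blast
qed

lemma aterm_mk:
  assumes A: "acls A" and K: "\<And>K e. model K \<Longrightarrow> range e \<subseteq> ext K \<Longrightarrow> \<exists>y\<in>ext K. ext y = A e"
  shows "aterm (\<lambda>e. mk (A e))"
  unfolding aterm_def
proof (intro conjI allI impI)
  show "mk (A e) \<in> ext K" if "model K" "range e \<subseteq> ext K" for K e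
    using K[OF that] mk_ext ext_in_V by metis
  have "adef (\<lambda>e. ext (e 0) = A (\<lambda>n. e (Suc n)))"
    by (rule adef_set_eq[OF acls_ext[OF aterm_var] acls_lift[OF A]])
  then show "adef (\<lambda>e. e 0 = mk (A (\<lambda>n. e (Suc n))))"
  proof (rule adef_cong)
    fix K and e :: "nat \<Rightarrow> 'a" assume a: "model K" "range e \<subseteq> ext K"
    have "isset (A (\<lambda>n. e (Suc n)))"
      using K[OF a(1) range_Suc[OF a(2)]] ext_in_V isset_def by metis
    then show "e 0 = mk (A (\<lambda>n. e (Suc n))) \<longleftrightarrow> ext (e 0) = A (\<lambda>n. e (Suc n))"
      by (rule mk_eq_iff) (use a ext_in_V in auto)
  qed
qed

lemma aterm_suc: "aterm F \<Longrightarrow> aterm (\<lambda>e. suc (F e))"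
proof -
  assume F: "aterm F"
  show ?thesis unfolding suc_def
  proof (rule aterm_mk)
    show "acls (\<lambda>e. insert (F e) (ext (F e)))" by (intro acls_insert acls_ext F)
    show "\<exists>y\<in>ext K. ext y = insert (F e) (ext (F e))" if "model K" "range e \<subseteq> ext K" for K e
      using model_suc[OF that(1) aterm_in[OF F that]] ext_suc[OF ext_in_V[OF aterm_in[OF F that]]] by blast
  qed
qed

lemma aterm_zero: "aterm (\<lambda>e. num 0)"
  unfolding num.simps(1)
  by (rule aterm_mk[OF acls_empty]) (use model_empty num_0 in blast)

lemma aterm_num: "aterm (\<lambda>e. num n)"
  by (induction n) (simp_all add: num_Suc aterm_suc aterm_zero)

lemmas code_defs = var_def con_def cMem_def cEq_def cS_def cApp2_def cNeg_def cAnd_def cAll_def cAll2_def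
  triple_def cImp_def cIff_def cEx_def c_separation_def c_replacement_def

text \<open>The well-foundedness clause ranges over all sets of the universe, but
  \<open>foundation\<close> makes it true outright, and a predecessor of \<open>m\<close> is found
  among the members of \<open>m\<close>. What remains is bounded by \<open>n\<close>, hence
  absolute.\<close>

lemma Omega_iff': "n \<in> Omega \<longleftrightarrow> n \<in> V \<and>
     (\<forall>x\<in>ext n. ext x \<subseteq> ext n) \<and> (\<forall>x\<in>ext n. \<forall>y\<in>ext n. x \<epsilon> y \<or> x = y \<or> y \<epsilon> x) \<and>
     (\<forall>m\<in>insert n (ext n). ext m = {} \<or> (\<exists>k\<in>ext m. ext m = insert k (ext k)))"
proof -
  have "zero_or_suc m \<longleftrightarrow> ext m = {} \<or> (\<exists>k\<in>ext m. ext m = insert k (ext k))" for m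
    unfolding zero_or_suc_def using ext_in_V by blast
  moreover have "(\<forall>y\<in>V. ext y \<subseteq> ext n \<and> ext y \<noteq> {} \<longrightarrow> (\<exists>z\<in>ext y. ext z \<inter> ext y = {}))"
    using foundation by blast
  ultimately show ?thesis unfolding Omega_iff by simp
qed

lemma adef_in_Omega: "adef (\<lambda>e. e i \<in> Omega)"
proof (rule adef_cong)
  show "adef (\<lambda>e. (\<forall>x\<in>ext (e i). ext x \<subseteq> ext (e i)) \<and> (\<forall>x\<in>ext (e i). \<forall>y\<in>ext (e i). x \<epsilon> y \<or> x = y \<or> y \<epsilon> x) \<and>
     (\<forall>m\<in>insert (e i) (ext (e i)). ext m = {} \<or> (\<exists>k\<in>ext m. ext m = insert k (ext k))))"
    by (intro adef_rules)
  fix K and e :: "nat \<Rightarrow> 'a" assume "model K" "range e \<subseteq> ext K"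
  then have "e i \<in> V" using ext_in_V by auto
  then show "e i \<in> Omega \<longleftrightarrow> (\<forall>x\<in>ext (e i). ext x \<subseteq> ext (e i)) \<and> (\<forall>x\<in>ext (e i). \<forall>y\<in>ext (e i). x \<epsilon> y \<or> x = y \<or> y \<epsilon> x) \<and>
     (\<forall>m\<in>insert (e i) (ext (e i)). ext m = {} \<or> (\<exists>k\<in>ext m. ext m = insert k (ext k)))"
    unfolding Omega_iff' by simp
qed

text \<open>Infinity yields just an inductive set \<open>I\<close> in \<open>N\<close>. It contains
  all numbers of the universe, nonstandard ones included, because a least number outside
  \<open>I\<close> would be neither zero nor a successor. Then \<open>omega\<close> is separated
  from \<open>I\<close> within \<open>N\<close>.\<close>

lemma model_Omega: assumes N: "model N" shows "omega \<in> ext N"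
proof -
  obtain c where c: "c \<in> ext N" using model_nonempty[OF N] by blast
  have inf: "holds (ext N) E (\<lambda>_. c) Infinity"
    by (rule model_single[OF N]) (use c in \<open>auto simp: ZFC_single_axioms_def\<close>)
  have "\<exists>I\<in>ext N. (\<exists>z\<in>ext N. z \<epsilon> I \<and> (\<forall>w\<in>ext N. \<not> w \<epsilon> z)) \<and>
      (\<forall>y\<in>ext N. y \<epsilon> I \<longrightarrow> (\<exists>s\<in>ext N. s \<epsilon> I \<and> (\<forall>w\<in>ext N. w \<epsilon> s \<longleftrightarrow> w \<epsilon> y \<or> w = y)))"
    using inf by (simp add: Infinity_def Is_empty_def Is_succ_def Let_def)
  then obtain I where I: "I \<in> ext N" "\<exists>z\<in>ext N. z \<epsilon> I \<and> (\<forall>w\<in>ext N. \<not> w \<epsilon> z)"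
      "\<forall>y\<in>ext N. y \<epsilon> I \<longrightarrow> (\<exists>s\<in>ext N. s \<epsilon> I \<and> (\<forall>w\<in>ext N. w \<epsilon> s \<longleftrightarrow> w \<epsilon> y \<or> w = y))" by blast
  have IV: "I \<in> V" using I(1) ext_in_V by blast
  have zero: "num 0 \<in> ext I"
  proof -
    obtain z where z: "z \<in> ext N" "z \<epsilon> I" "\<forall>w\<in>ext N. \<not> w \<epsilon> z" using I(2) by blast
    have "ext z = {}" using z(3) model_trans[OF N z(1)] extD by blast
    then have "z = num 0" using z ext_in_V num_0_unique by blast
    then show ?thesis using z by (simp add: mem_ext)
  qed
  have step: "suc y \<in> ext I" if y: "y \<in> ext I" for y
  proof -
    have yN: "y \<in> ext N" "y \<in> V" "y \<epsilon> I" using model_trans[OF N I(1) y] y extD by auto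
    then obtain s where s: "s \<in> ext N" "s \<epsilon> I" "\<forall>w\<in>ext N. w \<epsilon> s \<longleftrightarrow> w \<epsilon> y \<or> w = y" using I(3) by blast
    have sV: "s \<in> V" using s ext_in_V by blast
    have "w \<in> ext s \<longleftrightarrow> w \<in> insert y (ext y)" for w
      using s(3) model_trans[OF N s(1), of w] model_trans[OF N yN(1), of w] yN(1,2) mem_ext[of w] ext_in_V[of w N] extD
      by blast
    then have "s = suc y" using sV yN ext_eqI[of s "suc y"] by (simp add: set_eq_iff)
    then show ?thesis using s sV by (simp add: mem_ext)
  qed
  have sub: "Omega \<subseteq> ext I"
  proof
    fix n assume n: "n \<in> Omega"
    show "n \<in> ext I"
    proof (rule ccontr)
      assume nI: "n \<notin> ext I"
      have "\<exists>k\<in>ext (suc n) - ext I. \<forall>j\<in>ext k. j \<notin> ext (suc n) - ext I"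
        by (rule Omega_min[OF Omega_suc[OF n] isset_Diff]) (use n nI IV in auto)
      then obtain k where k: "k \<in> ext (suc n)" "k \<notin> ext I" "\<forall>j\<in>ext k. j \<notin> ext (suc n) - ext I" by blast
      have kO: "k \<in> Omega" using k(1) Omega_elem[OF Omega_suc[OF n]] by blast
      have "zero_or_suc k" using Omega_zs[OF kO] by blast
      then consider "ext k = {}" | m where "m \<in> V" "ext k = insert m (ext m)"
        unfolding zero_or_suc_def by blast
      then show False
      proof cases
        case 1
        then have "k = num 0" using num_0_unique kO by simp
        then show ?thesis using zero k by simp
      next
        case 2
        then have "m \<in> ext k" by simp
        then have "m \<in> ext I" using k Omega_trans[OF Omega_suc[OF n] k(1)] by blast
        then have "suc m \<in> ext I" by (rule step)
        moreover have "k = suc m" using 2 kO ext_eqI[of k "suc m"] by simp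
        ultimately show ?thesis using k by blast
      qed
    qed
  qed
  obtain y where y: "y \<in> ext N" "ext y = {z \<in> ext I. z \<in> Omega}"
    using model_sep[OF N adef_in_Omega[of 0], of "\<lambda>_. c" I] c I by auto
  have "ext y = Omega" using y sub by blast
  then have "y = omega" using ext_eqI[of y omega] y ext_in_V by simp
  then show ?thesis using y by simp
qed

lemma Omega_in_model: "model N \<Longrightarrow> n \<in> Omega \<Longrightarrow> n \<in> ext N"
  using model_trans[OF _ model_Omega] by simp

lemma acls_Omega: "acls (\<lambda>e. Omega)"
  by (rule aclsI) (auto intro: Omega_in_model adef_in_Omega)

lemma adef_is_fun: "aterm F \<Longrightarrow> acls A \<Longrightarrow> acls B \<Longrightarrow> adef (\<lambda>e. is_fun (F e) (A e) (B e))"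
proof -
  assume a: "aterm F" "acls A" "acls B"
  have "adef (\<lambda>e. (\<forall>p\<in>ext (F e). \<exists>x\<in>A e. \<exists>y\<in>B e. p = opair x y) \<and>
     (\<forall>x\<in>A e. \<exists>y\<in>B e. opair x y \<epsilon> F e \<and> (\<forall>z\<in>B e. opair x z \<epsilon> F e \<longrightarrow> z = y)))"
    by (intro adef_rules a acls_lift[OF a(2)] acls_lift[OF a(3)] acls_lift[OF acls_lift[OF a(3)]]
        aterm_lift[OF aterm_lift[OF a(1)]] aterm_lift[OF aterm_lift[OF aterm_lift[OF a(1)]]])
  then show ?thesis
  proof (rule adef_cong)
    fix K and e :: "nat \<Rightarrow> 'a" assume K: "model K" "range e \<subseteq> ext K"
    have "F e \<in> V" using aterm_in[OF a(1) K] ext_in_V by blast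
    then show "is_fun (F e) (A e) (B e) \<longleftrightarrow> (\<forall>p\<in>ext (F e). \<exists>x\<in>A e. \<exists>y\<in>B e. p = opair x y) \<and>
     (\<forall>x\<in>A e. \<exists>y\<in>B e. opair x y \<epsilon> F e \<and> (\<forall>z\<in>B e. opair x z \<epsilon> F e \<longrightarrow> z = y))"
      unfolding is_fun_def Ex1_def by (simp only: simp_thms) (intro arg_cong2[where f = "(\<and>)"] refl ball_cong; blast)
  qed
qed

lemma adef_is_fun_V: "acls A \<Longrightarrow> adef (\<lambda>e. is_fun (e i) (A e) V)"
proof -
  assume a: "acls A"
  have "adef (\<lambda>e. (\<forall>p\<in>ext (e i). \<exists>x\<in>A e. \<exists>y\<in>V. p = opair x y \<and> True) \<and>
     (\<forall>x\<in>A e. (\<exists>y\<in>V. opair x y \<epsilon> e i \<and> True) \<and>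
       \<not> (\<exists>y\<in>V. opair x y \<epsilon> e i \<and> (\<exists>z\<in>V. opair x z \<epsilon> e i \<and> y \<noteq> z))))"
    by (intro adef_ex_snd adef_ex_value adef_const adef_rules a acls_lift[OF a])
  then show ?thesis
  proof (rule adef_cong)
    fix K and e :: "nat \<Rightarrow> 'a" assume K: "model K" "range e \<subseteq> ext K"
    have "e i \<in> V" using K ext_in_V by blast
    then show "is_fun (e i) (A e) V \<longleftrightarrow> (\<forall>p\<in>ext (e i). \<exists>x\<in>A e. \<exists>y\<in>V. p = opair x y \<and> True) \<and>
     (\<forall>x\<in>A e. (\<exists>y\<in>V. opair x y \<epsilon> e i \<and> True) \<and>
       \<not> (\<exists>y\<in>V. opair x y \<epsilon> e i \<and> (\<exists>z\<in>V. opair x z \<epsilon> e i \<and> y \<noteq> z)))"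
      unfolding is_fun_def Ex1_def by (simp only: simp_thms) (intro arg_cong2[where f = "(\<and>)"] refl ball_cong; blast)
  qed
qed

section \<open>Absoluteness of formation\<close>

text \<open>In a block of quantifiers the witnesses are confined jointly, since the matrix may bound
  them only together, as in \<open>opair x y \<epsilon> f\<close>.\<close>

lemma adef_exV2:
  assumes P: "adef (\<lambda>e. P (e (Suc 0)) (e 0) (\<lambda>n. e (Suc (Suc n))))"
    and w: "\<And>K e x y. model K \<Longrightarrow> range e \<subseteq> ext K \<Longrightarrow> x \<in> V \<Longrightarrow> y \<in> V \<Longrightarrow> P x y e \<Longrightarrow> x \<in> ext K \<and> y \<in> ext K"
  shows "adef (\<lambda>e. \<exists>x\<in>V. \<exists>y\<in>V. P x y e)"
proof (rule adef_exV)
  show "adef (\<lambda>e. \<exists>y\<in>V. P (e 0) y (\<lambda>n. e (Suc n)))"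
  proof (rule adef_exV[OF P])
    show "y \<in> ext K" if "model K" "range e \<subseteq> ext K" "y \<in> V" "P (e 0) y (\<lambda>n. e (Suc n))" for K e y
      using w[OF that(1) range_Suc[OF that(2)], of "e 0" y] that ext_in_V by auto
  qed
  show "x \<in> ext K" if "model K" "range e \<subseteq> ext K" "x \<in> V" "\<exists>y\<in>V. P x y e" for K e x
    using w[OF that(1,2,3)] that(4) by blast
qed

lemma adef_exV3:
  assumes P: "adef (\<lambda>e. P (e (Suc (Suc 0))) (e (Suc 0)) (e 0) (\<lambda>n. e (Suc (Suc (Suc n)))))"
    and w: "\<And>K e x y z. model K \<Longrightarrow> range e \<subseteq> ext K \<Longrightarrow> x \<in> V \<Longrightarrow> y \<in> V \<Longrightarrow> z \<in> V \<Longrightarrow> P x y z e \<Longrightarrow>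
      x \<in> ext K \<and> y \<in> ext K \<and> z \<in> ext K"
  shows "adef (\<lambda>e. \<exists>x\<in>V. \<exists>y\<in>V. \<exists>z\<in>V. P x y z e)"
proof (rule adef_exV)
  show "adef (\<lambda>e. \<exists>y\<in>V. \<exists>z\<in>V. P (e 0) y z (\<lambda>n. e (Suc n)))"
  proof (rule adef_exV2[OF P])
    show "y \<in> ext K \<and> z \<in> ext K" if "model K" "range e \<subseteq> ext K" "y \<in> V" "z \<in> V" "P (e 0) y z (\<lambda>n. e (Suc n))" for K e y z
      using w[OF that(1) range_Suc[OF that(2)], of "e 0" y z] that ext_in_V by auto
  qed
  show "x \<in> ext K" if "model K" "range e \<subseteq> ext K" "x \<in> V" "\<exists>y\<in>V. \<exists>z\<in>V. P x y z e" for K e x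
    using w[OF that(1,2,3)] that(4) by blast
qed

lemma adef_exV6:
  assumes P: "adef (\<lambda>e. P (e (Suc (Suc (Suc (Suc (Suc 0)))))) (e (Suc (Suc (Suc (Suc 0))))) (e (Suc (Suc (Suc 0))))
      (e (Suc (Suc 0))) (e (Suc 0)) (e 0) (\<lambda>n. e (Suc (Suc (Suc (Suc (Suc (Suc n))))))))"
    and w: "\<And>K e x y z a b c. model K \<Longrightarrow> range e \<subseteq> ext K \<Longrightarrow> x \<in> V \<Longrightarrow> y \<in> V \<Longrightarrow> z \<in> V \<Longrightarrow>
      a \<in> V \<Longrightarrow> b \<in> V \<Longrightarrow> c \<in> V \<Longrightarrow> P x y z a b c e \<Longrightarrow>
      x \<in> ext K \<and> y \<in> ext K \<and> z \<in> ext K \<and> a \<in> ext K \<and> b \<in> ext K \<and> c \<in> ext K"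
  shows "adef (\<lambda>e. \<exists>x\<in>V. \<exists>y\<in>V. \<exists>z\<in>V. \<exists>a\<in>V. \<exists>b\<in>V. \<exists>c\<in>V. P x y z a b c e)"
proof (rule adef_exV3)
  show "adef (\<lambda>e. \<exists>a\<in>V. \<exists>b\<in>V. \<exists>c\<in>V. P (e (Suc (Suc 0))) (e (Suc 0)) (e 0) a b c (\<lambda>n. e (Suc (Suc (Suc n)))))"
  proof (rule adef_exV3[OF P])
    show "x \<in> ext K \<and> y \<in> ext K \<and> z \<in> ext K" if "model K" "range e \<subseteq> ext K" "x \<in> V" "y \<in> V" "z \<in> V"
      "P (e (Suc (Suc 0))) (e (Suc 0)) (e 0) x y z (\<lambda>n. e (Suc (Suc (Suc n))))" for K e x y z
      using w[OF that(1) range_Suc[OF range_Suc[OF range_Suc[OF that(2)]]], of "e (Suc (Suc 0))" "e (Suc 0)" "e 0" x y z]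
        that ext_in_V by auto
  qed
  show "x \<in> ext K \<and> y \<in> ext K \<and> z \<in> ext K" if "model K" "range e \<subseteq> ext K" "x \<in> V" "y \<in> V" "z \<in> V"
    "\<exists>a\<in>V. \<exists>b\<in>V. \<exists>c\<in>V. P x y z a b c e" for K e x y z
    using w[OF that(1-5)] that(6) by blast
qed

lemma aterm_triple: "aterm F \<Longrightarrow> aterm G \<Longrightarrow> aterm H \<Longrightarrow> aterm (\<lambda>e. triple (F e) (G e) (H e))"
  unfolding triple_def by (intro aterm_opair)

lemma aterm_codes:
  "aterm F \<Longrightarrow> aterm (\<lambda>e. var (F e))" "aterm F \<Longrightarrow> aterm (\<lambda>e. con (F e))"
  "aterm F \<Longrightarrow> aterm G \<Longrightarrow> aterm (\<lambda>e. cMem (F e) (G e))" "aterm F \<Longrightarrow> aterm G \<Longrightarrow> aterm (\<lambda>e. cEq (F e) (G e))"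
  "aterm F \<Longrightarrow> aterm (\<lambda>e. cS (F e))" "aterm F \<Longrightarrow> aterm G \<Longrightarrow> aterm (\<lambda>e. cApp2 (F e) (G e))"
  "aterm F \<Longrightarrow> aterm (\<lambda>e. cNeg (F e))" "aterm F \<Longrightarrow> aterm G \<Longrightarrow> aterm (\<lambda>e. cAnd (F e) (G e))"
  "aterm F \<Longrightarrow> aterm G \<Longrightarrow> aterm (\<lambda>e. cAll (F e) (G e))" "aterm F \<Longrightarrow> aterm G \<Longrightarrow> aterm (\<lambda>e. cAll2 (F e) (G e))"
  unfolding code_defs by (intro aterm_opair aterm_num; assumption)+

lemma closure_rules:
  assumes "model K"
  shows "x \<in> ext K \<Longrightarrow> y \<in> ext K \<Longrightarrow> opair x y \<in> ext K"
    "x \<in> ext K \<Longrightarrow> y \<in> ext K \<Longrightarrow> z \<in> ext K \<Longrightarrow> triple x y z \<in> ext K"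
    "num n \<in> ext K"
    "x \<in> ext K \<Longrightarrow> var x \<in> ext K" "x \<in> ext K \<Longrightarrow> con x \<in> ext K"
    "x \<in> ext K \<Longrightarrow> y \<in> ext K \<Longrightarrow> cMem x y \<in> ext K" "x \<in> ext K \<Longrightarrow> y \<in> ext K \<Longrightarrow> cEq x y \<in> ext K"
    "x \<in> ext K \<Longrightarrow> cS x \<in> ext K" "x \<in> ext K \<Longrightarrow> y \<in> ext K \<Longrightarrow> cApp2 x y \<in> ext K"
    "x \<in> ext K \<Longrightarrow> cNeg x \<in> ext K" "x \<in> ext K \<Longrightarrow> y \<in> ext K \<Longrightarrow> cAnd x y \<in> ext K"
    "x \<in> ext K \<Longrightarrow> y \<in> ext K \<Longrightarrow> cAll x y \<in> ext K" "x \<in> ext K \<Longrightarrow> y \<in> ext K \<Longrightarrow> cAll2 x y \<in> ext K"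
  using assms Omega_in_model[OF assms num_in_Omega] by (auto simp: code_defs intro: model_opair)

lemma in_modelI: "v \<in> V \<Longrightarrow> \<exists>y\<in>ext K. ext y = ext v \<Longrightarrow> v \<in> ext K"
  using ext_eqI ext_in_V by metis

lemma opair_mem_closed:
  "model K \<Longrightarrow> f \<in> ext K \<Longrightarrow> opair x y \<epsilon> f \<Longrightarrow> x \<in> V \<Longrightarrow> y \<in> V \<Longrightarrow> x \<in> ext K \<and> y \<in> ext K"
  using model_opairD model_trans opair_mem_iff by blast

text \<open>The entries lie in \<open>K\<close> by induction along the sequence. For
  \<open>f\<close> itself a second induction is needed: there is no least \<open>k\<close> such that
  the part of \<open>f\<close> up to \<open>k\<close> is missing from \<open>K\<close>, because this
  part arises from the preceding one by adding a single pair of elements of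
  \<open>K\<close>.\<close>

lemma gen_closed:
  assumes K: "model K" and g: "genseq step n f" and m: "mono_step step"
    and st: "\<And>P y. y \<in> V \<Longrightarrow> step P y \<Longrightarrow> (\<And>z. z \<in> V \<Longrightarrow> P z \<Longrightarrow> z \<in> ext K) \<Longrightarrow> y \<in> ext K"
  shows "f \<in> ext K" "occ f y \<Longrightarrow> y \<in> ext K"
proof -
  have n: "n \<in> Omega" "n \<in> V" "f \<in> V" using genseq_in_V[OF g] by auto
  have entry: "y \<in> ext K" if y: "occ f y" for y
  proof -
    have "(\<lambda>e. e 0 \<epsilon> e (Suc 0)) (env (y # [K]))"
    proof (rule gen_induct[OF g m _ _ _ y])
      show "adef (\<lambda>e. e 0 \<epsilon> e (Suc 0))" by (intro adef_rules)
      show "set [K] \<subseteq> V" using K model_in_V by simp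
      fix P y assume "y \<in> V" "step P y" and P: "\<And>z. z \<in> V \<Longrightarrow> P z \<Longrightarrow> occ f z \<and> env (z # [K]) 0 \<epsilon> env (z # [K]) (Suc 0)"
      then have "y \<in> ext K" by (intro st[of y P]) (auto simp: mem_ext)
      then show "env (y # [K]) 0 \<epsilon> env (y # [K]) (Suc 0)" by (auto dest: extD)
    qed
    then show ?thesis using y by (simp add: mem_ext occ_def)
  qed
  then show "occ f y \<Longrightarrow> y \<in> ext K" .
  define pre where "pre A = {p \<in> ext f. \<exists>j\<in>A. \<exists>z\<in>V. p = opair j z \<and> True}" for A
  have "adef (\<lambda>e. \<not> (\<exists>h\<in>ext (e 2). ext h = {p \<in> ext (e 1). \<exists>j\<in>insert (e 0) (ext (e 0)). \<exists>z\<in>V. p = opair j z \<and> True}))"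
    by (intro adef_ex_snd adef_const adef_rules)
  from separation[OF this, of "[f, K]" "suc n"] n K model_in_V
  have "isset {k \<in> ext (suc n). \<not> (\<exists>h\<in>ext K. ext h = pre (insert k (ext k)))}" (is "isset ?B")
    unfolding pre_def by (simp add: numeral_2_eq_2)
  have good: "\<exists>h\<in>ext K. ext h = pre (insert k (ext k))" if k0: "k \<in> ext (suc n)" for k
  proof (rule ccontr)
    assume "\<not> ?thesis"
    then have "?B \<noteq> {}" using k0 by blast
    then obtain k where k: "k \<in> ?B" "\<forall>j\<in>ext k. j \<notin> ?B"
      using Omega_min[OF Omega_suc[OF n(1)] \<open>isset ?B\<close>] by blast
    have kO: "k \<in> Omega" "k \<in> V" using k(1) Omega_elem[OF Omega_suc[OF n(1)]] by auto
    have kn: "k \<in> insert n (ext n)" using k(1) n by simp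
    obtain y where y: "y \<in> V" "opair k y \<epsilon> f"
      using is_fun_ex[of f "insert n (ext n)" V k] g kn unfolding genseq_def by blast
    have prev: "\<exists>h\<in>ext K. ext h = pre (ext k)"
    proof -
      consider "ext k = {}" | m where "m \<in> V" "ext k = insert m (ext m)"
        using Omega_zs[OF kO(1)] unfolding zero_or_suc_def by blast
      then show ?thesis
      proof cases
        case 1
        then show ?thesis using model_empty[OF K] num_0(2) by (intro bexI[of _ "num 0"]) (auto simp: pre_def)
      next
        case 2
        then have "m \<in> ext k" by simp
        moreover from this have "m \<in> ext (suc n)" using k(1) Omega_trans[OF Omega_suc[OF n(1)]] by blast
        ultimately have "\<exists>h\<in>ext K. ext h = pre (insert m (ext m))" using k(2) by blast
        then show ?thesis using 2 by simp
      qed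
    qed
    have one: "pre (insert k (ext k)) = insert (opair k y) (pre (ext k))"
    proof (intro set_eqI iffI)
      fix p assume "p \<in> pre (insert k (ext k))"
      then obtain j z where jz: "p \<in> ext f" "j = k \<or> j \<in> ext k" "z \<in> V" "p = opair j z" by (auto simp: pre_def)
      show "p \<in> insert (opair k y) (pre (ext k))"
      proof (cases "j = k")
        case True
        then have "opair k z \<epsilon> f" using jz extD by blast
        then have "z = y" using genseq_unique[OF g] y jz kO by blast
        then show ?thesis using jz True by simp
      next
        case False
        then show ?thesis using jz by (auto simp: pre_def)
      qed
    next
      fix p assume "p \<in> insert (opair k y) (pre (ext k))"
      then show "p \<in> pre (insert k (ext k))" using y kO by (auto simp: pre_def opair_mem_iff[symmetric])
    qed
    obtain h where h: "h \<in> ext K" "ext h = pre (ext k)" using prev by blast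
    have "occ f y" using y kO by (auto simp: occ_def)
    then have "opair k y \<in> ext K" using entry Omega_in_model[OF K kO(1)] model_opair[OF K] by blast
    then have "mk (insert (opair k y) (ext h)) \<in> ext K" by (rule model_insert[OF K _ h(1)])
    moreover have "ext (mk (insert (opair k y) (ext h))) = insert (opair k y) (ext h)"
      using y kO ext_in_V[OF h(1)] by simp
    then have "ext (mk (insert (opair k y) (ext h))) = pre (insert k (ext k))"
      unfolding one h(2) .
    ultimately show False using k(1) by blast
  qed
  then obtain h where h: "h \<in> ext K" "ext h = pre (insert n (ext n))" using n by auto
  have "pre (insert n (ext n)) = ext f"
    unfolding pre_def using genseq_elem[OF g] by auto
  then have "f = h" using h n ext_eqI ext_in_V by metis
  then show "f \<in> ext K" using h by simp
qed

lemma generated_closed: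
  assumes "model K" "generated step y" "mono_step step"
    "\<And>P y. y \<in> V \<Longrightarrow> step P y \<Longrightarrow> (\<And>z. z \<in> V \<Longrightarrow> P z \<Longrightarrow> z \<in> ext K) \<Longrightarrow> y \<in> ext K"
  shows "y \<in> ext K"
proof -
  obtain n f where g: "genseq step n f" "occ f y" using generated_occ[OF assms(2)] by blast
  show ?thesis by (rule gen_closed(2)[OF assms(1) g(1) assms(3) _ g(2)]) (rule assms(4))
qed

text \<open>Closure of models under one step yields absoluteness of everything generated: by
  \<open>gen_closed\<close> the sequence lies in the model, so the quantifier over sequences can be
  confined. In the first premise index \<open>0\<close> is the entry, \<open>1\<close> the stage and
  \<open>2\<close> the sequence.\<close>

lemma adef_generated:
  assumes st: "adef (\<lambda>e. step (\<lambda>n. e (Suc (Suc (Suc n)))) (\<lambda>z. \<exists>j\<in>ext (e (Suc 0)). opair j z \<epsilon> e (Suc (Suc 0))) (e 0))"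
    and mono: "\<And>e. mono_step (step e)"
    and closed: "\<And>K e P y. model K \<Longrightarrow> range e \<subseteq> ext K \<Longrightarrow> y \<in> V \<Longrightarrow> step e P y \<Longrightarrow>
       (\<And>z. z \<in> V \<Longrightarrow> P z \<Longrightarrow> z \<in> ext K) \<Longrightarrow> y \<in> ext K"
    and F: "aterm F"
  shows "adef (\<lambda>e. generated (step e) (F e))"
proof -
  have main: "adef (\<lambda>e. generated (step (\<lambda>n. e (Suc n))) (e 0))"
  proof (rule adef_cong)
    show "adef (\<lambda>e. \<exists>n\<in>Omega. \<exists>f\<in>V. genseq (step (\<lambda>n. e (Suc n))) n f \<and> opair n (e 0) \<epsilon> f)"
    proof (rule adef_bex[OF acls_Omega], rule adef_exV, rule adef_and)
      have "adef (\<lambda>e. step (\<lambda>n. e (Suc (Suc (Suc (Suc (Suc n)))))) (\<lambda>z. \<exists>j\<in>ext (e (Suc 0)). opair j z \<epsilon> e (Suc (Suc 0))) (e 0))"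
        using adef_rename[OF st, of "\<lambda>n. if n < 3 then n else Suc (Suc n)"] by simp
      then have "adef (\<lambda>e. e (Suc 0) \<in> Omega \<and> is_fun (e 0) (insert (e (Suc 0)) (ext (e (Suc 0)))) V \<and>
        (\<forall>k\<in>insert (e (Suc 0)) (ext (e (Suc 0))). \<not> (\<exists>y\<in>V. opair k y \<epsilon> e 0 \<and>
          \<not> step (\<lambda>n. e (Suc (Suc (Suc n)))) (\<lambda>z. \<exists>j\<in>ext k. opair j z \<epsilon> e 0) y)))"
        by (intro adef_and adef_in[OF aterm_var acls_Omega] adef_is_fun_V adef_ball adef_not
            adef_ex_value[where R = "\<lambda>y e. \<not> step (\<lambda>n. e (Suc (Suc (Suc (Suc n))))) (\<lambda>z. \<exists>j\<in>ext (e 0). opair j z \<epsilon> e (Suc 0)) y"]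
            acls_insert acls_ext aterm_var)
      then show "adef (\<lambda>e. genseq (step (\<lambda>n. e (Suc (Suc (Suc n))))) (e (Suc 0)) (e 0))"
        by (rule adef_cong) (auto simp: genseq_def is_fun_def)
      show "adef (\<lambda>e. opair (e (Suc 0)) (e (Suc (Suc 0))) \<epsilon> e 0)" by (intro adef_rules)
    next
      fix K x and e :: "nat \<Rightarrow> 'a"
      assume K: "model K" "range e \<subseteq> ext K" "x \<in> V"
        and g: "genseq (step (\<lambda>n. e (Suc (Suc n)))) (e 0) x \<and> opair (e 0) (e (Suc 0)) \<epsilon> x"
      show "x \<in> ext K"
        by (rule gen_closed(1)[OF K(1) conjunct1[OF g] mono]) (rule closed[OF K(1) range_Suc[OF range_Suc[OF K(2)]]])
    qed
    fix K and e :: "nat \<Rightarrow> 'a" assume K: "model K" "range e \<subseteq> ext K"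
    then have "e 0 \<in> V" using ext_in_V by auto
    then show "generated (step (\<lambda>n. e (Suc n))) (e 0) \<longleftrightarrow>
      (\<exists>n\<in>Omega. \<exists>f\<in>V. genseq (step (\<lambda>n. e (Suc n))) n f \<and> opair n (e 0) \<epsilon> f)"
      unfolding generated_iff using genseq_in_V by blast
  qed
  show ?thesis by (rule adef_sub[OF main F])
qed

text \<open>The predicate that a formation step receives at stage \<open>k\<close> of the sequence
  \<open>f\<close>. Definability of steps is shown for this argument, since an arbitrary predicate
  is not among the individuals on which a formula can depend.\<close>

definition prior :: "'a \<Rightarrow> 'a \<Rightarrow> 'a \<Rightarrow> 'a \<Rightarrow> 'a \<Rightarrow> bool" where
  "prior k f \<psi> w s \<longleftrightarrow> (\<exists>j\<in>ext k. opair j (triple \<psi> w s) \<epsilon> f)"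

lemma adef_prior:
  assumes "aterm A" "aterm B" "aterm F" "aterm G" "aterm H"
  shows "adef (\<lambda>e. prior (A e) (B e) (F e) (G e) (H e))"
  unfolding prior_def
  by (intro adef_bex acls_ext adef_opair_mem aterm_triple aterm_var assms assms[THEN aterm_lift])

lemma prior_closed:
  assumes K: "model K" "f \<in> ext K" and p: "prior k f \<psi> w s" and V: "\<psi> \<in> V" "w \<in> V" "s \<in> V"
  shows "\<psi> \<in> ext K \<and> w \<in> ext K \<and> s \<in> ext K"
proof -
  obtain j where "j \<in> ext k" "opair j (triple \<psi> w s) \<epsilon> f" using p by (auto simp: prior_def)
  then have "triple \<psi> w s \<in> ext K" using opair_mem_closed[OF K, of j "triple \<psi> w s"] V ext_in_V by simp
  then show ?thesis using model_tripleD[OF K(1)] V by blast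
qed

lemma adef_formed:
  assumes st: "adef (\<lambda>e. step (\<lambda>n. e (Suc (Suc (Suc (Suc (Suc n)))))) (prior (e (Suc (Suc (Suc 0)))) (e (Suc (Suc (Suc (Suc 0))))))
      (e (Suc (Suc 0))) (e (Suc 0)) (e 0))"
    and mono: "\<And>e. mono3 (step e)"
    and closed: "\<And>K e P \<phi> v r. model K \<Longrightarrow> range e \<subseteq> ext K \<Longrightarrow> \<phi> \<in> V \<Longrightarrow> v \<in> V \<Longrightarrow> r \<in> V \<Longrightarrow> step e P \<phi> v r \<Longrightarrow>
       (\<And>\<psi> w s. \<psi> \<in> V \<Longrightarrow> w \<in> V \<Longrightarrow> s \<in> V \<Longrightarrow> P \<psi> w s \<Longrightarrow> \<psi> \<in> ext K \<and> w \<in> ext K \<and> s \<in> ext K) \<Longrightarrow>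
       \<phi> \<in> ext K \<and> v \<in> ext K \<and> r \<in> ext K"
  shows "adef (\<lambda>e. formed_by (step e) (e i) (e j) (e k))"
proof -
  have cl: "y \<in> ext K" if K: "model K" "range e \<subseteq> ext K" and y: "y \<in> V" "lift3 (step e) P y"
    and P: "\<And>z. z \<in> V \<Longrightarrow> P z \<Longrightarrow> z \<in> ext K" for K e P y
  proof -
    obtain \<phi> v r where *: "\<phi> \<in> V" "v \<in> V" "r \<in> V" "y = triple \<phi> v r" "step e (\<lambda>\<psi> w s. P (triple \<psi> w s)) \<phi> v r"
      using y(2) unfolding lift3_def by (elim bexE conjE)
    have "\<phi> \<in> ext K \<and> v \<in> ext K \<and> r \<in> ext K"
    proof (rule closed[OF K *(1-3,5)])
      show "\<psi> \<in> ext K \<and> w \<in> ext K \<and> s \<in> ext K" if "\<psi> \<in> V" "w \<in> V" "s \<in> V" "P (triple \<psi> w s)" for \<psi> w s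
        by (rule model_tripleD[OF K(1) P[OF triple_in_V[OF that(1-3)] that(4)] that(1-3)])
    qed
    then show ?thesis using * closure_rules(2)[OF K(1)] by simp
  qed
  have g: "adef (\<lambda>e. generated (lift3 (step e)) (F e))" if F: "aterm F" for F
  proof (rule adef_generated[OF _ _ _ F])
    show "adef (\<lambda>e. lift3 (step (\<lambda>n. e (Suc (Suc (Suc n))))) (\<lambda>z. \<exists>j\<in>ext (e (Suc 0)). opair j z \<epsilon> e (Suc (Suc 0))) (e 0))"
      unfolding lift3_def prior_def[symmetric]
    proof (rule adef_ex_triple[OF aterm_var])
      have "adef (\<lambda>e. step (\<lambda>n. e (Suc (Suc (Suc (Suc (Suc (Suc n))))))) (\<lambda>\<psi> w s. prior (e (Suc (Suc (Suc (Suc 0))))) (e (Suc (Suc (Suc (Suc (Suc 0)))))) \<psi> w s)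
          (e (Suc (Suc 0))) (e (Suc 0)) (e 0))"
        using adef_rename[OF st, of "\<lambda>n. if n < 3 then n else Suc n"] by simp
      then show "adef (\<lambda>e. step (\<lambda>n. e (Suc (Suc (Suc (Suc (Suc (Suc n)))))))
        (\<lambda>\<psi> w s. prior (e (Suc (Suc (Suc (Suc 0))))) (e (Suc (Suc (Suc (Suc (Suc 0)))))) \<psi> w s)
          (e (Suc (Suc 0))) (e (Suc 0)) (e 0))" .
    qed
    show "mono_step (lift3 (step e))" for e by (rule mono_lift3[OF mono])
    show "y \<in> ext K" if "model K" "range e \<subseteq> ext K" "y \<in> V" "lift3 (step e) P y"
      "\<And>z. z \<in> V \<Longrightarrow> P z \<Longrightarrow> z \<in> ext K" for K e P y
      by (rule cl[OF that])
  qed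
  show "adef (\<lambda>e. formed_by (step e) (e i) (e j) (e k))"
  proof (rule adef_cong[OF g])
    show "aterm (\<lambda>e. triple (e i) (e j) (e k))" by (intro aterm_triple aterm_var)
    show "formed_by (step e) (e i) (e j) (e k) \<longleftrightarrow> generated (lift3 (step e)) (triple (e i) (e j) (e k))"
      if "model K" "range e \<subseteq> ext K" for K e
      unfolding formed_by_iff using that ext_in_V by auto
  qed
qed

lemma formed_closed:
  assumes K: "model K" and m: "mono3 step"
    and st: "\<And>P \<phi> v r. \<phi> \<in> V \<Longrightarrow> v \<in> V \<Longrightarrow> r \<in> V \<Longrightarrow> step P \<phi> v r \<Longrightarrow>
       (\<And>\<psi> w s. \<psi> \<in> V \<Longrightarrow> w \<in> V \<Longrightarrow> s \<in> V \<Longrightarrow> P \<psi> w s \<Longrightarrow> \<psi> \<in> ext K \<and> w \<in> ext K \<and> s \<in> ext K) \<Longrightarrow>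
       \<phi> \<in> ext K \<and> v \<in> ext K \<and> r \<in> ext K"
    and f: "formed_by step \<phi> v r"
  shows "\<phi> \<in> ext K \<and> v \<in> ext K \<and> r \<in> ext K"
proof -
  define R where "R \<phi> v r k q \<longleftrightarrow> \<phi> \<epsilon> k \<and> v \<epsilon> k \<and> r \<epsilon> k" for \<phi> v r k q :: 'a
  have R: "R \<phi> v r K K \<longleftrightarrow> \<phi> \<in> ext K \<and> v \<in> ext K \<and> r \<in> ext K" if "\<phi> \<in> V" "v \<in> V" "r \<in> V" for \<phi> v r
    unfolding R_def using that by (simp add: mem_ext)
  have "R \<phi> v r K K"
  proof (rule formed_induct[where R = R, OF f m])
    show "adef (\<lambda>e. R (e 0) (e (Suc 0)) (e (Suc (Suc 0))) (e (Suc (Suc (Suc 0)))) (e (Suc (Suc (Suc (Suc 0))))))"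
      unfolding R_def by (intro adef_rules)
    fix \<phi> v r assume V: "\<phi> \<in> V" "v \<in> V" "r \<in> V"
      and s: "step (\<lambda>\<phi> v r. formed_by step \<phi> v r \<and> R \<phi> v r K K) \<phi> v r"
    show "R \<phi> v r K K" unfolding R[OF V] by (rule st[OF V s]) (use R in blast)
  qed (use model_in_V[OF K] in simp_all)
  then show ?thesis using R f unfolding formed_by_iff by blast
qed

lemma acls_terms: "aterm F \<Longrightarrow> acls (\<lambda>e. terms (ext (F e)))"
proof (rule acls_comp1[of "\<lambda>c. terms (ext c)"], rule aclsI)
  fix i
  show "terms (ext (e i)) \<subseteq> ext K" if "model K" "range e \<subseteq> ext K" for K and e :: "nat \<Rightarrow> 'a"
    using that Omega_in_model[OF that(1)] closure_rules(4,5)[OF that(1)] model_trans[OF that(1)]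
    unfolding terms_def by blast
  have "adef (\<lambda>e. (\<exists>j\<in>Omega. e 0 = var j) \<or> (\<exists>c\<in>ext (e (Suc i)). e 0 = con c))"
    by (intro adef_rules acls_Omega aterm_codes)
  then show "adef (\<lambda>e. e 0 \<in> terms (ext (e (Suc i))))"
    by (rule adef_cong) (auto simp: terms_def)
qed

lemma acls_term_vars: "aterm F \<Longrightarrow> acls (\<lambda>e. term_vars (F e))"
  unfolding term_vars_def
  by (intro acls_Collect acls_Omega adef_eq aterm_lift aterm_codes aterm_var)

lemma adef_set_atom: "adef (\<lambda>e. set_atom (ext (e i)) (e j) (e k) (e l))"
  unfolding set_atom_def
  by (intro adef_rules acls_terms acls_term_vars aterm_codes)

lemma adef_predicate_atom: "adef (\<lambda>e. predicate_atom (ext (e i)) (e j) (e k) (e l))"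
  unfolding predicate_atom_def
  by (intro adef_rules acls_terms acls_term_vars aterm_codes acls_Omega)

lemma adef_second_order_step: "adef (\<lambda>e. second_order_step (prior (e a) (e b)) (e i) (e j) (e k))"
  unfolding second_order_step_def
proof (rule adef_bex[OF acls_Omega], rule adef_exV2)
  show "adef (\<lambda>e. e (Suc (Suc (Suc i))) = cAll2 (e (Suc (Suc 0))) (e (Suc 0)) \<and>
      prior (e (Suc (Suc (Suc a)))) (e (Suc (Suc (Suc b)))) (e (Suc 0)) (e (Suc (Suc (Suc j)))) (e 0) \<and>
      ext (e (Suc (Suc (Suc k)))) = ext (e 0) - {e (Suc (Suc 0))})"
    by (intro adef_prior aterm_codes adef_rules)
  show "x \<in> ext K \<and> y \<in> ext K" if "model K" "range e \<subseteq> ext K" "x \<in> V" "y \<in> V"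
    "e (Suc i) = cAll2 (e 0) x \<and> prior (e (Suc a)) (e (Suc b)) x (e (Suc j)) y \<and> ext (e (Suc k)) = ext y - {e 0}"
    for K x y and e :: "nat \<Rightarrow> 'a"
    using prior_closed[OF that(1), of "e (Suc b)" "e (Suc a)" x "e (Suc j)" y] that ext_in_V by auto
qed

lemma adef_first_order_step: "adef (\<lambda>e. first_order_step (prior (e a) (e b)) (e i) (e j) (e k))"
  unfolding first_order_step_def
proof (intro adef_or)
  show "adef (\<lambda>e. \<exists>p\<in>V. e i = cNeg p \<and> prior (e a) (e b) p (e j) (e k))"
  proof (rule adef_exV)
    show "adef (\<lambda>e. e (Suc i) = cNeg (e 0) \<and> prior (e (Suc a)) (e (Suc b)) (e 0) (e (Suc j)) (e (Suc k)))"
      by (intro adef_prior aterm_codes adef_rules)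
    show "x \<in> ext K" if "model K" "range e \<subseteq> ext K" "x \<in> V" "e i = cNeg x \<and> prior (e a) (e b) x (e j) (e k)"
      for K x and e :: "nat \<Rightarrow> 'a"
      using prior_closed[OF that(1), of "e b" "e a" x "e j" "e k"] that ext_in_V by auto
  qed
  show "adef (\<lambda>e. \<exists>p\<in>V. \<exists>q\<in>V. \<exists>v1\<in>V. \<exists>v2\<in>V. \<exists>r1\<in>V. \<exists>r2\<in>V. e i = cAnd p q \<and>
      prior (e a) (e b) p v1 r1 \<and> prior (e a) (e b) q v2 r2 \<and>
        ext (e j) = ext v1 \<union> ext v2 \<and> ext (e k) = ext r1 \<union> ext r2)"
  proof (rule adef_exV6)
    show "p \<in> ext K \<and> q \<in> ext K \<and> v1 \<in> ext K \<and> v2 \<in> ext K \<and> r1 \<in> ext K \<and> r2 \<in> ext K"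
      if "model K" "range e \<subseteq> ext K" "p \<in> V" "q \<in> V" "v1 \<in> V" "v2 \<in> V" "r1 \<in> V" "r2 \<in> V"
      "e i = cAnd p q \<and> prior (e a) (e b) p v1 r1 \<and> prior (e a) (e b) q v2 r2 \<and>
        ext (e j) = ext v1 \<union> ext v2 \<and> ext (e k) = ext r1 \<union> ext r2" for K p q v1 v2 r1 r2 and e :: "nat \<Rightarrow> 'a"
      using prior_closed[OF that(1), of "e b" "e a" p v1 r1] prior_closed[OF that(1), of "e b" "e a" q v2 r2] that by auto
  qed (intro adef_prior aterm_codes adef_rules)
  show "adef (\<lambda>e. \<exists>ia\<in>Omega. \<exists>p\<in>V. \<exists>w\<in>V. e i = cAll ia p \<and> prior (e a) (e b) p w (e k) \<and> ext (e j) = ext w - {ia})"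
  proof (rule adef_bex[OF acls_Omega], rule adef_exV2)
    show "x \<in> ext K \<and> y \<in> ext K" if "model K" "range e \<subseteq> ext K" "x \<in> V" "y \<in> V"
      "e (Suc i) = cAll (e 0) x \<and> prior (e (Suc a)) (e (Suc b)) x y (e (Suc k)) \<and> ext (e (Suc j)) = ext y - {e 0}"
      for K x y and e :: "nat \<Rightarrow> 'a"
      using prior_closed[OF that(1), of "e (Suc b)" "e (Suc a)" x y "e (Suc k)"] that ext_in_V by auto
  qed (intro adef_prior aterm_codes adef_rules)
qed

section \<open>Closure of models under the formation steps\<close>

lemma model_Diff: assumes K: "model K" and w: "w \<in> ext K" "i \<in> ext K"
  shows "\<exists>y\<in>ext K. ext y = ext w - {i}"
proof -
  have "adef (\<lambda>e. e 0 \<noteq> e (Suc 0))" by (intro adef_rules)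
  from model_sep[OF K this, of "\<lambda>_. i" w] w show ?thesis by (auto simp: set_diff_eq)
qed

lemma term_vars_closed: assumes K: "model K" shows "\<exists>y\<in>ext K. ext y = term_vars t"
proof (cases "\<exists>i\<in>Omega. t = var i")
  case True
  then obtain i where i: "i \<in> Omega" "t = var i" by blast
  have "mk {i, i} \<in> ext K" using model_pair[OF K] Omega_in_model[OF K i(1)] by blast
  then show ?thesis using i by (intro bexI[of _ "mk {i, i}"]) (auto simp: term_vars_var)
next
  case False
  then have "ext (num 0) = term_vars t" by (auto simp: term_vars_def)
  then show ?thesis using model_empty[OF K] by blast
qed

lemma Un_closed: "model K \<Longrightarrow> \<exists>y\<in>ext K. ext y = A \<Longrightarrow> \<exists>y\<in>ext K. ext y = B \<Longrightarrow> \<exists>y\<in>ext K. ext y = A \<union> B"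
proof (elim bexE)
  fix x y assume K: "model K" and xy: "x \<in> ext K" "ext x = A" "y \<in> ext K" "ext y = B"
  have "mk (ext x \<union> ext y) \<in> ext K" by (rule model_Un[OF K xy(1,3)])
  moreover have "ext (mk (ext x \<union> ext y)) = ext x \<union> ext y"
    using ext_in_V[OF xy(1)] ext_in_V[OF xy(3)] by simp
  then have "ext (mk (ext x \<union> ext y)) = A \<union> B" unfolding xy(2,4) .
  ultimately show ?thesis by blast
qed

lemma empty_closed: "model K \<Longrightarrow> \<exists>y\<in>ext K. ext y = {}"
  using model_empty num_0(2) by blast

lemma terms_closed: "model K \<Longrightarrow> C \<subseteq> ext K \<Longrightarrow> t \<in> terms C \<Longrightarrow> t \<in> ext K"
  unfolding terms_def using Omega_in_model closure_rules(4,5) by blast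

lemma set_atom_closed:
  assumes K: "model K" "C \<subseteq> ext K" and V: "v \<in> V" "r \<in> V" and s: "set_atom C \<phi> v r"
  shows "\<phi> \<in> ext K \<and> v \<in> ext K \<and> r \<in> ext K"
proof -
  obtain s t where st: "s \<in> terms C" "t \<in> terms C" "\<phi> = cMem s t \<or> \<phi> = cEq s t"
    "ext v = term_vars s \<union> term_vars t" "ext r = {}" using s unfolding set_atom_def by blast
  have "\<phi> \<in> ext K" using st(3) terms_closed[OF K st(1)] terms_closed[OF K st(2)] closure_rules(6,7)[OF K(1)] by blast
  moreover have "v \<in> ext K" by (rule in_modelI[OF V(1)]) (unfold st(4), intro Un_closed term_vars_closed K(1))
  moreover have "r \<in> ext K" by (rule in_modelI[OF V(2)]) (unfold st(5), rule empty_closed[OF K(1)])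
  ultimately show ?thesis by blast
qed

lemma predicate_atom_closed:
  assumes K: "model K" "C \<subseteq> ext K" and V: "v \<in> V" "r \<in> V" and s: "predicate_atom C \<phi> v r"
  shows "\<phi> \<in> ext K \<and> v \<in> ext K \<and> r \<in> ext K"
  using s unfolding predicate_atom_def
proof (elim disjE bexE conjE)
  fix t assume t: "t \<in> terms C" "\<phi> = cS t" "ext v = term_vars t" "ext r = {}"
  have "v \<in> ext K" by (rule in_modelI[OF V(1)]) (unfold t(3), intro term_vars_closed K(1))
  moreover have "r \<in> ext K" by (rule in_modelI[OF V(2)]) (unfold t(4), rule empty_closed[OF K(1)])
  ultimately show ?thesis using t(2) terms_closed[OF K t(1)] closure_rules(8)[OF K(1)] by blast
next
  fix j t assume t: "j \<in> Omega" "t \<in> terms C" "\<phi> = cApp2 j t" "ext v = term_vars t" "ext r = {j}"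
  have j: "j \<in> ext K" by (rule Omega_in_model[OF K(1) t(1)])
  have "v \<in> ext K" by (rule in_modelI[OF V(1)]) (unfold t(4), intro term_vars_closed K(1))
  moreover have "\<exists>y\<in>ext K. ext y = {j}"
    using model_pair[OF K(1) j j] t(1) by (intro bexI[of _ "mk {j, j}"]) auto
  then have "r \<in> ext K" by (intro in_modelI[OF V(2)]) (unfold t(5))
  ultimately show ?thesis using t(3) j terms_closed[OF K t(2)] closure_rules(9)[OF K(1)] by blast
qed

lemma first_order_step_closed:
  assumes K: "model K" and V: "v \<in> V" "r \<in> V" and s: "first_order_step P \<phi> v r"
    and P: "\<And>\<psi> w s. \<psi> \<in> V \<Longrightarrow> w \<in> V \<Longrightarrow> s \<in> V \<Longrightarrow> P \<psi> w s \<Longrightarrow> \<psi> \<in> ext K \<and> w \<in> ext K \<and> s \<in> ext K"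
  shows "\<phi> \<in> ext K \<and> v \<in> ext K \<and> r \<in> ext K"
  using s unfolding first_order_step_def
proof (elim disjE bexE conjE)
  fix p assume "p \<in> V" "\<phi> = cNeg p" "P p v r"
  then show ?thesis using P[of p v r] V closure_rules(10)[OF K] by blast
next
  fix p q v1 v2 r1 r2 assume a: "p \<in> V" "q \<in> V" "v1 \<in> V" "v2 \<in> V" "r1 \<in> V" "r2 \<in> V"
    "\<phi> = cAnd p q" "P p v1 r1" "P q v2 r2" "ext v = ext v1 \<union> ext v2" "ext r = ext r1 \<union> ext r2"
  have *: "p \<in> ext K" "v1 \<in> ext K" "r1 \<in> ext K" "q \<in> ext K" "v2 \<in> ext K" "r2 \<in> ext K"
    using P[of p v1 r1] P[of q v2 r2] a by auto
  have "v \<in> ext K" by (rule in_modelI[OF V(1)]) (unfold a(10), rule Un_closed[OF K], (use * in blast)+)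
  moreover have "r \<in> ext K" by (rule in_modelI[OF V(2)]) (unfold a(11), rule Un_closed[OF K], (use * in blast)+)
  ultimately show ?thesis using * a(7) closure_rules(11)[OF K] by blast
next
  fix i p w assume a: "i \<in> Omega" "p \<in> V" "w \<in> V" "\<phi> = cAll i p" "P p w r" "ext v = ext w - {i}"
  have *: "p \<in> ext K" "w \<in> ext K" "r \<in> ext K" "i \<in> ext K" using P[of p w r] a V Omega_in_model[OF K] by auto
  have "v \<in> ext K" by (rule in_modelI[OF V(1)]) (unfold a(6), rule model_Diff[OF K *(2,4)])
  then show ?thesis using * a(4) closure_rules(12)[OF K] by blast
qed

lemma second_order_step_closed:
  assumes K: "model K" and V: "v \<in> V" "r \<in> V" and s: "second_order_step P \<phi> v r"
    and P: "\<And>\<psi> w s. \<psi> \<in> V \<Longrightarrow> w \<in> V \<Longrightarrow> s \<in> V \<Longrightarrow> P \<psi> w s \<Longrightarrow> \<psi> \<in> ext K \<and> w \<in> ext K \<and> s \<in> ext K"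
  shows "\<phi> \<in> ext K \<and> v \<in> ext K \<and> r \<in> ext K"
proof -
  obtain j p s where a: "j \<in> Omega" "p \<in> V" "s \<in> V" "\<phi> = cAll2 j p" "P p v s" "ext r = ext s - {j}"
    using s unfolding second_order_step_def by blast
  have *: "p \<in> ext K" "v \<in> ext K" "s \<in> ext K" "j \<in> ext K" using P[of p v s] a V Omega_in_model[OF K] by auto
  have "r \<in> ext K" by (rule in_modelI[OF V(2)]) (unfold a(6), rule model_Diff[OF K *(3,4)])
  then show ?thesis using * a(4) closure_rules(13)[OF K] by blast
qed

lemma L2_step_closed:
  assumes K: "model K" "C \<subseteq> ext K" and V: "v \<in> V" "r \<in> V" and s: "L2_step C P \<phi> v r"
    and P: "\<And>\<psi> w s. \<psi> \<in> V \<Longrightarrow> w \<in> V \<Longrightarrow> s \<in> V \<Longrightarrow> P \<psi> w s \<Longrightarrow> \<psi> \<in> ext K \<and> w \<in> ext K \<and> s \<in> ext K"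
  shows "\<phi> \<in> ext K \<and> v \<in> ext K \<and> r \<in> ext K"
  using s unfolding L2_step_def
proof (elim disjE)
  assume "set_atom C \<phi> v r"
  then show ?thesis by (rule set_atom_closed[OF K V])
next
  assume "predicate_atom C \<phi> v r"
  then show ?thesis by (rule predicate_atom_closed[OF K V])
next
  assume "first_order_step P \<phi> v r"
  then show ?thesis by (rule first_order_step_closed[OF K(1) V _ P])
next
  assume "second_order_step P \<phi> v r"
  then show ?thesis by (rule second_order_step_closed[OF K(1) V _ P])
qed

lemma NS_step_closed:
  assumes K: "model K" "C \<subseteq> ext K" and V: "v \<in> V" "r \<in> V" and s: "NS_step C P \<phi> v r"
    and P: "\<And>\<psi> w s. \<psi> \<in> V \<Longrightarrow> w \<in> V \<Longrightarrow> s \<in> V \<Longrightarrow> P \<psi> w s \<Longrightarrow> \<psi> \<in> ext K \<and> w \<in> ext K \<and> s \<in> ext K"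
  shows "\<phi> \<in> ext K \<and> v \<in> ext K \<and> r \<in> ext K"
  by (rule L2_step_closed[OF K V _ P]) (use s in \<open>auto simp: L2_step_def NS_step_def\<close>)

lemma L_step_closed:
  assumes K: "model K" and V: "v \<in> V" "r \<in> V" and s: "L_step P \<phi> v r"
    and P: "\<And>\<psi> w s. \<psi> \<in> V \<Longrightarrow> w \<in> V \<Longrightarrow> s \<in> V \<Longrightarrow> P \<psi> w s \<Longrightarrow> \<psi> \<in> ext K \<and> w \<in> ext K \<and> s \<in> ext K"
  shows "\<phi> \<in> ext K \<and> v \<in> ext K \<and> r \<in> ext K"
  by (rule L2_step_closed[OF K empty_subsetI V L_step_imp[OF s] P])

lemma L2_closed:
  assumes "model K" "C \<subseteq> ext K" "L2_formula C \<phi> v r"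
  shows "\<phi> \<in> ext K \<and> v \<in> ext K \<and> r \<in> ext K"
  by (rule formed_closed[OF assms(1) mono3_steps(2) _ assms(3)[unfolded formula_iffs]])
    (rule L2_step_closed[OF assms(1,2)])

lemma NS_closed:
  assumes "model K" "C \<subseteq> ext K" "no_second_order_quantifiers C \<phi> v r"
  shows "\<phi> \<in> ext K \<and> v \<in> ext K \<and> r \<in> ext K"
  by (rule formed_closed[OF assms(1) mono3_steps(3) _ assms(3)[unfolded formula_iffs]])
    (rule NS_step_closed[OF assms(1,2)])

lemma L_closed: "model K \<Longrightarrow> L_formula \<phi> v \<Longrightarrow> \<phi> \<in> ext K \<and> v \<in> ext K"
  using L2_closed[OF _ empty_subsetI L_imp_L2] by blast

lemma Pi_step_closed:
  assumes K: "model K" "C \<subseteq> ext K" and V: "v \<in> V" "r \<in> V" and s: "Pi_step C P \<phi> v r"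
    and P: "\<And>\<psi> w s. \<psi> \<in> V \<Longrightarrow> w \<in> V \<Longrightarrow> s \<in> V \<Longrightarrow> P \<psi> w s \<Longrightarrow> \<psi> \<in> ext K \<and> w \<in> ext K \<and> s \<in> ext K"
  shows "\<phi> \<in> ext K \<and> v \<in> ext K \<and> r \<in> ext K"
  using s unfolding Pi_step_def
proof
  assume "no_second_order_quantifiers C \<phi> v r"
  then show ?thesis by (rule NS_closed[OF K])
next
  assume "second_order_step P \<phi> v r"
  then show ?thesis by (rule second_order_step_closed[OF K(1) V _ P])
qed

lemma Pi11_closed:
  assumes "model K" "C \<subseteq> ext K" "Pi11_sentence C \<phi>"
  shows "\<phi> \<in> ext K"
proof -
  have "\<phi> \<in> ext K \<and> num 0 \<in> ext K \<and> num 0 \<in> ext K"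
    by (rule formed_closed[OF assms(1) mono3_steps(4) _ assms(3)[unfolded Pi11_sentence_def formula_iffs]])
      (rule Pi_step_closed[OF assms(1,2)])
  then show ?thesis ..
qed

section \<open>Definability of the classes of formulas\<close>

lemma ext_closed: "model K \<Longrightarrow> m \<in> ext K \<Longrightarrow> ext m \<subseteq> ext K"
  using model_trans by blast

lemma ext_range_closed: "model K \<Longrightarrow> range e \<subseteq> ext K \<Longrightarrow> ext (e c) \<subseteq> ext K"
  using ext_closed by blast

lemma adef_L2_formula: "adef (\<lambda>e. L2_formula (ext (e c)) (e i) (e j) (e k))"
  unfolding formula_iffs
proof (rule adef_formed[where step = "\<lambda>e. L2_step (ext (e c))", OF _ mono3_steps(2)])
  show "adef (\<lambda>e. L2_step (ext (e (Suc (Suc (Suc (Suc (Suc c))))))) (prior (e (Suc (Suc (Suc 0)))) (e (Suc (Suc (Suc (Suc 0))))))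
      (e (Suc (Suc 0))) (e (Suc 0)) (e 0))"
    unfolding L2_step_def by (intro adef_or adef_set_atom adef_predicate_atom adef_first_order_step adef_second_order_step)
qed (rule L2_step_closed[OF _ ext_range_closed])

lemma adef_no_second_order_quantifiers: "adef (\<lambda>e. no_second_order_quantifiers (ext (e c)) (e i) (e j) (e k))"
  unfolding formula_iffs
proof (rule adef_formed[where step = "\<lambda>e. NS_step (ext (e c))", OF _ mono3_steps(3)])
  show "adef (\<lambda>e. NS_step (ext (e (Suc (Suc (Suc (Suc (Suc c))))))) (prior (e (Suc (Suc (Suc 0)))) (e (Suc (Suc (Suc (Suc 0))))))
      (e (Suc (Suc 0))) (e (Suc 0)) (e 0))"
    unfolding NS_step_def by (intro adef_or adef_set_atom adef_predicate_atom adef_first_order_step)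
qed (rule NS_step_closed[OF _ ext_range_closed])

lemma adef_Pi11_formula: "adef (\<lambda>e. Pi11_formula (ext (e c)) (e i) (e j) (e k))"
  unfolding formula_iffs
proof (rule adef_formed[where step = "\<lambda>e. Pi_step (ext (e c))", OF _ mono3_steps(4)])
  show "adef (\<lambda>e. Pi_step (ext (e (Suc (Suc (Suc (Suc (Suc c))))))) (prior (e (Suc (Suc (Suc 0)))) (e (Suc (Suc (Suc (Suc 0))))))
      (e (Suc (Suc 0))) (e (Suc 0)) (e 0))"
    unfolding Pi_step_def by (intro adef_or adef_no_second_order_quantifiers adef_second_order_step)
qed (rule Pi_step_closed[OF _ ext_range_closed])

lemma adef_Pi11_sentence: "adef (\<lambda>e. Pi11_sentence (ext (e c)) (e i))"
  unfolding Pi11_sentence_def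
  by (rule adef_comp4[of "\<lambda>c. Pi11_formula (ext c)", OF adef_Pi11_formula aterm_var aterm_var aterm_num aterm_num])

lemma adef_L_formula: "adef (\<lambda>e. L_formula (e i) (e j))"
proof -
  have sa: "adef (\<lambda>e. set_atom {} (e i) (e j) (e k))" for i j k
    using adef_comp4[of "\<lambda>c. set_atom (ext c)", OF adef_set_atom aterm_zero aterm_var aterm_var aterm_var] by simp
  have "adef (\<lambda>e. formed_by L_step (e i) (e j) (e k))" for i j k
  proof (rule adef_formed[where step = "\<lambda>e. L_step", OF _ mono3_steps(1)])
    show "adef (\<lambda>e. L_step (prior (e (Suc (Suc (Suc 0)))) (e (Suc (Suc (Suc (Suc 0))))))
      (e (Suc (Suc 0))) (e (Suc 0)) (e 0))"
      unfolding L_step_def by (intro adef_or sa adef_first_order_step)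
  qed (rule L_step_closed)
  then show ?thesis unfolding formula_iffs
    by (rule adef_comp3[of "formed_by L_step", OF _ aterm_var aterm_var aterm_num])
qed

text \<open>The restriction of a given function to the free variables of a formula is obtained along the
  formation of the formula by finite set operations, hence lies in every model containing the values.\<close>

lemma fun_closed:
  assumes K: "model K" and f: "L2_formula C \<phi> v r" and a: "is_fun a X Y"
    and X: "X \<subseteq> V" "X \<subseteq> ext v \<or> X \<subseteq> ext r" and Y: "Y \<subseteq> ext K"
  shows "a \<in> ext K"
proof -
  have YV: "Y \<subseteq> V" using Y ext_subset by blast
  have aV: "a \<in> V" by (rule is_fun_in_V[OF a])
  define pre where "pre a A = {p \<in> ext a. \<exists>i\<in>A. \<exists>y\<in>V. p = opair i y \<and> True}" for a A
  define good where "good a K A \<longleftrightarrow> (\<exists>h\<in>ext K. ext h = pre a A)" for a K A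
  have g0: "good a K {}" unfolding good_def pre_def using empty_closed[OF K] by simp
  have single: "pre a {i} = {} \<or> (\<exists>y\<in>Y. pre a {i} = {opair i y})" if i: "i \<in> Omega" for i
  proof (cases "i \<in> X")
    case True
    then obtain y where y: "y \<in> Y" "opair i y \<epsilon> a" using is_fun_ex[OF a] by blast
    have un: "z = y" if "z \<in> V" "opair i z \<in> ext a" for z
    proof -
      have z: "opair i z \<epsilon> a" using that extD by blast
      then have "z \<in> Y" using is_fun_mem[OF a z Omega_in_V[OF i] that(1) X(1) YV] by blast
      then show ?thesis using is_fun_unique[OF a z y(2) True _ y(1)] by blast
    qed
    have "opair i y \<in> ext a" using y YV i opair_mem_iff[of i y a] by auto
    then have "pre a {i} = {opair i y}" unfolding pre_def using un y YV by blast
    then show ?thesis using y by blast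
  next
    case False
    have "\<not> opair i z \<in> ext a" if "z \<in> V" for z
      using is_fun_mem[OF a _ Omega_in_V[OF i] that X(1) YV] False extD by blast
    then have "pre a {i} = {}" unfolding pre_def by blast
    then show ?thesis by blast
  qed
  have g1: "good a K {i}" if i: "i \<in> Omega" for i
    using single[OF i]
  proof
    assume "pre a {i} = {}"
    then show ?thesis using empty_closed[OF K] unfolding good_def by simp
  next
    assume "\<exists>y\<in>Y. pre a {i} = {opair i y}"
    then obtain y where y: "y \<in> Y" "pre a {i} = {opair i y}" by blast
    have o: "opair i y \<in> ext K" using model_opair[OF K Omega_in_model[OF K i]] y Y by blast
    then have "mk {opair i y, opair i y} \<in> ext K" by (intro model_pair K)
    moreover have "ext (mk {opair i y, opair i y}) = {opair i y}" using ext_in_V[OF o] by simp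
    ultimately show ?thesis unfolding good_def y(2) by blast
  qed
  have g2: "good a K (A \<union> B)" if "good a K A" "good a K B" for A B
  proof -
    have "pre a (A \<union> B) = pre a A \<union> pre a B" unfolding pre_def by blast
    then show ?thesis using Un_closed[OF K] that unfolding good_def by simp
  qed
  \<comment> \<open>A quantifier removes one variable, hence at most one pair from the restricted
    function, and the model can subtract a single element.\<close>
  have g3: "good a K (A - {i})" if A: "good a K A" "A \<subseteq> V" and i: "i \<in> Omega" for A i
  proof -
    have *: "pre a (A - {i}) = pre a A - pre a {i}"
    proof (intro set_eqI iffI)
      fix p assume p: "p \<in> pre a (A - {i})"
      then obtain j y where j: "p \<in> ext a" "j \<in> A" "j \<noteq> i" "y \<in> V" "p = opair j y" unfolding pre_def by blast
      have "p \<notin> pre a {i}"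
      proof
        assume "p \<in> pre a {i}"
        then obtain z where "z \<in> V" "p = opair i z" unfolding pre_def by blast
        then show False using j A(2) i opair_inject[of j y i z] by auto
      qed
      then show "p \<in> pre a A - pre a {i}" using j unfolding pre_def by blast
    next
      fix p assume "p \<in> pre a A - pre a {i}"
      then show "p \<in> pre a (A - {i})" unfolding pre_def by blast
    qed
    obtain h where h: "h \<in> ext K" "ext h = pre a A" using A(1) unfolding good_def by blast
    from single[OF i] show ?thesis
    proof
      assume "pre a {i} = {}"
      then show ?thesis using A * unfolding good_def by simp
    next
      assume "\<exists>y\<in>Y. pre a {i} = {opair i y}"
      then obtain y where y: "y \<in> Y" "pre a {i} = {opair i y}" by blast
      have "opair i y \<in> ext K" using model_opair[OF K Omega_in_model[OF K i]] y Y by blast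
      from model_Diff[OF K h(1) this] show ?thesis unfolding good_def * y(2) h(2) .
    qed
  qed
  define R where "R \<phi> v r a K \<longleftrightarrow> good a K (ext v) \<and> good a K (ext r)" for \<phi> v r a K :: 'a
  have "R \<phi> v r a K"
  proof (rule formed_induct[where R = R, OF f[unfolded formula_iffs]])
    show "adef (\<lambda>e. R (e 0) (e (Suc 0)) (e (Suc (Suc 0))) (e (Suc (Suc (Suc 0)))) (e (Suc (Suc (Suc (Suc 0))))))"
      unfolding R_def good_def pre_def
      by (intro adef_ex_snd adef_const adef_rules)
    fix \<phi> v r assume V: "\<phi> \<in> V" "v \<in> V" "r \<in> V"
      and s: "L2_step C (\<lambda>\<phi> v r. formed_by (L2_step C) \<phi> v r \<and> R \<phi> v r a K) \<phi> v r"
    have tv: "good a K (term_vars t)" for t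
    proof (cases "\<exists>i\<in>Omega. t = var i")
      case True
      then show ?thesis using g1 by (auto simp: term_vars_var)
    next
      case False
      then have "term_vars t = {}" by (auto simp: term_vars_def)
      then show ?thesis using g0 by simp
    qed
    show "R \<phi> v r a K"
      using s unfolding L2_step_def set_atom_def predicate_atom_def first_order_step_def second_order_step_def R_def
      by (elim disjE bexE conjE) (simp_all add: g0 g1 g2 g3 tv ext_subset)
  qed (use aV model_in_V[OF K] in simp_all)
  then obtain h where h: "h \<in> ext K" "ext h = pre a (ext v) \<or> ext h = pre a (ext r)"
    "X \<subseteq> ext v \<and> ext h = pre a (ext v) \<or> X \<subseteq> ext r \<and> ext h = pre a (ext r)"
    using X(2) unfolding R_def good_def by blast
  have "pre a Z = ext a" if "X \<subseteq> Z" for Z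
    unfolding pre_def using is_fun_elem[OF a] that YV by blast
  then have "ext h = ext a" using h(3) by auto
  then have "a = h" using aV h(1) ext_in_V ext_eqI by metis
  then show ?thesis using h by simp
qed

section \<open>Absoluteness of satisfaction\<close>

lemma assignments_closed:
  assumes "model K" "m \<in> ext K" "d \<in> ext K" "L2_formula (ext m) \<phi> v r"
  shows "is_fun a (ext v) (ext m) \<Longrightarrow> a \<in> ext K" "is_fun A (ext r) (ext d) \<Longrightarrow> A \<in> ext K"
  by (erule fun_closed[OF assms(1,4) _ ext_subset _ ext_closed[OF assms(1,2)]], simp)
    (erule fun_closed[OF assms(1,4) _ ext_subset _ ext_closed[OF assms(1,3)]], simp)

definition in_truth_set where
  "in_truth_set m d v r Q t \<longleftrightarrow> (\<exists>a\<in>V. \<exists>A\<in>V. t = opair a A \<and>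
     is_fun a (ext v) (ext m) \<and> is_fun A (ext r) (ext d) \<and> Q a A)"

lemma adef_in_truth_set:
  assumes Q: "adef (\<lambda>e. Q (\<lambda>n. e (Suc (Suc n))) (e (Suc 0)) (e 0))"
  shows "adef (\<lambda>e. in_truth_set (e m) (e d) (e v) (e r) (Q e) (e t))"
  unfolding in_truth_set_def
  by (rule adef_ex_fst_snd[OF aterm_var]) (intro adef_and adef_is_fun acls_ext aterm_var Q)

text \<open>The equation for \<open>ext T\<close> is split into two inclusions. The formula
  condition is repeated inside the last quantifier block because it is what confines the assignments
  \<open>a\<close> and \<open>A\<close> to a model, as \<open>adef_exV2\<close> demands.\<close>

lemma truth_set_iff:
  assumes "T \<in> V"
  shows "truth_set (ext m) (ext d) \<phi> T Q \<longleftrightarrow> (\<exists>v\<in>V. \<exists>r\<in>V. L2_formula (ext m) \<phi> v r \<and>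
    (\<forall>t\<in>ext T. in_truth_set m d v r Q t) \<and>
    \<not> (\<exists>a\<in>V. \<exists>A\<in>V. L2_formula (ext m) \<phi> v r \<and> is_fun a (ext v) (ext m) \<and> is_fun A (ext r) (ext d) \<and> Q a A \<and>
        \<not> opair a A \<epsilon> T))"
proof -
  have "ext T = {opair a A | a A. is_fun a (ext v) (ext m) \<and> is_fun A (ext r) (ext d) \<and> Q a A} \<longleftrightarrow>
    (\<forall>t\<in>ext T. in_truth_set m d v r Q t) \<and>
    (\<forall>a\<in>V. \<forall>A\<in>V. is_fun a (ext v) (ext m) \<and> is_fun A (ext r) (ext d) \<and> Q a A \<longrightarrow> opair a A \<epsilon> T)"
    (is "_ = ?X \<longleftrightarrow> ?A \<and> ?B") for v r
  proof
    assume e: "ext T = ?X"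
    have ?A unfolding e in_truth_set_def using is_fun_in_V by blast
    moreover have ?B
    proof (intro ballI impI)
      fix a A assume "a \<in> V" "A \<in> V" "is_fun a (ext v) (ext m) \<and> is_fun A (ext r) (ext d) \<and> Q a A"
      then have "opair a A \<in> ext T" unfolding e by blast
      then show "opair a A \<epsilon> T" using extD by blast
    qed
    ultimately show "?A \<and> ?B" ..
  next
    assume a: "?A \<and> ?B"
    show "ext T = ?X"
    proof (intro set_eqI iffI)
      fix t assume "t \<in> ext T"
      then show "t \<in> ?X" using a unfolding in_truth_set_def by blast
    next
      fix t assume "t \<in> ?X"
      then obtain b B where t: "t = opair b B" "is_fun b (ext v) (ext m)" "is_fun B (ext r) (ext d)" "Q b B" by blast
      then have "b \<in> V" "B \<in> V" using is_fun_in_V by blast+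
      then show "t \<in> ext T" using a t by (simp add: opair_mem_iff)
    qed
  qed
  then show ?thesis unfolding truth_set_def by (intro bex_cong refl) blast
qed

lemma adef_truth_set:
  assumes Q: "adef (\<lambda>e. Q (\<lambda>n. e (Suc (Suc n))) (e (Suc 0)) (e 0))"
  shows "adef (\<lambda>e. truth_set (ext (e m)) (ext (e d)) (e i) (e j) (Q e))"
proof (rule adef_cong)
  show "adef (\<lambda>e. \<exists>v\<in>V. \<exists>r\<in>V. L2_formula (ext (e m)) (e i) v r \<and>
    (\<forall>t\<in>ext (e j). in_truth_set (e m) (e d) v r (Q e) t) \<and>
    \<not> (\<exists>a\<in>V. \<exists>A\<in>V. L2_formula (ext (e m)) (e i) v r \<and> is_fun a (ext v) (ext (e m)) \<and> is_fun A (ext r) (ext (e d)) \<and> Q e a A \<and>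
        \<not> opair a A \<epsilon> e j))"
  proof (rule adef_exV2)
    \<comment> \<open>\<open>Q\<close> keeps its two arguments at \<open>0\<close> and
      \<open>1\<close>, while its assignment moves past two (\<open>Q4\<close>) or three
      (\<open>Q5\<close>) further bound variables.\<close>
    have Q4: "adef (\<lambda>e. Q (\<lambda>n. e (Suc (Suc (Suc (Suc n))))) (e (Suc 0)) (e 0))"
      using adef_rename[OF Q, of "\<lambda>n. if n < 2 then n else Suc (Suc n)"] by simp
    have Q5: "adef (\<lambda>e. Q (\<lambda>n. e (Suc (Suc (Suc (Suc (Suc n)))))) (e (Suc 0)) (e 0))"
      using adef_rename[OF Q, of "\<lambda>n. if n < 2 then n else Suc (Suc (Suc n))"] by simp
    show "adef (\<lambda>e. L2_formula (ext (e (Suc (Suc m)))) (e (Suc (Suc i))) (e (Suc 0)) (e 0) \<and>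
      (\<forall>t\<in>ext (e (Suc (Suc j))). in_truth_set (e (Suc (Suc m))) (e (Suc (Suc d))) (e (Suc 0)) (e 0) (Q (\<lambda>n. e (Suc (Suc n)))) t) \<and>
      \<not> (\<exists>a\<in>V. \<exists>A\<in>V. L2_formula (ext (e (Suc (Suc m)))) (e (Suc (Suc i))) (e (Suc 0)) (e 0) \<and>
         is_fun a (ext (e (Suc 0))) (ext (e (Suc (Suc m)))) \<and> is_fun A (ext (e 0)) (ext (e (Suc (Suc d)))) \<and>
         Q (\<lambda>n. e (Suc (Suc n))) a A \<and> \<not> opair a A \<epsilon> e (Suc (Suc j))))"
    proof (intro adef_and adef_L2_formula adef_ball acls_ext aterm_var adef_not)
      show "adef (\<lambda>e. in_truth_set (e (Suc (Suc (Suc m)))) (e (Suc (Suc (Suc d)))) (e (Suc (Suc 0))) (e (Suc 0))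
         (Q (\<lambda>n. e (Suc (Suc (Suc n))))) (e 0))"
        by (rule adef_in_truth_set[where Q = "\<lambda>e. Q (\<lambda>n. e (Suc (Suc (Suc n))))"]) (rule Q5)
      show "adef (\<lambda>e. \<exists>a\<in>V. \<exists>A\<in>V. L2_formula (ext (e (Suc (Suc m)))) (e (Suc (Suc i))) (e (Suc 0)) (e 0) \<and>
         is_fun a (ext (e (Suc 0))) (ext (e (Suc (Suc m)))) \<and> is_fun A (ext (e 0)) (ext (e (Suc (Suc d)))) \<and>
         Q (\<lambda>n. e (Suc (Suc n))) a A \<and> \<not> opair a A \<epsilon> e (Suc (Suc j)))"
      proof (rule adef_exV2)
        show "adef (\<lambda>e. L2_formula (ext (e (Suc (Suc (Suc (Suc m)))))) (e (Suc (Suc (Suc (Suc i))))) (e (Suc (Suc (Suc 0)))) (e (Suc (Suc 0))) \<and>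
         is_fun (e (Suc 0)) (ext (e (Suc (Suc (Suc 0))))) (ext (e (Suc (Suc (Suc (Suc m)))))) \<and>
         is_fun (e 0) (ext (e (Suc (Suc 0)))) (ext (e (Suc (Suc (Suc (Suc d)))))) \<and>
         Q (\<lambda>n. e (Suc (Suc (Suc (Suc n))))) (e (Suc 0)) (e 0) \<and> \<not> opair (e (Suc 0)) (e 0) \<epsilon> e (Suc (Suc (Suc (Suc j)))))"
          by (intro adef_and adef_L2_formula adef_is_fun acls_ext aterm_var adef_not adef_opair_mem Q4)
        fix K x y and e :: "nat \<Rightarrow> 'a" assume K: "model K" "range e \<subseteq> ext K"
          and a: "L2_formula (ext (e (Suc (Suc m)))) (e (Suc (Suc i))) (e (Suc 0)) (e 0) \<and>
         is_fun x (ext (e (Suc 0))) (ext (e (Suc (Suc m)))) \<and> is_fun y (ext (e 0)) (ext (e (Suc (Suc d)))) \<and>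
         Q (\<lambda>n. e (Suc (Suc n))) x y \<and> \<not> opair x y \<epsilon> e (Suc (Suc j))"
        have "e (Suc (Suc m)) \<in> ext K" "e (Suc (Suc d)) \<in> ext K" using K by auto
        from assignments_closed[OF K(1) this conjunct1[OF a]] show "x \<in> ext K \<and> y \<in> ext K" using a by blast
      qed
    qed
    fix K x y and e :: "nat \<Rightarrow> 'a" assume K: "model K" "range e \<subseteq> ext K"
      and a: "L2_formula (ext (e m)) (e i) x y \<and> (\<forall>t\<in>ext (e j). in_truth_set (e m) (e d) x y (Q e) t) \<and>
       \<not> (\<exists>a\<in>V. \<exists>A\<in>V. L2_formula (ext (e m)) (e i) x y \<and> is_fun a (ext x) (ext (e m)) \<and>
           is_fun A (ext y) (ext (e d)) \<and> Q e a A \<and> \<not> opair a A \<epsilon> e j)"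
    show "x \<in> ext K \<and> y \<in> ext K" using L2_closed[OF K(1) ext_range_closed[OF K] conjunct1[OF a]] by blast
  qed
  show "truth_set (ext (e m)) (ext (e d)) (e i) (e j) (Q e) \<longleftrightarrow> (\<exists>v\<in>V. \<exists>r\<in>V. L2_formula (ext (e m)) (e i) v r \<and>
    (\<forall>t\<in>ext (e j). in_truth_set (e m) (e d) v r (Q e) t) \<and>
    \<not> (\<exists>a\<in>V. \<exists>A\<in>V. L2_formula (ext (e m)) (e i) v r \<and> is_fun a (ext v) (ext (e m)) \<and> is_fun A (ext r) (ext (e d)) \<and> Q e a A \<and>
        \<not> opair a A \<epsilon> e j))" if "model K" "range e \<subseteq> ext K" for K e
    by (rule truth_set_iff) (use that ext_in_V in auto)
qed

text \<open>A Kuratowski pair is a set of subsets of the union of \<open>x\<close> and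
  \<open>y\<close>, so two power sets taken in \<open>K\<close> bound all pairs; a bound is all that
  \<open>model_sep\<close> requires.\<close>

lemma times_bound:
  assumes K: "model K" and xy: "x \<in> ext K" "y \<in> ext K"
  shows "\<exists>z\<in>ext K. \<forall>p\<in>ext x. \<forall>q\<in>ext y. opair p q \<in> ext z"
proof -
  have V: "x \<in> V" "y \<in> V" using xy ext_in_V by auto
  obtain z1 where z1: "z1 \<in> ext K" "ext z1 = {w \<in> ext K. ext w \<subseteq> ext (mk (ext x \<union> ext y))}"
    using model_Pow[OF K model_Un[OF K xy]] by blast
  obtain z2 where z2: "z2 \<in> ext K" "ext z2 = {w \<in> ext K. ext w \<subseteq> ext z1}"
    using model_Pow[OF K z1(1)] by blast
  have "opair p q \<in> ext z2" if pq: "p \<in> ext x" "q \<in> ext y" for p q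
  proof -
    have pK: "p \<in> ext K" "q \<in> ext K" using pq xy model_trans[OF K] by blast+
    then have pV: "p \<in> V" "q \<in> V" using ext_in_V by auto
    have m: "mk {p, p} \<in> ext K" "mk {p, q} \<in> ext K" by (intro model_pair[OF K] pK)+
    have u: "ext (mk (ext x \<union> ext y)) = ext x \<union> ext y" using V by simp
    have "ext (mk {p, p}) \<subseteq> ext x \<union> ext y" "ext (mk {p, q}) \<subseteq> ext x \<union> ext y" using pq pV by auto
    then have "mk {p} \<in> ext z1" "mk {p, q} \<in> ext z1" using z1(2) m u by auto
    then have "ext (opair p q) \<subseteq> ext z1" using pV by (simp add: opair_def)
    then show ?thesis using z2(2) model_opair[OF K pK] by blast
  qed
  then show ?thesis using z2(1) by blast
qed

lemma fun_bound:
  assumes K: "model K" and xy: "x \<in> ext K" "y \<in> ext K"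
  shows "\<exists>z\<in>ext K. \<forall>a\<in>ext K. is_fun a (ext x) (ext y) \<longrightarrow> a \<in> ext z"
proof -
  obtain z where z: "z \<in> ext K" "\<forall>p\<in>ext x. \<forall>q\<in>ext y. opair p q \<in> ext z" using times_bound[OF assms] by blast
  obtain w where w: "w \<in> ext K" "ext w = {u \<in> ext K. ext u \<subseteq> ext z}" using model_Pow[OF K z(1)] by blast
  have "a \<in> ext w" if "a \<in> ext K" "is_fun a (ext x) (ext y)" for a
    unfolding w(2) using is_fun_elem[OF that(2)] z(2) that(1) by blast
  then show ?thesis using w(1) by blast
qed

text \<open>All assignments for the formula belong to \<open>K\<close> and are bounded by a set
  there, from which \<open>T\<close> is cut out by Separation in \<open>K\<close>. So a model
  contains the truth sets that the universe computes.\<close>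

lemma truth_set_closed:
  assumes K: "model K" and md: "m \<in> ext K" "d \<in> ext K" and T: "T \<in> V" and e: "range e \<subseteq> ext K"
    and Q: "adef (\<lambda>e. Q (\<lambda>n. e (Suc (Suc n))) (e (Suc 0)) (e 0))"
    and t: "truth_set (ext m) (ext d) \<phi> T (Q e)"
  shows "T \<in> ext K"
proof -
  obtain v r where vr: "v \<in> V" "r \<in> V" "L2_formula (ext m) \<phi> v r"
    "ext T = {opair a A | a A. is_fun a (ext v) (ext m) \<and> is_fun A (ext r) (ext d) \<and> Q e a A}"
    using t by (rule truth_setE)
  have vrK: "v \<in> ext K" "r \<in> ext K" using L2_closed[OF K ext_closed[OF K md(1)] vr(3)] by auto
  obtain z1 where z1: "z1 \<in> ext K" "\<forall>a\<in>ext K. is_fun a (ext v) (ext m) \<longrightarrow> a \<in> ext z1"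
    using fun_bound[OF K vrK(1) md(1)] by blast
  obtain z2 where z2: "z2 \<in> ext K" "\<forall>a\<in>ext K. is_fun a (ext r) (ext d) \<longrightarrow> a \<in> ext z2"
    using fun_bound[OF K vrK(2) md(2)] by blast
  obtain z where z: "z \<in> ext K" "\<forall>p\<in>ext z1. \<forall>q\<in>ext z2. opair p q \<in> ext z"
    using times_bound[OF K z1(1) z2(1)] by blast
  have "adef (\<lambda>e. in_truth_set (e 1) (e 2) (e 3) (e 4) (Q (\<lambda>n. e (Suc (Suc (Suc (Suc (Suc n))))))) (e 0))"
    by (rule adef_in_truth_set[where Q = "\<lambda>e. Q (\<lambda>n. e (Suc (Suc (Suc (Suc (Suc n))))))"])
      (use adef_rename[OF Q, of "\<lambda>n. if n < 2 then n else Suc (Suc (Suc (Suc (Suc n))))"] in simp)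
  from model_sep[OF K this, of "case_nat m (case_nat d (case_nat v (case_nat r e)))" z] z(1) e md vrK
  have "\<exists>y\<in>ext K. ext y = {t \<in> ext z. in_truth_set m d v r (Q e) t}"
    by (auto simp: image_subset_iff numeral_2_eq_2 numeral_3_eq_3 eval_nat_numeral split: nat.splits)
  moreover have "{t \<in> ext z. in_truth_set m d v r (Q e) t} = ext T"
  proof -
    have *: "opair a A \<in> ext z" if "is_fun a (ext v) (ext m)" "is_fun A (ext r) (ext d)" for a A
      using assignments_closed[OF K md vr(3)] that z1(2) z2(2) z(2) by blast
    show ?thesis unfolding vr(4) in_truth_set_def using * is_fun_in_V by blast
  qed
  ultimately show ?thesis using in_modelI[OF T] by simp
qed

lemma adef_denotes: "aterm F \<Longrightarrow> aterm G \<Longrightarrow> aterm H \<Longrightarrow> adef (\<lambda>e. denotes (F e) (G e) (H e))"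
proof (rule adef_comp3[of denotes])
  show "adef (\<lambda>e. denotes (e i) (e j) (e k))" for i j k
    unfolding denotes_def by (intro adef_rules acls_Omega aterm_codes)
qed

text \<open>The conditions from the clauses of \<open>sat_step\<close>, with classes replaced by
  sets that represent them; each then depends on finitely many individuals and can be treated by
  \<open>adef\<close>.\<close>

definition "QMem m s t a (A::'a) \<longleftrightarrow> (\<exists>x\<in>ext m. \<exists>y\<in>ext m. denotes a s x \<and> denotes a t y \<and> x \<epsilon> y)"
definition "QEq m s t a (A::'a) \<longleftrightarrow> (\<exists>x\<in>ext m. denotes a s x \<and> denotes a t x)"
definition "QS u t a (A::'a) \<longleftrightarrow> (\<exists>x\<in>ext u. denotes a t x)"
definition "QApp2 m d j t a A \<longleftrightarrow> (\<exists>x\<in>ext m. \<exists>X\<in>ext d. denotes a t x \<and> opair j X \<epsilon> A \<and> x \<epsilon> X)"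
definition "QNeg T a A \<longleftrightarrow> \<not> opair a A \<epsilon> T"
definition "QSub T a A \<longleftrightarrow> (\<exists>b\<in>V. \<exists>B\<in>V. ext b \<subseteq> ext a \<and> ext B \<subseteq> ext A \<and> opair b B \<epsilon> T)"
definition "QAnd T1 T2 a A \<longleftrightarrow> QSub T1 a A \<and> QSub T2 a A"
definition "QAll m i T a A \<longleftrightarrow> (\<forall>x\<in>ext m. \<exists>b\<in>V. ext b \<subseteq> insert (opair i x) (ext a) \<and> opair b A \<epsilon> T)"
definition "QAll2 d j T a A \<longleftrightarrow> (\<forall>X\<in>ext d. \<exists>B\<in>V. ext B \<subseteq> insert (opair j X) (ext A) \<and> opair a B \<epsilon> T)"

lemmas Q_defs = QMem_def[abs_def] QEq_def[abs_def] QS_def[abs_def] QApp2_def[abs_def] QNeg_def[abs_def]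
  QSub_def[abs_def] QAnd_def[abs_def] QAll_def[abs_def] QAll2_def[abs_def]

lemma adef_Q:
  "adef (\<lambda>e. QMem (e m) (e s) (e t) (e a) (e b))"
  "adef (\<lambda>e. QEq (e m) (e s) (e t) (e a) (e b))"
  "adef (\<lambda>e. QS (e m) (e t) (e a) (e b))"
  "adef (\<lambda>e. QApp2 (e m) (e d) (e s) (e t) (e a) (e b))"
  "adef (\<lambda>e. QNeg (e t) (e a) (e b))"
  "adef (\<lambda>e. QAnd (e s) (e t) (e a) (e b))"
  "adef (\<lambda>e. QAll (e m) (e s) (e t) (e a) (e b))"
  "adef (\<lambda>e. QAll2 (e d) (e s) (e t) (e a) (e b))"
proof -
  show "adef (\<lambda>e. QMem (e m) (e s) (e t) (e a) (e b))" "adef (\<lambda>e. QEq (e m) (e s) (e t) (e a) (e b))"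
    "adef (\<lambda>e. QS (e m) (e t) (e a) (e b))" "adef (\<lambda>e. QApp2 (e m) (e d) (e s) (e t) (e a) (e b))"
    "adef (\<lambda>e. QNeg (e t) (e a) (e b))"
    unfolding QMem_def QEq_def QS_def QApp2_def QNeg_def by (intro adef_denotes adef_rules)+
  have *: "adef (\<lambda>e. QSub (e t) (e a) (e b))" for t a b
    unfolding QSub_def
  proof (rule adef_exV2)
    show "x \<in> ext K \<and> y \<in> ext K" if "model K" "range e \<subseteq> ext K" "x \<in> V" "y \<in> V"
      "ext x \<subseteq> ext (e a) \<and> ext y \<subseteq> ext (e b) \<and> opair x y \<epsilon> e t" for K x y and e :: "nat \<Rightarrow> 'a"
      using opair_mem_closed[OF that(1), of "e t" x y] that by blast
  qed (intro adef_rules)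
  then show "adef (\<lambda>e. QAnd (e s) (e t) (e a) (e b))" unfolding QAnd_def by (intro adef_and)
  show "adef (\<lambda>e. QAll (e m) (e s) (e t) (e a) (e b))" unfolding QAll_def
  proof (rule adef_ball[OF acls_ext[OF aterm_var]], rule adef_exV)
    show "x \<in> ext K" if "model K" "range e \<subseteq> ext K" "x \<in> V"
      "ext x \<subseteq> insert (opair (e (Suc s)) (e 0)) (ext (e (Suc a))) \<and> opair x (e (Suc b)) \<epsilon> e (Suc t)" for K x and e :: "nat \<Rightarrow> 'a"
      using opair_mem_closed[OF that(1), of "e (Suc t)" x "e (Suc b)"] that ext_in_V by blast
  qed (intro adef_rules aterm_opair)
  show "adef (\<lambda>e. QAll2 (e d) (e s) (e t) (e a) (e b))" unfolding QAll2_def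
  proof (rule adef_ball[OF acls_ext[OF aterm_var]], rule adef_exV)
    show "x \<in> ext K" if "model K" "range e \<subseteq> ext K" "x \<in> V"
      "ext x \<subseteq> insert (opair (e (Suc s)) (e 0)) (ext (e (Suc b))) \<and> opair (e (Suc a)) x \<epsilon> e (Suc t)" for K x and e :: "nat \<Rightarrow> 'a"
      using opair_mem_closed[OF that(1), of "e (Suc t)" "e (Suc a)" x] that ext_in_V by blast
  qed (intro adef_rules aterm_opair)
qed

lemma adef_truth_set_Q:
  "adef (\<lambda>e. truth_set (ext (e m)) (ext (e d)) (e i) (e j) (QMem (e k) (e l) (e n)))"
  "adef (\<lambda>e. truth_set (ext (e m)) (ext (e d)) (e i) (e j) (QEq (e k) (e l) (e n)))"
  "adef (\<lambda>e. truth_set (ext (e m)) (ext (e d)) (e i) (e j) (QS (e k) (e l)))"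
  "adef (\<lambda>e. truth_set (ext (e m)) (ext (e d)) (e i) (e j) (QApp2 (e k) (e l) (e n) (e p)))"
  "adef (\<lambda>e. truth_set (ext (e m)) (ext (e d)) (e i) (e j) (QNeg (e k)))"
  "adef (\<lambda>e. truth_set (ext (e m)) (ext (e d)) (e i) (e j) (QAnd (e k) (e l)))"
  "adef (\<lambda>e. truth_set (ext (e m)) (ext (e d)) (e i) (e j) (QAll (e k) (e l) (e n)))"
  "adef (\<lambda>e. truth_set (ext (e m)) (ext (e d)) (e i) (e j) (QAll2 (e k) (e l) (e n)))"
  by (rule adef_truth_set, rule adef_Q)+

lemma sat_step_iff:
  "sat_step (ext m) (ext u) (ext d) P \<phi> T \<longleftrightarrow>
     (\<exists>s\<in>terms (ext m). \<exists>t\<in>terms (ext m). \<phi> = cMem s t \<and> truth_set (ext m) (ext d) \<phi> T (QMem m s t)) \<or>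
     (\<exists>s\<in>terms (ext m). \<exists>t\<in>terms (ext m). \<phi> = cEq s t \<and> truth_set (ext m) (ext d) \<phi> T (QEq m s t)) \<or>
     (\<exists>t\<in>terms (ext m). \<phi> = cS t \<and> truth_set (ext m) (ext d) \<phi> T (QS u t)) \<or>
     (\<exists>j\<in>Omega. \<exists>t\<in>terms (ext m). \<phi> = cApp2 j t \<and> truth_set (ext m) (ext d) \<phi> T (QApp2 m d j t)) \<or>
     (\<exists>p\<in>V. \<exists>T1\<in>V. \<phi> = cNeg p \<and> P p T1 \<and> truth_set (ext m) (ext d) \<phi> T (QNeg T1)) \<or>
     (\<exists>p\<in>V. \<exists>q\<in>V. \<exists>T1\<in>V. \<exists>T2\<in>V. \<phi> = cAnd p q \<and> P p T1 \<and> P q T2 \<and> truth_set (ext m) (ext d) \<phi> T (QAnd T1 T2)) \<or>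
     (\<exists>i\<in>Omega. \<exists>p\<in>V. \<exists>T1\<in>V. \<phi> = cAll i p \<and> P p T1 \<and> truth_set (ext m) (ext d) \<phi> T (QAll m i T1)) \<or>
     (\<exists>j\<in>Omega. \<exists>p\<in>V. \<exists>T1\<in>V. \<phi> = cAll2 j p \<and> P p T1 \<and> truth_set (ext m) (ext d) \<phi> T (QAll2 d j T1))"
  unfolding sat_step_def Q_defs by (rule refl)

definition prior2 :: "'a \<Rightarrow> 'a \<Rightarrow> 'a \<Rightarrow> 'a \<Rightarrow> bool" where
  "prior2 k f \<psi> s \<longleftrightarrow> (\<exists>j\<in>ext k. opair j (opair \<psi> s) \<epsilon> f)"

lemma adef_prior2:
  assumes "aterm A" "aterm B" "aterm F" "aterm G"
  shows "adef (\<lambda>e. prior2 (A e) (B e) (F e) (G e))"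
  unfolding prior2_def
  by (intro adef_bex acls_ext adef_opair_mem aterm_opair aterm_var assms assms[THEN aterm_lift])

lemma prior2_closed:
  assumes K: "model K" "f \<in> ext K" and p: "prior2 k f \<psi> s" and V: "\<psi> \<in> V" "s \<in> V"
  shows "\<psi> \<in> ext K \<and> s \<in> ext K"
proof -
  obtain j where "j \<in> ext k" "opair j (opair \<psi> s) \<epsilon> f" using p by (auto simp: prior2_def)
  then have "opair \<psi> s \<in> ext K" using opair_mem_closed[OF K, of j "opair \<psi> s"] V ext_in_V by simp
  then show ?thesis using model_opairD[OF K(1)] V by blast
qed

lemma adef_exV4:
  assumes P: "adef (\<lambda>e. P (e (Suc (Suc (Suc 0)))) (e (Suc (Suc 0))) (e (Suc 0)) (e 0) (\<lambda>n. e (Suc (Suc (Suc (Suc n))))))"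
    and w: "\<And>K e x y z a. model K \<Longrightarrow> range e \<subseteq> ext K \<Longrightarrow> x \<in> V \<Longrightarrow> y \<in> V \<Longrightarrow> z \<in> V \<Longrightarrow> a \<in> V \<Longrightarrow> P x y z a e \<Longrightarrow>
      x \<in> ext K \<and> y \<in> ext K \<and> z \<in> ext K \<and> a \<in> ext K"
  shows "adef (\<lambda>e. \<exists>x\<in>V. \<exists>y\<in>V. \<exists>z\<in>V. \<exists>a\<in>V. P x y z a e)"
proof (rule adef_exV2)
  show "adef (\<lambda>e. \<exists>z\<in>V. \<exists>a\<in>V. P (e (Suc 0)) (e 0) z a (\<lambda>n. e (Suc (Suc n))))"
  proof (rule adef_exV2[OF P])
    show "x \<in> ext K \<and> y \<in> ext K" if "model K" "range e \<subseteq> ext K" "x \<in> V" "y \<in> V"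
      "P (e (Suc 0)) (e 0) x y (\<lambda>n. e (Suc (Suc n)))" for K e x y
      using w[OF that(1) range_Suc[OF range_Suc[OF that(2)]], of "e (Suc 0)" "e 0" x y] that ext_in_V by auto
  qed
  show "x \<in> ext K \<and> y \<in> ext K" if "model K" "range e \<subseteq> ext K" "x \<in> V" "y \<in> V"
    "\<exists>z\<in>V. \<exists>a\<in>V. P x y z a e" for K e x y
    using w[OF that(1-4)] that(5) by blast
qed

lemma adef_sat_step:
  "adef (\<lambda>e. sat_step (ext (e m)) (ext (e u)) (ext (e d)) (prior2 (e k) (e f)) (e i) (e j))"
  unfolding sat_step_iff
proof (intro adef_or)
  note rules = adef_truth_set_Q adef_prior2 adef_and adef_eq aterm_codes aterm_var
  show "adef (\<lambda>e. \<exists>s\<in>terms (ext (e m)). \<exists>t\<in>terms (ext (e m)). e i = cMem s t \<and> truth_set (ext (e m)) (ext (e d)) (e i) (e j) (QMem (e m) s t))"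
    by (intro rules adef_bex acls_terms)
  show "adef (\<lambda>e. \<exists>s\<in>terms (ext (e m)). \<exists>t\<in>terms (ext (e m)). e i = cEq s t \<and> truth_set (ext (e m)) (ext (e d)) (e i) (e j) (QEq (e m) s t))"
    by (intro rules adef_bex acls_terms)
  show "adef (\<lambda>e. \<exists>t\<in>terms (ext (e m)). e i = cS t \<and> truth_set (ext (e m)) (ext (e d)) (e i) (e j) (QS (e u) t))"
    by (intro rules adef_bex acls_terms)
  show "adef (\<lambda>e. \<exists>ja\<in>Omega. \<exists>t\<in>terms (ext (e m)). e i = cApp2 ja t \<and> truth_set (ext (e m)) (ext (e d)) (e i) (e j) (QApp2 (e m) (e d) ja t))"
    by (intro rules adef_bex acls_terms acls_Omega)
  show "adef (\<lambda>e. \<exists>p\<in>V. \<exists>T1\<in>V. e i = cNeg p \<and> prior2 (e k) (e f) p T1 \<and> truth_set (ext (e m)) (ext (e d)) (e i) (e j) (QNeg T1))"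
  proof (rule adef_exV2)
    show "x \<in> ext K \<and> y \<in> ext K" if "model K" "range e \<subseteq> ext K" "x \<in> V" "y \<in> V"
      "e i = cNeg x \<and> prior2 (e k) (e f) x y \<and> R" for K x y R and e :: "nat \<Rightarrow> 'a"
      using prior2_closed[OF that(1), of "e f" "e k" x y] that by blast
  qed (intro rules)
  show "adef (\<lambda>e. \<exists>p\<in>V. \<exists>q\<in>V. \<exists>T1\<in>V. \<exists>T2\<in>V. e i = cAnd p q \<and> prior2 (e k) (e f) p T1 \<and> prior2 (e k) (e f) q T2 \<and>
      truth_set (ext (e m)) (ext (e d)) (e i) (e j) (QAnd T1 T2))"
  proof (rule adef_exV4)
    show "x \<in> ext K \<and> y \<in> ext K \<and> z \<in> ext K \<and> a \<in> ext K" if "model K" "range e \<subseteq> ext K" "x \<in> V" "y \<in> V" "z \<in> V" "a \<in> V"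
      "e i = cAnd x y \<and> prior2 (e k) (e f) x z \<and> prior2 (e k) (e f) y a \<and> R" for K x y z a R and e :: "nat \<Rightarrow> 'a"
      using prior2_closed[OF that(1), of "e f" "e k" x z] prior2_closed[OF that(1), of "e f" "e k" y a] that by blast
  qed (intro rules)
  show "adef (\<lambda>e. \<exists>ia\<in>Omega. \<exists>p\<in>V. \<exists>T1\<in>V. e i = cAll ia p \<and> prior2 (e k) (e f) p T1 \<and> truth_set (ext (e m)) (ext (e d)) (e i) (e j) (QAll (e m) ia T1))"
  proof (rule adef_bex[OF acls_Omega], rule adef_exV2)
    show "x \<in> ext K \<and> y \<in> ext K" if "model K" "range e \<subseteq> ext K" "x \<in> V" "y \<in> V"
      "e (Suc i) = cAll (e 0) x \<and> prior2 (e (Suc k)) (e (Suc f)) x y \<and> R" for K x y R and e :: "nat \<Rightarrow> 'a"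
      using prior2_closed[OF that(1), of "e (Suc f)" "e (Suc k)" x y] that by blast
  qed (intro rules)
  show "adef (\<lambda>e. \<exists>ja\<in>Omega. \<exists>p\<in>V. \<exists>T1\<in>V. e i = cAll2 ja p \<and> prior2 (e k) (e f) p T1 \<and> truth_set (ext (e m)) (ext (e d)) (e i) (e j) (QAll2 (e d) ja T1))"
  proof (rule adef_bex[OF acls_Omega], rule adef_exV2)
    show "x \<in> ext K \<and> y \<in> ext K" if "model K" "range e \<subseteq> ext K" "x \<in> V" "y \<in> V"
      "e (Suc i) = cAll2 (e 0) x \<and> prior2 (e (Suc k)) (e (Suc f)) x y \<and> R" for K x y R and e :: "nat \<Rightarrow> 'a"
      using prior2_closed[OF that(1), of "e (Suc f)" "e (Suc k)" x y] that by blast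
  qed (intro rules)
qed

lemma sat_step_closed:
  assumes K: "model K" and md: "m \<in> ext K" "u \<in> ext K" "d \<in> ext K" and V: "T \<in> V"
    and s: "sat_step (ext m) (ext u) (ext d) P \<phi> T"
    and P: "\<And>\<psi> S. \<psi> \<in> V \<Longrightarrow> S \<in> V \<Longrightarrow> P \<psi> S \<Longrightarrow> \<psi> \<in> ext K \<and> S \<in> ext K"
  shows "\<phi> \<in> ext K \<and> T \<in> ext K"
proof -
  have \<phi>: "\<phi> \<in> ext K" using sat_step_formula[OF s] L2_closed[OF K ext_closed[OF K md(1)]] by blast
  have tm: "t \<in> ext K" if "t \<in> terms (ext m)" for t
    using terms_closed[OF K ext_closed[OF K md(1)] that] .
  \<comment> \<open>The parameters of a clause, at most four, occupy positions \<open>0\<close> to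
    \<open>3\<close>; shorter lists are padded by repetition.\<close>
  have r: "range (case_nat a (case_nat b (case_nat c (\<lambda>_. g)))) \<subseteq> ext K" if "a \<in> ext K" "b \<in> ext K" "c \<in> ext K" "g \<in> ext K" for a b c g
    using that by (auto split: nat.splits)
  note tc = truth_set_closed[OF K md(1,3) V r]
  have "T \<in> ext K"
    using s unfolding sat_step_iff
  proof (elim disjE bexE conjE)
    fix s t assume a: "s \<in> terms (ext m)" "t \<in> terms (ext m)" "truth_set (ext m) (ext d) \<phi> T (QMem m s t)"
    show ?thesis
      by (rule tc[where Q = "\<lambda>e. QMem (e 0) (e 1) (e 2)", of m s t t]) (use a md tm adef_Q(1) in \<open>simp_all add: numeral_2_eq_2\<close>)
  next
    fix s t assume a: "s \<in> terms (ext m)" "t \<in> terms (ext m)" "truth_set (ext m) (ext d) \<phi> T (QEq m s t)"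
    show ?thesis
      by (rule tc[where Q = "\<lambda>e. QEq (e 0) (e 1) (e 2)", of m s t t]) (use a md tm adef_Q(2) in \<open>simp_all add: numeral_2_eq_2\<close>)
  next
    fix t assume a: "t \<in> terms (ext m)" "truth_set (ext m) (ext d) \<phi> T (QS u t)"
    show ?thesis
      by (rule tc[where Q = "\<lambda>e. QS (e 0) (e 1)", of u t t t]) (use a md tm adef_Q(3) in \<open>simp_all add: numeral_2_eq_2\<close>)
  next
    fix j t assume a: "j \<in> Omega" "t \<in> terms (ext m)" "truth_set (ext m) (ext d) \<phi> T (QApp2 m d j t)"
    show ?thesis
      by (rule tc[where Q = "\<lambda>e. QApp2 (e 0) (e 1) (e 2) (e 3)", of m d j t])
        (use a md tm adef_Q(4) Omega_in_model[OF K] in \<open>simp_all add: numeral_2_eq_2 numeral_3_eq_3\<close>)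
  next
    fix p T1 assume a: "p \<in> V" "T1 \<in> V" "P p T1" "truth_set (ext m) (ext d) \<phi> T (QNeg T1)"
    show ?thesis
      by (rule tc[where Q = "\<lambda>e. QNeg (e 0)", of T1 T1 T1 T1]) (use a P[of p T1] adef_Q(5) in \<open>simp_all\<close>)
  next
    fix p q T1 T2 assume a: "p \<in> V" "q \<in> V" "T1 \<in> V" "T2 \<in> V" "P p T1" "P q T2" "truth_set (ext m) (ext d) \<phi> T (QAnd T1 T2)"
    show ?thesis
      by (rule tc[where Q = "\<lambda>e. QAnd (e 0) (e 1)", of T1 T2 T1 T1]) (use a P[of p T1] P[of q T2] adef_Q(6) in \<open>simp_all\<close>)
  next
    fix i p T1 assume a: "i \<in> Omega" "p \<in> V" "T1 \<in> V" "P p T1" "truth_set (ext m) (ext d) \<phi> T (QAll m i T1)"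
    show ?thesis
      by (rule tc[where Q = "\<lambda>e. QAll (e 0) (e 1) (e 2)", of m i T1 T1])
        (use a md P[of p T1] adef_Q(7) Omega_in_model[OF K] in \<open>simp_all add: numeral_2_eq_2\<close>)
  next
    fix j p T1 assume a: "j \<in> Omega" "p \<in> V" "T1 \<in> V" "P p T1" "truth_set (ext m) (ext d) \<phi> T (QAll2 d j T1)"
    show ?thesis
      by (rule tc[where Q = "\<lambda>e. QAll2 (e 0) (e 1) (e 2)", of d j T1 T1])
        (use a md P[of p T1] adef_Q(8) Omega_in_model[OF K] in \<open>simp_all add: numeral_2_eq_2\<close>)
  qed
  with \<phi> show ?thesis ..
qed

lemma adef_tset:
  "adef (\<lambda>e. tset (ext (e m)) (ext (e u)) (ext (e d)) (e i) (e j))"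
  and tset_closed: "model K \<Longrightarrow> m' \<in> ext K \<Longrightarrow> u' \<in> ext K \<Longrightarrow> d' \<in> ext K \<Longrightarrow>
    tset (ext m') (ext u') (ext d') \<phi> T \<Longrightarrow> \<phi> \<in> ext K \<and> T \<in> ext K"
proof -
  have cl: "y \<in> ext K" if K: "model K" and md: "m \<in> ext K" "u \<in> ext K" "d \<in> ext K" and y: "sat_gen (ext m) (ext u) (ext d) P y"
    and P: "\<And>z. z \<in> V \<Longrightarrow> P z \<Longrightarrow> z \<in> ext K" for K m u d y P
  proof -
    obtain \<psi> S where *: "\<psi> \<in> V" "S \<in> V" "y = opair \<psi> S" "sat_step (ext m) (ext u) (ext d) (\<lambda>\<psi> S. P (opair \<psi> S)) \<psi> S"
      using y unfolding sat_gen_def by (elim bexE conjE)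
    have "\<psi> \<in> ext K \<and> S \<in> ext K"
    proof (rule sat_step_closed[OF K md *(2,4)])
      show "\<chi> \<in> ext K \<and> R \<in> ext K" if "\<chi> \<in> V" "R \<in> V" "P (opair \<chi> R)" for \<chi> R
        by (rule model_opairD[OF K P[OF opair_in_V[OF that(1,2)] that(3)] that(1,2)])
    qed
    then show ?thesis using * model_opair[OF K] by simp
  qed
  have g: "adef (\<lambda>e. generated (sat_gen (ext (e m)) (ext (e u)) (ext (e d))) (F e))" if F: "aterm F" for F
  proof (rule adef_generated[OF _ mono_sat_gen _ F])
    show "adef (\<lambda>e. sat_gen (ext (e (Suc (Suc (Suc m))))) (ext (e (Suc (Suc (Suc u))))) (ext (e (Suc (Suc (Suc d)))))
       (\<lambda>z. \<exists>j\<in>ext (e (Suc 0)). opair j z \<epsilon> e (Suc (Suc 0))) (e 0))"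
      unfolding sat_gen_def prior2_def[symmetric]
      by (rule adef_ex_fst_snd[OF aterm_var]) (rule adef_sat_step)
    show "y \<in> ext K" if "model K" "range e \<subseteq> ext K" "y \<in> V" "sat_gen (ext (e m)) (ext (e u)) (ext (e d)) P y"
      "\<And>z. z \<in> V \<Longrightarrow> P z \<Longrightarrow> z \<in> ext K" for K P y and e :: "nat \<Rightarrow> 'a"
      by (rule cl[OF that(1) _ _ _ that(4,5)]) (use that(2) in auto)
  qed
  show "adef (\<lambda>e. tset (ext (e m)) (ext (e u)) (ext (e d)) (e i) (e j))"
  proof (rule adef_cong[OF g])
    show "aterm (\<lambda>e. opair (e i) (e j))" by (intro aterm_opair aterm_var)
    show "tset (ext (e m)) (ext (e u)) (ext (e d)) (e i) (e j) \<longleftrightarrow> generated (sat_gen (ext (e m)) (ext (e u)) (ext (e d))) (opair (e i) (e j))"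
      if "model K" "range e \<subseteq> ext K" for K e
      unfolding tset_def using that ext_in_V by auto
  qed
  show "\<phi> \<in> ext K \<and> T \<in> ext K" if K: "model K" and md: "m' \<in> ext K" "u' \<in> ext K" "d' \<in> ext K"
    and t: "tset (ext m') (ext u') (ext d') \<phi> T"
  proof -
    have V: "\<phi> \<in> V" "T \<in> V" "generated (sat_gen (ext m') (ext u') (ext d')) (opair \<phi> T)"
      using t by (auto simp: tset_def)
    have "opair \<phi> T \<in> ext K"
      by (rule generated_closed[OF K V(3) mono_sat_gen]) (rule cl[OF K md])
    then show ?thesis using model_opairD[OF K] V by blast
  qed
qed

lemma adef_sat: "adef (\<lambda>e. sat (ext (e m)) (ext (e u)) (ext (e d)) (e i) (e a) (e b))"
proof (rule adef_cong)
  show "adef (\<lambda>e. \<exists>T\<in>V. opair (e a) (e b) \<epsilon> T \<and> tset (ext (e m)) (ext (e u)) (ext (e d)) (e i) T)"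
  proof (rule adef_exV)
    show "adef (\<lambda>e. opair (e (Suc a)) (e (Suc b)) \<epsilon> e 0 \<and> tset (ext (e (Suc m))) (ext (e (Suc u))) (ext (e (Suc d))) (e (Suc i)) (e 0))"
      by (intro adef_and adef_opair_mem aterm_var adef_tset)
    show "x \<in> ext K" if "model K" "range e \<subseteq> ext K" "opair (e a) (e b) \<epsilon> x \<and> tset (ext (e m)) (ext (e u)) (ext (e d)) (e i) x"
      for K x and e :: "nat \<Rightarrow> 'a"
      using tset_closed[OF that(1), of "e m" "e u" "e d" "e i" x] that(2,3) by blast
  qed
  show "sat (ext (e m)) (ext (e u)) (ext (e d)) (e i) (e a) (e b) \<longleftrightarrow>
    (\<exists>T\<in>V. opair (e a) (e b) \<epsilon> T \<and> tset (ext (e m)) (ext (e u)) (ext (e d)) (e i) T)"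
    if "model K" "range e \<subseteq> ext K" for K e
    by (rule sat_iff) (use that ext_in_V in auto)
qed

section \<open>Absoluteness of indescribability\<close>

lemma adef_sat1: "adef (\<lambda>e. sat1 (e m) (e i) (e a))"
proof -
  have "adef (\<lambda>e. sat (ext (e m)) (ext (num 0)) (ext (num 0)) (e i) (e a) (num 0))"
    by (rule adef_sub[of "\<lambda>x e. sat (ext (e m)) (ext x) (ext x) (e i) (e a) x", OF adef_sat aterm_zero])
  then show ?thesis by (simp add: sat1_def)
qed

lemma insert_closed:
  assumes "model K" "p \<in> ext K" "a \<in> ext K" "b \<in> V" "ext b = insert p (ext a)"
  shows "b \<in> ext K"
proof (rule in_modelI[OF assms(4)])
  have "ext (mk (insert p (ext a))) = insert p (ext a)"
    using ext_in_V[OF assms(2)] ext_in_V[OF assms(3)] by simp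
  then show "\<exists>y\<in>ext K. ext y = ext b" using model_insert[OF assms(1-3)] assms(5) by metis
qed

section \<open>Definable subsets of a model\<close>

lemma adef_Def_body:
  "adef (\<lambda>e. \<exists>b\<in>V. ext b = insert (opair (e i) (e x)) (ext (e a)) \<and> sat1 (e m) (e \<phi>) b)"
proof (rule adef_exV)
  show "adef (\<lambda>e. ext (e 0) = insert (opair (e (Suc i)) (e (Suc x))) (ext (e (Suc a))) \<and> sat1 (e (Suc m)) (e (Suc \<phi>)) (e 0))"
    by (intro adef_and adef_set_eq acls_ext acls_insert aterm_opair aterm_var adef_sat1)
  show "b \<in> ext K" if "model K" "range e \<subseteq> ext K" "b \<in> V"
    "ext b = insert (opair (e i) (e x)) (ext (e a)) \<and> sat1 (e m) (e \<phi>) b" for K b and e :: "nat \<Rightarrow> 'a"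
    by (rule insert_closed[OF that(1) model_opair[OF that(1)] _ that(3) conjunct1[OF that(4)]]) (use that(2) in auto)
qed

lemma L_fun_closed:
  assumes "model K" "m \<in> ext K" "L_formula \<phi> v" "is_fun a X (ext m)" "X \<subseteq> ext v"
  shows "a \<in> ext K"
  by (rule fun_closed[OF assms(1) L_imp_L2[OF assms(3), of "{}"] assms(4) _ _ ext_closed[OF assms(1,2)]])
    (use assms(5) ext_subset in blast)+

lemma adef_Def: "adef (\<lambda>e. e j \<in> Def (e m))"
proof (rule adef_cong)
  \<comment> \<open>The clause \<open>L_formula \<phi> v\<close> occurs twice: the outer copy
    confines \<open>\<phi>\<close> and \<open>v\<close> to the model, the inner one the parameter
    assignment \<open>a\<close>.\<close>
  show "adef (\<lambda>e. \<exists>\<phi>\<in>V. \<exists>v\<in>V. L_formula \<phi> v \<and> (\<exists>i\<in>ext v. \<exists>a\<in>V.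
     L_formula \<phi> v \<and> is_fun a (ext v - {i}) (ext (e m)) \<and>
     ext (e j) = {x \<in> ext (e m). \<exists>b\<in>V. ext b = insert (opair i x) (ext a) \<and> sat1 (e m) \<phi> b}))"
  proof (rule adef_exV2, rule adef_and[OF adef_L_formula], rule adef_bex[OF acls_ext[OF aterm_var]], rule adef_exV)
    show "adef (\<lambda>e. L_formula (e (Suc (Suc (Suc 0)))) (e (Suc (Suc 0))) \<and>
      is_fun (e 0) (ext (e (Suc (Suc 0))) - {e (Suc 0)}) (ext (e (Suc (Suc (Suc (Suc m)))))) \<and>
      ext (e (Suc (Suc (Suc (Suc j))))) = {x \<in> ext (e (Suc (Suc (Suc (Suc m))))).
        \<exists>b\<in>V. ext b = insert (opair (e (Suc 0)) x) (ext (e 0)) \<and> sat1 (e (Suc (Suc (Suc (Suc m))))) (e (Suc (Suc (Suc 0)))) b})"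
      by (intro adef_and adef_L_formula adef_is_fun acls_Diff acls_ext acls_insert acls_empty aterm_var adef_set_eq acls_Collect adef_Def_body)
    show "x \<in> ext K" if "model K" "range e \<subseteq> ext K" "x \<in> V"
      "L_formula (e (Suc (Suc 0))) (e (Suc 0)) \<and> is_fun x (ext (e (Suc 0)) - {e 0}) (ext (e (Suc (Suc (Suc m))))) \<and> R"
      for K x R and e :: "nat \<Rightarrow> 'a"
      by (rule L_fun_closed[OF that(1) _ conjunct1[OF that(4)] conjunct1[OF conjunct2[OF that(4)]]]) (use that(2) in auto)
    show "x \<in> ext K \<and> y \<in> ext K" if "model K" "range e \<subseteq> ext K" "L_formula x y \<and> R" for K x y R and e :: "nat \<Rightarrow> 'a"
      using L_closed[OF that(1) conjunct1[OF that(3)]] .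
  qed
  show "e j \<in> Def (e m) \<longleftrightarrow> (\<exists>\<phi>\<in>V. \<exists>v\<in>V. L_formula \<phi> v \<and> (\<exists>i\<in>ext v. \<exists>a\<in>V.
     L_formula \<phi> v \<and> is_fun a (ext v - {i}) (ext (e m)) \<and>
     ext (e j) = {x \<in> ext (e m). \<exists>b\<in>V. ext b = insert (opair i x) (ext a) \<and> sat1 (e m) \<phi> b}))"
    if "model K" "range e \<subseteq> ext K" for K e
  proof -
    have "e j \<in> V" using that ext_in_V by blast
    then show ?thesis unfolding Def_def by blast
  qed
qed

lemma DefE:
  assumes "X \<in> Def M"
  obtains \<phi> v i a where "X \<in> V" "L_formula \<phi> v" "i \<in> ext v" "is_fun a (ext v - {i}) (ext M)"
    "ext X = {x \<in> ext M. \<exists>b\<in>V. ext b = insert (opair i x) (ext a) \<and> sat1 M \<phi> b}"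
  using assms unfolding Def_def by blast

lemma Def_subset: "X \<in> Def M \<Longrightarrow> ext X \<subseteq> ext M"
  by (erule DefE) blast

lemma Def_closed: assumes K: "model K" and m: "m \<in> ext K" and X: "X \<in> Def m" shows "X \<in> ext K"
proof -
  obtain \<phi> v i a where *: "X \<in> V" "L_formula \<phi> v" "i \<in> ext v" "is_fun a (ext v - {i}) (ext m)"
    "ext X = {x \<in> ext m. \<exists>b\<in>V. ext b = insert (opair i x) (ext a) \<and> sat1 m \<phi> b}"
    using X by (rule DefE)
  have c: "\<phi> \<in> ext K" "v \<in> ext K" "i \<in> ext K" using L_closed[OF K *(2)] *(3) model_trans[OF K] by auto
  have a: "a \<in> ext K" by (rule L_fun_closed[OF K m *(2,4)]) blast
  have r: "range (case_nat i (case_nat a (case_nat m (\<lambda>_. \<phi>)))) \<subseteq> ext K"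
    using a c m by (auto split: nat.splits)
  have "\<exists>y\<in>ext K. ext y = {x \<in> ext m. \<exists>b\<in>V. ext b = insert (opair i x) (ext a) \<and> sat1 m \<phi> b}"
    using model_sep[OF K adef_Def_body[of "Suc 0" 0 "Suc (Suc 0)" "Suc (Suc (Suc 0))" "Suc (Suc (Suc (Suc 0)))"] r m] by simp
  then show ?thesis using in_modelI[OF *(1)] *(5) by simp
qed

lemma acls_Def: "aterm F \<Longrightarrow> acls (\<lambda>e. Def (F e))"
  by (rule acls_comp1[of Def], rule aclsI) (use Def_closed in blast, rule adef_Def)

text \<open>All definable subsets lie in \<open>K\<close>, so they can be separated from the power
  set of \<open>m\<close> in \<open>K\<close>. The range of the second-order quantifiers thereby
  becomes a set, which \<open>sat\<close> can take as a parameter.\<close>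

lemma Def_set: assumes K: "model K" and m: "m \<in> ext K" shows "\<exists>d\<in>ext K. ext d = Def m"
proof -
  obtain z where z: "z \<in> ext K" "ext z = {y \<in> ext K. ext y \<subseteq> ext m}" using model_Pow[OF K m] by blast
  have "range (\<lambda>_::nat. m) \<subseteq> ext K" using m by auto
  from model_sep[OF K adef_Def[of 0 "Suc 0"] this z(1)]
  have "\<exists>y\<in>ext K. ext y = {X \<in> ext z. X \<in> Def m}" by simp
  moreover have "{X \<in> ext z. X \<in> Def m} = Def m"
    using Def_closed[OF K m] Def_subset z(2) by blast
  ultimately show ?thesis by simp
qed

lemma aterm_Def: "aterm F \<Longrightarrow> aterm (\<lambda>e. mk (Def (F e)))"
  by (rule aterm_mk[OF acls_Def]) (use Def_set aterm_in in blast)+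

lemma isset_Def: assumes "M \<in> V" shows "isset (Def M)"
proof -
  obtain K where "model K" "M \<in> ext K" using model_containing[of "[M]"] assms by auto
  then show ?thesis using Def_set ext_in_V unfolding isset_def by metis
qed

lemma adef_sat2: "adef (\<lambda>e. sat2 (e m) (e u) (Def (e m)) (e i))"
proof (rule adef_cong)
  have "adef (\<lambda>e. sat (ext (e m)) (ext (e u)) (ext (e d)) (e i) (num 0) (num 0))" for m u d i
    by (rule adef_sub[of "\<lambda>x e. sat (ext (e m)) (ext (e u)) (ext (e d)) (e i) x x", OF adef_sat aterm_zero])
  then show "adef (\<lambda>e. sat (ext (e m)) (ext (e u)) (ext (mk (Def (e m)))) (e i) (num 0) (num 0))"
    by (intro adef_sub[of "\<lambda>x e. sat (ext (e m)) (ext (e u)) (ext x) (e i) (num 0) (num 0)", OF _ aterm_Def[OF aterm_var]])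
  show "sat2 (e m) (e u) (Def (e m)) (e i) \<longleftrightarrow> sat (ext (e m)) (ext (e u)) (ext (mk (Def (e m)))) (e i) (num 0) (num 0)"
    if "model K" "range e \<subseteq> ext K" for K e
  proof -
    have "e m \<in> V" using that ext_in_V by blast
    then show ?thesis unfolding sat2_def using isset_Def by simp
  qed
qed

section \<open>Models of ZFC and indescribability inside a model\<close>

lemma adef_true_in: "adef (\<lambda>e. true_in (e m) (e i))"
proof (rule adef_cong)
  show "adef (\<lambda>e. \<exists>v\<in>V. L_formula (e i) v \<and> \<not> (\<exists>a\<in>V. L_formula (e i) v \<and> is_fun a (ext v) (ext (e m)) \<and> \<not> sat1 (e m) (e i) a))"
  proof (rule adef_exV, rule adef_and[OF adef_L_formula], rule adef_not, rule adef_exV)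
    show "adef (\<lambda>e. L_formula (e (Suc (Suc i))) (e (Suc 0)) \<and> is_fun (e 0) (ext (e (Suc 0))) (ext (e (Suc (Suc m)))) \<and>
       \<not> sat1 (e (Suc (Suc m))) (e (Suc (Suc i))) (e 0))"
      by (intro adef_and adef_not adef_L_formula adef_is_fun acls_ext aterm_var adef_sat1)
    show "x \<in> ext K" if "model K" "range e \<subseteq> ext K" "L_formula (e (Suc i)) (e 0) \<and> is_fun x (ext (e 0)) (ext (e (Suc m))) \<and> R"
      for K x R and e :: "nat \<Rightarrow> 'a"
      by (rule L_fun_closed[OF that(1) _ conjunct1[OF that(3)] conjunct1[OF conjunct2[OF that(3)]]]) (use that(2) in auto)
    show "x \<in> ext K" if "model K" "L_formula (e i) x \<and> R" for K x R and e :: "nat \<Rightarrow> 'a"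
      using L_closed[OF that(1) conjunct1[OF that(2)]] by blast
  qed
  show "true_in (e m) (e i) \<longleftrightarrow> (\<exists>v\<in>V. L_formula (e i) v \<and> \<not> (\<exists>a\<in>V. L_formula (e i) v \<and> is_fun a (ext v) (ext (e m)) \<and> \<not> sat1 (e m) (e i) a))" for e
    unfolding true_in_def by blast
qed

lemma aterm_quote: "aterm (\<lambda>e. quote p)"
  by (induction p) (simp_all add: aterm_codes aterm_num)

lemma aterm_separation:
  assumes "aterm P" "aterm X" "aterm Y" "aterm Z"
  shows "aterm (\<lambda>e. c_separation (P e) (X e) (Y e) (Z e))"
  unfolding c_separation_def cEx_def cIff_def cImp_def by (intro aterm_codes assms)

lemma aterm_replacement:
  assumes "aterm P" "aterm A" "aterm B" "aterm X" "aterm Y" "aterm Z"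
  shows "aterm (\<lambda>e. c_replacement (P e) (A e) (B e) (X e) (Y e) (Z e))"
  unfolding c_replacement_def cEx_def cIff_def cImp_def by (intro aterm_codes assms)

lemma finite_axioms: "finite ZFC_single_axioms" by (simp add: ZFC_single_axioms_def)

lemma adef_ZFC_axiom: "adef (\<lambda>e. ZFC_axiom (e i))"
  unfolding ZFC_axiom_def
proof (intro adef_or)
  have "adef (\<lambda>e. \<exists>p\<in>ZFC_single_axioms. e i = quote p)"
    by (intro adef_Bex_finite finite_axioms adef_eq aterm_var aterm_quote)
  then show "adef (\<lambda>e. e i \<in> quote ` ZFC_single_axioms)" by (rule adef_cong) blast
  show "adef (\<lambda>e. \<exists>p\<in>V. \<exists>v\<in>V. \<exists>x\<in>Omega. \<exists>y\<in>Omega. \<exists>z\<in>Omega. L_formula p v \<and> distinct [x, y, z] \<and>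
        y \<notin> ext v \<and> e i = c_separation p x y z)"
  proof (rule adef_exV2)
    show "adef (\<lambda>e. \<exists>x\<in>Omega. \<exists>y\<in>Omega. \<exists>z\<in>Omega. L_formula (e (Suc 0)) (e 0) \<and> distinct [x, y, z] \<and>
        y \<notin> ext (e 0) \<and> e (Suc (Suc i)) = c_separation (e (Suc 0)) x y z)"
      unfolding distinct.simps list.set
      by (intro adef_bex acls_Omega adef_and adef_L_formula adef_not adef_in acls_ext acls_insert acls_empty adef_eq aterm_separation aterm_replacement aterm_var adef_const)
    show "x \<in> ext K \<and> y \<in> ext K" if "model K" "\<exists>a\<in>Omega. \<exists>b\<in>Omega. \<exists>c\<in>Omega. L_formula x y \<and> R a b c" for K x y R
      using L_closed[OF that(1)] that(2) by blast
  qed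
  show "adef (\<lambda>e. \<exists>p\<in>V. \<exists>v\<in>V. \<exists>A\<in>Omega. \<exists>B\<in>Omega. \<exists>x\<in>Omega. \<exists>y\<in>Omega. \<exists>z\<in>Omega.
        L_formula p v \<and> distinct [A, B, x, y, z] \<and> B \<notin> ext v \<and> z \<notin> ext v \<and> e i = c_replacement p A B x y z)"
  proof (rule adef_exV2)
    show "adef (\<lambda>e. \<exists>A\<in>Omega. \<exists>B\<in>Omega. \<exists>x\<in>Omega. \<exists>y\<in>Omega. \<exists>z\<in>Omega.
        L_formula (e (Suc 0)) (e 0) \<and> distinct [A, B, x, y, z] \<and> B \<notin> ext (e 0) \<and> z \<notin> ext (e 0) \<and>
        e (Suc (Suc i)) = c_replacement (e (Suc 0)) A B x y z)"
      unfolding distinct.simps list.set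
      by (intro adef_bex acls_Omega adef_and adef_L_formula adef_not adef_in acls_ext acls_insert acls_empty adef_eq aterm_separation aterm_replacement aterm_var adef_const)
    show "p \<in> ext K \<and> v \<in> ext K" if "model K" "\<exists>A\<in>Omega. \<exists>B\<in>Omega. \<exists>x\<in>Omega. \<exists>y\<in>Omega. \<exists>z\<in>Omega.
        L_formula p v \<and> R A B x y z" for K p v R
      using L_closed[OF that(1)] that(2) by blast
  qed
qed

lemma ZFC_axiom_closed: assumes K: "model K" and ax: "ZFC_axiom \<phi>" shows "\<phi> \<in> ext K"
proof -
  obtain c where c: "c \<in> ext K" using model_nonempty[OF K] by blast
  have r: "range (case_nat p (case_nat A (case_nat B (case_nat x (case_nat y (\<lambda>_. z)))))) \<subseteq> ext K"
    if "p \<in> ext K" "A \<in> ext K" "B \<in> ext K" "x \<in> ext K" "y \<in> ext K" "z \<in> ext K" for p A B x y z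
    using that by (auto split: nat.splits)
  note O = Omega_in_model[OF K]
  show ?thesis using ax unfolding ZFC_axiom_def
  proof (elim disjE bexE conjE)
    assume "\<phi> \<in> quote ` ZFC_single_axioms"
    then show ?thesis using aterm_in[OF aterm_quote K, of "\<lambda>_. c"] c by auto
  next
    fix p v x y z assume a: "x \<in> Omega" "y \<in> Omega" "z \<in> Omega" "L_formula p v" "\<phi> = c_separation p x y z"
    have p: "p \<in> ext K" using L_closed[OF K a(4)] by blast
    show ?thesis
      using aterm_in[OF aterm_separation[OF aterm_var[of 0] aterm_var[of "Suc 0"] aterm_var[of "Suc (Suc 0)"] aterm_var[of "Suc (Suc (Suc 0))"]]
          K r[OF p O[OF a(1)] O[OF a(2)] O[OF a(3)] O[OF a(3)] O[OF a(3)]]] a(5) by simp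
  next
    fix p v A B x y z assume a: "A \<in> Omega" "B \<in> Omega" "x \<in> Omega" "y \<in> Omega" "z \<in> Omega" "L_formula p v" "\<phi> = c_replacement p A B x y z"
    have p: "p \<in> ext K" using L_closed[OF K a(6)] by blast
    show ?thesis
      using aterm_in[OF aterm_replacement[OF aterm_var[of 0] aterm_var[of "Suc 0"] aterm_var[of "Suc (Suc 0)"] aterm_var[of "Suc (Suc (Suc 0))"]
            aterm_var[of "Suc (Suc (Suc (Suc 0)))"] aterm_var[of "Suc (Suc (Suc (Suc (Suc 0))))"]]
          K r[OF p O[OF a(1)] O[OF a(2)] O[OF a(3)] O[OF a(4)] O[OF a(5)]]] a(7) by simp
  qed
qed

text \<open>All axioms, including instances of the schemes for nonstandard formulas, lie in
  \<open>K\<close> by \<open>ZFC_axiom_closed\<close>, and truth in a set is absolute. So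
  \<open>K\<close> recognizes among its elements the same transitive models as the universe
  does.\<close>

lemma adef_model: "adef (\<lambda>e. model (e i))"
proof (rule adef_cong)
  show "adef (\<lambda>e. (\<forall>x\<in>ext (e i). ext x \<subseteq> ext (e i)) \<and> \<not> (\<exists>\<phi>\<in>V. ZFC_axiom \<phi> \<and> \<not> true_in (e i) \<phi>))"
  proof (intro adef_and adef_not adef_ball adef_subset acls_ext aterm_var)
    show "adef (\<lambda>e. \<exists>\<phi>\<in>V. ZFC_axiom \<phi> \<and> \<not> true_in (e i) \<phi>)"
    proof (rule adef_exV)
      show "adef (\<lambda>e. ZFC_axiom (e 0) \<and> \<not> true_in (e (Suc i)) (e 0))"
        by (intro adef_and adef_not adef_ZFC_axiom adef_true_in)
      show "x \<in> ext K" if "model K" "ZFC_axiom x \<and> R" for K x R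
        using ZFC_axiom_closed[OF that(1)] that(2) by blast
    qed
  qed
  show "model (e i) \<longleftrightarrow> (\<forall>x\<in>ext (e i). ext x \<subseteq> ext (e i)) \<and> \<not> (\<exists>\<phi>\<in>V. ZFC_axiom \<phi> \<and> \<not> true_in (e i) \<phi>)"
    if "model K" "range e \<subseteq> ext K" for K e
  proof -
    have "e i \<in> V" using that ext_in_V by blast
    then show ?thesis unfolding model_def by blast
  qed
qed

text \<open>Every quantifier is confined: \<open>U\<close> and \<open>W\<close> range over definable
  subsets, the sentence \<open>\<phi>\<close> lies in the model by \<open>Pi11_closed\<close>, and
  \<open>N\<close> is an element of the given model. As a result indescribability itself can be
  reflected and used in Separation.\<close>

lemma adef_Pi11_indescribable: "adef (\<lambda>e. Pi11_indescribable (e i))"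
proof (rule adef_cong)
  show "adef (\<lambda>e. \<forall>U\<in>Def (e i). \<not> (\<exists>\<phi>\<in>V. Pi11_sentence (ext (e i)) \<phi> \<and> sat2 (e i) U (Def (e i)) \<phi> \<and>
     \<not> (\<exists>N\<in>ext (e i). model N \<and> Pi11_sentence (ext N) \<phi> \<and>
        (\<exists>W\<in>Def N. ext W = ext U \<inter> ext N \<and> sat2 N W (Def N) \<phi>))))"
  proof (rule adef_ball[OF acls_Def[OF aterm_var]], rule adef_not, rule adef_exV)
    show "adef (\<lambda>e. Pi11_sentence (ext (e (Suc (Suc i)))) (e 0) \<and> sat2 (e (Suc (Suc i))) (e (Suc 0)) (Def (e (Suc (Suc i)))) (e 0) \<and>
     \<not> (\<exists>N\<in>ext (e (Suc (Suc i))). model N \<and> Pi11_sentence (ext N) (e 0) \<and>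
        (\<exists>W\<in>Def N. ext W = ext (e (Suc 0)) \<inter> ext N \<and> sat2 N W (Def N) (e 0))))"
      by (intro adef_and adef_not adef_bex adef_set_eq acls_Int acls_ext acls_Def aterm_var adef_model adef_sat2 adef_Pi11_sentence)
    show "x \<in> ext K" if "model K" "range e \<subseteq> ext K" "Pi11_sentence (ext (e (Suc i))) x \<and> R" for K x R and e :: "nat \<Rightarrow> 'a"
      by (rule Pi11_closed[OF that(1) ext_range_closed[OF that(1,2)] conjunct1[OF that(3)]])
  qed
  show "Pi11_indescribable (e i) \<longleftrightarrow> (\<forall>U\<in>Def (e i). \<not> (\<exists>\<phi>\<in>V. Pi11_sentence (ext (e i)) \<phi> \<and> sat2 (e i) U (Def (e i)) \<phi> \<and>
     \<not> (\<exists>N\<in>ext (e i). model N \<and> Pi11_sentence (ext N) \<phi> \<and>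
        (\<exists>W\<in>Def N. ext W = ext U \<inter> ext N \<and> sat2 N W (Def N) \<phi>))))" for e
  proof -
    have 1: "(\<exists>N\<in>V. model N \<and> N \<epsilon> e i \<and> Q N) \<longleftrightarrow> (\<exists>N\<in>ext (e i). model N \<and> Q N)" for Q
      by (auto simp: ext_def)
    have 2: "(\<forall>\<phi>\<in>V. A \<phi> \<and> B \<phi> \<longrightarrow> C \<phi>) \<longleftrightarrow> \<not> (\<exists>\<phi>\<in>V. A \<phi> \<and> B \<phi> \<and> \<not> C \<phi>)" for A B C
      by blast
    show ?thesis unfolding Pi11_indescribable_def 1 2 by (rule refl)
  qed
qed

lemma elementary_asg: assumes "elementary_submodel M N" "asg M g" shows "asg N g"
proof -
  have sub: "ext M \<subseteq> ext N" using assms(1) unfolding elementary_submodel_def by blast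
  show ?thesis unfolding asg_def
  proof (rule is_funI[where h = "ap g"])
    note g = assms(2)
    show "g \<in> V" "Omega \<subseteq> V" "ext N \<subseteq> V" using asg_in_V[OF g] ext_subset by auto
    show "\<exists>x\<in>Omega. \<exists>y\<in>ext N. p = opair x y" if "p \<in> ext g" for p
      using that asg_elem[OF g] asg_ap[OF g] sub by blast
    show "ap g x \<in> ext N" if "x \<in> Omega" for x using asg_ap[OF g that] sub by blast
    show "opair x y \<epsilon> g \<longleftrightarrow> y = ap g x" if "x \<in> Omega" "y \<in> ext N" for x y
      using asg_mem[OF g that(1)] that(2) ext_in_V by blast
  qed
qed

lemma elementary_Sat:
  assumes e: "elementary_submodel M N" and g: "asg M g" and f: "L_formula \<phi> v"
  shows "Sat M \<phi> g \<longleftrightarrow> Sat N \<phi> g"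
  unfolding Sat_iff[OF f]
  using e restr_fun[OF g f] is_fun_in_V L_in_V[OF f] f unfolding elementary_submodel_def by blast

text \<open>One standard sentence says in \<open>M\<close> and in \<open>N\<close> alike that there
  is an indescribable model. In \<open>N\<close> it is witnessed by \<open>M\<close>, so it holds in
  \<open>M\<close> by elementarity.\<close>

lemma extendible_reflects:
  assumes M: "model M" "Pi11_indescribable M" and ext: "extendible M"
  shows "\<exists>M'\<in>ext M. model M' \<and> Pi11_indescribable M'"
proof -
  obtain N where N: "model N" "M \<in> ext N" "elementary_submodel M N"
    using ext M unfolding extendible_def by (auto simp: model_def mem_ext)
  have "adef (\<lambda>e. model (e 0) \<and> Pi11_indescribable (e 0))"
    by (intro adef_and adef_model adef_Pi11_indescribable)
  then obtain p where p: "\<And>K e. model K \<Longrightarrow> range e \<subseteq> ext K \<Longrightarrow>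
      holds (ext K) E e p \<longleftrightarrow> model (e 0) \<and> Pi11_indescribable (e 0)" using adefE by blast
  obtain v where f: "L_formula (quote_with num (FEx 0 p)) v"
    using Lco_formula[OF Lco_quote[OF range_num Lco_Nil]] by auto
  obtain c where c: "c \<in> ext M" using model_nonempty[OF M(1)] by blast
  \<comment> \<open>Any assignment will do: by the choice of \<open>p\<close> the truth value
    depends on the quantified element alone.\<close>
  obtain g where "is_fun g (ext omega) (ext M)" using const_fun[OF _ c, of omega] by auto
  then have g: "asg M g" by (simp add: asg_def)
  have *: "Sat K (quote_with num (FEx 0 p)) g \<longleftrightarrow> (\<exists>x\<in>ext K. model x \<and> Pi11_indescribable x)"
    if K: "model K" and gK: "asg K g" for K
  proof -
    have "range ((\<lambda>n. ap g (num n))(0 := x)) \<subseteq> ext K" if "x \<in> ext K" for x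
      using that asg_ap[OF gK num_in_Omega] by auto
    then show ?thesis unfolding Sat_quote[OF K range_num inj_num gK] using p[OF K] by simp
  qed
  have "Sat N (quote_with num (FEx 0 p)) g"
    unfolding *[OF N(1) elementary_asg[OF N(3) g]] using M N(2) by blast
  then show ?thesis
    unfolding elementary_Sat[OF N(3) g f, symmetric] *[OF M(1) g] .
qed

lemma not_extendible_exists:
  assumes "model M" "Pi11_indescribable M"
  shows "\<exists>M'. model M' \<and> Pi11_indescribable M' \<and> \<not> extendible M'"
proof -
  have MV: "M \<in> V" using assms(1) by (rule model_in_V)
  have "adef (\<lambda>e. model (e 0) \<and> Pi11_indescribable (e 0))"
    by (intro adef_and adef_model adef_Pi11_indescribable)
  \<comment> \<open>Including \<open>M\<close> makes the set nonempty; members of any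
    \<open>M'\<close> in it remain in \<open>ext M\<close> by transitivity.\<close>
  from separation[OF this, of "[]" "mk (insert M (ext M))"] MV
  obtain s where s: "s \<in> V" "ext s = {x \<in> insert M (ext M). model x \<and> Pi11_indescribable x}"
    by (auto elim!: issetE)
  then obtain M' where M': "M' \<in> ext s" "ext M' \<inter> ext s = {}" using foundation[of s] assms by blast
  have M1: "M' = M \<or> M' \<in> ext M" "model M'" "Pi11_indescribable M'" using M'(1) unfolding s(2) by auto
  have "\<not> extendible M'"
  proof
    assume "extendible M'"
    then obtain M'' where M2: "M'' \<in> ext M'" "model M''" "Pi11_indescribable M''"
      using extendible_reflects[OF M1(2,3)] by blast
    then have "M'' \<in> ext M" using M1(1) model_trans[OF assms(1)] by blast
    then have "M'' \<in> ext s" unfolding s(2) using M2 by blast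
    then show False using M'(2) M2(1) by blast
  qed
  then show ?thesis using M1 by blast
qed

section \<open>Reflection\<close>

lemma Sat_cImp:
  assumes N: "model N" and g: "asg N g" and f: "L_formula (cImp p q) v" and p: "p \<in> V" "q \<in> V"
  shows "Sat N (cImp p q) g \<longleftrightarrow> (Sat N p g \<longrightarrow> Sat N q g)"
proof -
  have V: "cNeg q \<in> V" "cAnd p (cNeg q) \<in> V" using p by simp_all
  have 1: "L_formula (cAnd p (cNeg q)) v" using L_cNeg_inv[OF V(2)] f unfolding cImp_def .
  obtain w where 2: "L_formula (cNeg q) w" using L_cAnd_inv[OF p(1) V(1) 1] .
  show ?thesis
    unfolding cImp_def Sat_cNeg[OF N g f[unfolded cImp_def] V(2)] Sat_cAnd[OF N g 1 p(1) V(1)] Sat_cNeg[OF N g 2 p(2)] by simp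
qed

lemma Sat_cIff:
  assumes N: "model N" and g: "asg N g" and f: "L_formula (cIff p q) v" and p: "p \<in> V" "q \<in> V"
  shows "Sat N (cIff p q) g \<longleftrightarrow> (Sat N p g \<longleftrightarrow> Sat N q g)"
proof -
  have V: "cImp p q \<in> V" "cImp q p \<in> V" using p by (simp_all add: cImp_def)
  obtain v1 v2 where 1: "L_formula (cImp p q) v1" "L_formula (cImp q p) v2"
    using L_cAnd_inv[OF V] f unfolding cIff_def by blast
  show ?thesis
    unfolding cIff_def Sat_cAnd[OF N g f[unfolded cIff_def] V] Sat_cImp[OF N g 1(1) p] Sat_cImp[OF N g 1(2) p(2,1)] by blast
qed

lemma Sat_cEx:
  assumes N: "model N" and g: "asg N g" and f: "L_formula (cEx i p) v" and p: "p \<in> V" "i \<in> Omega"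
  shows "Sat N (cEx i p) g \<longleftrightarrow> (\<exists>x\<in>ext N. Sat N p (upd g i x))"
proof -
  have V: "cNeg p \<in> V" "cAll i (cNeg p) \<in> V" using p by simp_all
  have 1: "L_formula (cAll i (cNeg p)) v" using L_cNeg_inv[OF V(2)] f unfolding cEx_def .
  obtain w where 2: "L_formula (cNeg p) w" using L_cAll_inv[OF V(1) _ 1] p(2) by auto
  show ?thesis
    unfolding cEx_def Sat_cNeg[OF N g f[unfolded cEx_def] V(2)] Sat_cAll[OF N g 1 V(1) p(2)]
    using Sat_cNeg[OF N upd(1)[OF g p(2)] 2 p(1)] by blast
qed

lemma Lco_Imp: assumes "Lco \<Phi>" "p \<in> set \<Phi>" "q \<in> set \<Phi>" shows "Lco (cImp p q # \<Phi>)"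
proof -
  have "Lco (cNeg q # \<Phi>)" by (rule Lco_Neg[OF assms(1,3)])
  then have "Lco (cAnd p (cNeg q) # cNeg q # \<Phi>)" by (rule Lco_And) (use assms in auto)
  then have "Lco (cNeg (cAnd p (cNeg q)) # cAnd p (cNeg q) # cNeg q # \<Phi>)" by (rule Lco_Neg) simp
  then show ?thesis unfolding cImp_def by (rule Lco_mono) auto
qed

lemma Lco_Iff: assumes "Lco \<Phi>" "p \<in> set \<Phi>" "q \<in> set \<Phi>" shows "Lco (cIff p q # \<Phi>)"
proof -
  have "Lco (cImp p q # \<Phi>)" by (rule Lco_Imp[OF assms])
  then have "Lco (cImp q p # cImp p q # \<Phi>)" by (rule Lco_Imp) (use assms in auto)
  then have "Lco (cAnd (cImp p q) (cImp q p) # cImp q p # cImp p q # \<Phi>)" by (rule Lco_And) simp_all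
  then show ?thesis unfolding cIff_def by (rule Lco_mono) auto
qed

lemma Lco_Ex: assumes "Lco \<Phi>" "p \<in> set \<Phi>" "i \<in> Omega" shows "Lco (cEx i p # \<Phi>)"
proof -
  have "Lco (cNeg p # \<Phi>)" by (rule Lco_Neg[OF assms(1,2)])
  then have "Lco (cAll i (cNeg p) # cNeg p # \<Phi>)" by (rule Lco_All) (use assms in auto)
  then have "Lco (cNeg (cAll i (cNeg p)) # cAll i (cNeg p) # cNeg p # \<Phi>)" by (rule Lco_Neg) simp
  then show ?thesis unfolding cEx_def by (rule Lco_mono) auto
qed

text \<open>Supplies the variables of a standard formula with numbers from \<open>m\<close> upwards,
  where \<open>m\<close> will bound the variables of a code that may be nonstandard.\<close>

definition shift :: "'a \<Rightarrow> nat \<Rightarrow> 'a" where "shift m n = (suc ^^ n) m"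

lemma shift_Omega: "m \<in> Omega \<Longrightarrow> shift m n \<in> Omega"
  by (induction n) (auto simp: shift_def)

lemma shift_mono: assumes m: "m \<in> Omega" shows "k < n \<Longrightarrow> shift m k \<in> ext (shift m n)"
proof (induction n)
  case (Suc n)
  have "ext (shift m (Suc n)) = insert (shift m n) (ext (shift m n))"
    using Omega_in_V[OF shift_Omega[OF m, of n]] by (simp add: shift_def)
  then show ?case using Suc by (auto simp: less_Suc_eq)
qed simp

lemma inj_shift: assumes m: "m \<in> Omega" shows "inj (shift m)"
proof (rule injI)
  fix k n assume e: "shift m k = shift m n"
  have "\<not> k < n" "\<not> n < k"
    using shift_mono[OF m, of k n] shift_mono[OF m, of n k] Omega_irrefl[OF shift_Omega[OF m]] e by auto
  then show "k = n" by simp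
qed

lemma shift_fresh: assumes m: "m \<in> Omega" shows "shift m n \<notin> ext m"
proof (cases n)
  case 0
  then show ?thesis using Omega_irrefl[OF m] by (simp add: shift_def)
next
  case (Suc k)
  then have "m \<in> ext (shift m n)" using shift_mono[OF m, of 0 n] by (simp add: shift_def)
  then show ?thesis using Omega_asym[OF shift_Omega[OF m]] by blast
qed

text \<open>\<open>Def\<close> describes an assignment as \<open>a\<close> enlarged by one pair,
  \<open>Sat\<close> as the restriction of a total assignment; this equates the two
  descriptions.\<close>

lemma restr_insert:
  assumes g: "asg N g" and v: "v \<in> V" "ext v \<subseteq> Omega" and i: "i \<in> ext v" and w: "w \<in> V" "ext w = ext v - {i}"
    and h: "asg N h" and eq: "\<And>j. j \<in> ext w \<Longrightarrow> ap h j = ap g j" and b: "b \<in> V"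
  shows "b = restr h v \<longleftrightarrow> ext b = insert (opair i (ap h i)) (ext (restr g w))"
proof -
  have w': "ext w \<subseteq> Omega" using v w by blast
  have "ext (restr h v) = insert (opair i (ap h i)) (ext (restr g w))"
    unfolding restr(2)[OF h v] restr(2)[OF g w(1) w']
  proof (intro set_eqI iffI)
    fix p assume "p \<in> {opair j (ap h j) | j. j \<in> ext v}"
    then obtain j where "j \<in> ext v" "p = opair j (ap h j)" by blast
    then show "p \<in> insert (opair i (ap h i)) {opair j (ap g j) | j. j \<in> ext w}"
      using eq w(2) by (cases "j = i") auto
  next
    fix p assume "p \<in> insert (opair i (ap h i)) {opair j (ap g j) | j. j \<in> ext w}"
    then consider "p = opair i (ap h i)" | j where "j \<in> ext w" "p = opair j (ap g j)" by blast
    then show "p \<in> {opair j (ap h j) | j. j \<in> ext v}"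
      using i w(2) eq by cases force+
  qed
  then show ?thesis using b restr(1)[OF h v] ext_eqI by metis
qed

text \<open>The code of the class \<open>U\<close> may be a formula of nonstandard length. Therefore the sentence that is
  reflected from \<open>N\<close> to \<open>M\<close> is assembled inside the universe, from that code and from the code of
  the standard formula expressing the remaining conditions, with variables fresh for the former.\<close>

theorem extendible_Pi11_indescribable:
  assumes M: "model M" and ex: "extendible M" shows "Pi11_indescribable M"
  unfolding Pi11_indescribable_def
proof (intro ballI impI, elim conjE)
  fix U \<phi> assume U: "U \<in> Def M" and \<phi>: "Pi11_sentence (ext M) \<phi>" and s: "sat2 M U (Def M) \<phi>"
  have MV: "M \<in> V" using M by (rule model_in_V)
  obtain N where N: "model N" "M \<in> ext N" "elementary_submodel M N"
    using ex MV unfolding extendible_def by (auto simp: mem_ext)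
  have MN: "ext M \<subseteq> ext N" by (rule ext_closed[OF N(1,2)])
  obtain \<psi> v i a where d: "U \<in> V" "L_formula \<psi> v" "i \<in> ext v" "is_fun a (ext v - {i}) (ext M)"
    "ext U = {x \<in> ext M. \<exists>b\<in>V. ext b = insert (opair i x) (ext a) \<and> sat1 M \<psi> b}"
    using U by (rule DefE)
  have v: "v \<in> V" "ext v \<subseteq> Omega" "\<psi> \<in> V" using L_in_V[OF d(2)] L_vars[OF d(2)] by auto
  have i: "i \<in> Omega" "i \<in> V" using v d(3) by auto
  obtain m0 where m0: "m0 \<in> Omega" "ext v \<subseteq> ext m0" using fresh[OF d(2)] by blast
  \<comment> \<open>The variable \<open>f 0\<close> will name the reflected model,
    \<open>f (Suc 0)\<close> its predicate and \<open>f (Suc (Suc 0))\<close> the sentence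
    \<open>\<phi>\<close>; none of them is free in \<open>\<psi>\<close>.\<close>
  define f where "f = shift m0"
  have f: "range f \<subseteq> Omega" "inj f" "\<And>n. f n \<in> Omega" "\<And>n. f n \<notin> ext v" "\<And>n. f n \<noteq> i"
    using shift_Omega[OF m0(1)] inj_shift[OF m0(1)] shift_fresh[OF m0(1)] m0(2) d(3) unfolding f_def by auto
  have f01: "f 0 \<noteq> f (Suc 0)" "f 0 \<noteq> f (Suc (Suc 0))" "f (Suc 0) \<noteq> f (Suc (Suc 0))" using f(2) by (auto simp: inj_eq)
  have \<phi>M: "\<phi> \<in> ext M" by (rule Pi11_closed[OF M order_refl \<phi>])
  \<comment> \<open>Everything demanded of the reflected model except the agreement of its predicate
    with \<open>U\<close>. This part is absolute, hence given by a standard formula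
    \<open>\<theta>\<close>.\<close>
  define R where "R m w p \<longleftrightarrow> model m \<and> w \<in> Def m \<and> Pi11_sentence (ext m) p \<and> sat2 m w (Def m) p" for m w p
  have "adef (\<lambda>e. R (e 0) (e (Suc 0)) (e (Suc (Suc 0))))"
    unfolding R_def by (intro adef_and adef_model adef_Def adef_Pi11_sentence adef_sat2)
  then obtain \<theta> where \<theta>: "\<And>K e. model K \<Longrightarrow> range e \<subseteq> ext K \<Longrightarrow>
    holds (ext K) E e \<theta> \<longleftrightarrow> R (e 0) (e (Suc 0)) (e (Suc (Suc 0)))" using adefE by blast
  let ?\<Theta> = "quote_with f \<theta>" and ?A = "cMem (var i) (var (f 0))" and ?B = "cMem (var i) (var (f (Suc 0)))"
  \<comment> \<open>\<open>U\<close> need not be an element of \<open>M\<close>, so it cannot be a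
    parameter of a sentence reflected to \<open>M\<close>. The agreement on the new model is
    expressed through its defining formula \<open>\<psi>\<close> instead, whose own parameters stay
    free.\<close>
  let ?C = "cAll i (cImp ?A (cIff ?B \<psi>))"
  let ?\<chi> = "cEx (f 0) (cEx (f (Suc 0)) (cAnd ?\<Theta> ?C))"
  have "Lco (?A # ?B # ?\<Theta> # [\<psi>])"
    by (intro Lco_Mem Lco_quote f i L_formula_Lco[OF d(2)])
  then have "Lco (cIff ?B \<psi> # ?A # ?B # ?\<Theta> # [\<psi>])" by (rule Lco_Iff) simp_all
  then have "Lco (cImp ?A (cIff ?B \<psi>) # cIff ?B \<psi> # ?A # ?B # ?\<Theta> # [\<psi>])" by (rule Lco_Imp) simp_all
  then have "Lco (?C # cImp ?A (cIff ?B \<psi>) # cIff ?B \<psi> # ?A # ?B # ?\<Theta> # [\<psi>])" by (rule Lco_All) (simp_all add: i)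
  then have "Lco (cAnd ?\<Theta> ?C # ?C # cImp ?A (cIff ?B \<psi>) # cIff ?B \<psi> # ?A # ?B # ?\<Theta> # [\<psi>])" by (rule Lco_And) simp_all
  then have co1: "Lco (cEx (f (Suc 0)) (cAnd ?\<Theta> ?C) # cAnd ?\<Theta> ?C # ?C # cImp ?A (cIff ?B \<psi>) # cIff ?B \<psi> # ?A # ?B # ?\<Theta> # [\<psi>])"
    by (rule Lco_Ex) (simp_all add: f)
  then have co: "Lco (?\<chi> # cEx (f (Suc 0)) (cAnd ?\<Theta> ?C) # cAnd ?\<Theta> ?C # ?C # cImp ?A (cIff ?B \<psi>) # cIff ?B \<psi> # ?A # ?B # ?\<Theta> # [\<psi>])"
    by (rule Lco_Ex) (simp_all add: f)
  note form = Lco_formula[OF co] and inV = Lco_in_V[OF co]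
  obtain x1 where F1: "L_formula ?\<chi> x1" using form by (metis list.set_intros)
  obtain x2 where F2: "L_formula (cEx (f (Suc 0)) (cAnd ?\<Theta> ?C)) x2" using form by (metis list.set_intros)
  obtain x3 where F3: "L_formula (cAnd ?\<Theta> ?C) x3" using form by (metis list.set_intros)
  obtain x4 where F4: "L_formula ?C x4" using form by (metis list.set_intros)
  obtain x5 where F5: "L_formula (cImp ?A (cIff ?B \<psi>)) x5" using form by (metis list.set_intros)
  obtain x6 where F6: "L_formula (cIff ?B \<psi>) x6" using form by (metis list.set_intros)
  have FV: "cEx (f (Suc 0)) (cAnd ?\<Theta> ?C) \<in> V" "cAnd ?\<Theta> ?C \<in> V" "?\<Theta> \<in> V" "?C \<in> V" "cImp ?A (cIff ?B \<psi>) \<in> V"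
    "cIff ?B \<psi> \<in> V" "?A \<in> V" "?B \<in> V" "\<psi> \<in> V"
    using inV by simp_all
  obtain w where w: "w \<in> V" "ext w = ext v - {i}"
    using isset_Diff[OF v(1), of "mk {i}"] i by (auto elim!: issetE)
  have w': "ext w \<subseteq> Omega" using w v by blast
  obtain c where c: "c \<in> ext M" using model_nonempty[OF M] by blast
  \<comment> \<open>\<open>g0\<close> carries the parameters \<open>a\<close> from the definition of
    \<open>U\<close>; \<open>g\<close> will add \<open>\<phi>\<close> as the value of
    \<open>f (Suc (Suc 0))\<close>.\<close>
  obtain g0 where g0: "asg M g0" "restr g0 w = a"
    using extend_fun[OF _ w(1) w' c, of a] d(4) unfolding w(2) by blast
  define g where "g = upd g0 (f (Suc (Suc 0))) \<phi>"
  have g: "asg M g" and ap_g: "\<And>j. j \<in> Omega \<Longrightarrow> ap g j = (if j = f (Suc (Suc 0)) then \<phi> else ap g0 j)"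
    unfolding g_def using upd[OF g0(1) f(3) \<phi>M] by blast+
  let ?h = "\<lambda>m u x. upd (upd (upd g (f 0) m) (f (Suc 0)) u) i x"
  have hh: "asg K (?h m u x)" "\<And>j. j \<in> Omega \<Longrightarrow> ap (?h m u x) j = (if j = i then x else if j = f (Suc 0) then u else if j = f 0 then m else ap g j)"
    if gK: "asg K g" and mux: "m \<in> ext K" "u \<in> ext K" "x \<in> ext K" for K m u x
  proof -
    note 1 = upd[OF gK f(3) mux(1)]
    note 2 = upd[OF 1(1) f(3) mux(2)]
    note 3 = upd[OF 2(1) i(1) mux(3)]
    show "asg K (?h m u x)" by (rule 3(1))
    show "ap (?h m u x) j = (if j = i then x else if j = f (Suc 0) then u else if j = f 0 then m else ap g j)"
      if "j \<in> Omega" for j using 3(2)[OF that] 2(2)[OF that] 1(2)[OF that] by simp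
  qed
  have \<chi>: "Sat K ?\<chi> g \<longleftrightarrow> (\<exists>m\<in>ext K. \<exists>u\<in>ext K. R m u \<phi> \<and> (\<forall>x\<in>ext K. x \<epsilon> m \<longrightarrow> (x \<epsilon> u \<longleftrightarrow> Sat K \<psi> (?h m u x))))"
    if K: "model K" and gK: "asg K g" for K
  proof -
    have inner: "Sat K (cAnd ?\<Theta> ?C) (upd (upd g (f 0) m) (f (Suc 0)) u) \<longleftrightarrow>
      R m u \<phi> \<and> (\<forall>x\<in>ext K. x \<epsilon> m \<longrightarrow> (x \<epsilon> u \<longleftrightarrow> Sat K \<psi> (?h m u x)))" if mu: "m \<in> ext K" "u \<in> ext K" for m u
    proof -
      note 1 = upd[OF gK f(3) mu(1)]
      note 2 = upd[OF 1(1) f(3) mu(2)]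
      let ?k = "upd (upd g (f 0) m) (f (Suc 0)) u"
      have "range (\<lambda>n. ap ?k (f n)) \<subseteq> ext K" using asg_ap[OF 2(1) f(3)] by blast
      then have "Sat K ?\<Theta> ?k \<longleftrightarrow> R m u \<phi>"
        unfolding Sat_quote[OF K f(1,2) 2(1)] using \<theta>[OF K] 1(2)[OF f(3)] 2(2)[OF f(3)] ap_g[OF f(3)] f01 by simp
      moreover have "Sat K (cImp ?A (cIff ?B \<psi>)) (?h m u x) \<longleftrightarrow> (x \<epsilon> m \<longrightarrow> (x \<epsilon> u \<longleftrightarrow> Sat K \<psi> (?h m u x)))"
        if x: "x \<in> ext K" for x
      proof -
        note h = hh[OF gK mu x]
        show ?thesis
          unfolding Sat_cImp[OF K h(1) F5 FV(7,6)] Sat_cIff[OF K h(1) F6 FV(8,9)]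
            Sat_atom(1)[OF K h(1) i(1) f(3)] h(2)[OF i(1)] h(2)[OF f(3)]
          using f01 f(5) by simp
      qed
      ultimately show ?thesis
        unfolding Sat_cAnd[OF K 2(1) F3 FV(3,4)] Sat_cAll[OF K 2(1) F4 FV(5) i(1)] by simp
    qed
    have "Sat K (cEx (f (Suc 0)) (cAnd ?\<Theta> ?C)) (upd g (f 0) m) \<longleftrightarrow>
      (\<exists>u\<in>ext K. R m u \<phi> \<and> (\<forall>x\<in>ext K. x \<epsilon> m \<longrightarrow> (x \<epsilon> u \<longleftrightarrow> Sat K \<psi> (?h m u x))))" if m: "m \<in> ext K" for m
      unfolding Sat_cEx[OF K upd(1)[OF gK f(3) m] F2 FV(2) f(3)] using inner[OF m] by simp
    then show ?thesis unfolding Sat_cEx[OF K gK F1 FV(1) f(3)] by simp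
  qed
  \<comment> \<open>Applied with \<open>K = N\<close>, where \<open>el\<close> is elementarity, and
    with \<open>K = M\<close>, where it is trivial. The values \<open>m\<close> and
    \<open>u\<close>, which may lie outside \<open>M\<close>, sit at variables not in
    \<open>ext v\<close>; so for \<open>x\<close> in \<open>M\<close> the restricted assignment has
    all its values in \<open>M\<close>.\<close>
  have psi_U: "Sat K \<psi> (?h m u x) \<longleftrightarrow> x \<in> ext U"
    if g0K: "asg K g0" and hK: "asg K (?h m u x)"
      and ap: "\<And>j. j \<in> Omega \<Longrightarrow> ap (?h m u x) j = (if j = i then x else if j = f (Suc 0) then u else if j = f 0 then m else ap g j)"
      and x: "x \<in> ext M" and el: "\<And>b. is_fun b (ext v) (ext M) \<Longrightarrow> sat1 M \<psi> b \<longleftrightarrow> sat1 K \<psi> b" for K m u x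
  proof -
    have ap0: "ap (?h m u x) j = ap g0 j" if j: "j \<in> ext w" for j
    proof -
      have "j \<in> Omega" "j \<in> ext v" "j \<noteq> i" using j w w' by auto
      then show ?thesis using ap[of j] ap_g[of j] f(4) by metis
    qed
    let ?b = "restr (?h m u x) v"
    have "is_fun ?b (ext v) (ext M)"
    proof (rule is_funI[where h = "ap (?h m u x)"])
      show *: "ap (?h m u x) j \<in> ext M" if "j \<in> ext v" for j
        using that ap[OF i(1)] ap0[of j] x w(2) asg_ap[OF g0(1), of j] v(2) by (cases "j = i") auto
      show "\<exists>j\<in>ext v. \<exists>y\<in>ext M. p = opair j y" if "p \<in> ext ?b" for p
        using that * unfolding restr(2)[OF hK v(1,2)] by blast
      show "opair j y \<epsilon> ?b \<longleftrightarrow> y = ap (?h m u x) j" if "j \<in> ext v" "y \<in> ext M" for j y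
        by (rule restr_mem[OF hK v(1,2) that(1) ext_in_V[OF that(2)]])
    qed (use restr(1)[OF hK v(1,2)] ext_subset in auto)
    then have "Sat K \<psi> (?h m u x) \<longleftrightarrow> sat1 M \<psi> ?b" using el Sat_iff[OF d(2)] by blast
    also have "\<dots> \<longleftrightarrow> (\<exists>b\<in>V. b = ?b \<and> sat1 M \<psi> b)"
      using restr(1)[OF hK v(1,2)] by blast
    also have "\<dots> \<longleftrightarrow> (\<exists>b\<in>V. ext b = insert (opair i x) (ext a) \<and> sat1 M \<psi> b)"
      using restr_insert[OF g0K v(1,2) d(3) w hK ap0] ap[OF i(1)] g0(2) by simp
    finally show ?thesis unfolding d(5) using x by simp
  qed
  have UN: "U \<in> ext N" by (rule Def_closed[OF N(1,2) U])
  have gN: "asg N g" by (rule elementary_asg[OF N(3) g])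
  \<comment> \<open>In \<open>N\<close> the witnesses are \<open>M\<close> and \<open>U\<close>
    themselves; their agreement with \<open>\<psi>\<close> on \<open>M\<close> is the definition of
    \<open>U\<close>, read in \<open>N\<close> by elementarity.\<close>
  have "Sat N ?\<chi> g"
    unfolding \<chi>[OF N(1) gN]
  proof (rule bexI[OF _ N(2)], rule bexI[OF _ UN], intro conjI ballI impI)
    show "R M U \<phi>" unfolding R_def using M U \<phi> s by blast
    fix x assume x: "x \<in> ext N" "x \<epsilon> M"
    then have xM: "x \<in> ext M" using ext_in_V by (simp add: mem_ext)
    note hN = hh[OF gN N(2) UN x(1)]
    have "sat1 M \<psi> b \<longleftrightarrow> sat1 N \<psi> b" if "is_fun b (ext v) (ext M)" for b
      using N(3) d(2) v that is_fun_in_V[OF that] unfolding elementary_submodel_def by blast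
    from psi_U[OF elementary_asg[OF N(3) g0(1)] hN xM this]
    show "x \<epsilon> U \<longleftrightarrow> Sat N \<psi> (?h M U x)" using mem_ext[OF ext_in_V[OF xM], of U] by simp
  qed
  then have "Sat M ?\<chi> g" using elementary_Sat[OF N(3) g F1] by blast
  then obtain m u where mu: "m \<in> ext M" "u \<in> ext M" "R m u \<phi>" "\<forall>x\<in>ext M. x \<epsilon> m \<longrightarrow> (x \<epsilon> u \<longleftrightarrow> Sat M \<psi> (?h m u x))"
    unfolding \<chi>[OF M g] by blast
  \<comment> \<open>The reflected sentence compares \<open>u\<close> with \<open>U\<close> only on
    members of \<open>m\<close>; that \<open>u\<close> has no other members follows from its being
    in \<open>Def m\<close>.\<close>
  have "ext u = ext U \<inter> ext m"
  proof (intro set_eqI)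
    fix x
    show "x \<in> ext u \<longleftrightarrow> x \<in> ext U \<inter> ext m"
    proof (cases "x \<in> ext m")
      case True
      then have x: "x \<in> ext M" "x \<epsilon> m" "x \<in> V" using model_trans[OF M mu(1)] extD by auto
      have "x \<epsilon> u \<longleftrightarrow> x \<in> ext U"
        using mu(4) x psi_U[OF g0(1) hh[OF g mu(1,2) x(1)] x(1) refl] by blast
      then show ?thesis using True x(3) by (simp add: mem_ext)
    next
      case False
      then show ?thesis using Def_subset[of u m] mu(3) unfolding R_def by blast
    qed
  qed
  then show "\<exists>N\<in>V. model N \<and> N \<epsilon> M \<and> Pi11_sentence (ext N) \<phi> \<and>
        (\<exists>W\<in>Def N. ext W = ext U \<inter> ext N \<and> sat2 N W (Def N) \<phi>)"
    using mu(1,3) extD unfolding R_def by blast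
qed

end

theorem proposition3p3:
  fixes V :: "'a set" and E :: "'a \<Rightarrow> 'a \<Rightarrow> bool"
  shows
    "(universe.LZFC V E \<longrightarrow>
        (\<forall>M\<in>V. universe.model V E M \<longrightarrow> universe.extendible V E M \<longrightarrow>
           universe.Pi11_indescribable V E M)) \<and>
     (universe.LZFC V E \<and> universe.Found_On V E \<longrightarrow>
        (\<exists>M\<in>V. universe.model V E M \<and> universe.Pi11_indescribable V E M) \<longrightarrow>
        (\<exists>M\<in>V. universe.model V E M \<and> universe.Pi11_indescribable V E M \<and>
           \<not> universe.extendible V E M))"
proof (intro conjI impI ballI)
  fix M assume L: "universe.LZFC V E" and M: "M \<in> V" "universe.model V E M" "universe.extendible V E M"
  \<comment> \<open>An empty structure would satisfy \<open>LZFC\<close> vacuously; the given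
    element \<open>M\<close> of \<open>V\<close> supplies the assumption
    \<open>nonempty\<close>.\<close>
  interpret lzfc V E
    using L M unfolding universe.LZFC_def by unfold_locales auto
  show "Pi11_indescribable M" using M(2,3) by (rule extendible_Pi11_indescribable)
next
  assume L: "universe.LZFC V E \<and> universe.Found_On V E"
    and ex: "\<exists>M\<in>V. universe.model V E M \<and> universe.Pi11_indescribable V E M"
  interpret lzfc V E
    using L ex unfolding universe.LZFC_def by unfold_locales auto
  show "\<exists>M\<in>V. model M \<and> Pi11_indescribable M \<and> \<not> extendible M"
    using ex not_extendible_exists model_in_V by blast
qed

end
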